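(* The three classes of functions $US(\mathbb{R})$ (universal symbols), $CH(\mathbb{R})$ (symbols admitting, from every compact set, an extension to a translated scalar multiple of a continuous positive-definite function) and $PD(\mathbb{R})$ (the same with positive-definite functions not required to be continuous) coincide: $$US(\mathbb{R})=CH(\mathbb{R})=PD(\mathbb{R}).$$
   Context: **Hermitian elements.** A complex unital Banach algebra $\mathcal{A}$ is a complex Banach space that is also an algebra with unit $\mathbf{1}_{\mathcal{A}}$, $\|\mathbf{1}_{\mathcal{A}}\|=1$, and $\|ab\|\le\|a\|\,\|b\|$ for all $a,b\in\mathcal{A}$ (not assumed commutative). For $a\in\mathcal{A}$, $\sigma(a)$ is its spectrum and $|a|=\max\{|\lambda|:\lambda\in\sigma(a)\}$ its spectral radius. An element $a$ is Hermitian if its numerical range $V(a)=\{\varphi(a):\varphi\in\mathcal{A}^*,\ \varphi(\mathbf{1}_{\mathcal{A}})=\|\varphi\|=1\}$ is contained in $\mathbb{R}$; equivalently, $\|\exp(ita)\|=1$ for all $t\in\mathbb{R}$. $H(\mathcal{A})$ denotes the set of Hermitian elements; for $a\in H(\mathcal{A})$ one has $\sigma(a)\subset V(a)\subset\mathbb{R}$. **Symbols and functional calculus.** $M(\mathbb{R})$ is the Banach algebra (under convolution and total variation norm) of finite complex Borel measures on $\mathbb{R}$; $\hat\mu(\xi)=\int_{\mathbb{R}}e^{i\xi x}\,d\mu(x)$; $B(\mathbb{R})=\{\hat\mu:\mu\in M(\mathbb{R})\}$. $B_{loc}(\mathbb{R})$ is the algebra of all functions $F:\mathbb{R}\to\mathbb{C}$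 that belong locally to $B(\mathbb{R})$ (every point has a neighborhood on which $F$ coincides with an element of $B(\mathbb{R})$; equivalently, on a neighborhood of every compact set $F$ coincides with an element of $B(\mathbb{R})$). Elements of $B_{loc}(\mathbb{R})$ are called symbols. For a symbol $F$ and $a\in H(\mathcal{A})$, choose $\mu\in M(\mathbb{R})$ with $F=\hat\mu$ in a real neighborhood of $\sigma(a)$ and set $F(a)=\int_{\mathbb{R}}\exp(ita)\,d\mu(t)$; this does not depend on the choice of $\mu$. **The classes.** - $US(\mathbb{R})$ is the set of symbols $F\in B_{loc}(\mathbb{R})$ that are universal, i.e. $\|F(a)\|=|F(a)|$ (norm equals spectral radius) for each complex unital Banach algebra $\mathcal{A}$ and all $a\in H(\mathcal{A})$. - A function $\varphi:\mathbb{R}\to\mathbb{C}$ is positive-definite if $\sum_{j,k=1}^n\varphi(x_j-x_k)c_j\overline{c_k}\ge0$ for all finite sets $x_1,\dots,x_n\in\mathbb{R}$, $c_1,\dots,c_n\in\mathbb{C}$ (no continuity required). - $PD(\mathbb{R})$ is the set of symbols $F\in B_{loc}(\mathbb{R})$ such that for each nonempty compact set $K\subset\mathbb{R}$ there exist $c\in\mathbb{C}$, $x_0\in K$ and a positive-definite function $\varphi$ on $\mathbb{R}$ with $F(x)=c\,\varphi(x-x_0)$ for all $x\in K$. - $CH(\mathbb{R})$ is the set of symbols $F$ satisfying the same condition with $\varphi$ in addition chosen continuous on $\mathbb{R}$. *)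

theory Defs
  imports "HOL-Analysis.Analysis" "HOL-Algebra.Module"
begin

section \<open>Complex unital Banach algebras\<close>

text \<open>
  Universality of a symbol quantifies over all complex unital Banach algebras, so an algebra has to
  be an object (a record with an explicit carrier) rather than a type of class \<open>banach\<close>.
\<close>

definition complex_ring :: "complex ring" where
  "complex_ring = \<lparr>carrier = UNIV, mult = (*), one = 1, zero = 0, add = (+)\<rparr>"

record 'a normed_alg = "(complex, 'a) module" +
  nrm :: "'a \<Rightarrow> real"

text \<open>The locale \<open>Metric_space\<close> requires a nonnegative, symmetric distance on the whole type, while
  nothing is assumed about \<open>nrm\<close> outside the carrier; hence the case distinction.\<close>

definition nrm_dist :: "('a, 'r) normed_alg_scheme \<Rightarrow> 'a \<Rightarrow> 'a \<Rightarrow> real" where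
  "nrm_dist A x y =
     (if x \<in> carrier A \<and> y \<in> carrier A then nrm A (x \<ominus>\<^bsub>A\<^esub> y) else 0)"

abbreviation nrm_topology :: "('a, 'r) normed_alg_scheme \<Rightarrow> 'a topology" where
  "nrm_topology A \<equiv> Metric_space.mtopology (carrier A) (nrm_dist A)"

locale complex_unital_banach_algebra = Ring.ring A for A (structure) +
  assumes complex_module: "Module.module complex_ring A"
    and smult_mult_left: "\<lbrakk>x \<in> carrier A; y \<in> carrier A\<rbrakk> \<Longrightarrow> (c \<odot> x) \<otimes> y = c \<odot> (x \<otimes> y)"
    and smult_mult_right: "\<lbrakk>x \<in> carrier A; y \<in> carrier A\<rbrakk> \<Longrightarrow> x \<otimes> (c \<odot> y) = c \<odot> (x \<otimes> y)"
    and nrm_nonneg: "x \<in> carrier A \<Longrightarrow> 0 \<le> nrm A x"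
    and nrm_eq_0_iff: "x \<in> carrier A \<Longrightarrow> nrm A x = 0 \<longleftrightarrow> x = \<zero>"
    and nrm_triangle: "\<lbrakk>x \<in> carrier A; y \<in> carrier A\<rbrakk> \<Longrightarrow> nrm A (x \<oplus> y) \<le> nrm A x + nrm A y"
    and nrm_smult: "x \<in> carrier A \<Longrightarrow> nrm A (c \<odot> x) = cmod c * nrm A x"
    and nrm_mult: "\<lbrakk>x \<in> carrier A; y \<in> carrier A\<rbrakk> \<Longrightarrow> nrm A (x \<otimes> y) \<le> nrm A x * nrm A y"
    and nrm_one: "nrm A \<one> = 1"
    and complete: "Metric_space.mcomplete (carrier A) (nrm_dist A)"

definition spectrum :: "('a, 'r) normed_alg_scheme \<Rightarrow> 'a \<Rightarrow> complex set" where
  "spectrum A a = {z. z \<odot>\<^bsub>A\<^esub> \<one>\<^bsub>A\<^esub> \<ominus>\<^bsub>A\<^esub> a \<notin> Units A}"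

definition spectral_radius :: "('a, 'r) normed_alg_scheme \<Rightarrow> 'a \<Rightarrow> real" where
  "spectral_radius A a = (SUP z\<in>spectrum A a. cmod z)"

definition alg_exp :: "('a, 'r) normed_alg_scheme \<Rightarrow> 'a \<Rightarrow> 'a" where
  "alg_exp A a = (THE s. limitin (nrm_topology A)
     (\<lambda>n. \<Oplus>\<^bsub>A\<^esub>k\<in>{..<n}. (1 / fact k) \<odot>\<^bsub>A\<^esub> (a [^]\<^bsub>A\<^esub> k)) s sequentially)"

definition dual_space :: "('a, 'r) normed_alg_scheme \<Rightarrow> ('a \<Rightarrow> complex) set" where
  "dual_space A = {f.
     (\<forall>x\<in>carrier A. \<forall>y\<in>carrier A. f (x \<oplus>\<^bsub>A\<^esub> y) = f x + f y) \<and>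
     (\<forall>c. \<forall>x\<in>carrier A. f (c \<odot>\<^bsub>A\<^esub> x) = c * f x) \<and>
     (\<exists>B. \<forall>x\<in>carrier A. cmod (f x) \<le> B * nrm A x)}"

definition dual_nrm :: "('a, 'r) normed_alg_scheme \<Rightarrow> ('a \<Rightarrow> complex) \<Rightarrow> real" where
  "dual_nrm A f = (SUP x\<in>{x \<in> carrier A. nrm A x \<le> 1}. cmod (f x))"

definition numerical_range :: "('a, 'r) normed_alg_scheme \<Rightarrow> 'a \<Rightarrow> complex set" where
  "numerical_range A a = {f a | f. f \<in> dual_space A \<and> f \<one>\<^bsub>A\<^esub> = 1 \<and> dual_nrm A f = 1}"

definition hermitian_elements :: "('a, 'r) normed_alg_scheme \<Rightarrow> 'a set" where
  "hermitian_elements A = {a \<in> carrier A. numerical_range A a \<subseteq> \<real>}"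


section \<open>Complex Borel measures on the real line and symbols\<close>

text \<open>A complex measure is a set function; its values on non-Borel sets are irrelevant.\<close>

definition complex_borel_measure :: "(real set \<Rightarrow> complex) \<Rightarrow> bool" where
  "complex_borel_measure \<mu> \<longleftrightarrow>
     (\<forall>E :: nat \<Rightarrow> real set. range E \<subseteq> sets borel \<and> disjoint_family E \<longrightarrow>
        (\<lambda>n. \<mu> (E n)) sums \<mu> (\<Union>n. E n))"

text \<open>\<open>\<mu> = h d\<nu>\<close> for a finite positive Borel measure \<open>\<nu>\<close>. By the Radon-Nikodym theorem every complex
  Borel measure has such a representation (e.g. the polar decomposition, with \<open>\<nu>\<close> the total
  variation of \<open>\<mu>\<close>), and the integral below does not depend on which one is chosen.\<close>

definition has_density :: "(real set \<Rightarrow> complex) \<Rightarrow> real measure \<Rightarrow> (real \<Rightarrow> complex) \<Rightarrow> bool" where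
  "has_density \<mu> \<nu> h \<longleftrightarrow> finite_measure \<nu> \<and> sets \<nu> = sets borel \<and> integrable \<nu> h \<and>
     (\<forall>E\<in>sets borel. \<mu> E = set_lebesgue_integral \<nu> E h)"

definition cm_integral :: "(real set \<Rightarrow> complex) \<Rightarrow> (real \<Rightarrow> complex) \<Rightarrow> complex" where
  "cm_integral \<mu> f =
     (let (\<nu>, h) = (SOME (\<nu>, h). has_density \<mu> \<nu> h) in LINT x|\<nu>. f x * h x)"

definition fourier_stieltjes :: "(real set \<Rightarrow> complex) \<Rightarrow> real \<Rightarrow> complex" where
  "fourier_stieltjes \<mu> \<xi> = cm_integral \<mu> (\<lambda>x. exp (\<i> * of_real (\<xi> * x)))"

definition B_R :: "(real \<Rightarrow> complex) set" where
  "B_R = {fourier_stieltjes \<mu> | \<mu>. complex_borel_measure \<mu>}"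

definition B_loc :: "(real \<Rightarrow> complex) set" where
  "B_loc = {F. \<forall>x. \<exists>U. open U \<and> x \<in> U \<and> (\<exists>G\<in>B_R. \<forall>y\<in>U. F y = G y)}"


section \<open>Functional calculus\<close>

text \<open>Vector-valued integration is meant in the weak sense: the integral is the element of the
  algebra whose image under every bounded functional is the corresponding scalar integral. For a
  bounded norm-continuous integrand such as \<open>t \<mapsto> exp (ita)\<close> it agrees with the Bochner integral.\<close>

definition alg_integral ::
  "('a, 'r) normed_alg_scheme \<Rightarrow> (real set \<Rightarrow> complex) \<Rightarrow> (real \<Rightarrow> 'a) \<Rightarrow> 'a" where
  "alg_integral A \<mu> g = (THE b. b \<in> carrier A \<and>
     (\<forall>f\<in>dual_space A. f b = cm_integral \<mu> (\<lambda>t. f (g t))))"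

definition represents_near_spectrum ::
  "('a, 'r) normed_alg_scheme \<Rightarrow> (real \<Rightarrow> complex) \<Rightarrow> 'a \<Rightarrow> (real set \<Rightarrow> complex) \<Rightarrow> bool" where
  "represents_near_spectrum A F a \<mu> \<longleftrightarrow> complex_borel_measure \<mu> \<and>
     (\<exists>U. open U \<and> spectrum A a \<subseteq> of_real ` U \<and> (\<forall>x\<in>U. F x = fourier_stieltjes \<mu> x))"

definition symbol_apply :: "('a, 'r) normed_alg_scheme \<Rightarrow> (real \<Rightarrow> complex) \<Rightarrow> 'a \<Rightarrow> 'a" where
  "symbol_apply A F a =
     alg_integral A (SOME \<mu>. represents_near_spectrum A F a \<mu>)
       (\<lambda>t. alg_exp A ((\<i> * of_real t) \<odot>\<^bsub>A\<^esub> a))"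


section \<open>The three classes\<close>

text \<open>HOL cannot quantify over types inside a formula, so universality is relative to a type \<open>'a\<close>
  from which the elements of the algebras are drawn. By lemma \<open>carrier_type_large\<close> below, a type
  hosts a complex unital Banach algebra only if the reals inject into it. Hence a statement proved
  for all types \<open>'a\<close> of at least the cardinality of the continuum covers all such algebras.\<close>

definition US :: "'a itself \<Rightarrow> (real \<Rightarrow> complex) set" where
  "US _ = {F \<in> B_loc. \<forall>A :: 'a normed_alg. complex_unital_banach_algebra A \<longrightarrow>
     (\<forall>a\<in>hermitian_elements A. nrm A (symbol_apply A F a) = spectral_radius A (symbol_apply A F a))}"

definition positive_definite :: "(real \<Rightarrow> complex) \<Rightarrow> bool" where
  "positive_definite \<phi> \<longleftrightarrow> (\<forall>(n::nat) (x :: nat \<Rightarrow> real) (c :: nat \<Rightarrow> complex).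
     (\<Sum>j<n. \<Sum>k<n. \<phi> (x j - x k) * c j * cnj (c k)) \<in> \<real>\<^sub>\<ge>\<^sub>0)"

definition PD :: "(real \<Rightarrow> complex) set" where
  "PD = {F \<in> B_loc. \<forall>K. compact K \<and> K \<noteq> {} \<longrightarrow>
     (\<exists>c. \<exists>x0\<in>K. \<exists>\<phi>. positive_definite \<phi> \<and> (\<forall>x\<in>K. F x = c * \<phi> (x - x0)))}"

definition CH :: "(real \<Rightarrow> complex) set" where
  "CH = {F \<in> B_loc. \<forall>K. compact K \<and> K \<noteq> {} \<longrightarrow>
     (\<exists>c. \<exists>x0\<in>K. \<exists>\<phi>. positive_definite \<phi> \<and> continuous_on UNIV \<phi> \<and>
        (\<forall>x\<in>K. F x = c * \<phi> (x - x0)))}"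

lemma carrier_type_large:
  fixes A :: "('a, 'r) normed_alg_scheme"
  assumes "complex_unital_banach_algebra A"
  shows "\<exists>f :: real \<Rightarrow> 'a. inj f"
proof -
  interpret complex_unital_banach_algebra A by fact
  interpret M: Module.module complex_ring A by (rule complex_module)
  have cl: "z \<odot>\<^bsub>A\<^esub> \<one>\<^bsub>A\<^esub> \<in> carrier A" for z
    by (rule M.smult_closed) (auto simp: complex_ring_def)
  have add: "(z + w) \<odot>\<^bsub>A\<^esub> \<one>\<^bsub>A\<^esub> = z \<odot>\<^bsub>A\<^esub> \<one>\<^bsub>A\<^esub> \<oplus>\<^bsub>A\<^esub> w \<odot>\<^bsub>A\<^esub> \<one>\<^bsub>A\<^esub>" for z w
    using M.smult_l_distr[of z w "\<one>\<^bsub>A\<^esub>"] by (simp add: complex_ring_def)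
  have "inj (\<lambda>r::real. of_real r \<odot>\<^bsub>A\<^esub> \<one>\<^bsub>A\<^esub>)"
  proof (rule injI)
    fix r s :: real
    assume eq: "of_real r \<odot>\<^bsub>A\<^esub> \<one>\<^bsub>A\<^esub> = of_real s \<odot>\<^bsub>A\<^esub> \<one>\<^bsub>A\<^esub>"
    let ?d = "of_real (r - s) :: complex"
    have "of_real s \<odot>\<^bsub>A\<^esub> \<one>\<^bsub>A\<^esub> \<oplus>\<^bsub>A\<^esub> ?d \<odot>\<^bsub>A\<^esub> \<one>\<^bsub>A\<^esub> = of_real s \<odot>\<^bsub>A\<^esub> \<one>\<^bsub>A\<^esub>"
      using add[of "of_real s" ?d] eq by simp
    then have "?d \<odot>\<^bsub>A\<^esub> \<one>\<^bsub>A\<^esub> = \<zero>\<^bsub>A\<^esub>"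
      using cl add.l_cancel_one by blast
    then have "nrm A (?d \<odot>\<^bsub>A\<^esub> \<one>\<^bsub>A\<^esub>) = 0"
      using nrm_eq_0_iff[OF cl] by blast
    then have "cmod ?d = 0"
      using nrm_smult[of "\<one>\<^bsub>A\<^esub>" ?d] nrm_one by simp
    then show "r = s" by simp
  qed
  then show ?thesis by blast
qed

end

theory Submission
  imports Defs "HOL-Probability.Probability" "HOL-Real_Asymp.Real_Asymp"
begin

text \<open>
  \<open>PD = CH\<close>: for \<open>F\<close> in \<open>PD\<close> the maximum of \<open>|F|\<close> over an interval is attained at an endpoint. Over
  the convex hull of a compact set \<open>K\<close> the positive-definite function is continuous, because \<open>F\<close> is, and it
  can be re-based at an endpoint, which lies in \<open>K\<close>.

  \<open>PD\<close> is contained in \<open>US\<close>: let \<open>a\<close> be Hermitian and \<open>f\<close> a functional of norm at most one. The Fourier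
  transform of \<open>exp (-\<epsilon>|t|) f (exp (-ita))\<close> is a difference of resolvents on the two sides of the real
  axis, hence concentrates at the spectrum as \<open>\<epsilon> \<rightarrow> 0\<close>. So \<open>f (F(a))\<close> only depends on \<open>F\<close> near
  the spectrum. If there \<open>F\<close> is a translate of \<open>c \<phi>\<close> with \<open>\<phi>\<close> positive-definite, then \<open>|f (F(a))|\<close> is at
  most \<open>|c| \<phi>(0)\<close>, because Fourier transforms of damped positive-definite functions are nonnegative. Shrinking
  the interval around the spectrum bounds \<open>\<parallel>F(a)\<parallel>\<close> by \<open>|F|\<close> at an endpoint of the spectrum, and approximate
  eigenvectors show that this value belongs to the spectrum of \<open>F(a)\<close>.

  \<open>US\<close> is contained in \<open>PD\<close>: for finite \<open>K\<close> apply universality to the functions on \<open>K\<close>, acting as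
  coefficient multipliers on the trigonometric polynomials with frequencies in \<open>K\<close>; the coordinate function is
  Hermitian. This gives \<open>|\<Sum> l\<^sub>k F k| \<le> max |F| sup |\<Sum> l\<^sub>k exp (ikx)|\<close>. If \<open>x0\<close> is a maximum point of
  \<open>|F|\<close> on a compact set, the Hahn--Banach theorem extends \<open>exp (ikx) \<mapsto> F (k + x0) / F x0\<close> to a functional
  of norm one on the bounded functions that maps \<open>1\<close> to \<open>1\<close>; it is positive, so its values at the characters
  form a positive-definite function.
\<close>


section \<open>Complex measures\<close>

text \<open>Several obstacles shape the argument. The bound \<open>|c| \<phi>(0)\<close> for the
  norm equals \<open>|F x0|\<close> at a base point that may lie in a gap of the spectrum; the
  endpoint principle is what turns it into a bound by spectral values. The function
  \<open>f (exp (-ita))\<close> is bounded but in general not integrable, hence the damping; and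
  pairing its transform with \<phi> calls for measurability, which is why members of
  \<open>PD\<close> are moved into \<open>CH\<close> before any algebra is considered. Conversely,
  Hahn--Banach on the bounded functions gives no control of continuity of the resulting
  positive-definite function, so universality leads to \<open>PD\<close> and not directly to
  \<open>CH\<close>. Each constraint passed to Hahn--Banach involves finitely many frequencies, so
  finite-dimensional algebras are enough to test universality. Their carriers have the size of the
  continuum, and an injection of the reals into \<open>'a\<close> realises them inside that
  type.\<close>

lemma complex_borel_measure_sums:
  assumes "complex_borel_measure \<mu>" "range E \<subseteq> sets borel" "disjoint_family E"
  shows "(\<lambda>n::nat. \<mu> (E n)) sums \<mu> (\<Union>n. E n)"
  using assms unfolding complex_borel_measure_def by blast

lemma complex_borel_measure_empty:
  assumes "complex_borel_measure \<mu>"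
  shows "\<mu> {} = 0"
proof -
  have "(\<lambda>n::nat. \<mu> {}) sums \<mu> {}"
    using complex_borel_measure_sums[OF assms, of "\<lambda>_. {}"] by (simp add: disjoint_family_on_def)
  then have "(\<lambda>n::nat. \<mu> {}) \<longlonglongrightarrow> 0"
    using sums_summable summable_LIMSEQ_zero by blast
  then show ?thesis by (simp add: LIMSEQ_const_iff)
qed

lemma complex_borel_measure_Un:
  assumes \<mu>: "complex_borel_measure \<mu>" and "A \<in> sets borel" "B \<in> sets borel" "A \<inter> B = {}"
  shows "\<mu> (A \<union> B) = \<mu> A + \<mu> B"
proof -
  let ?E = "binaryset A B"
  have "disjoint_family ?E"
    using assms by (auto simp: disjoint_family_on_def binaryset_def)
  then have "(\<lambda>n. \<mu> (?E n)) sums \<mu> (\<Union>n. ?E n)"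
    using assms by (intro complex_borel_measure_sums[OF \<mu>]) (auto simp: range_binaryset_eq)
  moreover have "(\<lambda>n. \<mu> (?E n)) sums (\<Sum>n\<in>{0,1}. \<mu> (?E n))"
    by (rule sums_finite) (auto simp: binaryset_def complex_borel_measure_empty[OF \<mu>])
  ultimately show ?thesis
    by (auto simp: UN_binaryset_eq binaryset_def dest: sums_unique2)
qed

lemma complex_borel_measure_Diff:
  assumes \<mu>: "complex_borel_measure \<mu>" and "A \<in> sets borel" "B \<in> sets borel" "A \<subseteq> B"
  shows "\<mu> (B - A) = \<mu> B - \<mu> A"
proof -
  have "\<mu> (A \<union> (B - A)) = \<mu> A + \<mu> (B - A)"
    using assms by (intro complex_borel_measure_Un) auto
  moreover have "A \<union> (B - A) = B" using assms(4) by blast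
  ultimately show ?thesis by simp
qed

text \<open>If \<open>\<mu>\<close> were unbounded on the subsets of a set \<open>S\<close>, then \<open>S\<close> would split into a part on
  which it is unbounded and a part of measure at least \<open>1\<close>. Iterating yields infinitely many
  disjoint sets of measure at least \<open>1\<close>.\<close>

lemma complex_borel_measure_bounded:
  assumes \<mu>: "complex_borel_measure \<mu>"
  obtains B where "\<And>A. A \<in> sets borel \<Longrightarrow> cmod (\<mu> A) \<le> B"
proof -
  define unb where "unb S \<longleftrightarrow> S \<in> sets borel \<and> (\<forall>B. \<exists>A\<in>sets borel. A \<subseteq> S \<and> cmod (\<mu> A) > B)" for S
  have split: "\<exists>T. unb T \<and> T \<subseteq> S \<and> cmod (\<mu> (S - T)) \<ge> 1" if S: "unb S" for S
  proof -
    \<comment> \<open>The margin \<open>cmod (\<mu> S) + 1\<close> forces both \<open>A\<close> and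
      \<open>S - A\<close> to have measure of modulus at least 1, so whichever of them is unbounded,
      the other can be split off.\<close>
    from S obtain A where A: "A \<in> sets borel" "A \<subseteq> S" "cmod (\<mu> A) > cmod (\<mu> S) + 1"
      unfolding unb_def by blast
    have SB: "S \<in> sets borel" using S by (simp add: unb_def)
    have "unb A \<or> unb (S - A)"
    proof (rule ccontr)
      assume "\<not> ?thesis"
      then obtain B1 B2 where B: "\<And>C. C \<in> sets borel \<Longrightarrow> C \<subseteq> A \<Longrightarrow> cmod (\<mu> C) \<le> B1"
        "\<And>C. C \<in> sets borel \<Longrightarrow> C \<subseteq> S - A \<Longrightarrow> cmod (\<mu> C) \<le> B2"
        using A(1) SB unfolding unb_def by (metis linorder_not_less sets.Diff)
      from S obtain C where C: "C \<in> sets borel" "C \<subseteq> S" "cmod (\<mu> C) > B1 + B2"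
        unfolding unb_def by blast
      have "\<mu> (C \<inter> A \<union> (C - A)) = \<mu> (C \<inter> A) + \<mu> (C - A)"
        using C(1) A(1) by (intro complex_borel_measure_Un[OF \<mu>]) auto
      moreover have "C \<inter> A \<union> (C - A) = C" by blast
      ultimately have "cmod (\<mu> C) \<le> cmod (\<mu> (C \<inter> A)) + cmod (\<mu> (C - A))"
        by (metis norm_triangle_ineq)
      also have "\<dots> \<le> B1 + B2"
        using C A by (intro add_mono B) auto
      finally show False using C(3) by simp
    qed
    moreover have "cmod (\<mu> (S - A)) \<ge> 1"
      using complex_borel_measure_Diff[OF \<mu> A(1) SB A(2)] A(3) norm_triangle_ineq2[of "\<mu> A" "\<mu> S"]
      by (simp add: norm_minus_commute)
    moreover have "cmod (\<mu> (S - (S - A))) \<ge> 1"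
    proof -
      have "S - (S - A) = A" using A(2) by blast
      then show ?thesis using A(3) norm_ge_zero[of "\<mu> S"] by (simp only:)
    qed
    ultimately show ?thesis
      using A(2) by (metis Diff_subset)
  qed
  have "\<not> unb UNIV"
  proof
    assume U: "unb UNIV"
    obtain f where f: "f 0 = UNIV" "\<And>n. unb (f n)"
      "\<And>n. f (Suc n) \<subseteq> f n \<and> cmod (\<mu> (f n - f (Suc n))) \<ge> 1"
    proof -
      define g where "g S = (SOME T. unb T \<and> T \<subseteq> S \<and> cmod (\<mu> (S - T)) \<ge> 1)" for S
      have g: "unb (g S) \<and> g S \<subseteq> S \<and> cmod (\<mu> (S - g S)) \<ge> 1" if "unb S" for S
        unfolding g_def by (rule someI_ex[OF split[OF that]])
      have "unb ((g ^^ n) UNIV)" for n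
        by (induction n) (use U g in auto)
      then show thesis
        using g by (intro that[of "\<lambda>n. (g ^^ n) UNIV"]) auto
    qed
    let ?D = "\<lambda>n. f n - f (Suc n)"
    have "disjoint_family (\<lambda>n. - f (Suc n) - - f n)"
      using f(3) by (intro disjoint_family_Suc) auto
    moreover have "- f (Suc n) - - f n = ?D n" for n by blast
    ultimately have "disjoint_family ?D" by simp
    moreover have "range ?D \<subseteq> sets borel"
      using f(2) unfolding unb_def by blast
    ultimately have "(\<lambda>n. \<mu> (?D n)) \<longlonglongrightarrow> 0"
      using complex_borel_measure_sums[OF \<mu>] sums_summable summable_LIMSEQ_zero by blast
    from LIMSEQ_D[OF this zero_less_one] obtain n where "cmod (\<mu> (?D n)) < 1"
      by auto
    then show False using f(3)[of n] by simp
  qed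
  then show thesis
    using that unfolding unb_def by (metis linorder_not_less sets.top space_borel subset_UNIV)
qed

text \<open>Bridge from real-valued set functions, in which the variation argument is phrased, to
  objects of type \<open>measure\<close>.\<close>

lemma finite_borel_measure_from_sums:
  fixes m :: "real set \<Rightarrow> real"
  assumes nonneg: "\<And>A. A \<in> sets borel \<Longrightarrow> 0 \<le> m A"
    and sums: "\<And>E :: nat \<Rightarrow> real set. range E \<subseteq> sets borel \<Longrightarrow> disjoint_family E \<Longrightarrow> (\<lambda>n. m (E n)) sums m (\<Union>n. E n)"
  obtains M where "finite_measure M" "sets M = sets borel" "\<And>A. A \<in> sets borel \<Longrightarrow> measure M A = m A"
proof -
  have "(\<lambda>n::nat. m {}) sums m {}"
    using sums[of "\<lambda>_. {}"] by (simp add: disjoint_family_on_def)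
  then have "(\<lambda>n::nat. m {}) \<longlonglongrightarrow> 0"
    using sums_summable summable_LIMSEQ_zero by blast
  then have m0: "m {} = 0" by (simp add: LIMSEQ_const_iff)
  define M where "M = measure_of UNIV (sets (borel :: real measure)) (\<lambda>A. ennreal (m A))"
  have sets: "sets M = sets borel"
    unfolding M_def by (metis sets.sets_measure_of_eq space_borel)
  have em: "emeasure M A = ennreal (m A)" if "A \<in> sets borel" for A
  proof (rule emeasure_measure_of[OF M_def])
    show "A \<in> sets M" using that sets by simp
    show "positive (sets M) (\<lambda>A. ennreal (m A))"
      by (simp add: positive_def m0)
    show "countably_additive (sets M) (\<lambda>A. ennreal (m A))"
    proof (rule countably_additiveI)
      fix E :: "nat \<Rightarrow> real set"
      assume E: "range E \<subseteq> sets M" "disjoint_family E" "\<Union> (range E) \<in> sets M"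
      then have "(\<lambda>n. m (E n)) sums m (\<Union>n. E n)" by (intro sums) (auto simp: sets)
      moreover have "\<And>n. 0 \<le> m (E n)" using E(1) by (intro nonneg) (auto simp: sets)
      ultimately show "(\<Sum>i. ennreal (m (E i))) = ennreal (m (\<Union> (range E)))"
        by (simp add: suminf_ennreal2 sums_iff)
    qed
  qed auto
  show thesis
  proof (rule that[OF _ sets])
    have "space M = UNIV" using sets_eq_imp_space_eq[OF sets] by simp
    then show "finite_measure M"
      by (intro finite_measureI) (simp add: em)
    show "measure M A = m A" if "A \<in> sets borel" for A
      using em[OF that] nonneg[OF that] by (simp add: measure_def)
  qed
qed

lemma finite_measure_sums:
  assumes "finite_measure M" "range E \<subseteq> sets M" "disjoint_family E"
  shows "(\<lambda>n::nat. measure M (E n)) sums measure M (\<Union>n. E n)"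
  using assms by (rule finite_measure.finite_measure_UNION)

text \<open>The measure of \<open>E\<close> is the upper variation, the supremum of
  \<open>Re (\<mu> A)\<close> over Borel \<open>A\<close> inside \<open>E\<close>, finite because
  \<mu> is bounded. Near-optimal subsets of the disjoint \<open>E i\<close> unite to a subset of the
  union, which is one half of sigma-additivity; cutting a subset of the union along the
  \<open>E i\<close> is the other.\<close>

lemma complex_borel_measure_positive_part:
  fixes \<mu> :: "real set \<Rightarrow> complex"
  assumes \<mu>: "complex_borel_measure \<mu>"
  obtains P where "finite_measure P" "sets P = sets borel"
    "\<And>A. A \<in> sets borel \<Longrightarrow> Re (\<mu> A) \<le> measure P A"
proof -
  obtain B where B: "\<And>A. A \<in> sets borel \<Longrightarrow> cmod (\<mu> A) \<le> B"
    using complex_borel_measure_bounded[OF \<mu>] by metis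
  define p where "p E = (SUP A\<in>{A\<in>sets borel. A \<subseteq> E}. Re (\<mu> A))" for E
  have bdd: "bdd_above ((\<lambda>A. Re (\<mu> A)) ` {A\<in>sets borel. A \<subseteq> E})" for E
    by (intro bdd_aboveI[of _ B]) (use B complex_Re_le_cmod order_trans in blast)
  have upper: "Re (\<mu> A) \<le> p E" if "A \<in> sets borel" "A \<subseteq> E" for A E
    unfolding p_def using that by (intro cSUP_upper bdd) auto
  have least: "p E \<le> C" if "\<And>A. A \<in> sets borel \<Longrightarrow> A \<subseteq> E \<Longrightarrow> Re (\<mu> A) \<le> C" for E C
    unfolding p_def using that by (intro cSUP_least) auto
  have nonneg: "0 \<le> p E" for E
    using upper[of "{}" E] by (simp add: complex_borel_measure_empty[OF \<mu>])
  have Re_sums: "(\<lambda>n. Re (\<mu> (E n))) sums Re (\<mu> (\<Union>n. E n))"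
    if "range E \<subseteq> sets borel" "disjoint_family E" for E :: "nat \<Rightarrow> real set"
    using complex_borel_measure_sums[OF \<mu> that] by (rule sums_Re)
  have sums: "(\<lambda>n. p (E n)) sums p (\<Union>n. E n)"
    if E: "range E \<subseteq> sets borel" "disjoint_family E" for E :: "nat \<Rightarrow> real set"
  proof -
    have fin: "(\<Sum>i<n. p (E i)) \<le> p (\<Union>n. E n)" for n
    proof (rule field_le_epsilon)
      fix e :: real assume e: "e > 0"
      \<comment> \<open>The errors of \<open>n\<close> sets add up to \<open>n * d\<close>, at most
        \<open>e\<close>; the summand 1 covers \<open>n = 0\<close>.\<close>
      define d where "d = e / (real n + 1)"
      have d: "d > 0" using e by (simp add: d_def)
      have "\<exists>A\<in>sets borel. A \<subseteq> E i \<and> p (E i) - d < Re (\<mu> A)" for i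
        using less_cSUP_iff[OF _ bdd, of "E i" "p (E i) - d"] d unfolding p_def by auto
      then obtain A where A: "\<And>i. A i \<in> sets borel" "\<And>i. A i \<subseteq> E i" "\<And>i. p (E i) - d < Re (\<mu> (A i))"
        by metis
      define A' where "A' i = (if i < n then A i else {})" for i
      have "disjoint_family A'"
        using E(2) A(2) unfolding disjoint_family_on_def A'_def by (auto; blast)
      then have "(\<lambda>i. Re (\<mu> (A' i))) sums Re (\<mu> (\<Union>i. A' i))"
        using A(1) by (intro Re_sums) (auto simp: A'_def[abs_def] image_subset_iff)
      moreover have "(\<lambda>i. Re (\<mu> (A' i))) sums (\<Sum>i<n. Re (\<mu> (A' i)))"
        by (rule sums_finite) (auto simp: A'_def complex_borel_measure_empty[OF \<mu>])
      ultimately have "(\<Sum>i<n. Re (\<mu> (A' i))) = Re (\<mu> (\<Union>i. A' i))"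
        using sums_unique2 by blast
      also have "\<dots> \<le> p (\<Union>n. E n)"
        using A by (intro upper) (auto simp: A'_def)
      finally have "(\<Sum>i<n. Re (\<mu> (A' i))) \<le> p (\<Union>n. E n)" .
      moreover have "(\<Sum>i<n. p (E i) - d) \<le> (\<Sum>i<n. Re (\<mu> (A' i)))"
        by (intro sum_mono) (use A(3) in \<open>auto simp: A'_def less_imp_le\<close>)
      moreover have "(\<Sum>i<n. p (E i) - d) = (\<Sum>i<n. p (E i)) - real n * d"
        by (simp add: sum_subtractf)
      moreover have "real n * d \<le> e"
        using e by (simp add: d_def divide_simps)
      ultimately show "(\<Sum>i<n. p (E i)) \<le> p (\<Union>n. E n) + e" by linarith
    qed
    have summ: "summable (\<lambda>i. p (E i))"
      by (rule bounded_imp_summable[where B = "p (\<Union>n. E n)"])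
        (use nonneg fin[of "Suc _"] in \<open>auto simp: lessThan_Suc_atMost\<close>)
    have le1: "(\<Sum>i. p (E i)) \<le> p (\<Union>n. E n)"
      by (rule suminf_le_const[OF summ fin])
    have le2: "p (\<Union>n. E n) \<le> (\<Sum>i. p (E i))"
    proof (rule least)
      fix A assume A: "A \<in> sets borel" "A \<subseteq> (\<Union>n. E n)"
      have "(\<lambda>i. Re (\<mu> (A \<inter> E i))) sums Re (\<mu> (\<Union>i. A \<inter> E i))"
      proof (rule Re_sums)
        show "disjoint_family (\<lambda>i. A \<inter> E i)"
          using E(2) by (auto simp: disjoint_family_on_def)
      qed (use A(1) E(1) in auto)
      moreover have "(\<Union>i. A \<inter> E i) = A" using A(2) by blast
      ultimately have "(\<lambda>i. Re (\<mu> (A \<inter> E i))) sums Re (\<mu> A)" by simp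
      then show "Re (\<mu> A) \<le> (\<Sum>i. p (E i))"
        using summ
      proof (rule sums_le[rotated, OF _ summable_sums])
        show "Re (\<mu> (A \<inter> E i)) \<le> p (E i)" for i
          using A(1) E(1) by (intro upper) auto
      qed
    qed
    show ?thesis
      using summable_sums[OF summ] order_antisym[OF le1 le2] by simp
  qed
  show thesis
    using finite_borel_measure_from_sums[of p, OF nonneg sums] upper that by (metis order_refl)
qed

text \<open>Domination implies absolute continuity. The Radon--Nikodym derivative is taken
  real-valued so that it can enter Bochner integrals.\<close>

lemma finite_measure_density_exists:
  fixes M :: "real measure"
  assumes \<nu>: "finite_measure \<nu>" "sets \<nu> = sets borel" and M: "finite_measure M" "sets M = sets borel"
    and le: "\<And>A. A \<in> sets borel \<Longrightarrow> measure M A \<le> measure \<nu> A"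
  obtains D where "integrable \<nu> D" "\<And>A. A \<in> sets borel \<Longrightarrow> measure M A = set_lebesgue_integral \<nu> A D"
proof -
  interpret N: finite_measure \<nu> by fact
  interpret M: finite_measure M by fact
  have ac: "absolutely_continuous \<nu> M"
    unfolding absolutely_continuous_def null_sets_def
    using le \<nu>(2) M(2) by (auto simp: N.emeasure_eq_measure M.emeasure_eq_measure)
      (metis measure_nonneg order_antisym)
  obtain D :: "real \<Rightarrow> real" where D: "D \<in> borel_measurable \<nu>" "AE x in \<nu>. RN_deriv \<nu> M x = ennreal (D x)" "\<And>x. 0 \<le> D x"
    using N.real_RN_deriv[OF M(1) ac] M(2) \<nu>(2) by metis
  have eq: "density \<nu> D = M"
    using N.density_RN_deriv[OF ac] M(2) \<nu>(2) D
    by (subst density_cong[of "\<lambda>x. ennreal (D x)" \<nu> "RN_deriv \<nu> M"]) auto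
  have em: "emeasure M A = (\<integral>\<^sup>+x. ennreal (indicator A x * D x) \<partial>\<nu>)" if "A \<in> sets borel" for A
  proof -
    have "emeasure M A = (\<integral>\<^sup>+x. ennreal (D x) * indicator A x \<partial>\<nu>)"
      using that \<nu>(2) D(1) by (subst eq[symmetric]) (simp add: emeasure_density)
    also have "\<dots> = (\<integral>\<^sup>+x. ennreal (indicator A x * D x) \<partial>\<nu>)"
      by (intro nn_integral_cong) (auto simp: indicator_def)
    finally show ?thesis .
  qed
  have sp: "space \<nu> = UNIV" using sets_eq_imp_space_eq[OF \<nu>(2)] by simp
  show thesis
  proof (rule that)
    have "(\<integral>\<^sup>+x. ennreal (D x) \<partial>\<nu>) = ennreal (measure M UNIV)"
      using em[of UNIV] by (simp add: M.emeasure_eq_measure)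
    then have "(\<integral>\<^sup>+x. ennreal (D x) \<partial>\<nu>) < \<infinity>"
      by simp
    then show int: "integrable \<nu> D"
      using D by (intro integrableI_nonneg) auto
    show "measure M A = set_lebesgue_integral \<nu> A D" if A: "A \<in> sets borel" for A
    proof -
      have "integrable \<nu> (\<lambda>x. indicator A x * D x)"
        using integrable_mult_indicator[OF _ int, of A] A \<nu>(2) by simp
      then have "emeasure M A = ennreal (\<integral>x. indicator A x * D x \<partial>\<nu>)"
        unfolding em[OF A] using D(3) by (intro nn_integral_eq_integral) auto
      then show ?thesis
        unfolding set_lebesgue_integral_def
        by (simp add: measure_def integral_nonneg_AE D(3))
    qed
  qed
qed

lemma complex_borel_measure_scale:
  assumes "complex_borel_measure \<mu>"
  shows "complex_borel_measure (\<lambda>A. c * \<mu> A)"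
  using assms unfolding complex_borel_measure_def by (auto intro: sums_mult)

text \<open>A positive measure \<open>P\<close> above the real part leaves a positive remainder
  \<open>P'\<close>, and likewise \<open>Q\<close> and \<open>Q'\<close> for the imaginary part,
  which is the real part of \<open>-\<i>\<close> times \<mu>. The sum \<nu> of the four dominates
  each, so all have densities against a single measure.\<close>

lemma complex_borel_measure_has_density:
  assumes \<mu>: "complex_borel_measure \<mu>"
  shows "\<exists>\<nu> h. has_density \<mu> \<nu> h"
proof -
  obtain P where P: "finite_measure P" "sets P = sets borel"
    "\<And>A. A \<in> sets borel \<Longrightarrow> Re (\<mu> A) \<le> measure P A"
    using complex_borel_measure_positive_part[OF \<mu>] by metis
  obtain Q where Q: "finite_measure Q" "sets Q = sets borel"
    "\<And>A. A \<in> sets borel \<Longrightarrow> Im (\<mu> A) \<le> measure Q A"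
    using complex_borel_measure_positive_part[OF complex_borel_measure_scale[OF \<mu>, of "-\<i>"]] by auto
  have Psums: "(\<lambda>n. measure P (E n)) sums measure P (\<Union>n. E n)"
    and Qsums: "(\<lambda>n. measure Q (E n)) sums measure Q (\<Union>n. E n)"
    and Rsums: "(\<lambda>n. Re (\<mu> (E n))) sums Re (\<mu> (\<Union>n. E n))"
    and Isums: "(\<lambda>n. Im (\<mu> (E n))) sums Im (\<mu> (\<Union>n. E n))"
    if "range E \<subseteq> sets borel" "disjoint_family E" for E :: "nat \<Rightarrow> real set"
    using finite_measure_sums[OF P(1), of E] finite_measure_sums[OF Q(1), of E] that P(2) Q(2)
      complex_borel_measure_sums[OF \<mu> that] by (auto intro: sums_Re sums_Im)
  obtain P' where P': "finite_measure P'" "sets P' = sets borel"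
    "\<And>A. A \<in> sets borel \<Longrightarrow> measure P' A = measure P A - Re (\<mu> A)"
    by (rule finite_borel_measure_from_sums[of "\<lambda>A. measure P A - Re (\<mu> A)"])
      (use P(3) in \<open>auto intro!: sums_diff Psums Rsums\<close>)
  obtain Q' where Q': "finite_measure Q'" "sets Q' = sets borel"
    "\<And>A. A \<in> sets borel \<Longrightarrow> measure Q' A = measure Q A - Im (\<mu> A)"
    by (rule finite_borel_measure_from_sums[of "\<lambda>A. measure Q A - Im (\<mu> A)"])
      (use Q(3) in \<open>auto intro!: sums_diff Qsums Isums\<close>)
  have P'sums: "(\<lambda>n. measure P' (E n)) sums measure P' (\<Union>n. E n)"
    and Q'sums: "(\<lambda>n. measure Q' (E n)) sums measure Q' (\<Union>n. E n)"
    if "range E \<subseteq> sets borel" "disjoint_family E" for E :: "nat \<Rightarrow> real set"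
    using finite_measure_sums[OF P'(1), of E] finite_measure_sums[OF Q'(1), of E] that P'(2) Q'(2)
    by auto
  obtain \<nu> where \<nu>: "finite_measure \<nu>" "sets \<nu> = sets borel"
    "\<And>A. A \<in> sets borel \<Longrightarrow> measure \<nu> A = measure P A + measure Q A + measure P' A + measure Q' A"
  proof (rule finite_borel_measure_from_sums[of "\<lambda>A. measure P A + measure Q A + measure P' A + measure Q' A"])
    show "(\<lambda>n. measure P (E n) + measure Q (E n) + measure P' (E n) + measure Q' (E n)) sums
       (measure P (\<Union>n. E n) + measure Q (\<Union>n. E n) + measure P' (\<Union>n. E n) + measure Q' (\<Union>n. E n))"
      if "range E \<subseteq> sets borel" "disjoint_family E" for E :: "nat \<Rightarrow> real set"
      by (intro sums_add Psums Qsums P'sums Q'sums that)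
  qed auto
  note density = finite_measure_density_exists[OF \<nu>(1,2)]
  obtain D1 where D1: "integrable \<nu> D1" "\<And>A. A \<in> sets borel \<Longrightarrow> measure P A = set_lebesgue_integral \<nu> A D1"
    using density[OF P(1,2)] \<nu>(3) by auto
  obtain D2 where D2: "integrable \<nu> D2" "\<And>A. A \<in> sets borel \<Longrightarrow> measure Q A = set_lebesgue_integral \<nu> A D2"
    using density[OF Q(1,2)] \<nu>(3) by auto
  obtain D3 where D3: "integrable \<nu> D3" "\<And>A. A \<in> sets borel \<Longrightarrow> measure P' A = set_lebesgue_integral \<nu> A D3"
    using density[OF P'(1,2)] \<nu>(3) by auto
  obtain D4 where D4: "integrable \<nu> D4" "\<And>A. A \<in> sets borel \<Longrightarrow> measure Q' A = set_lebesgue_integral \<nu> A D4"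
    using density[OF Q'(1,2)] \<nu>(3) by auto
  define h where "h x = complex_of_real (D1 x - D3 x) + \<i> * complex_of_real (D2 x - D4 x)" for x
  have h: "integrable \<nu> h"
    unfolding h_def using D1(1) D2(1) D3(1) D4(1) by auto
  have "\<mu> A = set_lebesgue_integral \<nu> A h" if A: "A \<in> sets borel" for A
  proof -
    have A\<nu>: "A \<in> sets \<nu>" using A \<nu>(2) by simp
    have int: "integrable \<nu> (\<lambda>x. indicator A x * D x)" if "integrable \<nu> D" for D :: "real \<Rightarrow> real"
      using integrable_mult_indicator[OF A\<nu> that] by simp
    have "set_lebesgue_integral \<nu> A h = (\<integral>x. complex_of_real (indicator A x * D1 x - indicator A x * D3 x)
        + \<i> * complex_of_real (indicator A x * D2 x - indicator A x * D4 x) \<partial>\<nu>)"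
      unfolding set_lebesgue_integral_def h_def
      by (intro Bochner_Integration.integral_cong) (auto simp: indicator_def)
    also have "\<dots> = complex_of_real ((\<integral>x. indicator A x * D1 x \<partial>\<nu>) - (\<integral>x. indicator A x * D3 x \<partial>\<nu>))
        + \<i> * complex_of_real ((\<integral>x. indicator A x * D2 x \<partial>\<nu>) - (\<integral>x. indicator A x * D4 x \<partial>\<nu>))"
      using int[OF D1(1)] int[OF D2(1)] int[OF D3(1)] int[OF D4(1)]
      by (simp del: of_real_diff of_real_mult)
    also have "\<dots> = complex_of_real (measure P A - measure P' A) + \<i> * complex_of_real (measure Q A - measure Q' A)"
      using D1(2)[OF A] D2(2)[OF A] D3(2)[OF A] D4(2)[OF A] by (simp add: set_lebesgue_integral_def)
    also have "\<dots> = \<mu> A"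
      using P'(3)[OF A] Q'(3)[OF A] by (simp add: complex_eq_iff)
    finally show ?thesis by simp
  qed
  then have "has_density \<mu> \<nu> h"
    unfolding has_density_def using \<nu>(1,2) h by blast
  then show ?thesis by blast
qed


text \<open>Resolves the choice inside \<open>cm_integral\<close>: one density serves all
  integrands, so the integral becomes an ordinary Bochner integral.\<close>

lemma complex_borel_measure_integral:
  assumes "complex_borel_measure \<mu>"
  obtains \<nu> h where "finite_measure \<nu>" "sets \<nu> = sets borel" "integrable \<nu> h"
    "\<And>f. cm_integral \<mu> f = (LINT x|\<nu>. f x * h x)"
    "\<And>A. A \<in> sets borel \<Longrightarrow> \<mu> A = (LINT x|\<nu>. indicator A x * h x)"
proof -
  define p where "p = (SOME (\<nu>, h). has_density \<mu> \<nu> h)"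
  have "\<exists>p. case p of (\<nu>, h) \<Rightarrow> has_density \<mu> \<nu> h"
    using complex_borel_measure_has_density[OF assms] by auto
  then have "case p of (\<nu>, h) \<Rightarrow> has_density \<mu> \<nu> h"
    unfolding p_def by (rule someI_ex)
  then have *: "has_density \<mu> (fst p) (snd p)" by (simp add: case_prod_beta)
  have ind: "indicator A x *\<^sub>R snd p x = indicator A x * snd p x" for A x
    by (simp add: indicator_def)
  have cm: "cm_integral \<mu> f = (LINT x|fst p. f x * snd p x)" for f
    by (simp add: cm_integral_def p_def case_prod_beta Let_def)
  show thesis
    by (rule that[OF _ _ _ cm])
      (use * in \<open>auto simp: has_density_def set_lebesgue_integral_def ind\<close>)
qed

section \<open>Integration functionals and Fourier--Stieltjes transforms\<close>

definition bounded_borel :: "(real \<Rightarrow> complex) \<Rightarrow> bool" where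
  "bounded_borel f \<longleftrightarrow> f \<in> borel_measurable borel \<and> (\<exists>B. \<forall>x. cmod (f x) \<le> B)"

text \<open>Integration against a complex measure; additivity and bounded convergence are all that is used.\<close>

definition sigma_functional :: "((real \<Rightarrow> complex) \<Rightarrow> complex) \<Rightarrow> bool" where
  "sigma_functional L \<longleftrightarrow>
     (\<forall>f g. bounded_borel f \<longrightarrow> bounded_borel g \<longrightarrow> L (\<lambda>x. f x + g x) = L f + L g) \<and>
     (\<forall>c f. bounded_borel f \<longrightarrow> L (\<lambda>x. c * f x) = c * L f) \<and>
     (\<forall>s f B. (\<forall>n::nat. s n \<in> borel_measurable borel) \<longrightarrow> (\<forall>n x. cmod (s n x) \<le> B) \<longrightarrow>
        (\<forall>x. (\<lambda>n. s n x) \<longlonglongrightarrow> f x) \<longrightarrow> (\<lambda>n. L (s n)) \<longlonglongrightarrow> L f)"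

lemma sigma_functionalD:
  assumes "sigma_functional L"
  shows "\<And>f g. bounded_borel f \<Longrightarrow> bounded_borel g \<Longrightarrow> L (\<lambda>x. f x + g x) = L f + L g"
    "\<And>c f. bounded_borel f \<Longrightarrow> L (\<lambda>x. c * f x) = c * L f"
    "\<And>s f B. (\<And>n::nat. s n \<in> borel_measurable borel) \<Longrightarrow> (\<And>n x. cmod (s n x) \<le> B) \<Longrightarrow>
        (\<And>x. (\<lambda>n. s n x) \<longlonglongrightarrow> f x) \<Longrightarrow> (\<lambda>n. L (s n)) \<longlonglongrightarrow> L f"
  using assms unfolding sigma_functional_def by blast+

lemma sigma_functionalI:
  assumes "\<And>f g. bounded_borel f \<Longrightarrow> bounded_borel g \<Longrightarrow> L (\<lambda>x. f x + g x) = L f + L g"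
    and "\<And>c f. bounded_borel f \<Longrightarrow> L (\<lambda>x. c * f x) = c * L f"
    and "\<And>s f B. (\<And>n::nat. s n \<in> borel_measurable borel) \<Longrightarrow> (\<And>n x. cmod (s n x) \<le> B) \<Longrightarrow>
        (\<And>x. (\<lambda>n. s n x) \<longlonglongrightarrow> f x) \<Longrightarrow> (\<lambda>n. L (s n)) \<longlonglongrightarrow> L f"
  shows "sigma_functional L"
  using assms unfolding sigma_functional_def by blast

lemma bounded_borel_indicator: "A \<in> sets borel \<Longrightarrow> bounded_borel (indicator A)"
  unfolding bounded_borel_def by (auto simp: indicator_def intro!: exI[of _ 1])

lemma bounded_borel_exp: "bounded_borel (\<lambda>x. iexp (\<xi> * x))"
  unfolding bounded_borel_def by (auto intro!: exI[of _ 1])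

lemma sigma_functional_sum:
  assumes L: "sigma_functional L" and "finite I" "\<And>i. i \<in> I \<Longrightarrow> bounded_borel (f i)"
  shows "bounded_borel (\<lambda>x. \<Sum>i\<in>I. f i x) \<and> L (\<lambda>x. \<Sum>i\<in>I. f i x) = (\<Sum>i\<in>I. L (f i))"
  using assms(2,3)
proof (induction I)
  case empty
  have "bounded_borel (\<lambda>_. 0)" by (auto simp: bounded_borel_def)
  with sigma_functionalD(2)[OF L this, of 0] show ?case by simp
next
  case (insert i I)
  let ?g = "\<lambda>x. \<Sum>i\<in>I. f i x"
  have *: "bounded_borel ?g" "L ?g = (\<Sum>i\<in>I. L (f i))" "bounded_borel (f i)"
    using insert by auto
  have "bounded_borel (\<lambda>x. f i x + ?g x)"
    using *(1,3) unfolding bounded_borel_def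
    by (auto intro: norm_triangle_mono)
  then show ?case
    using insert(1,2) *(2) sigma_functionalD(1)[OF L *(3) *(1)] by simp
qed

text \<open>Agreement on indicators passes to simple functions by linearity and to bounded Borel
  functions by bounded convergence. Hence integrals depend on the measure alone, whatever density
  was chosen.\<close>

lemma sigma_functional_eqI:
  assumes L1: "sigma_functional L1" and L2: "sigma_functional L2"
    and eq: "\<And>A. A \<in> sets borel \<Longrightarrow> L1 (indicator A) = L2 (indicator A)"
    and f: "bounded_borel f"
  shows "L1 f = L2 f"
proof -
  obtain B where fm: "f \<in> borel_measurable borel" and B: "\<And>x. cmod (f x) \<le> B"
    using f unfolding bounded_borel_def by auto
  obtain s where s: "\<And>i. simple_function borel (s i)" "\<And>x. (\<lambda>i. s i x) \<longlonglongrightarrow> f x"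
    "\<And>i x. dist (s i x) 0 \<le> 2 * dist (f x) 0"
    using borel_measurable_implies_sequence_metric[OF fm, of 0] by auto
  have sm: "s n \<in> borel_measurable borel" for n
    using s(1) by (rule borel_measurable_simple_function)
  have sB: "cmod (s n x) \<le> 2 * B" for n x
    using s(3)[of n x] B[of x] by simp
  have "L1 (s n) = L2 (s n)" for n
  proof -
    let ?I = "s n ` UNIV" and ?g = "\<lambda>y x. y * indicator (s n -` {y}) x"
    have fin: "finite ?I" using s(1)[of n] by (simp add: simple_function_def)
    have sets: "s n -` {y} \<in> sets borel" for y
      using measurable_sets[OF sm, of "{y}" n] by simp
    have g: "bounded_borel (?g y)" for y
      unfolding bounded_borel_def
    proof (intro conjI exI allI)
      show "?g y \<in> borel_measurable borel"
        by (rule borel_measurable_times[OF borel_measurable_const borel_measurable_indicator[OF sets]])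
      show "cmod (?g y x) \<le> cmod y" for x by (simp add: indicator_def)
    qed
    have "(\<Sum>y\<in>?I. ?g y x) = (\<Sum>y\<in>?I. if y = s n x then y else 0)" for x
      by (intro sum.cong) (auto simp: indicator_def)
    then have sn: "s n = (\<lambda>x. \<Sum>y\<in>?I. ?g y x)"
      using fin by (simp add: sum.delta fun_eq_iff)
    have sum_eq: "L (s n) = (\<Sum>y\<in>?I. y * L (indicator (s n -` {y})))" if "sigma_functional L" for L
      by (subst sn) (use sigma_functional_sum[OF that fin g] sigma_functionalD(2)[OF that bounded_borel_indicator[OF sets]] in simp)
    show ?thesis
      unfolding sum_eq[OF L1] sum_eq[OF L2] eq[OF sets] ..
  qed
  then have "(\<lambda>n. L2 (s n)) \<longlonglongrightarrow> L1 f"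
    using sigma_functionalD(3)[OF L1 sm sB s(2)] by simp
  then show ?thesis
    using sigma_functionalD(3)[OF L2 sm sB s(2)] LIMSEQ_unique by blast
qed

text \<open>Stated for a pull-back along \<open>X\<close> so that it covers both integration against
  a density, with \<open>X\<close> the identity, and the convolution averages of
  \<open>f (s + t)\<close> in \<open>B_R_mult_fourier_transform\<close>.\<close>

lemma sigma_functional_integral:
  fixes H :: "'b \<Rightarrow> complex"
  assumes X: "X \<in> borel_measurable M" and H: "integrable M H"
  shows "sigma_functional (\<lambda>f. LINT \<omega>|M. f (X \<omega>) * H \<omega>)"
proof -
  have int: "integrable M (\<lambda>\<omega>. f (X \<omega>) * H \<omega>)" if f: "bounded_borel f" for f
  proof -
    obtain B where fm: "f \<in> borel_measurable borel" and B: "\<And>x. cmod (f x) \<le> B"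
      using f unfolding bounded_borel_def by auto
    show ?thesis
    proof (rule Bochner_Integration.integrable_bound[of M "\<lambda>\<omega>. B * cmod (H \<omega>)"])
      show "AE \<omega> in M. norm (f (X \<omega>) * H \<omega>) \<le> norm (B * cmod (H \<omega>))"
        using B by (intro AE_I2) (auto simp: norm_mult abs_mult intro!: mult_right_mono order_trans[OF B abs_ge_self])
    qed (use H fm X in auto)
  qed
  show ?thesis
    unfolding sigma_functional_def
  proof (intro conjI allI impI)
    fix f g assume "bounded_borel f" "bounded_borel g"
    then show "(LINT \<omega>|M. (f (X \<omega>) + g (X \<omega>)) * H \<omega>) = (LINT \<omega>|M. f (X \<omega>) * H \<omega>) + (LINT \<omega>|M. g (X \<omega>) * H \<omega>)"
      by (simp add: distrib_right int)
  next
    fix c f assume "bounded_borel f"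
    then show "(LINT \<omega>|M. c * f (X \<omega>) * H \<omega>) = c * (LINT \<omega>|M. f (X \<omega>) * H \<omega>)"
      by (simp add: mult.assoc)
  next
    fix s :: "nat \<Rightarrow> real \<Rightarrow> complex" and f B assume s: "\<forall>n. s n \<in> borel_measurable borel" "\<forall>n x. cmod (s n x) \<le> B" "\<forall>x. (\<lambda>n. s n x) \<longlonglongrightarrow> f x"
    have fm: "f \<in> borel_measurable borel"
      by (rule borel_measurable_LIMSEQ_metric[of s]) (use s in auto)
    show "(\<lambda>n. LINT \<omega>|M. s n (X \<omega>) * H \<omega>) \<longlonglongrightarrow> (LINT \<omega>|M. f (X \<omega>) * H \<omega>)"
    proof (rule integral_dominated_convergence[of _ _ _ "\<lambda>\<omega>. B * cmod (H \<omega>)"])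
      show "AE \<omega> in M. norm (s n (X \<omega>) * H \<omega>) \<le> B * cmod (H \<omega>)" for n
        using s(2) by (auto simp: norm_mult intro!: mult_right_mono)
      show "(\<lambda>\<omega>. f (X \<omega>) * H \<omega>) \<in> borel_measurable M"
        using fm X H by auto
      show "(\<lambda>\<omega>. s n (X \<omega>) * H \<omega>) \<in> borel_measurable M" for n
        using measurable_compose[OF X spec[OF s(1)]] H by auto
    qed (use s(3) H in \<open>auto intro!: tendsto_intros AE_I2\<close>)
  qed
qed

lemma sigma_functional_cm_integral:
  assumes "complex_borel_measure \<mu>"
  shows "sigma_functional (cm_integral \<mu>)"
    and "\<And>A. A \<in> sets borel \<Longrightarrow> cm_integral \<mu> (indicator A) = \<mu> A"
proof -
  obtain \<nu> h where *: "finite_measure \<nu>" "sets \<nu> = sets borel" "integrable \<nu> h"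
    "\<And>f. cm_integral \<mu> f = (LINT x|\<nu>. f x * h x)"
    "\<And>A. A \<in> sets borel \<Longrightarrow> \<mu> A = (LINT x|\<nu>. indicator A x * h x)"
    using complex_borel_measure_integral[OF assms] by metis
  have "(\<lambda>x. x) \<in> borel_measurable \<nu>"
    by (simp add: measurable_ident_sets[OF *(2)])
  from sigma_functional_integral[OF this *(3)]
  moreover have "(\<lambda>f. LINT x|\<nu>. f x * h x) = cm_integral \<mu>"
    by (simp add: fun_eq_iff *(4))
  ultimately show "sigma_functional (cm_integral \<mu>)" by simp
  show "\<And>A. A \<in> sets borel \<Longrightarrow> cm_integral \<mu> (indicator A) = \<mu> A"
    by (simp add: *(4,5))
qed

lemma complex_borel_measure_sigma_functional:
  assumes L: "sigma_functional L"
  shows "complex_borel_measure (\<lambda>A. L (indicator A))"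
  unfolding complex_borel_measure_def
proof (intro allI impI)
  fix E :: "nat \<Rightarrow> real set" assume E: "range E \<subseteq> sets borel \<and> disjoint_family E"
  have bb: "bounded_borel (indicator (E n))" for n
    using E by (intro bounded_borel_indicator) auto
  let ?s = "\<lambda>n x. \<Sum>i<n. indicator (E i) x :: complex"
  have s_eq: "?s n = indicator (\<Union>i<n. E i)" for n
    using E by (intro ext) (subst indicator_UN_disjoint, auto intro: disjoint_family_on_mono)
  have "(\<lambda>n. L (?s n)) \<longlonglongrightarrow> L (indicator (\<Union>n. E n))"
  proof (rule sigma_functionalD(3)[OF L])
    show "?s n \<in> borel_measurable borel" for n
      using sigma_functional_sum[OF L, of "{..<n}" "\<lambda>i. indicator (E i)"] bb unfolding bounded_borel_def by blast
    show "cmod (?s n x) \<le> 1" for n x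
      unfolding fun_cong[OF s_eq] by (simp add: indicator_def)
    show "(\<lambda>n. ?s n x) \<longlonglongrightarrow> indicator (\<Union>n. E n) x" for x
      unfolding fun_cong[OF s_eq] by (rule LIMSEQ_indicator_UN)
  qed
  moreover have "L (?s n) = (\<Sum>i<n. L (indicator (E i)))" for n
    using sigma_functional_sum[OF L, of "{..<n}" "\<lambda>i. indicator (E i)"] bb by blast
  ultimately show "(\<lambda>n. L (indicator (E n))) sums L (indicator (\<Union>n. E n))"
    by (simp add: sums_def)
qed

text \<open>Complex measures and functionals with bounded convergence determine each other. Closure
  properties of \<open>B_R\<close> can therefore be proved by writing down a functional, without
  touching densities.\<close>

lemma B_R_iff:
  "G \<in> B_R \<longleftrightarrow> (\<exists>L. sigma_functional L \<and> G = (\<lambda>\<xi>. L (\<lambda>x. iexp (\<xi> * x))))"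
proof
  assume "G \<in> B_R"
  then obtain \<mu> where "complex_borel_measure \<mu>" "G = fourier_stieltjes \<mu>"
    by (auto simp: B_R_def)
  then show "\<exists>L. sigma_functional L \<and> G = (\<lambda>\<xi>. L (\<lambda>x. iexp (\<xi> * x)))"
    using sigma_functional_cm_integral(1)[of \<mu>]
    by (intro exI[of _ "cm_integral \<mu>"]) (auto simp: fourier_stieltjes_def fun_eq_iff)
next
  assume "\<exists>L. sigma_functional L \<and> G = (\<lambda>\<xi>. L (\<lambda>x. iexp (\<xi> * x)))"
  then obtain L where L: "sigma_functional L" "G = (\<lambda>\<xi>. L (\<lambda>x. iexp (\<xi> * x)))"
    by blast
  let ?\<mu> = "\<lambda>A. L (indicator A)"
  have \<mu>: "complex_borel_measure ?\<mu>" by (rule complex_borel_measure_sigma_functional[OF L(1)])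
  have "cm_integral ?\<mu> (\<lambda>x. iexp (\<xi> * x)) = L (\<lambda>x. iexp (\<xi> * x))" for \<xi>
    by (rule sigma_functional_eqI[OF sigma_functional_cm_integral(1)[OF \<mu>] L(1) _ bounded_borel_exp])
      (rule sigma_functional_cm_integral(2)[OF \<mu>])
  then have "G = fourier_stieltjes ?\<mu>"
    by (simp add: L(2) fourier_stieltjes_def fun_eq_iff)
  with \<mu> show "G \<in> B_R" unfolding B_R_def by blast
qed

lemma B_R_add:
  assumes "F \<in> B_R" "G \<in> B_R"
  shows "(\<lambda>\<xi>. F \<xi> + G \<xi>) \<in> B_R"
proof -
  obtain L1 L2 where L: "sigma_functional L1" "sigma_functional L2"
    and *: "F = (\<lambda>\<xi>. L1 (\<lambda>x. iexp (\<xi> * x)))" "G = (\<lambda>\<xi>. L2 (\<lambda>x. iexp (\<xi> * x)))"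
    using assms unfolding B_R_iff by blast
  have "sigma_functional (\<lambda>f. L1 f + L2 f)"
  proof (rule sigma_functionalI)
    show "(\<lambda>n. L1 (s n) + L2 (s n)) \<longlonglongrightarrow> L1 f + L2 f"
      if "\<And>n. s n \<in> borel_measurable borel" "\<And>n x. cmod (s n x) \<le> B" "\<And>x. (\<lambda>n. s n x) \<longlonglongrightarrow> f x"
      for s :: "nat \<Rightarrow> real \<Rightarrow> complex" and f B
      using that by (intro tendsto_add sigma_functionalD(3)[OF L(1)] sigma_functionalD(3)[OF L(2)])
  qed (simp_all add: sigma_functionalD(1,2)[OF L(1)] sigma_functionalD(1,2)[OF L(2)] distrib_left)
  then show ?thesis unfolding B_R_iff * by (intro exI[of _ "\<lambda>f. L1 f + L2 f"]) simp
qed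

text \<open>Products of transforms come from convolutions: \<open>C f s\<close> averages
  \<open>f (s + t)\<close> against \<open>k\<close>, and \<open>L\<close> composed with
  \<open>C\<close> is integration against the convolution of the measure with \<open>k\<close>.
  Characters are eigenfunctions of \<open>C\<close> with eigenvalue \<open>T \<xi>\<close>.\<close>

lemma B_R_mult_fourier_transform:
  assumes F: "F \<in> B_R" and k: "integrable lborel k"
    and T: "\<And>\<xi>. T \<xi> = (LINT t|lborel. iexp (\<xi> * t) * k t)"
  shows "(\<lambda>\<xi>. T \<xi> * F \<xi>) \<in> B_R"
proof -
  obtain L where L: "sigma_functional L" "F = (\<lambda>\<xi>. L (\<lambda>x. iexp (\<xi> * x)))"
    using F unfolding B_R_iff by blast
  define C where "C f s = (LINT t|lborel. f (s + t) * k t)" for f :: "real \<Rightarrow> complex" and s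
  have km [measurable]: "k \<in> borel_measurable borel" using k by auto
  have sC: "sigma_functional (\<lambda>f. C f s)" for s
    unfolding C_def by (rule sigma_functional_integral[OF _ k]) simp
  have C_meas: "C f \<in> borel_measurable borel" if [measurable]: "f \<in> borel_measurable borel" for f
    unfolding C_def by measurable
  have C_bound: "cmod (C f s) \<le> B * (LINT t|lborel. cmod (k t))"
    if f: "f \<in> borel_measurable borel" "\<And>x. cmod (f x) \<le> B" for f s B
  proof -
    have "cmod (C f s) \<le> (LINT t|lborel. B * cmod (k t))"
      unfolding C_def
    proof (rule Bochner_Integration.integral_norm_bound_integral)
      show "integrable lborel (\<lambda>t. f (s + t) * k t)"
        by (rule Bochner_Integration.integrable_bound[of _ "\<lambda>t. B * cmod (k t)"])
          (use k f in \<open>auto simp: norm_mult abs_mult intro!: mult_right_mono order_trans[OF f(2) abs_ge_self]\<close>)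
    qed (use k f in \<open>auto simp: norm_mult intro!: mult_right_mono\<close>)
    then show ?thesis by simp
  qed
  have bb: "bounded_borel (C f)" if "bounded_borel f" for f
    using that C_meas C_bound unfolding bounded_borel_def by meson
  have "sigma_functional (\<lambda>f. L (C f))"
    unfolding sigma_functional_def
  proof (intro conjI allI impI)
    fix f g assume fg: "bounded_borel f" "bounded_borel g"
    have "C (\<lambda>x. f x + g x) = (\<lambda>s. C f s + C g s)"
      using sigma_functionalD(1)[OF sC fg] by (simp add: fun_eq_iff)
    then show "L (C (\<lambda>x. f x + g x)) = L (C f) + L (C g)"
      using sigma_functionalD(1)[OF L(1) bb[OF fg(1)] bb[OF fg(2)]] by simp
  next
    fix c f assume f: "bounded_borel f"
    have "C (\<lambda>x. c * f x) = (\<lambda>s. c * C f s)"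
      using sigma_functionalD(2)[OF sC f] by (simp add: fun_eq_iff)
    then show "L (C (\<lambda>x. c * f x)) = c * L (C f)"
      using sigma_functionalD(2)[OF L(1) bb[OF f]] by simp
  next
    fix s :: "nat \<Rightarrow> real \<Rightarrow> complex" and f B assume s: "\<forall>n. s n \<in> borel_measurable borel" "\<forall>n x. cmod (s n x) \<le> B" "\<forall>x. (\<lambda>n. s n x) \<longlonglongrightarrow> f x"
    show "(\<lambda>n. L (C (s n))) \<longlonglongrightarrow> L (C f)"
      by (rule sigma_functionalD(3)[OF L(1) C_meas C_bound[where B = B]])
        (use s sigma_functionalD(3)[OF sC, of s B f] in auto)
  qed
  moreover have "L (C (\<lambda>x. iexp (\<xi> * x))) = T \<xi> * F \<xi>" for \<xi>
  proof -
    have "C (\<lambda>x. iexp (\<xi> * x)) = (\<lambda>s. T \<xi> * iexp (\<xi> * s))"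
    proof
      fix s
      have "C (\<lambda>x. iexp (\<xi> * x)) s = (LINT t|lborel. iexp (\<xi> * s) * (iexp (\<xi> * t) * k t))"
        unfolding C_def by (simp add: distrib_left exp_add mult.assoc)
      also have "\<dots> = T \<xi> * iexp (\<xi> * s)"
        unfolding T integral_mult_right_zero by (rule mult.commute)
      finally show "C (\<lambda>x. iexp (\<xi> * x)) s = T \<xi> * iexp (\<xi> * s)" .
    qed
    then show ?thesis
      using sigma_functionalD(2)[OF L(1) bounded_borel_exp] by (simp add: L(2))
  qed
  ultimately show ?thesis
    unfolding B_R_iff by (intro exI[of _ "\<lambda>f. L (C f)"]) (auto simp: fun_eq_iff)
qed

lemma B_R_continuous:
  assumes "F \<in> B_R"
  shows "isCont F \<xi>"
proof -
  obtain L where L: "sigma_functional L" "F = (\<lambda>\<xi>. L (\<lambda>x. iexp (\<xi> * x)))"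
    using assms unfolding B_R_iff by blast
  show ?thesis
    unfolding continuous_at_sequentially comp_def L(2)
    by (intro allI impI sigma_functionalD(3)[OF L(1), where B = 1]) (auto intro!: tendsto_intros)
qed

lemma B_loc_continuous:
  assumes "F \<in> B_loc"
  shows "continuous_on UNIV F"
proof -
  have "isCont F x" for x
  proof -
    obtain U G where *: "open U" "x \<in> U" "G \<in> B_R" "\<forall>y\<in>U. F y = G y"
      using assms unfolding B_loc_def by blast
    have "isCont F x \<longleftrightarrow> isCont G x"
      by (rule isCont_cong) (use * in \<open>auto simp: eventually_nhds\<close>)
    then show ?thesis using B_R_continuous[OF *(3)] by simp
  qed
  then show ?thesis by (simp add: continuous_on_eq_continuous_at)
qed


section \<open>Fourier inversion\<close>

lemma (in pair_sigma_finite) integrable_pair_mult: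
  fixes f g :: "_ \<Rightarrow> complex"
  assumes f: "integrable M1 f" and g: "integrable M2 g"
  shows "integrable (M1 \<Otimes>\<^sub>M M2) (\<lambda>(x, y). f x * g y)"
proof (rule Fubini_integrable)
  have [measurable]: "f \<in> borel_measurable M1" "g \<in> borel_measurable M2" using f g by auto
  show "(\<lambda>(x, y). f x * g y) \<in> borel_measurable (M1 \<Otimes>\<^sub>M M2)" by measurable
  show "integrable M1 (\<lambda>x. LINT y|M2. norm (case (x, y) of (x, y) \<Rightarrow> f x * g y))"
    using f by (simp add: norm_mult)
qed (use g in simp)

text \<open>Since the kernel is bounded by 1, the integrable product of \<open>f\<close> and
  \<open>g\<close> dominates. In the applications \<open>e\<close> is a character
  \<open>iexp (x * y)\<close>.\<close>

lemma (in pair_sigma_finite) Fubini_bounded_kernel: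
  fixes f g :: "_ \<Rightarrow> complex" and e :: "_ \<Rightarrow> _ \<Rightarrow> complex"
  assumes f: "integrable M1 f" and g: "integrable M2 g"
    and e: "case_prod e \<in> borel_measurable (M1 \<Otimes>\<^sub>M M2)" "\<And>x y. cmod (e x y) \<le> 1"
  shows "(LINT x|M1. f x * (LINT y|M2. e x y * g y)) = (LINT y|M2. (LINT x|M1. f x * e x y) * g y)"
proof -
  have [measurable]: "f \<in> borel_measurable M1" "g \<in> borel_measurable M2" using f g by auto
  note e(1)[measurable]
  have "integrable (M1 \<Otimes>\<^sub>M M2) (\<lambda>(x, y). f x * e x y * g y)"
  proof (rule Bochner_Integration.integrable_bound[OF integrable_pair_mult[OF f g]])
    have "cmod (f x) * cmod (e x y) * cmod (g y) \<le> cmod (f x) * cmod (g y)" for x y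
      by (intro mult_right_mono mult_right_le_one_le e(2)) auto
    then show "AE z in M1 \<Otimes>\<^sub>M M2. norm (case z of (x, y) \<Rightarrow> f x * e x y * g y) \<le> norm (case z of (x, y) \<Rightarrow> f x * g y)"
      by (auto simp: norm_mult)
  qed measurable
  from Fubini_integral[OF this]
  have "(LINT x|M1. LINT y|M2. f x * (e x y * g y)) = (LINT y|M2. LINT x|M1. f x * e x y * g y)"
    by (simp add: mult.assoc)
  then show ?thesis
    by (simp only: integral_mult_right_zero integral_mult_left_zero)
qed

text \<open>Unnormalised and of width \<open>1 / \<delta>\<close>: it tends to 1 as \<delta> tends
  to 0, so it acts as a convergence factor on the frequency side.\<close>

definition gaussian :: "real \<Rightarrow> real \<Rightarrow> complex" where
  "gaussian \<delta> x = of_real (exp (- (\<delta> * x)\<^sup>2 / 2))"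

lemma std_normal_fourier:
  "(LINT x|lborel. iexp (\<xi> * x) * of_real (std_normal_density x)) = of_real (exp (- \<xi>\<^sup>2 / 2))"
proof -
  have "char std_normal_distribution \<xi> = (LINT x|lborel. std_normal_density x *\<^sub>R iexp (\<xi> * x))"
    unfolding char_def by (subst integral_density) auto
  then show ?thesis
    by (simp add: char_std_normal_distribution scaleR_conv_of_real mult.commute)
qed

lemma gaussian_fourier:
  assumes \<delta>: "\<delta> > 0"
  shows "(LINT x|lborel. iexp (\<xi> * x) * gaussian \<delta> x) = of_real (sqrt (2 * pi) / \<delta> * exp (- (\<xi> / \<delta>)\<^sup>2 / 2))"
proof -
  have "of_real (exp (- (\<xi> / \<delta>)\<^sup>2 / 2)) = (LINT x|lborel. iexp (\<xi> / \<delta> * x) * complex_of_real (std_normal_density x))"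
    by (rule std_normal_fourier[symmetric])
  also have "\<dots> = \<bar>\<delta>\<bar> *\<^sub>R (LINT x|lborel. iexp (\<xi> / \<delta> * (0 + \<delta> * x)) * complex_of_real (std_normal_density (0 + \<delta> * x)))"
    by (rule lborel_integral_real_affine) (use \<delta> in simp)
  also have "\<dots> = \<delta> *\<^sub>R (LINT x|lborel. of_real (1 / sqrt (2 * pi)) * (iexp (\<xi> * x) * gaussian \<delta> x))"
    using \<delta> by (simp add: std_normal_density_def gaussian_def mult_ac)
  also have "\<dots> = of_real (\<delta> / sqrt (2 * pi)) * (LINT x|lborel. iexp (\<xi> * x) * gaussian \<delta> x)"
    by (simp only: integral_mult_right_zero scaleR_conv_of_real) simp
  finally show ?thesis
    using \<delta> by (simp add: field_simps)
qed

lemma gaussian_integrable: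
  assumes \<delta>: "\<delta> > 0"
  shows "integrable lborel (gaussian \<delta>)"
proof -
  have "integrable lborel (\<lambda>x. complex_of_real (std_normal_density (0 + \<delta> * x)))"
    by (rule lborel_integrable_real_affine) (use \<delta> in \<open>auto intro!: integrable_normal_density\<close>)
  then have "integrable lborel (\<lambda>x. of_real (sqrt (2 * pi)) * complex_of_real (std_normal_density (0 + \<delta> * x)))"
    by simp
  moreover have "(\<lambda>x. of_real (sqrt (2 * pi)) * complex_of_real (std_normal_density (0 + \<delta> * x))) = gaussian \<delta>"
    by (simp add: std_normal_density_def gaussian_def fun_eq_iff)
  ultimately show ?thesis by (simp only:)
qed

definition fourier :: "(real \<Rightarrow> complex) \<Rightarrow> real \<Rightarrow> complex" where
  "fourier w x = (LINT t|lborel. iexp (x * t) * w t)"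

lemma fourier_measurable [measurable]:
  assumes "integrable lborel w"
  shows "fourier w \<in> borel_measurable borel"
proof -
  have [measurable]: "w \<in> borel_measurable borel" using assms by auto
  show ?thesis unfolding fourier_def by measurable
qed

lemma fourier_bound:
  assumes "integrable lborel w"
  shows "cmod (fourier w x) \<le> (LINT t|lborel. cmod (w t))"
  unfolding fourier_def
proof (rule Bochner_Integration.integral_norm_bound_integral)
  have [measurable]: "w \<in> borel_measurable borel" using assms by auto
  show "integrable lborel (\<lambda>t. iexp (x * t) * w t)"
    by (rule Bochner_Integration.integrable_bound[OF assms]) (auto simp: norm_mult)
qed (use assms in \<open>auto simp: norm_mult\<close>)

text \<open>Fubini moves the transform from \<open>w\<close> onto the Gaussian, whose transform is a
  Gaussian of width \<delta> centred at \<open>s\<close>; substituting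
  \<open>t = s + \<delta> * z\<close> yields normal averages of \<open>w\<close>. The factor
  \<open>2 * pi\<close> is \<open>sqrt (2 * pi)\<close> from the transform times another one from
  normalising the density.\<close>

lemma fourier_gaussian_smoothing:
  fixes w :: "real \<Rightarrow> complex"
  assumes w: "integrable lborel w" and \<delta>: "\<delta> > 0"
  shows "(LINT x|lborel. fourier w x * exp (- \<i> * of_real (x * s)) * gaussian \<delta> x)
     = 2 * pi * (LINT z|lborel. of_real (std_normal_density z) * w (s + \<delta> * z))"
proof -
  have g: "integrable lborel (\<lambda>x. exp (- \<i> * of_real (x * s)) * gaussian \<delta> x)"
    by (rule Bochner_Integration.integrable_bound[OF gaussian_integrable[OF \<delta>]])
      (auto simp: norm_mult gaussian_def)
  have "(LINT x|lborel. fourier w x * exp (- \<i> * of_real (x * s)) * gaussian \<delta> x) =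
      (LINT x|lborel. (LINT t|lborel. w t * iexp (x * t)) * (exp (- \<i> * of_real (x * s)) * gaussian \<delta> x))"
    by (simp add: fourier_def mult_ac)
  also have "\<dots> = (LINT t|lborel. w t * (LINT x|lborel. iexp (x * t) * (exp (- \<i> * of_real (x * s)) * gaussian \<delta> x)))"
    by (rule lborel_pair.Fubini_bounded_kernel[OF w g, symmetric]) auto
  also have "\<dots> = (LINT t|lborel. w t * (LINT x|lborel. iexp ((t - s) * x) * gaussian \<delta> x))"
  proof -
    have "iexp (x * t) * (exp (- \<i> * of_real (x * s)) * gaussian \<delta> x)
        = iexp ((t - s) * x) * gaussian \<delta> x" for x t
    proof -
      have "\<i> * of_real (x * t) + - \<i> * of_real (x * s) = \<i> * of_real ((t - s) * x)"
        by (simp add: algebra_simps)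
      then show ?thesis
        by (simp only: mult.assoc[symmetric] exp_add[symmetric])
    qed
    then show ?thesis by (simp only:)
  qed
  also have "\<dots> = (LINT t|lborel. w t * of_real (sqrt (2 * pi) / \<delta> * exp (- ((t - s) / \<delta>)\<^sup>2 / 2)))"
    by (simp only: gaussian_fourier[OF \<delta>])
  also have "\<dots> = \<bar>\<delta>\<bar> *\<^sub>R (LINT z|lborel. w (s + \<delta> * z) * of_real (sqrt (2 * pi) / \<delta> * exp (- ((s + \<delta> * z - s) / \<delta>)\<^sup>2 / 2)))"
    by (rule lborel_integral_real_affine) (use \<delta> in simp)
  also have "\<dots> = (LINT z|lborel. \<delta> *\<^sub>R (w (s + \<delta> * z) * of_real (sqrt (2 * pi) / \<delta> * exp (- z\<^sup>2 / 2))))"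
    using \<delta> by simp
  also have "\<dots> = (LINT z|lborel. complex_of_real (2 * pi) * (of_real (std_normal_density z) * w (s + \<delta> * z)))"
  proof (rule Bochner_Integration.integral_cong[OF refl])
    fix z
    have "sqrt (2 * pi) * sqrt (2 * pi) = 2 * pi" by simp
    then have "sqrt (2 * pi) = 2 * pi / sqrt (2 * pi)"
      by (metis nonzero_eq_divide_eq pi_neq_zero mult_eq_0_iff zero_neq_numeral)
    then have "sqrt (2 * pi) * exp (- z\<^sup>2 / 2) = 2 * pi / sqrt (2 * pi) * exp (- z\<^sup>2 / 2)"
      by (rule arg_cong)
    then have "\<delta> * (sqrt (2 * pi) / \<delta> * exp (- z\<^sup>2 / 2)) = 2 * pi * std_normal_density z"
      using \<delta> unfolding std_normal_density_def by simp
    then have *: "complex_of_real (\<delta> * (sqrt (2 * pi) / \<delta> * exp (- z\<^sup>2 / 2))) = complex_of_real (2 * pi) * of_real (std_normal_density z)"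
      by (simp only: of_real_mult)
    have 0: "\<delta> *\<^sub>R (w (s + \<delta> * z) * of_real c) = complex_of_real (\<delta> * c) * w (s + \<delta> * z)" for c
      by (simp add: scaleR_conv_of_real)
    show "\<delta> *\<^sub>R (w (s + \<delta> * z) * of_real (sqrt (2 * pi) / \<delta> * exp (- z\<^sup>2 / 2)))
      = complex_of_real (2 * pi) * (of_real (std_normal_density z) * w (s + \<delta> * z))"
      unfolding 0 * by (simp only: mult.assoc)
  qed
  finally show ?thesis by simp
qed

lemma std_normal_integrable: "integrable lborel (\<lambda>z. complex_of_real (std_normal_density z))"
  by (auto intro!: integrable_normal_density)

lemma std_normal_integral: "(LINT z|lborel. complex_of_real (std_normal_density z)) = 1"
  using std_normal_fourier[of 0] by simp

text \<open>Both sides of the smoothing identity converge as \<delta> tends to 0: the left one is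
  dominated by \<open>fourier w\<close>, the right one by \<open>B\<close> times the normal
  density.\<close>

theorem fourier_inversion:
  fixes w :: "real \<Rightarrow> complex"
  assumes w: "integrable lborel w" and cont: "continuous_on UNIV w"
    and bound: "\<And>t. cmod (w t) \<le> B" and fw: "integrable lborel (fourier w)"
  shows "(LINT x|lborel. fourier w x * exp (- \<i> * of_real (x * s))) = 2 * pi * w s"
proof (rule LIMSEQ_unique)
  define d where "d n = 1 / (real n + 1)" for n
  have d: "d n > 0" for n by (simp add: d_def)
  have d0: "d \<longlonglongrightarrow> 0" unfolding d_def by real_asymp
  have [measurable]: "w \<in> borel_measurable borel" "fourier w \<in> borel_measurable borel"
    using w fw by auto
  have isc: "isCont w s" for s
    using cont by (simp add: continuous_on_eq_continuous_at)
  show "(\<lambda>n. LINT x|lborel. fourier w x * exp (- \<i> * of_real (x * s)) * gaussian (d n) x) \<longlonglongrightarrow>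
      (LINT x|lborel. fourier w x * exp (- \<i> * of_real (x * s)))"
  proof (rule integral_dominated_convergence[of _ _ _ "\<lambda>x. cmod (fourier w x)"])
    show "AE x in lborel. (\<lambda>n. fourier w x * exp (- \<i> * of_real (x * s)) * gaussian (d n) x)
        \<longlonglongrightarrow> fourier w x * exp (- \<i> * of_real (x * s))"
    proof (rule AE_I2)
      fix x
      have "(\<lambda>n. gaussian (d n) x) \<longlonglongrightarrow> of_real (exp (- (0 * x)\<^sup>2 / 2))"
        unfolding gaussian_def by (intro tendsto_intros d0)
          simp
      then have "(\<lambda>n. gaussian (d n) x) \<longlonglongrightarrow> 1" by simp
      from tendsto_mult[OF tendsto_const this]
      show "(\<lambda>n. fourier w x * exp (- \<i> * of_real (x * s)) * gaussian (d n) x)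
        \<longlonglongrightarrow> fourier w x * exp (- \<i> * of_real (x * s))" by fastforce
    qed
    show "AE x in lborel. norm (fourier w x * exp (- \<i> * of_real (x * s)) * gaussian (d n) x) \<le> cmod (fourier w x)" for n
      by (auto simp: norm_mult gaussian_def mult_right_le_one_le)
  qed (use fw in \<open>auto simp: gaussian_def\<close>)
  have "(\<lambda>n. LINT z|lborel. of_real (std_normal_density z) * w (s + d n * z)) \<longlonglongrightarrow>
     (LINT z|lborel. of_real (std_normal_density z) * w s)"
  proof (rule integral_dominated_convergence[of _ _ _ "\<lambda>z. B * std_normal_density z"])
    show "AE z in lborel. (\<lambda>n. of_real (std_normal_density z) * w (s + d n * z))
       \<longlonglongrightarrow> of_real (std_normal_density z) * w s"
    proof (rule AE_I2)
      fix z
      have "(\<lambda>n. s + d n * z) \<longlonglongrightarrow> s + 0 * z" by (intro tendsto_intros d0)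
      then have "(\<lambda>n. s + d n * z) \<longlonglongrightarrow> s" by simp
      from isCont_tendsto_compose[OF isc this]
      show "(\<lambda>n. of_real (std_normal_density z) * w (s + d n * z)) \<longlonglongrightarrow> of_real (std_normal_density z) * w s"
        by (intro tendsto_intros)
    qed
    have "std_normal_density z * cmod (w u) \<le> B * std_normal_density z" for z u
      by (subst mult.commute[of B]) (intro mult_left_mono bound, auto)
    then show "AE z in lborel. norm (of_real (std_normal_density z) * w (s + d n * z)) \<le> B * std_normal_density z" for n
      by (simp add: norm_mult)
  qed (use std_normal_integrable in \<open>auto intro!: integrable_normal_density\<close>)
  then have "(\<lambda>n. 2 * pi * (LINT z|lborel. of_real (std_normal_density z) * w (s + d n * z))) \<longlonglongrightarrow>
      2 * pi * w s"
    using std_normal_integral by (intro tendsto_intros) simp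
  then show "(\<lambda>n. LINT x|lborel. fourier w x * exp (- \<i> * of_real (x * s)) * gaussian (d n) x) \<longlonglongrightarrow> 2 * pi * w s"
    by (simp only: fourier_gaussian_smoothing[OF w d])
qed

text \<open>At \<open>s = 0\<close> the smoothing identity bounds the Gaussian-weighted integrals of
  the transform by \<open>2 * pi * B\<close>, uniformly in the width. As the transform equals its
  modulus, Fatou's lemma removes the weight.\<close>

lemma fourier_nonneg_integrable:
  fixes w :: "real \<Rightarrow> complex"
  assumes w: "integrable lborel w" and bound: "\<And>t. cmod (w t) \<le> B"
    and nonneg: "\<And>x. fourier w x \<in> \<real>\<^sub>\<ge>\<^sub>0"
  shows "integrable lborel (fourier w)" and "(LINT x|lborel. cmod (fourier w x)) \<le> 2 * pi * B"
proof -
  define d where "d n = 1 / (real n + 1)" for n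
  have d: "d n > 0" for n by (simp add: d_def)
  have d0: "d \<longlonglongrightarrow> 0" unfolding d_def by real_asymp
  have [measurable]: "w \<in> borel_measurable borel" "fourier w \<in> borel_measurable borel"
    using w fourier_measurable[OF w] by auto
  have p: "fourier w x = of_real (cmod (fourier w x))" for x
    using nonneg[of x] by (auto elim: nonneg_Reals_cases)
  have B: "0 \<le> B" using bound[of 0] norm_ge_zero order_trans by blast
  let ?f = "\<lambda>n x. cmod (fourier w x) * exp (- (d n * x)\<^sup>2 / 2)"
  have int: "integrable lborel (\<lambda>x. complex_of_real (?f n x))" for n
  proof (rule Bochner_Integration.integrable_bound)
    show "integrable lborel (\<lambda>x. of_real (LINT t|lborel. cmod (w t)) * gaussian (d n) x)"
      using gaussian_integrable[OF d] by simp
    have "cmod (fourier w x) * exp (- (d n * x)\<^sup>2 / 2) \<le> \<bar>LINT t|lborel. cmod (w t)\<bar> * exp (- (d n * x)\<^sup>2 / 2)" for x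
      by (intro mult_right_mono order_trans[OF fourier_bound[OF w] abs_ge_self]) auto
    then show "AE x in lborel. norm (complex_of_real (?f n x)) \<le> norm (of_real (LINT t|lborel. cmod (w t)) * gaussian (d n) x)"
      by (simp add: norm_mult gaussian_def abs_mult)
  qed simp
  have int_le: "(LINT x|lborel. ?f n x) \<le> 2 * pi * B" for n
  proof -
    have "(LINT x|lborel. complex_of_real (?f n x)) = (LINT x|lborel. fourier w x * exp (- \<i> * of_real (x * 0)) * gaussian (d n) x)"
      by (intro Bochner_Integration.integral_cong refl) (subst (2) p, simp add: gaussian_def)
    also have "\<dots> = 2 * pi * (LINT z|lborel. of_real (std_normal_density z) * w (0 + d n * z))"
      by (rule fourier_gaussian_smoothing[OF w d])
    finally have "complex_of_real (LINT x|lborel. ?f n x) = 2 * pi * (LINT z|lborel. of_real (std_normal_density z) * w (0 + d n * z))"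
      by (simp only: integral_complex_of_real)
    from arg_cong[OF this, of cmod]
    have "\<bar>LINT x|lborel. ?f n x\<bar> = cmod (2 * pi * (LINT z|lborel. of_real (std_normal_density z) * w (0 + d n * z)))"
      by (simp only: norm_of_real)
    also have "\<dots> = 2 * pi * cmod (LINT z|lborel. of_real (std_normal_density z) * w (0 + d n * z))"
      by (simp add: norm_mult)
    also have "cmod (LINT z|lborel. of_real (std_normal_density z) * w (0 + d n * z)) \<le> (LINT z|lborel. B * std_normal_density z)"
    proof -
      have *: "std_normal_density z * cmod (w u) \<le> B * std_normal_density z" for z u
        by (subst mult.commute[of B]) (intro mult_left_mono bound, auto)
      have int: "integrable lborel (\<lambda>z. B * std_normal_density z)" by (auto intro!: integrable_normal_density)
      have **: "norm (complex_of_real (std_normal_density z) * w u) \<le> B * std_normal_density z" for z u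
        using * by (simp add: norm_mult)
      have "integrable lborel (\<lambda>z. complex_of_real (std_normal_density z) * w (0 + d n * z))"
      proof (rule Bochner_Integration.integrable_bound[OF int])
        show "AE z in lborel. norm (complex_of_real (std_normal_density z) * w (0 + d n * z)) \<le> norm (B * std_normal_density z)"
          unfolding real_norm_def by (intro AE_I2 order_trans[OF ** abs_ge_self])
      qed simp
      from Bochner_Integration.integral_norm_bound_integral[OF this int **] show ?thesis .
    qed
    also have "(LINT z|lborel. B * std_normal_density z) = B"
    proof -
      have "complex_of_real (LINT z|lborel. std_normal_density z) = 1"
        using std_normal_integral by (simp only: integral_complex_of_real)
      then have "(LINT z|lborel. std_normal_density z) = 1"
        by (simp only: of_real_eq_1_iff)
      then show ?thesis by (simp only: integral_mult_right_zero mult_1_right)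
    qed
    finally show ?thesis by simp
  qed
  have nn: "(\<integral>\<^sup>+x. ennreal (cmod (fourier w x)) \<partial>lborel) \<le> ennreal (2 * pi * B)"
  proof -
    have "(\<lambda>n. ennreal (?f n x)) \<longlonglongrightarrow> ennreal (cmod (fourier w x))" for x
    proof -
      have "(\<lambda>n. ?f n x) \<longlonglongrightarrow> cmod (fourier w x) * exp (- (0 * x)\<^sup>2 / 2)"
        by (intro tendsto_intros d0) simp
      then show ?thesis by (intro tendsto_ennrealI) simp
    qed
    then have lim: "liminf (\<lambda>n. ennreal (?f n x)) = ennreal (cmod (fourier w x))" for x
      by (intro lim_imp_Liminf) auto
    have "(\<integral>\<^sup>+x. ennreal (cmod (fourier w x)) \<partial>lborel) \<le> liminf (\<lambda>n. \<integral>\<^sup>+x. ennreal (?f n x) \<partial>lborel)"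
    proof -
      have "(\<integral>\<^sup>+x. liminf (\<lambda>n. ennreal (?f n x)) \<partial>lborel) \<le> liminf (\<lambda>n. \<integral>\<^sup>+x. ennreal (?f n x) \<partial>lborel)"
        by (rule nn_integral_liminf) simp
      then show ?thesis by (simp only: lim)
    qed
    also have "\<dots> \<le> liminf (\<lambda>n::nat. ennreal (2 * pi * B))"
    proof (intro Liminf_mono always_eventually allI)
      fix n
      have "integrable lborel (?f n)" using int[of n] by (simp only: complex_of_real_integrable_eq)
      then have "(\<integral>\<^sup>+x. ennreal (?f n x) \<partial>lborel) = ennreal (LINT x|lborel. ?f n x)"
        by (intro nn_integral_eq_integral) auto
      then show "(\<integral>\<^sup>+x. ennreal (?f n x) \<partial>lborel) \<le> ennreal (2 * pi * B)"
        using int_le[of n] by (simp add: ennreal_leI)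
    qed
    also have "\<dots> = ennreal (2 * pi * B)" by (rule Liminf_const) simp
    finally show ?thesis .
  qed
  show I: "integrable lborel (fourier w)"
  proof (rule integrableI_bounded)
    show "(\<integral>\<^sup>+x. ennreal (norm (fourier w x)) \<partial>lborel) < \<infinity>"
      using nn by (rule le_less_trans) simp
  qed simp
  then have "ennreal (LINT x|lborel. cmod (fourier w x)) \<le> ennreal (2 * pi * B)"
    using nn by (subst (asm) nn_integral_eq_integral) auto
  then show "(LINT x|lborel. cmod (fourier w x)) \<le> 2 * pi * B"
    using B by (subst (asm) ennreal_le_iff) auto
qed


section \<open>Positive-definite functions\<close>

lemma positive_definite_one: "positive_definite (\<lambda>_. 1)"
  unfolding positive_definite_def
proof (intro allI)
  fix n :: nat and c :: "nat \<Rightarrow> complex"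
  have "(\<Sum>j<n. \<Sum>k<n. 1 * c j * cnj (c k)) = (\<Sum>j<n. c j) * cnj (\<Sum>k<n. c k)"
    by (simp add: sum_product)
  also have "\<dots> = of_real ((cmod (\<Sum>j<n. c j))\<^sup>2)"
    by (rule complex_norm_square[symmetric])
  finally show "(\<Sum>j<n. \<Sum>k<n. 1 * c j * cnj (c k)) \<in> \<real>\<^sub>\<ge>\<^sub>0"
    by simp
qed

lemma positive_definite_two:
  assumes "positive_definite \<phi>"
  shows "\<phi> 0 * (a * cnj a + b * cnj b) + \<phi> t * a * cnj b + \<phi> (- t) * b * cnj a \<in> \<real>\<^sub>\<ge>\<^sub>0"
proof -
  have "(\<Sum>j<2. \<Sum>k<2. \<phi> ((if j = (0::nat) then t else 0) - (if k = (0::nat) then t else 0))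
     * (if j = 0 then a else b) * cnj (if k = 0 then a else b)) \<in> \<real>\<^sub>\<ge>\<^sub>0"
    using assms unfolding positive_definite_def by meson
  then show ?thesis
    by (simp add: numeral_2_eq_2 algebra_simps)
qed

lemma positive_definite_zero_nonneg:
  assumes "positive_definite \<phi>"
  shows "\<phi> 0 \<in> \<real>\<^sub>\<ge>\<^sub>0"
  using positive_definite_two[OF assms, of 1 0 0] by simp

lemma positive_definite_zero:
  assumes "positive_definite \<phi>"
  shows "\<phi> 0 = of_real (cmod (\<phi> 0))"
  using positive_definite_zero_nonneg[OF assms]
  by (auto elim: nonneg_Reals_cases)

lemma positive_definite_minus:
  assumes "positive_definite \<phi>"
  shows "\<phi> (- t) = cnj (\<phi> t)"
proof -
  have 0: "Im (\<phi> 0) = 0"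
    using positive_definite_zero_nonneg[OF assms] by (simp add: complex_nonneg_Reals_iff)
  \<comment> \<open>The coefficients 1, 1 control the sum of the imaginary parts;
    \<open>\<i>\<close>, 1 control the difference of the real parts.\<close>
  have "Im (\<phi> t) + Im (\<phi> (-t)) = 0"
    using positive_definite_two[OF assms, of 1 1 t] 0 by (simp add: complex_nonneg_Reals_iff)
  moreover have "Re (\<phi> t) - Re (\<phi> (-t)) = 0"
    using positive_definite_two[OF assms, of \<i> 1 t] 0 by (simp add: complex_nonneg_Reals_iff)
  ultimately show ?thesis
    by (simp add: complex_eq_iff)
qed

lemma positive_definite_bound:
  assumes "positive_definite \<phi>"
  shows "cmod (\<phi> t) \<le> cmod (\<phi> 0)"
proof (cases "\<phi> t = 0")
  case False
  \<comment> \<open>This phase makes both cross terms of the two-point form equal to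
    \<open>- cmod (\<phi> t)\<close>.\<close>
  define b where "b = - \<phi> t / of_real (cmod (\<phi> t))"
  have b: "b * cnj b = 1"
    using False unfolding b_def
    by (simp add: complex_norm_square[symmetric] power2_eq_square)
  have 1: "\<phi> t * cnj b = - of_real (cmod (\<phi> t))"
    using False unfolding b_def
    by (simp add: complex_norm_square[symmetric] power2_eq_square)
  then have 2: "\<phi> (-t) * b = - of_real (cmod (\<phi> t))"
    unfolding positive_definite_minus[OF assms]
    by (metis complex_cnj_cnj complex_cnj_complex_of_real complex_cnj_minus complex_cnj_mult)
  have "\<phi> 0 * 2 - 2 * of_real (cmod (\<phi> t)) \<in> \<real>\<^sub>\<ge>\<^sub>0"
    using positive_definite_two[OF assms, of 1 b t] b 1 2 by simp
  then have "2 * Re (\<phi> 0) - 2 * cmod (\<phi> t) \<ge> 0"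
    by (simp add: complex_nonneg_Reals_iff)
  then show ?thesis
    using complex_Re_le_cmod[of "\<phi> 0"] by linarith
qed simp

text \<open>Cauchy--Schwarz for the semi-inner product with \<open>\<langle>e\<^sub>s, e\<^sub>t\<rangle> = \<phi> (s - t)\<close>, applied to
  \<open>e\<^sub>s - \<alpha> e\<^sub>t\<close> and \<open>e\<^sub>0\<close>.\<close>

lemma positive_definite_cauchy_schwarz:
  assumes pd: "positive_definite \<phi>" and \<alpha>: "cmod \<alpha> = 1"
  shows "(cmod (\<phi> s - \<alpha> * \<phi> t))\<^sup>2 \<le> cmod (\<phi> 0) * (2 * cmod (\<phi> 0) - 2 * Re (cnj \<alpha> * \<phi> (s - t)))"
proof (cases "\<phi> 0 = 0")
  case True
  then have "\<phi> x = 0" for x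
    using positive_definite_bound[OF pd, of x] by simp
  then show ?thesis by simp
next
  case False
  define r where "r = cmod (\<phi> 0)"
  have r: "r > 0" "\<phi> 0 = of_real r"
    using False positive_definite_zero[OF pd] by (auto simp: r_def)
  define z where "z = \<phi> s - \<alpha> * \<phi> t"
  \<comment> \<open>The coefficient of the orthogonal projection of
    \<open>e\<^sub>s - \<alpha> e\<^sub>t\<close> onto \<open>e\<^sub>0\<close>, which minimises the
    quadratic form.\<close>
  define w where "w = z / of_real r"
  let ?x = "\<lambda>j::nat. if j = 0 then s else if j = 1 then t else 0"
  let ?c = "\<lambda>j::nat. if j = 0 then 1 else if j = 1 then - \<alpha> else - w"
  have minus: "\<phi> (t - s) = cnj (\<phi> (s - t))"
    using positive_definite_minus[OF pd, of "s - t"] by simp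
  let ?S = "\<Sum>j<3. \<Sum>k<3. \<phi> (?x j - ?x k) * ?c j * cnj (?c k)"
  let ?X = "cnj \<alpha> * \<phi> (s - t)"
  have "?S \<in> \<real>\<^sub>\<ge>\<^sub>0"
    using pd unfolding positive_definite_def by meson
  moreover have S: "?S = \<phi> 0 * (1 + \<alpha> * cnj \<alpha> + w * cnj w) - (?X + cnj ?X) - (cnj w * z + cnj (cnj w * z))"
    using positive_definite_minus[OF pd] minus
    by (simp add: numeral_3_eq_3 z_def algebra_simps)
  moreover have 1: "\<alpha> * cnj \<alpha> = 1"
    using \<alpha> by (simp add: complex_norm_square[symmetric])
  moreover have 2: "cnj w * z = of_real ((cmod z)\<^sup>2 / r)"
    unfolding w_def using complex_norm_square[of z] by (simp add: mult.commute)
  moreover have 3: "w * cnj w = of_real ((cmod z)\<^sup>2 / r\<^sup>2)"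
    unfolding w_def using complex_norm_square[of z] by (simp add: power2_eq_square[of r])
  have "Re ?S = r * (2 + (cmod z)\<^sup>2 / r\<^sup>2) - 2 * Re ?X - 2 * ((cmod z)\<^sup>2 / r)"
    unfolding S 1 2 3 r(2) by (simp del: of_real_divide of_real_power)
  moreover have "0 \<le> Re ?S"
    using \<open>?S \<in> \<real>\<^sub>\<ge>\<^sub>0\<close> unfolding complex_nonneg_Reals_iff by (rule conjunct1)
  ultimately have "0 \<le> r * (2 + (cmod z)\<^sup>2 / r\<^sup>2) - 2 * Re ?X - 2 * ((cmod z)\<^sup>2 / r)"
    by linarith
  moreover have "r * ((cmod z)\<^sup>2 / r\<^sup>2) = (cmod z)\<^sup>2 / r"
    using r(1) by (simp add: power2_eq_square)
  ultimately have "(cmod z)\<^sup>2 / r \<le> 2 * r - 2 * Re ?X"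
    by (simp only: distrib_left)
  then have "(cmod z)\<^sup>2 \<le> (2 * r - 2 * Re ?X) * r"
    using r(1) by (simp only: pos_divide_le_eq)
  then show ?thesis
    by (simp only: z_def r_def mult.commute)
qed

text \<open>The equality case of the Cauchy--Schwarz estimate: with
  \<open>\<alpha> = \<phi> p / \<phi> 0\<close> and the points \<open>x + p\<close> and
  \<open>x\<close>, its right-hand side vanishes. This is what permits changing the base point in
  \<open>PD\<close>.\<close>

lemma positive_definite_quasi_periodic:
  assumes pd: "positive_definite \<phi>" and p: "cmod (\<phi> p) = cmod (\<phi> 0)"
  shows "\<phi> (x + p) * \<phi> 0 = \<phi> p * \<phi> x"
proof (cases "\<phi> 0 = 0")
  case True
  then have "\<phi> x = 0" for x
    using positive_definite_bound[OF pd, of x] by simp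
  then show ?thesis by simp
next
  case False
  define \<alpha> where "\<alpha> = \<phi> p / \<phi> 0"
  have \<alpha>: "cmod \<alpha> = 1"
    using False p by (simp add: \<alpha>_def norm_divide)
  have *: "\<phi> p = \<alpha> * \<phi> 0"
    using False by (simp add: \<alpha>_def)
  have "cnj \<alpha> * \<phi> (x + p - x) = \<phi> 0"
    using \<alpha> by (simp add: * mult.assoc[symmetric] complex_norm_square[symmetric] mult.commute[of "cnj \<alpha>"])
  moreover have "Re (\<phi> 0) = cmod (\<phi> 0)"
    by (metis Re_complex_of_real pd positive_definite_zero)
  ultimately have "(cmod (\<phi> (x + p) - \<alpha> * \<phi> x))\<^sup>2 \<le> 0"
    using positive_definite_cauchy_schwarz[OF pd \<alpha>, of "x + p" x] by simp
  then have "\<phi> (x + p) = \<alpha> * \<phi> x" by simp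
  then show ?thesis by (simp add: *)
qed

text \<open>Hermitian symmetry supplies the left limit at 0; the Cauchy--Schwarz estimate with
  \<open>\<alpha> = 1\<close> then bounds the increment over \<open>h\<close>, at every point, by
  the defect of \<open>Re (\<phi> h)\<close> from \<phi>(0). A one-sided hypothesis fits base points
  at the end of an interval.\<close>

lemma positive_definite_continuous:
  assumes pd: "positive_definite \<phi>" and cont: "(\<phi> \<longlongrightarrow> \<phi> 0) (at_right 0)"
  shows "continuous_on UNIV \<phi>"
proof -
  have "((\<lambda>x. cnj (\<phi> (- x))) \<longlongrightarrow> cnj (\<phi> 0)) (at_left 0)"
    using tendsto_cnj[OF cont] unfolding filterlim_at_left_to_right[of _ _ "0::real"]
    by simp
  moreover have "cnj (\<phi> 0) = \<phi> 0"
    using positive_definite_minus[OF pd, of 0] by simp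
  ultimately have "(\<phi> \<longlongrightarrow> \<phi> 0) (at_left 0)"
    by (simp add: positive_definite_minus[OF pd])
  with cont have at0: "(\<phi> \<longlongrightarrow> \<phi> 0) (at 0)"
    by (simp add: filterlim_split_at)
  have "isCont \<phi> t" for t
  proof -
    let ?g = "\<lambda>h. cmod (\<phi> 0) * (2 * cmod (\<phi> 0) - 2 * Re (\<phi> h))"
    have "(?g \<longlongrightarrow> cmod (\<phi> 0) * (2 * cmod (\<phi> 0) - 2 * Re (\<phi> 0))) (at 0)"
      by (intro tendsto_intros at0)
    moreover have "Re (\<phi> 0) = cmod (\<phi> 0)"
      by (metis Re_complex_of_real pd positive_definite_zero)
    ultimately have g: "(?g \<longlongrightarrow> 0) (at 0)" by simp
    have bnd: "(cmod (\<phi> (t + h) - \<phi> t))\<^sup>2 \<le> ?g h" for h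
      using positive_definite_cauchy_schwarz[OF pd, of 1 "t + h" t] by simp
    have "((\<lambda>h. (cmod (\<phi> (t + h) - \<phi> t))\<^sup>2) \<longlongrightarrow> 0) (at 0)"
      by (rule tendsto_sandwich[OF _ _ tendsto_const g]) (auto simp: bnd)
    then have "((\<lambda>h. sqrt ((cmod (\<phi> (t + h) - \<phi> t))\<^sup>2)) \<longlongrightarrow> sqrt 0) (at 0)"
      by (rule tendsto_real_sqrt)
    then have "((\<lambda>h. \<phi> (t + h) - \<phi> t) \<longlongrightarrow> 0) (at 0)"
      by (simp add: tendsto_norm_zero_iff)
    then show ?thesis
      by (simp add: isCont_iff LIM_zero_iff)
  qed
  then show ?thesis
    by (simp add: continuous_on_eq_continuous_at)
qed

section \<open>Maximum points and base points for members of \<open>PD\<close>\<close>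

lemma PD_base_point:
  assumes "F \<in> PD" "compact K" "K \<noteq> {}"
  obtains c x0 \<phi> where "x0 \<in> K" "positive_definite \<phi>" "\<And>x. x \<in> K \<Longrightarrow> F x = c * \<phi> (x - x0)"
    "\<And>x. x \<in> K \<Longrightarrow> cmod (F x) \<le> cmod (F x0)"
proof -
  obtain c x0 \<phi> where *: "x0 \<in> K" "positive_definite \<phi>" "\<forall>x\<in>K. F x = c * \<phi> (x - x0)"
    using assms unfolding PD_def by blast
  show thesis
  proof (rule that[OF *(1,2)])
    show "cmod (F x) \<le> cmod (F x0)" if "x \<in> K" for x
      using * that positive_definite_bound[OF *(2), of "x - x0"]
      by (simp add: norm_mult mult_left_mono)
  qed (use * in auto)
qed

text \<open>If \<open>|F|\<close> attains its maximum over \<open>[a, b]\<close> at \<open>x0\<close>, then \<open>g t = |F (x0 + t)|\<close> is even near \<open>0\<close>. The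
  definition of \<open>PD\<close> for the three points \<open>x0 - v\<close>, \<open>x0 + v\<close>, \<open>x0 + (2k+1)v\<close> then yields
  \<open>g v \<le> g ((2k+1)v)\<close>: otherwise the base point is \<open>x0 - v\<close> or \<open>x0 + v\<close>, so that the modulus of the
  positive-definite function has period \<open>2v\<close>. Letting \<open>v \<rightarrow> 0\<close> shows that \<open>g\<close> is constant up to an
  endpoint.\<close>

lemma PD_max_at_endpoint:
  assumes "F \<in> PD" and ab: "a \<le> b" and cont: "continuous_on {a..b} F"
  shows "\<forall>x\<in>{a..b}. cmod (F x) \<le> max (cmod (F a)) (cmod (F b))"
proof -
  obtain c x0 \<phi> where x0: "x0 \<in> {a..b}" and pd: "positive_definite \<phi>"
    and F: "\<And>x. x \<in> {a..b} \<Longrightarrow> F x = c * \<phi> (x - x0)"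
    and max: "\<And>x. x \<in> {a..b} \<Longrightarrow> cmod (F x) \<le> cmod (F x0)"
    using PD_base_point[OF assms(1), of "{a..b}"] ab by (metis atLeastatMost_empty_iff2 compact_Icc)
  define L where "L = min (x0 - a) (b - x0)"
  define g where "g t = cmod (F (x0 + t))" for t
  have in_ab: "x0 + t \<in> {a..b}" if "\<bar>t\<bar> \<le> L" for t
    using that x0 unfolding L_def by auto
  have even: "g (- t) = g t" if "\<bar>t\<bar> \<le> L" for t
    using F[OF in_ab[OF that]] F[OF in_ab[of "- t"]] that positive_definite_minus[OF pd, of t]
    by (simp add: g_def norm_mult)
  have step: "g v \<le> g ((2 * real k + 1) * v)" if v: "0 \<le> v" "(2 * real k + 1) * v \<le> L" for v k
  proof (rule ccontr)
    assume less: "\<not> g v \<le> g ((2 * real k + 1) * v)"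
    define w where "w = (2 * real k + 1) * v"
    have vw: "v \<le> w" using v by (simp add: w_def algebra_simps)
    let ?K = "{x0 - v, x0 + v, x0 + w}"
    obtain c' x1 \<psi> where x1: "x1 \<in> ?K" and pd': "positive_definite \<psi>"
      and F': "\<And>x. x \<in> ?K \<Longrightarrow> F x = c' * \<psi> (x - x1)"
      and max': "\<And>x. x \<in> ?K \<Longrightarrow> cmod (F x) \<le> cmod (F x1)"
      using PD_base_point[OF assms(1), of ?K] by (metis finite.emptyI finite_imp_compact finite_insert insert_not_empty)
    have gv: "cmod (F (x0 - v)) = g v" "cmod (F (x0 + v)) = g v" "cmod (F (x0 + w)) = g w"
      using even[of v] v vw by (auto simp: g_def w_def)
    have gw: "g w < g v" using less by (simp add: w_def)
    then have x1': "x1 = x0 - v \<or> x1 = x0 + v"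
      using x1 max'[of "x0 + v"] gv by force
    have "F x1 = c' * \<psi> 0" using F'[OF x1] by simp
    then have c': "c' \<noteq> 0" and \<psi>0: "\<psi> 0 \<noteq> 0"
      using x1' gw gv max'[of "x0 + v"] norm_ge_zero[of "F (x0 + w)"] by force+
    have *: "cmod (\<psi> (2 * v)) = cmod (\<psi> 0)"
    proof -
      have "cmod (\<psi> (x0 + v - x1)) = cmod (\<psi> (x0 - v - x1))"
      proof -
        have "cmod c' * cmod (\<psi> (x0 + v - x1)) = cmod c' * cmod (\<psi> (x0 - v - x1))"
          using F'[of "x0 + v"] F'[of "x0 - v"] gv by (simp add: norm_mult flip: norm_mult)
        then show ?thesis using c' by simp
      qed
      then have "cmod (\<psi> (2 * v)) = cmod (\<psi> 0) \<or> cmod (\<psi> 0) = cmod (\<psi> (- (2 * v)))"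
        using x1' by auto
      then show ?thesis
        by (metis complex_mod_cnj pd' positive_definite_minus)
    qed
    then have per: "cmod (\<psi> (x + 2 * v)) = cmod (\<psi> x)" for x
    proof -
      have "cmod (\<psi> (x + 2 * v)) * cmod (\<psi> 0) = cmod (\<psi> (2 * v)) * cmod (\<psi> x)"
        using arg_cong[OF positive_definite_quasi_periodic[OF pd' *, of x], of cmod]
        by (simp only: norm_mult)
      then show ?thesis using \<psi>0 * by simp
    qed
    have "cmod (\<psi> (x + real n * (2 * v))) = cmod (\<psi> x)" for n x
    proof (induction n)
      case (Suc n)
      then show ?case using per[of "x + real n * (2 * v)"] by (simp add: algebra_simps)
    qed simp
    \<comment> \<open>Since \<open>w = v + k * (2 * v)\<close>, exactly \<open>k\<close> periods
      lead from \<open>x0 + v\<close> to \<open>x0 + w\<close>.\<close>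
    from this[of "x0 + v - x1" k] have "cmod (\<psi> (x0 + w - x1)) = cmod (\<psi> (x0 + v - x1))"
      by (simp add: w_def algebra_simps)
    then have "g w = g v"
      using F'[of "x0 + v"] F'[of "x0 + w"] gv by (simp add: norm_mult)
    with gw show False by simp
  qed
  have L0: "L \<ge> 0" using x0 by (auto simp: L_def)
  have "g 0 \<le> g L"
  proof (rule tendsto_upperbound)
    \<comment> \<open>The points tend to 0 while their multiples by \<open>2 * k + 1\<close> all
      equal \<open>L\<close>, so \<open>step\<close> always compares with the same value
      \<open>g L\<close>.\<close>
    let ?v = "\<lambda>k. L / (2 * real k + 1)"
    have v: "?v \<longlonglongrightarrow> 0" by real_asymp
    have vL: "\<bar>?v k\<bar> \<le> L" for k
      using L0 by (simp add: divide_le_eq mult_left_le algebra_simps)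
    have "(\<lambda>k. F (x0 + ?v k)) \<longlonglongrightarrow> F x0"
    proof (rule continuous_on_tendsto_compose[OF cont _ x0])
      show "(\<lambda>k. x0 + ?v k) \<longlonglongrightarrow> x0"
        using tendsto_add[OF tendsto_const v, of x0] by simp
      show "\<forall>\<^sub>F k in sequentially. x0 + ?v k \<in> {a..b}"
        using in_ab[OF vL] by simp
    qed
    then show "(\<lambda>k. g (?v k)) \<longlonglongrightarrow> g 0"
      unfolding g_def by (simp add: tendsto_norm)
    show "\<forall>\<^sub>F k in sequentially. g (?v k) \<le> g L"
    proof (rule always_eventually, rule allI)
      fix k :: nat
      have "(2 * real k + 1) * ?v k = L" by (simp add: divide_simps)
      then show "g (?v k) \<le> g L"
        using step[of "?v k" k] L0 by simp
    qed
  qed simp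
  moreover have "g L = cmod (F a) \<or> g L = cmod (F b)"
    using even[of L] L0 by (auto simp: g_def L_def min_def)
  ultimately show ?thesis
    using max by (force simp: g_def)
qed

lemma PD_subset_CH:
  assumes cont: "\<And>F. F \<in> B_loc \<Longrightarrow> continuous_on UNIV F"
  shows "PD \<subseteq> CH"
proof
  fix F assume F: "F \<in> PD"
  then have B: "F \<in> B_loc" by (simp add: PD_def)
  have contF: "continuous_on S F" for S
    using cont[OF B] continuous_on_subset by blast
  have "\<exists>c. \<exists>x0\<in>K. \<exists>\<phi>. positive_definite \<phi> \<and> continuous_on UNIV \<phi> \<and> (\<forall>x\<in>K. F x = c * \<phi> (x - x0))"
    if K: "compact K" "K \<noteq> {}" for K
  proof -
    obtain a b where ab: "a \<in> K" "b \<in> K" "\<And>x. x \<in> K \<Longrightarrow> a \<le> x" "\<And>x. x \<in> K \<Longrightarrow> x \<le> b"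
      using compact_attains_inf[OF K] compact_attains_sup[OF K] by metis
    show ?thesis
    \<comment> \<open>In these cases \<open>F\<close> is constant on \<open>K\<close>. Otherwise
      \<open>F x0\<close>, \<open>c\<close> and \<phi>(0) are nonzero, and the hull is a proper
      interval with a one-sided neighbourhood of each of its points.\<close>
    proof (cases "(\<forall>x\<in>K. F x = 0) \<or> a = b")
      case True
      then have "\<forall>x\<in>K. F x = F a"
      proof
        assume "a = b"
        then show ?thesis
          using ab(3,4) by (auto intro!: arg_cong[of _ _ F] order_antisym)
      qed (use ab(1) in simp)
      then have "\<forall>x\<in>K. F x = F a * (\<lambda>_. 1) (x - a)" by simp
      with positive_definite_one ab(1) continuous_on_const[of UNIV "1::complex"] show ?thesis by blast
    next
      case False
      then have "a < b" using ab by force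
      then have ne: "{a..b} \<noteq> {}" by simp
      obtain c x0 \<phi> where x0: "x0 \<in> {a..b}" and pd: "positive_definite \<phi>"
        and F\<phi>: "\<And>x. x \<in> {a..b} \<Longrightarrow> F x = c * \<phi> (x - x0)"
        and max: "\<And>x. x \<in> {a..b} \<Longrightarrow> cmod (F x) \<le> cmod (F x0)"
        by (rule PD_base_point[OF F compact_Icc ne]) blast
      have "F x0 \<noteq> 0"
        using False max ab by force
      then have c: "c \<noteq> 0" and \<phi>0: "\<phi> 0 \<noteq> 0"
        using F\<phi>[OF x0] by auto
      have lim: "((\<lambda>h. F (x0 + h) / c) \<longlongrightarrow> F x0 / c) (at 0 within S)" for S
      proof -
        have "isCont F x0"
          using cont[OF B] by (simp add: continuous_on_eq_continuous_at)
        then have "((\<lambda>h. F (x0 + h)) \<longlongrightarrow> F x0) (at 0)"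
          by (simp add: isCont_iff)
        then have "((\<lambda>h. F (x0 + h)) \<longlongrightarrow> F x0) (at 0 within S)"
          by (rule tendsto_within_subset) simp
        then show ?thesis
          using c by (intro tendsto_intros) auto
      qed
      have x0c: "F x0 / c = \<phi> 0" using F\<phi>[OF x0] c by simp
      have "(\<phi> \<longlongrightarrow> \<phi> 0) (at_right 0)"
      \<comment> \<open>At the right end of the hull only the left limit can be read off from
        \<open>F\<close>; it is reflected by Hermitian symmetry.\<close>
      proof (cases "x0 < b")
        case True
        have "\<forall>\<^sub>F h in at_right 0. h < b - x0"
          using True by (intro eventually_at_rightI[of 0 "b - x0"]) auto
        then have "\<forall>\<^sub>F h in at_right 0. F (x0 + h) / c = \<phi> h"
          using eventually_at_right_less[of 0]
          by eventually_elim (use F\<phi> x0 c in auto)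
        from Lim_transform_eventually[OF lim this] show ?thesis
          by (simp add: x0c)
      next
        case False
        then have "x0 = b" using x0 by auto
        have "\<forall>\<^sub>F h in at_left 0. a - x0 < h"
          using \<open>x0 = b\<close> \<open>a < b\<close> by (intro eventually_at_leftI[of "a - x0"]) auto
        moreover have "\<forall>\<^sub>F h in at_left (0::real). h < 0"
          by (simp add: eventually_at_filter)
        ultimately have "\<forall>\<^sub>F h in at_left 0. F (x0 + h) / c = \<phi> h"
          by eventually_elim (use F\<phi> \<open>x0 = b\<close> c in auto)
        from Lim_transform_eventually[OF lim this] have "(\<phi> \<longlongrightarrow> \<phi> 0) (at_left 0)"
          by (simp add: x0c)
        then have "((\<lambda>h. cnj (\<phi> (- h))) \<longlongrightarrow> cnj (\<phi> 0)) (at_right 0)"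
          unfolding filterlim_at_left_to_right[of _ _ "0::real"] by (simp add: tendsto_cnj)
        moreover have "cnj (\<phi> 0) = \<phi> 0"
          using positive_definite_minus[OF pd, of 0] by simp
        ultimately show ?thesis
          by (simp add: positive_definite_minus[OF pd])
      qed
      from positive_definite_continuous[OF pd this] have cont\<phi>: "continuous_on UNIV \<phi>" .
      obtain e where e: "e \<in> K" "e \<in> {a..b}" "cmod (F e) = cmod (F x0)"
      proof -
        have "cmod (F x0) \<le> cmod (F a) \<or> cmod (F x0) \<le> cmod (F b)"
          using PD_max_at_endpoint[OF F less_imp_le[OF \<open>a < b\<close>] contF] x0 by (simp add: le_max_iff_disj)
        then show ?thesis
          using that[of a] that[of b] max[of a] max[of b] ab(1,2) \<open>a < b\<close> by (auto intro: order_antisym)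
      qed
      have "cmod (\<phi> (e - x0)) = cmod (\<phi> 0)"
        using e(3) F\<phi>[OF e(2)] F\<phi>[OF x0] c by (simp add: norm_mult)
      note per = positive_definite_quasi_periodic[OF pd this]
      \<comment> \<open>Since \<phi> has maximal modulus at \<open>e - x0\<close>, this is a
        quasi-period, and translating by it costs only a constant factor.\<close>
      have rb: "\<phi> (x - x0) = \<phi> (e - x0) / \<phi> 0 * \<phi> (x - e)" for x
      proof -
        have "x - e + (e - x0) = x - x0" by simp
        with per[of "x - e"] show ?thesis
          using \<phi>0 by (simp add: field_simps)
      qed
      have *: "\<forall>x\<in>K. F x = (c * (\<phi> (e - x0) / \<phi> 0)) * \<phi> (x - e)"
      proof
        fix x assume "x \<in> K"
        then have "F x = c * \<phi> (x - x0)" using F\<phi> ab by simp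
        then show "F x = c * (\<phi> (e - x0) / \<phi> 0) * \<phi> (x - e)"
          by (simp only: rb[of x] mult.assoc)
      qed
      show ?thesis
        by (rule exI, rule bexI[OF _ e(1)], rule exI[of _ \<phi>], intro conjI pd cont\<phi>, rule *)
    qed
  qed
  with B show "F \<in> CH" unfolding CH_def by blast
qed

lemma CH_subset_PD: "CH \<subseteq> PD"
  unfolding CH_def PD_def by blast


section \<open>Fourier transforms of positive-definite functions\<close>

text \<open>The difference \<open>m\<close> occurs for exactly \<open>n - \<bar>m\<bar>\<close>
  pairs of indices. These are the Fejer weights, i.e. samples of the tent function below.\<close>

lemma sum_int_differences:
  fixes G :: "int \<Rightarrow> 'a :: comm_ring_1"
  shows "(\<Sum>j<n. \<Sum>k<n. G (int j - int k)) = (\<Sum>m\<in>{- int n..int n}. of_int (int n - \<bar>m\<bar>) * G m)"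
proof (induction n)
  case (Suc n)
  have *: "(\<Sum>j<n. G (int j - int n)) + (\<Sum>k<n. G (int n - int k)) + G 0 = (\<Sum>m\<in>{- int n..int n}. G m)"
  proof -
    have 1: "(\<Sum>j<n. G (int j - int n)) = (\<Sum>m\<in>{- int n..<0}. G m)"
      by (rule sum.reindex_bij_witness[of _ "\<lambda>m. nat (m + int n)" "\<lambda>j. int j - int n"]) auto
    have 2: "(\<Sum>k<n. G (int n - int k)) = (\<Sum>m\<in>{1..int n}. G m)"
      by (rule sum.reindex_bij_witness[of _ "\<lambda>m. nat (int n - m)" "\<lambda>k. int n - int k"]) auto
    have "{- int n..int n} = {- int n..<0} \<union> ({1..int n} \<union> {0})" by auto
    moreover have "(\<Sum>m\<in>{- int n..<0} \<union> ({1..int n} \<union> {0}). G m) = (\<Sum>m\<in>{- int n..<0}. G m) + ((\<Sum>m\<in>{1..int n}. G m) + (\<Sum>m\<in>{0}. G m))"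
      by (subst sum.union_disjoint, simp, simp, force, subst sum.union_disjoint) auto
    ultimately show ?thesis using 1 2 by (simp add: add.assoc)
  qed
  have "(\<Sum>m\<in>{- int (Suc n)..int (Suc n)}. of_int (int (Suc n) - \<bar>m\<bar>) * G m)
     = (\<Sum>m\<in>{- int n..int n}. of_int (int (Suc n) - \<bar>m\<bar>) * G m)"
  proof (rule sum.mono_neutral_right)
    have "int (Suc n) - \<bar>m\<bar> = 0" if "m \<in> {- int (Suc n)..int (Suc n)} - {- int n..int n}" for m
      using that by auto
    then show "\<forall>m\<in>{- int (Suc n)..int (Suc n)} - {- int n..int n}. of_int (int (Suc n) - \<bar>m\<bar>) * G m = 0"
      by (metis mult_zero_left of_int_0)
  qed auto
  also have "\<dots> = (\<Sum>m\<in>{- int n..int n}. of_int (int n - \<bar>m\<bar>) * G m) + (\<Sum>m\<in>{- int n..int n}. G m)"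
    by (simp add: sum.distrib[symmetric] algebra_simps)
  also have "\<dots> = (\<Sum>j<n. \<Sum>k<n. G (int j - int k)) + ((\<Sum>j<n. G (int j - int n)) + (\<Sum>k<n. G (int n - int k)) + G 0)"
    using Suc * by simp
  also have "\<dots> = (\<Sum>j<Suc n. \<Sum>k<Suc n. G (int j - int k))"
    by (simp add: sum.distrib algebra_simps)
  finally show ?case by simp
qed simp

text \<open>A tent of height \<open>L\<close> and slope 1. In this normalisation its samples on the
  mesh \<open>L / n\<close> are the mesh width times the pair counts
  \<open>n - \<bar>m\<bar>\<close>.\<close>

definition triangle :: "real \<Rightarrow> real \<Rightarrow> real" where
  "triangle L x = max 0 (L - \<bar>x\<bar>)"

lemma triangle_bounds: "L \<ge> 0 \<Longrightarrow> 0 \<le> triangle L x \<and> triangle L x \<le> L"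
  by (auto simp: triangle_def)

lemma continuous_triangle [continuous_intros]: "continuous_on S (triangle L)"
  unfolding triangle_def by (intro continuous_intros)

lemma triangle_mult_integrable:
  fixes f :: "real \<Rightarrow> complex"
  assumes f: "f \<in> borel_measurable borel" "\<And>x. cmod (f x) \<le> B" and L: "L \<ge> 0"
  shows "integrable lborel (\<lambda>x. triangle L x * f x)"
proof (rule Bochner_Integration.integrable_bound)
  show "integrable lborel (\<lambda>x. indicator {-L..L} x * (L * B))"
    by (intro integrable_mult_left integrable_real_indicator) (auto simp: emeasure_lborel_Icc_eq)
  have "0 \<le> B" using f(2)[of 0] norm_ge_zero order_trans by blast
  then show "AE x in lborel. norm (triangle L x * f x) \<le> norm (indicator {-L..L} x * (L * B))"
    using triangle_bounds[OF L] L f(2)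
    by (auto simp: norm_mult indicator_def intro!: mult_mono) (auto simp: triangle_def)
  have "triangle L \<in> borel_measurable borel"
    by (intro borel_measurable_continuous_onI continuous_triangle)
  then show "(\<lambda>x. triangle L x * f x) \<in> borel_measurable lborel"
    using f(1) by simp
qed

text \<open>The Riemann sums of the integral over the mesh \<open>L/n\<close> are, up to a positive factor, the
  sums \<open>\<Sum> g (x\<^sub>j - x\<^sub>k)\<close> over the points \<open>x\<^sub>j = jL/n\<close> with \<open>j < n\<close>.\<close>

lemma positive_definite_triangle_integral:
  fixes g :: "real \<Rightarrow> complex"
  assumes pd: "positive_definite g" and cont: "continuous_on UNIV g" and L: "L > 0"
  shows "(LINT x|lborel. triangle L x * g x) \<in> \<real>\<^sub>\<ge>\<^sub>0"
proof -
  define H where "H x = triangle L x * g x" for x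
  define h where "h n = L / real (Suc n)" for n
  have h: "h n > 0" "h n \<le> L" for n using L by (auto simp: h_def field_simps)
  have h0: "h \<longlonglongrightarrow> 0" unfolding h_def by real_asymp
  define S where "S n x = H (h n * of_int \<lfloor>x / h n\<rfloor>)" for n x
  have contH: "continuous_on UNIV H"
    unfolding H_def by (intro continuous_intros cont continuous_on_of_real)
  have Hm [measurable]: "H \<in> borel_measurable borel"
    by (intro borel_measurable_continuous_onI contH)
  have gb: "cmod (g x) \<le> cmod (g 0)" for x
    by (rule positive_definite_bound[OF pd])
  have Hb: "cmod (H x) \<le> L * cmod (g 0)" for x
    using triangle_bounds[of L x] L gb unfolding H_def by (simp add: norm_mult mult_mono)
  have Hz: "H x = 0" if "\<bar>x\<bar> \<ge> L" for x
    using that by (simp add: H_def triangle_def)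
  have floor: "h n * of_int \<lfloor>x / h n\<rfloor> \<le> x" "x < h n * of_int \<lfloor>x / h n\<rfloor> + h n" for n x
    using floor_divide_lower[OF h(1)[of n], of x] floor_divide_upper[OF h(1)[of n], of x]
    by (simp_all add: algebra_simps)
  have lim: "(\<lambda>n. LINT x|lborel. S n x) \<longlonglongrightarrow> (LINT x|lborel. H x)"
  \<comment> \<open>Rounding down to the mesh moves a point by at most \<open>h n\<close>, hence by
    at most \<open>L\<close>; so the step functions vanish outside twice the support of
    \<open>H\<close>.\<close>
  proof (rule integral_dominated_convergence[of _ _ _ "\<lambda>x. indicator {-2*L..2*L} x * (L * cmod (g 0))"])
    show "integrable lborel (\<lambda>x. indicator {-2*L..2*L} x * (L * cmod (g 0)))"
      by (intro integrable_mult_left integrable_real_indicator) (auto simp: emeasure_lborel_Icc_eq)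
    show "AE x in lborel. (\<lambda>n. S n x) \<longlonglongrightarrow> H x"
    proof (rule AE_I2)
      fix x
      have "(\<lambda>n. x - h n) \<longlonglongrightarrow> x - 0" by (intro tendsto_intros h0)
      then have A: "(\<lambda>n. x - h n) \<longlonglongrightarrow> x" by simp
      have "x - h n \<le> h n * of_int \<lfloor>x / h n\<rfloor>" for n
        using floor(2)[of x n] by simp
      then have "(\<lambda>n. h n * of_int \<lfloor>x / h n\<rfloor>) \<longlonglongrightarrow> x"
        by (intro tendsto_sandwich[OF _ _ A tendsto_const] always_eventually allI floor(1))
      moreover have "isCont H x" using contH by (simp add: continuous_on_eq_continuous_at)
      ultimately show "(\<lambda>n. S n x) \<longlonglongrightarrow> H x"
        unfolding S_def by (rule isCont_tendsto_compose[rotated])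
    qed
    show "AE x in lborel. norm (S n x) \<le> indicator {-2*L..2*L} x * (L * cmod (g 0))" for n
    proof (rule AE_I2)
      fix x
      show "norm (S n x) \<le> indicator {-2*L..2*L} x * (L * cmod (g 0))"
      proof (cases "x \<in> {-2*L..2*L}")
        case True
        then show ?thesis using Hb by (simp add: S_def)
      next
        case False
        then have "\<bar>h n * of_int \<lfloor>x / h n\<rfloor>\<bar> \<ge> L"
          using floor[where n = n and x = x] h(2)[of n] by auto
        then show ?thesis using Hz False by (simp add: S_def)
      qed
    qed
    show "S n \<in> borel_measurable lborel" for n
      unfolding S_def by measurable
  qed simp
  have "(LINT x|lborel. S n x) \<in> \<real>\<^sub>\<ge>\<^sub>0" for n
  proof -
    let ?N = "Suc n"
    let ?J = "{- int ?N..int ?N}"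
    define I where "I m = {h n * of_int m ..< h n * of_int m + h n}" for m :: int
    have Iiff: "x \<in> I m \<longleftrightarrow> \<lfloor>x / h n\<rfloor> = m" for x m
      using h(1)[of n] unfolding I_def floor_eq_iff by (auto simp: field_simps)
    have "S n x = (\<Sum>m\<in>?J. indicator (I m) x *\<^sub>R H (h n * of_int m))" for x
    proof -
      have "(\<Sum>m\<in>?J. indicator (I m) x *\<^sub>R H (h n * of_int m)) = (\<Sum>m\<in>?J. if \<lfloor>x / h n\<rfloor> = m then H (h n * of_int m) else 0)"
        by (intro sum.cong) (auto simp: indicator_def Iiff)
      also have "\<dots> = (if \<lfloor>x / h n\<rfloor> \<in> ?J then S n x else 0)"
        by (simp add: S_def)
      also have "\<dots> = S n x"
      proof (cases "\<lfloor>x / h n\<rfloor> \<in> ?J")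
        case False
        have "h n * real ?N = L" by (simp add: h_def)
        moreover have "\<bar>real_of_int \<lfloor>x / h n\<rfloor>\<bar> \<ge> real ?N" using False by auto
        then have "h n * \<bar>real_of_int \<lfloor>x / h n\<rfloor>\<bar> \<ge> h n * real ?N"
          by (rule mult_left_mono) (use h(1)[of n] in simp)
        ultimately have "\<bar>h n * of_int \<lfloor>x / h n\<rfloor>\<bar> \<ge> L"
          using h(1)[of n] by (simp add: abs_mult)
        then have "S n x = 0" unfolding S_def by (rule Hz)
        then show ?thesis by simp
      qed simp
      finally show ?thesis by simp
    qed
    then have "(LINT x|lborel. S n x) = (LINT x|lborel. (\<Sum>m\<in>?J. indicator (I m) x *\<^sub>R H (h n * of_int m)))"
      by (simp only:)
    also have "\<dots> = (\<Sum>m\<in>?J. (LINT x|lborel. indicator (I m) x *\<^sub>R H (h n * of_int m)))"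
      using h(1)[of n] by (intro Bochner_Integration.integral_sum integrable_scaleR_left integrable_real_indicator) (auto simp: I_def)
    also have "\<dots> = (\<Sum>m\<in>?J. h n *\<^sub>R H (h n * of_int m))"
      using h(1)[of n] by (intro sum.cong refl) (auto simp: I_def)
    \<comment> \<open>One factor \<open>h n\<close> is the length of the cell, the other comes from
      the sample of the tent.\<close>
    also have "\<dots> = (\<Sum>m\<in>?J. of_real (h n)^2 * (of_int (int ?N - \<bar>m\<bar>) * g (h n * of_int m)))"
    proof (rule sum.cong[OF refl])
      fix m assume m: "m \<in> ?J"
      have "\<bar>h n * of_int m\<bar> \<le> L"
      proof -
        have "\<bar>h n * of_int m\<bar> = h n * of_int \<bar>m\<bar>" using h(1)[of n] by (simp add: abs_mult)
        also have "\<dots> \<le> h n * real ?N"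
          using m h(1)[of n] by (intro mult_left_mono) auto
        finally show ?thesis by (simp add: h_def)
      qed
      moreover have "L = h n * real ?N" by (simp add: h_def)
      ultimately have "triangle L (h n * of_int m) = h n * of_int (int ?N - \<bar>m\<bar>)"
        using h(1)[of n] by (simp add: triangle_def abs_mult algebra_simps)
      then show "h n *\<^sub>R H (h n * of_int m) = of_real (h n)^2 * (of_int (int ?N - \<bar>m\<bar>) * g (h n * of_int m))"
        by (simp only: H_def scaleR_conv_of_real power2_eq_square of_real_mult of_real_of_int_eq mult.assoc)
    qed
    also have "\<dots> = of_real (h n)^2 * (\<Sum>j<?N. \<Sum>k<?N. g (h n * of_int (int j - int k)))"
      by (simp only: sum_distrib_left sum_int_differences[where G = "\<lambda>m. g (h n * of_int m)"])
    also have "(\<Sum>j<?N. \<Sum>k<?N. g (h n * of_int (int j - int k))) = (\<Sum>j<?N. \<Sum>k<?N. g (h n * real j - h n * real k) * 1 * cnj 1)"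
      by (simp add: right_diff_distrib)
    also have "of_real (h n)^2 * \<dots> \<in> \<real>\<^sub>\<ge>\<^sub>0"
    proof (rule nonneg_Reals_mult_I)
      show "(\<Sum>j<?N. \<Sum>k<?N. g (h n * real j - h n * real k) * 1 * cnj 1) \<in> \<real>\<^sub>\<ge>\<^sub>0"
        using pd[unfolded positive_definite_def, THEN spec, of "?N", THEN spec, of "\<lambda>j. h n * real j", THEN spec, of "\<lambda>_. 1"] .
    qed (use h(1)[of n] in \<open>simp flip: of_real_power\<close>)
    finally show ?thesis .
  qed
  then have "(LINT x|lborel. H x) \<in> \<real>\<^sub>\<ge>\<^sub>0"
    by (intro closed_sequentially[OF closed_nonneg_Reals_complex _ lim]) auto
  then show ?thesis by (simp add: H_def)
qed

lemma positive_definite_modulate: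
  assumes "positive_definite \<phi>"
  shows "positive_definite (\<lambda>t. iexp (x * t) * \<phi> t)"
  unfolding positive_definite_def
proof (intro allI)
  fix n :: nat and y :: "nat \<Rightarrow> real" and c :: "nat \<Rightarrow> complex"
  have eq: "iexp (x * (y j - y k)) * \<phi> (y j - y k) * c j * cnj (c k)
      = \<phi> (y j - y k) * (iexp (x * y j) * c j) * cnj (iexp (x * y k) * c k)" for j k
    by (simp add: exp_cnj right_diff_distrib exp_diff exp_minus field_simps)
  show "(\<Sum>j<n. \<Sum>k<n. iexp (x * (y j - y k)) * \<phi> (y j - y k) * c j * cnj (c k)) \<in> \<real>\<^sub>\<ge>\<^sub>0"
    unfolding eq using assms[unfolded positive_definite_def, THEN spec, of n, THEN spec, of y, THEN spec, of "\<lambda>j. iexp (x * y j) * c j"]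
    .
qed

text \<open>A substitute for Bochner's theorem. Multiplying \<phi> by a character keeps it
  positive-definite, so each value of the transform is a triangle integral of a positive-definite
  function, hence nonnegative; nonnegativity then gives integrability, with norm controlled by the
  supremum of \<open>w\<close>.\<close>

lemma positive_definite_triangle_fourier:
  fixes \<phi> :: "real \<Rightarrow> complex"
  assumes pd: "positive_definite \<phi>" and cont: "continuous_on UNIV \<phi>" and L: "L > 0"
  defines "w \<equiv> \<lambda>t. triangle L t * \<phi> t"
  shows "integrable lborel w" "continuous_on UNIV w" "\<And>t. cmod (w t) \<le> L * cmod (\<phi> 0)"
    "\<And>x. fourier w x \<in> \<real>\<^sub>\<ge>\<^sub>0" "integrable lborel (fourier w)"
    "(LINT x|lborel. cmod (fourier w x)) \<le> 2 * pi * (L * cmod (\<phi> 0))"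
proof -
  note b = positive_definite_bound[OF pd]
  have m: "\<phi> \<in> borel_measurable borel" by (intro borel_measurable_continuous_onI cont)
  show int: "integrable lborel w"
    unfolding w_def by (rule triangle_mult_integrable[OF m b]) (use L in simp)
  show "continuous_on UNIV w"
    unfolding w_def by (intro continuous_intros cont continuous_on_of_real)
  show bd: "\<And>t. cmod (w t) \<le> L * cmod (\<phi> 0)"
    using triangle_bounds[of L] L b unfolding w_def by (simp add: norm_mult mult_mono)
  show nn: "fourier w x \<in> \<real>\<^sub>\<ge>\<^sub>0" for x
  proof -
    have "continuous_on UNIV (\<lambda>t. iexp (x * t) * \<phi> t)"
      by (intro continuous_intros cont)
    from positive_definite_triangle_integral[OF positive_definite_modulate[OF pd] this L]
    show ?thesis by (simp add: fourier_def w_def mult_ac)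
  qed
  show "integrable lborel (fourier w)" "(LINT x|lborel. cmod (fourier w x)) \<le> 2 * pi * (L * cmod (\<phi> 0))"
    by (rule fourier_nonneg_integrable[OF int bd nn])+
qed

text \<open>Replace \<phi> by its tent truncation \<open>\<phi>L\<close>. Fubini moves the transform
  from \<open>w\<close> to \<open>\<phi>L\<close>, where its integral norm is at most
  \<open>2 * pi * L * cmod (\<phi> 0)\<close>. Dividing by the height \<open>L\<close> of the tent
  and letting \<open>L\<close> grow recovers \<phi>.\<close>

theorem positive_definite_fourier_bound:
  fixes w \<phi> :: "real \<Rightarrow> complex"
  assumes pd: "positive_definite \<phi>" and cont: "continuous_on UNIV \<phi>"
    and w: "integrable lborel w" "\<And>t. cmod (w t) \<le> W" and fw: "integrable lborel (fourier w)"
  shows "cmod (LINT x|lborel. fourier w x * \<phi> x) \<le> 2 * pi * (cmod (\<phi> 0) * W)"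
proof (rule tendsto_upperbound)
  define \<phi>L where "\<phi>L n x = of_real (triangle (real (Suc n)) x) * \<phi> x" for n x
  have m [measurable]: "\<phi> \<in> borel_measurable borel" by (intro borel_measurable_continuous_onI cont)
  have [measurable]: "w \<in> borel_measurable borel" "fourier w \<in> borel_measurable borel" using w fw by auto
  have tm [measurable]: "triangle L \<in> borel_measurable borel" for L
    by (intro borel_measurable_continuous_onI continuous_triangle)
  note T = positive_definite_triangle_fourier[OF pd cont, of "real (Suc n)" for n, folded \<phi>L_def, simplified]
  have W: "0 \<le> W" using w(2)[of 0] norm_ge_zero order_trans by blast
  show "(\<lambda>n. cmod (LINT x|lborel. fourier w x * (\<phi>L n x / real (Suc n)))) \<longlonglongrightarrow> cmod (LINT x|lborel. fourier w x * \<phi> x)"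
  proof (intro tendsto_norm integral_dominated_convergence[of _ _ _ "\<lambda>x. cmod (fourier w x) * cmod (\<phi> 0)"])
    show "AE x in lborel. (\<lambda>n. fourier w x * (\<phi>L n x / real (Suc n))) \<longlonglongrightarrow> fourier w x * \<phi> x"
    proof (rule AE_I2)
      fix x
      have "(\<lambda>n. triangle (real (Suc n)) x / real (Suc n)) \<longlonglongrightarrow> 1"
        unfolding triangle_def by real_asymp
      then have "(\<lambda>n. fourier w x * (of_real (triangle (real (Suc n)) x / real (Suc n)) * \<phi> x)) \<longlonglongrightarrow> fourier w x * (of_real 1 * \<phi> x)"
        by (intro tendsto_intros)
      then show "(\<lambda>n. fourier w x * (\<phi>L n x / real (Suc n))) \<longlonglongrightarrow> fourier w x * \<phi> x"
        by (simp add: \<phi>L_def)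
    qed
    have "cmod (\<phi>L n x / real (Suc n)) \<le> cmod (\<phi> 0)" for n x
    proof -
      have "cmod (\<phi>L n x) \<le> real (Suc n) * cmod (\<phi> 0)" using T(3)[of n x] by simp
      then show ?thesis by (simp add: norm_divide divide_le_eq mult.commute del: of_nat_Suc)
    qed
    then show "AE x in lborel. norm (fourier w x * (\<phi>L n x / real (Suc n))) \<le> cmod (fourier w x) * cmod (\<phi> 0)" for n
      unfolding norm_mult by (intro AE_I2 mult_left_mono) auto
  qed (use fw in \<open>auto simp: \<phi>L_def\<close>)
  show "\<forall>\<^sub>F n in sequentially. cmod (LINT x|lborel. fourier w x * (\<phi>L n x / real (Suc n))) \<le> 2 * pi * (cmod (\<phi> 0) * W)"
  proof (intro always_eventually allI)
    fix n
    have "(LINT x|lborel. fourier w x * (\<phi>L n x / real (Suc n))) = (LINT x|lborel. \<phi>L n x * (LINT t|lborel. iexp (x * t) * w t)) / real (Suc n)"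
      by (simp add: fourier_def mult.commute del: of_nat_Suc)
    also have "(LINT x|lborel. \<phi>L n x * (LINT t|lborel. iexp (x * t) * w t)) = (LINT t|lborel. (LINT x|lborel. \<phi>L n x * iexp (x * t)) * w t)"
      by (rule lborel_pair.Fubini_bounded_kernel[OF T(1) w(1)]) auto
    also have "\<dots> = (LINT t|lborel. fourier (\<phi>L n) t * w t)"
      by (simp add: fourier_def mult.commute)
    also have "cmod (\<dots> / real (Suc n)) \<le> (LINT t|lborel. cmod (fourier (\<phi>L n) t) * W) / real (Suc n)"
    proof -
      note mm = borel_measurable_integrable[OF T(5)]
      have *: "norm (fourier (\<phi>L n) t * w t) \<le> cmod (fourier (\<phi>L n) t) * W" for t
        unfolding norm_mult by (intro mult_left_mono w(2)) auto
      have i: "integrable lborel (\<lambda>t. cmod (fourier (\<phi>L n) t) * W)"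
        using T(5)[of n] by auto
      have "integrable lborel (\<lambda>t. fourier (\<phi>L n) t * w t)"
      proof (rule Bochner_Integration.integrable_bound[OF i])
        show "AE t in lborel. norm (fourier (\<phi>L n) t * w t) \<le> norm (cmod (fourier (\<phi>L n) t) * W)"
          unfolding real_norm_def by (intro AE_I2 order_trans[OF * abs_ge_self])
      qed (use mm[of n] in auto)
      from Bochner_Integration.integral_norm_bound_integral[OF this i *] show ?thesis
        by (simp add: norm_divide divide_right_mono del: of_nat_Suc)
    qed
    also have "\<dots> = (LINT t|lborel. cmod (fourier (\<phi>L n) t)) * W / real (Suc n)"
      by simp
    also have "\<dots> \<le> 2 * pi * (real (Suc n) * cmod (\<phi> 0)) * W / real (Suc n)"
      using T(6)[of n] W by (intro divide_right_mono mult_right_mono) auto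
    also have "\<dots> = 2 * pi * (cmod (\<phi> 0) * W)"
      by (simp del: of_nat_Suc)
    finally show "cmod (LINT x|lborel. fourier w x * (\<phi>L n x / real (Suc n))) \<le> 2 * pi * (cmod (\<phi> 0) * W)" .
  qed
qed simp


section \<open>Cut-off functions and gluing of local representatives\<close>

text \<open>The constant 1 is positive-definite, so the tent has an integrable transform and
  inversion writes it as a transform in turn. This makes tents available as multipliers of
  \<open>B_R\<close>.\<close>

lemma triangle_fourier_representation:
  assumes L: "L > 0"
  obtains k where "integrable lborel k"
    "\<And>\<xi>. complex_of_real (triangle L (\<xi> - m)) = (LINT t|lborel. iexp (\<xi> * t) * k t)"
proof -
  define w where "w t = complex_of_real (triangle L t) * 1" for t
  note T = positive_definite_triangle_fourier[OF positive_definite_one continuous_on_const L, folded w_def]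
  have [measurable]: "fourier w \<in> borel_measurable borel" using T(5) by auto
  \<comment> \<open>Inversion carries \<open>exp (- \<i> * x * s)\<close>; conjugation, under which
    the real tent is invariant, corrects the sign. The exponential factor shifts the tent by
    \<open>m\<close>.\<close>
  define k where "k t = exp (- \<i> * of_real (m * t)) * cnj (fourier w t) / (2 * pi)" for t
  show thesis
  proof (rule that)
    show "integrable lborel k"
    proof (rule Bochner_Integration.integrable_bound[OF T(5)])
      have "integrable lborel (\<lambda>t. cnj (fourier w t))" using T(5) by simp
      from borel_measurable_integrable[OF this]
      have [measurable]: "(\<lambda>t. cnj (fourier w t)) \<in> borel_measurable borel" by simp
      show "k \<in> borel_measurable lborel" unfolding k_def by measurable
      have "1 \<le> 2 * pi" using pi_ge_two by simp
      then have "cmod (fourier w t) * 1 \<le> cmod (fourier w t) * (2 * pi)" for t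
        by (rule mult_left_mono) simp
      then show "AE t in lborel. norm (k t) \<le> norm (fourier w t)"
        by (simp add: k_def norm_mult norm_divide divide_le_eq)
    qed
    fix \<xi>
    have "(LINT x|lborel. fourier w x * exp (- \<i> * of_real (x * (\<xi> - m)))) = 2 * pi * w (\<xi> - m)"
      by (rule fourier_inversion[OF T(1,2,3,5)])
    then have "cnj (LINT x|lborel. fourier w x * exp (- \<i> * of_real (x * (\<xi> - m)))) = 2 * pi * w (\<xi> - m)"
      by (simp add: w_def)
    moreover have "cnj (fourier w x) * iexp (x * (\<xi> - m)) = cnj (fourier w x * exp (- \<i> * of_real (x * (\<xi> - m))))" for x
      by (simp add: exp_cnj)
    ultimately have "(LINT x|lborel. cnj (fourier w x) * iexp (x * (\<xi> - m))) = 2 * pi * w (\<xi> - m)"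
      by (simp only: Bochner_Integration.integral_cnj)
    moreover have "(LINT t|lborel. iexp (\<xi> * t) * k t) =
        (LINT x|lborel. (cnj (fourier w x) * iexp (x * (\<xi> - m))) / (2 * pi))"
    proof (rule Bochner_Integration.integral_cong[OF refl])
      fix x
      have "iexp (x * (\<xi> - m)) = iexp (\<xi> * x) * exp (- \<i> * of_real (m * x))"
        by (simp add: exp_add[symmetric] algebra_simps)
      then show "iexp (\<xi> * x) * k x = (cnj (fourier w x) * iexp (x * (\<xi> - m))) / (2 * pi)"
        by (simp add: k_def)
    qed
    ultimately show "complex_of_real (triangle L (\<xi> - m)) = (LINT t|lborel. iexp (\<xi> * t) * k t)"
      by (simp add: w_def)
  qed
qed

lemma B_R_scale: "F \<in> B_R \<Longrightarrow> (\<lambda>\<xi>. c * F \<xi>) \<in> B_R"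
  unfolding B_R_iff
proof safe
  fix L assume L: "sigma_functional L"
  have "sigma_functional (\<lambda>f. c * L f)"
  proof (rule sigma_functionalI)
    show "(\<lambda>n. c * L (s n)) \<longlonglongrightarrow> c * L f"
      if "\<And>n. s n \<in> borel_measurable borel" "\<And>n x. cmod (s n x) \<le> B" "\<And>x. (\<lambda>n. s n x) \<longlonglongrightarrow> f x"
      for s :: "nat \<Rightarrow> real \<Rightarrow> complex" and f B
      using that by (intro tendsto_mult tendsto_const sigma_functionalD(3)[OF L])
  qed (simp_all add: sigma_functionalD(1,2)[OF L] distrib_left)
  then show "\<exists>L'. sigma_functional L' \<and> (\<lambda>\<xi>. c * L (\<lambda>x. iexp (\<xi> * x))) = (\<lambda>\<xi>. L' (\<lambda>x. iexp (\<xi> * x)))"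
    by (intro exI[of _ "\<lambda>f. c * L f"]) simp
qed

lemma B_R_mult_triangle:
  fixes F :: "real \<Rightarrow> complex"
  assumes "F \<in> B_R" "L > 0"
  shows "(\<lambda>\<xi>. triangle L (\<xi> - m) * F \<xi>) \<in> B_R"
proof -
  obtain k where "integrable lborel k"
    "\<And>\<xi>. complex_of_real (triangle L (\<xi> - m)) = (LINT t|lborel. iexp (\<xi> * t) * k t)"
    using triangle_fourier_representation[OF assms(2)] by metis
  then show ?thesis by (rule B_R_mult_fourier_transform[OF assms(1)])
qed

text \<open>Bisection leaves only the gluing of representatives \<open>G1\<close> and
  \<open>G2\<close> of two adjacent intervals. They are joined as \<open>G2 + T * (G1 - G2)\<close>
  with a trapezoidal cut-off \<open>T\<close>, a difference of tents, so the result stays in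
  \<open>B_R\<close>.\<close>

lemma B_loc_on_interval:
  assumes F: "F \<in> B_loc" and ab: "a \<le> b"
  obtains G e where "G \<in> B_R" "e > 0" "\<And>y. y \<in> {a - e..b + e} \<Longrightarrow> F y = G y"
proof -
  \<comment> \<open>The margin \<open>e\<close> on both sides makes adjacent intervals overlap
    around their common endpoint, which leaves room for the slope of the cut-off.\<close>
  define P where "P a b \<longleftrightarrow> (\<exists>G\<in>B_R. \<exists>e>0. \<forall>y\<in>{a - e..b + e}. F y = G y)" for a b
  have "P a b"
    using ab
  proof (induction rule: Bolzano)
    case (trans a b c)
    obtain G1 e1 where 1: "G1 \<in> B_R" "e1 > 0" "\<And>y. y \<in> {a - e1..b + e1} \<Longrightarrow> F y = G1 y"
      using trans(1) unfolding P_def by blast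
    obtain G2 e2 where 2: "G2 \<in> B_R" "e2 > 0" "\<And>y. y \<in> {b - e2..c + e2} \<Longrightarrow> F y = G2 y"
      using trans(2) unfolding P_def by blast
    define e where "e = min e1 e2"
    define m where "m = a - e"
    define L where "L = b + e / 2 - m"
    define L' where "L' = b - e / 2 - m"
    have e: "e > 0" "e \<le> e1" "e \<le> e2" using 1 2 by (auto simp: e_def)
    have L: "L > 0" "L' > 0" "L - L' = e"
      using e trans(3) by (auto simp: L_def L'_def m_def field_simps)
    \<comment> \<open>Both tents are centred at \<open>m\<close>, the left end, and their
      half-widths differ by \<open>e\<close>. So \<open>T\<close> is 1 up to
      \<open>b - e / 2\<close> and 0 from \<open>b + e / 2\<close>; in between \<open>G1\<close> and
      \<open>G2\<close> both equal \<open>F\<close>.\<close>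
    define T where "T y = (triangle L (y - m) - triangle L' (y - m)) / e" for y
    have T1: "T y = 1" if "y \<in> {a - e..b - e / 2}" for y
      using that e L unfolding T_def triangle_def L_def L'_def m_def by (auto simp: max_def field_simps)
    have T0: "T y = 0" if "y \<ge> b + e / 2" for y
      using that e L unfolding T_def triangle_def L_def L'_def m_def by (auto simp: max_def field_simps)
    define D where "D y = G1 y + (- 1) * G2 y" for y
    define G where "G y = G2 y + ((1 / e) * (triangle L (y - m) * D y) + (- 1 / e) * (triangle L' (y - m) * D y))" for y
    have D: "D \<in> B_R"
      unfolding D_def by (intro B_R_add B_R_scale 1 2)
    have "G \<in> B_R"
      unfolding G_def by (intro B_R_add B_R_scale B_R_mult_triangle D L 2)
    moreover have G: "G y = G2 y + T y * D y" for y
      unfolding G_def T_def by (simp add: diff_divide_distrib algebra_simps)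
    moreover have "F y = G y" if y: "y \<in> {a - e / 2..c + e / 2}" for y
    proof -
      consider "y \<le> b - e / 2" | "b - e / 2 < y" "y < b + e / 2" | "y \<ge> b + e / 2" by linarith
      then show ?thesis
      proof cases
        case 1
        then have "F y = G1 y" "T y = 1" using y e trans(3,4) by (auto intro!: \<open>\<And>y. y \<in> {a - e1..b + e1} \<Longrightarrow> F y = G1 y\<close> T1)
        then show ?thesis by (simp add: G D_def)
      next
        case 2
        then have "F y = G1 y" "F y = G2 y"
          using y e trans(3,4) by (auto intro!: \<open>\<And>y. y \<in> {a - e1..b + e1} \<Longrightarrow> F y = G1 y\<close> \<open>\<And>y. y \<in> {b - e2..c + e2} \<Longrightarrow> F y = G2 y\<close>)
        then show ?thesis by (simp add: G D_def)
      next
        case 3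
        then have "F y = G2 y" "T y = 0"
          using y e trans(3,4) by (auto intro!: \<open>\<And>y. y \<in> {b - e2..c + e2} \<Longrightarrow> F y = G2 y\<close> T0)
        then show ?thesis by (simp add: G)
      qed
    qed
    ultimately show ?case
      unfolding P_def using e(1) by (intro bexI[of _ G] exI[of _ "e / 2"]) auto
  next
    case (local x)
    obtain U G where U: "open U" "x \<in> U" "G \<in> B_R" "\<forall>y\<in>U. F y = G y"
      using F unfolding B_loc_def by blast
    obtain r where r: "r > 0" "ball x r \<subseteq> U"
      using U(1,2) open_contains_ball by blast
    have "P u v" if "u \<le> x" "x \<le> v" "v - u < r / 2" for u v
      unfolding P_def
    proof (intro bexI[OF _ U(3)] exI[of _ "r / 4"] conjI ballI)
      fix y assume "y \<in> {u - r / 4..v + r / 4}"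
      then have "y \<in> ball x r" using that r(1) by (auto simp: dist_real_def)
      then show "F y = G y" using r(2) U(4) by blast
    qed (use r in simp)
    then show ?case using r(1) by (intro exI[of _ "r / 2"]) auto
  qed
  then show thesis unfolding P_def using that by blast
qed


section \<open>The Hahn--Banach theorem\<close>

text \<open>Explicit carrier and operations, because the theorem is applied both to a record algebra
  with its norm and to the bounded functions with the sup norm.\<close>

locale complex_vector_space =
  fixes V :: "'v set" and add :: "'v \<Rightarrow> 'v \<Rightarrow> 'v" (infixl "\<oplus>\<^sub>v" 65)
    and smul :: "complex \<Rightarrow> 'v \<Rightarrow> 'v" (infixr "\<cdot>\<^sub>v" 75) and zero :: 'v ("\<zero>\<^sub>v")
  assumes add_closed: "x \<in> V \<Longrightarrow> y \<in> V \<Longrightarrow> x \<oplus>\<^sub>v y \<in> V"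
    and smul_closed: "x \<in> V \<Longrightarrow> c \<cdot>\<^sub>v x \<in> V"
    and zero_closed: "\<zero>\<^sub>v \<in> V"
    and add_assoc: "x \<in> V \<Longrightarrow> y \<in> V \<Longrightarrow> z \<in> V \<Longrightarrow> x \<oplus>\<^sub>v y \<oplus>\<^sub>v z = x \<oplus>\<^sub>v (y \<oplus>\<^sub>v z)"
    and add_commute: "x \<in> V \<Longrightarrow> y \<in> V \<Longrightarrow> x \<oplus>\<^sub>v y = y \<oplus>\<^sub>v x"
    and add_zero: "x \<in> V \<Longrightarrow> x \<oplus>\<^sub>v \<zero>\<^sub>v = x"
    and smul_add: "x \<in> V \<Longrightarrow> y \<in> V \<Longrightarrow> c \<cdot>\<^sub>v (x \<oplus>\<^sub>v y) = c \<cdot>\<^sub>v x \<oplus>\<^sub>v c \<cdot>\<^sub>v y"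
    and add_smul: "x \<in> V \<Longrightarrow> (c + d) \<cdot>\<^sub>v x = c \<cdot>\<^sub>v x \<oplus>\<^sub>v d \<cdot>\<^sub>v x"
    and smul_smul: "x \<in> V \<Longrightarrow> c \<cdot>\<^sub>v d \<cdot>\<^sub>v x = (c * d) \<cdot>\<^sub>v x"
    and smul_one: "x \<in> V \<Longrightarrow> 1 \<cdot>\<^sub>v x = x"
    and smul_0: "x \<in> V \<Longrightarrow> 0 \<cdot>\<^sub>v x = \<zero>\<^sub>v"
begin

lemma add_interchange:
  assumes "x \<in> V" "y \<in> V" "z \<in> V" "w \<in> V"
  shows "(x \<oplus>\<^sub>v y) \<oplus>\<^sub>v (z \<oplus>\<^sub>v w) = (x \<oplus>\<^sub>v z) \<oplus>\<^sub>v (y \<oplus>\<^sub>v w)"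
  using assms by (metis add_assoc add_closed add_commute)

lemma add_neg: "x \<in> V \<Longrightarrow> x \<oplus>\<^sub>v (- 1) \<cdot>\<^sub>v x = \<zero>\<^sub>v"
  using add_smul[of x 1 "- 1"] by (simp add: smul_one smul_0)

text \<open>The value 0 outside \<open>V\<close> makes a functional determined by its restriction to
  \<open>V\<close>; otherwise minimality in the pointwise order of the whole type could not give
  equality.\<close>

definition sublinear :: "('v \<Rightarrow> real) \<Rightarrow> bool" where
  "sublinear q \<longleftrightarrow> (\<forall>x\<in>V. \<forall>y\<in>V. q (x \<oplus>\<^sub>v y) \<le> q x + q y) \<and>
     (\<forall>x\<in>V. \<forall>r\<ge>0. q (of_real r \<cdot>\<^sub>v x) = r * q x) \<and> (\<forall>x. x \<notin> V \<longrightarrow> q x = 0)"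

lemma sublinear_add: "sublinear q \<Longrightarrow> x \<in> V \<Longrightarrow> y \<in> V \<Longrightarrow> q (x \<oplus>\<^sub>v y) \<le> q x + q y"
  and sublinear_scale: "sublinear q \<Longrightarrow> x \<in> V \<Longrightarrow> r \<ge> 0 \<Longrightarrow> q (of_real r \<cdot>\<^sub>v x) = r * q x"
  and sublinear_outside: "sublinear q \<Longrightarrow> x \<notin> V \<Longrightarrow> q x = 0"
  unfolding sublinear_def by blast+

lemma sublinear_zero: "sublinear q \<Longrightarrow> q \<zero>\<^sub>v = 0"
  using sublinear_scale[OF _ zero_closed, of q 0] smul_0[OF zero_closed] by simp

lemma sublinear_lower:
  assumes "sublinear q" "x \<in> V" "y \<in> V"
  shows "q y - q ((- 1) \<cdot>\<^sub>v x) \<le> q (x \<oplus>\<^sub>v y)"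
proof -
  have "(x \<oplus>\<^sub>v y) \<oplus>\<^sub>v (- 1) \<cdot>\<^sub>v x = (x \<oplus>\<^sub>v (- 1) \<cdot>\<^sub>v x) \<oplus>\<^sub>v y"
    using assms(2,3) by (metis add_assoc add_commute smul_closed)
  also have "\<dots> = y"
    using assms(2,3) by (metis add_neg add_commute add_zero zero_closed)
  finally show ?thesis
    using sublinear_add[OF assms(1), of "x \<oplus>\<^sub>v y" "(- 1) \<cdot>\<^sub>v x"] assms(2,3)
    by (simp add: add_closed smul_closed)
qed

lemma sublinear_ge: "sublinear q \<Longrightarrow> x \<in> V \<Longrightarrow> - q ((- 1) \<cdot>\<^sub>v x) \<le> q x"
  using sublinear_lower[of q x "\<zero>\<^sub>v"] by (simp add: zero_closed add_zero sublinear_zero)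

text \<open>A pair \<open>(e, r)\<close> in the cone records the constraint that the functional to be constructed is
  at least \<open>r\<close> at \<open>e\<close>.\<close>

definition dominated_cone :: "('v \<Rightarrow> real) \<Rightarrow> ('v \<times> real) set \<Rightarrow> bool" where
  "dominated_cone q C \<longleftrightarrow> (\<zero>\<^sub>v, 0) \<in> C \<and> (\<forall>(e, r)\<in>C. e \<in> V \<and> r \<le> q e) \<and>
     (\<forall>(e, r)\<in>C. \<forall>(e', r')\<in>C. (e \<oplus>\<^sub>v e', r + r') \<in> C) \<and> (\<forall>(e, r)\<in>C. \<forall>t\<ge>0. (of_real t \<cdot>\<^sub>v e, t * r) \<in> C)"

text \<open>A linear functional \<open>g\<close> below \<open>q\<close> with \<open>g e\<close> at
  least \<open>r\<close> satisfies \<open>g x = g (x + e) - g e\<close>, which is at most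
  \<open>q (x + e) - r\<close>. The infimum collects all these forced upper bounds.\<close>

definition tighten :: "('v \<Rightarrow> real) \<Rightarrow> ('v \<times> real) set \<Rightarrow> 'v \<Rightarrow> real" where
  "tighten q C x = (if x \<in> V then INF (e, r)\<in>C. q (x \<oplus>\<^sub>v e) - r else 0)"

text \<open>Adding one constraint used for \<open>x\<close> to one used for \<open>y\<close> gives
  subadditivity; scaling constraints gives homogeneity. At \<open>-e\<close> the term of
  \<open>q\<close> becomes \<open>q 0 = 0\<close>, so a linear functional below the tightened one is
  at least \<open>r\<close> at \<open>e\<close>.\<close>

lemma tighten:
  assumes q: "sublinear q" and C: "dominated_cone q C"
  shows "sublinear (tighten q C)" and "tighten q C x \<le> q x"
    and "(e, r) \<in> C \<Longrightarrow> tighten q C ((- 1) \<cdot>\<^sub>v e) \<le> - r"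
proof -
  have ne: "C \<noteq> {}" and C0: "(\<zero>\<^sub>v, 0) \<in> C"
    and CV: "\<And>e r. (e, r) \<in> C \<Longrightarrow> e \<in> V \<and> r \<le> q e"
    and Cadd: "\<And>e r e' r'. (e, r) \<in> C \<Longrightarrow> (e', r') \<in> C \<Longrightarrow> (e \<oplus>\<^sub>v e', r + r') \<in> C"
    and Cscale: "\<And>e r t. (e, r) \<in> C \<Longrightarrow> t \<ge> 0 \<Longrightarrow> (of_real t \<cdot>\<^sub>v e, t * r) \<in> C"
    using C unfolding dominated_cone_def by blast+
  let ?f = "\<lambda>x (e, r). q (x \<oplus>\<^sub>v e) - r"
  have lower: "- q ((- 1) \<cdot>\<^sub>v x) \<le> q (x \<oplus>\<^sub>v e) - r" if "x \<in> V" "(e, r) \<in> C" for x e r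
    using sublinear_lower[OF q that(1), of e] CV[OF that(2)] by simp
  then have bdd: "bdd_below (?f x ` C)" if "x \<in> V" for x
    using that by (intro bdd_belowI[of _ "- q ((- 1) \<cdot>\<^sub>v x)"]) auto
  have le: "tighten q C x \<le> q (x \<oplus>\<^sub>v e) - r" if "x \<in> V" "(e, r) \<in> C" for x e r
    unfolding tighten_def using that cINF_lower[OF bdd[OF that(1)] that(2)] by simp
  have ge: "b \<le> tighten q C x" if "x \<in> V" "\<And>e r. (e, r) \<in> C \<Longrightarrow> b \<le> q (x \<oplus>\<^sub>v e) - r" for x b
    unfolding tighten_def using that cINF_greatest[OF ne, of b "?f x"] by auto
  show "tighten q C x \<le> q x"
    using le[OF _ C0, of x] by (cases "x \<in> V") (auto simp: add_zero tighten_def sublinear_outside[OF q])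
  show "tighten q C ((- 1) \<cdot>\<^sub>v e) \<le> - r" if "(e, r) \<in> C"
    using le[OF smul_closed that, of e "- 1"] CV[OF that]
    by (metis add_commute add_neg diff_0 q smul_closed sublinear_zero)
  have scale_le: "tighten q C (of_real t \<cdot>\<^sub>v x) \<le> t * tighten q C x" if x: "x \<in> V" and t: "t > 0" for x t
  proof -
    have "tighten q C (of_real t \<cdot>\<^sub>v x) / t \<le> tighten q C x"
    proof (rule ge[OF x])
      fix e r assume er: "(e, r) \<in> C"
      have "of_real t \<cdot>\<^sub>v x \<oplus>\<^sub>v of_real t \<cdot>\<^sub>v e = of_real t \<cdot>\<^sub>v (x \<oplus>\<^sub>v e)"
        using x CV[OF er] by (simp add: smul_add)
      then have "tighten q C (of_real t \<cdot>\<^sub>v x) \<le> t * q (x \<oplus>\<^sub>v e) - t * r"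
        using le[OF smul_closed[OF x] Cscale[OF er], of t "of_real t"] t x CV[OF er]
        by (simp add: sublinear_scale[OF q] add_closed)
      then show "tighten q C (of_real t \<cdot>\<^sub>v x) / t \<le> q (x \<oplus>\<^sub>v e) - r"
        using t by (simp add: field_simps)
    qed
    then show ?thesis using t by (simp add: field_simps)
  qed
  have zero: "tighten q C \<zero>\<^sub>v = 0"
  proof (rule order_antisym)
    show "tighten q C \<zero>\<^sub>v \<le> 0"
      using le[OF zero_closed C0] by (simp add: add_zero zero_closed sublinear_zero[OF q])
    show "0 \<le> tighten q C \<zero>\<^sub>v"
      by (rule ge[OF zero_closed]) (use CV in \<open>auto simp: add_commute[OF zero_closed] add_zero\<close>)
  qed
  show "sublinear (tighten q C)"
    unfolding sublinear_def
  proof (intro conjI ballI allI impI)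
    fix x y assume xy: "x \<in> V" "y \<in> V"
    have 1: "tighten q C (x \<oplus>\<^sub>v y) - (q (x \<oplus>\<^sub>v e) - r) \<le> q (y \<oplus>\<^sub>v e') - r'"
      if "(e, r) \<in> C" "(e', r') \<in> C" for e r e' r'
    proof -
      have "tighten q C (x \<oplus>\<^sub>v y) \<le> q ((x \<oplus>\<^sub>v y) \<oplus>\<^sub>v (e \<oplus>\<^sub>v e')) - (r + r')"
        using xy that by (intro le add_closed Cadd)
      also have "(x \<oplus>\<^sub>v y) \<oplus>\<^sub>v (e \<oplus>\<^sub>v e') = (x \<oplus>\<^sub>v e) \<oplus>\<^sub>v (y \<oplus>\<^sub>v e')"
        using xy CV that by (intro add_interchange) auto
      also have "q \<dots> \<le> q (x \<oplus>\<^sub>v e) + q (y \<oplus>\<^sub>v e')"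
        using xy CV that by (intro sublinear_add[OF q] add_closed) auto
      finally show ?thesis by simp
    qed
    have 2: "tighten q C (x \<oplus>\<^sub>v y) - (q (x \<oplus>\<^sub>v e) - r) \<le> tighten q C y" if "(e, r) \<in> C" for e r
      by (rule ge[OF xy(2) 1[OF that]])
    have "tighten q C (x \<oplus>\<^sub>v y) - tighten q C y \<le> tighten q C x"
      by (rule ge[OF xy(1)]) (use 2 in fastforce)
    then show "tighten q C (x \<oplus>\<^sub>v y) \<le> tighten q C x + tighten q C y" by simp
  next
    fix x and t :: real assume x: "x \<in> V" and t: "0 \<le> t"
    show "tighten q C (of_real t \<cdot>\<^sub>v x) = t * tighten q C x"
    proof (cases "t = 0")
      case True
      then show ?thesis using x zero by (simp add: smul_0)
    next
      case False
      then have t: "t > 0" using t by simp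
      have "of_real (1 / t) \<cdot>\<^sub>v of_real t \<cdot>\<^sub>v x = x"
        using t x by (simp add: smul_smul smul_one)
      then have "tighten q C x \<le> 1 / t * tighten q C (of_real t \<cdot>\<^sub>v x)"
        using scale_le[OF smul_closed[OF x], of "1 / t" "of_real t"] t by simp
      then show ?thesis using scale_le[OF x t] t by (simp add: field_simps)
    qed
  qed (simp add: tighten_def)
qed

text \<open>Zorn's lemma with pointwise infima of chains. They are finite because each member is at
  least \<open>- p (- x)\<close> at \<open>x\<close>, and subadditive because two members of a chain
  have a common lower bound in it.\<close>

lemma minimal_sublinear_exists:
  assumes p: "sublinear p"
  obtains q where "sublinear q" "q \<le> p" "\<And>q'. sublinear q' \<Longrightarrow> q' \<le> q \<Longrightarrow> q' = q"
proof -
  let ?A = "{q. sublinear q \<and> q \<le> p}"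
  let ?P = "\<lambda>a b :: 'v \<Rightarrow> real. b \<le> a"
  have "\<exists>m\<in>?A. \<forall>a\<in>?A. ?P m a \<longrightarrow> a = m"
  proof (rule predicate_Zorn)
    show "partial_order_on ?A (relation_of ?P ?A)"
      by (rule partial_order_on_relation_ofI) auto
    fix C assume "C \<in> Chains (relation_of ?P ?A)"
    then have CA: "\<And>q. q \<in> C \<Longrightarrow> sublinear q \<and> q \<le> p"
      and chain: "\<And>q q'. q \<in> C \<Longrightarrow> q' \<in> C \<Longrightarrow> q \<le> q' \<or> q' \<le> q"
      unfolding Chains_def relation_of_def by auto
    show "\<exists>u\<in>?A. \<forall>a\<in>C. u \<le> a"
    proof (cases "C = {}")
      case True
      then show ?thesis using p by auto
    next
      case ne: False
      define u where "u x = (INF q\<in>C. q x)" for x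
      have bdd: "bdd_below ((\<lambda>q. q x) ` C)" for x
      proof (cases "x \<in> V")
        case True
        have "- p ((- 1) \<cdot>\<^sub>v x) \<le> q x" if "q \<in> C" for q
          using sublinear_ge[of q x] CA[OF that] True by (smt (verit) le_funD)
        then show ?thesis by (intro bdd_belowI[of _ "- p ((- 1) \<cdot>\<^sub>v x)"]) auto
      next
        case False
        then have "0 \<le> q x" if "q \<in> C" for q
          using CA[OF that] sublinear_outside[of q x] by simp
        then show ?thesis by (rule bdd_belowI2)
      qed
      have le: "u x \<le> q x" if "q \<in> C" for q x
        unfolding u_def by (rule cINF_lower[OF bdd that])
      have ge: "b \<le> u x" if "\<And>q. q \<in> C \<Longrightarrow> b \<le> q x" for b x
        unfolding u_def by (rule cINF_greatest[OF ne that])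
      have scale_le: "u (of_real t \<cdot>\<^sub>v x) \<le> t * u x" if x: "x \<in> V" and t: "t > 0" for x t
      proof -
        have "u (of_real t \<cdot>\<^sub>v x) / t \<le> u x"
        proof (rule ge)
          fix q assume q: "q \<in> C"
          have "u (of_real t \<cdot>\<^sub>v x) \<le> t * q x"
            using le[OF q, of "of_real t \<cdot>\<^sub>v x"] CA[OF q] x t by (simp add: sublinear_scale)
          then show "u (of_real t \<cdot>\<^sub>v x) / t \<le> q x" using t by (simp add: field_simps)
        qed
        then show ?thesis using t by (simp add: field_simps)
      qed
      have zero: "u \<zero>\<^sub>v = 0"
      proof (rule order_antisym)
        obtain q where "q \<in> C" using ne by blast
        then show "u \<zero>\<^sub>v \<le> 0" using le[of q "\<zero>\<^sub>v"] CA[of q] sublinear_zero[of q] by simp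
        show "0 \<le> u \<zero>\<^sub>v"
        proof (rule ge)
          show "0 \<le> q \<zero>\<^sub>v" if "q \<in> C" for q
            using CA[OF that] sublinear_zero[of q] by simp
        qed
      qed
      have "sublinear u"
        unfolding sublinear_def
      proof (intro conjI ballI allI impI)
        fix x y assume xy: "x \<in> V" "y \<in> V"
        have 1: "u (x \<oplus>\<^sub>v y) - q x \<le> q' y" if q: "q \<in> C" "q' \<in> C" for q q'
        proof -
          obtain q'' where q'': "q'' \<in> C" "q'' \<le> q" "q'' \<le> q'"
            using chain[OF q] q by blast
          have "u (x \<oplus>\<^sub>v y) \<le> q'' x + q'' y"
            using le[OF q''(1), of "x \<oplus>\<^sub>v y"] sublinear_add[of q'' x y] CA[OF q''(1)] xy by simp
          also have "\<dots> \<le> q x + q' y" using le_funD[OF q''(2), of x] le_funD[OF q''(3), of y] by simp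
          finally show ?thesis by simp
        qed
        have 2: "u (x \<oplus>\<^sub>v y) - q x \<le> u y" if q: "q \<in> C" for q
          by (rule ge[OF 1[OF that]])
        have "u (x \<oplus>\<^sub>v y) - u y \<le> u x"
          by (rule ge) (use 2 in fastforce)
        then show "u (x \<oplus>\<^sub>v y) \<le> u x + u y" by simp
      next
        fix x and t :: real assume x: "x \<in> V" and t: "0 \<le> t"
        show "u (of_real t \<cdot>\<^sub>v x) = t * u x"
        proof (cases "t = 0")
          case True
          then show ?thesis using x zero by (simp add: smul_0)
        next
          case False
          then have t: "t > 0" using t by simp
          have "of_real (1 / t) \<cdot>\<^sub>v of_real t \<cdot>\<^sub>v x = x"
            using t x by (simp add: smul_smul smul_one)
          then have "u x \<le> 1 / t * u (of_real t \<cdot>\<^sub>v x)"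
            using scale_le[OF smul_closed[OF x], of "1 / t" "of_real t"] t by simp
          then show ?thesis using scale_le[OF x t] t by (simp add: field_simps)
        qed
      next
        fix x assume "x \<notin> V"
        then have "\<And>q. q \<in> C \<Longrightarrow> q x = 0" using CA sublinear_outside by blast
        then have "(\<lambda>q. q x) ` C = (\<lambda>_. 0) ` C" by (rule image_cong[OF refl])
        then show "u x = 0" using ne by (simp add: u_def image_constant_conv)
      qed
      moreover have "u \<le> p"
      proof -
        obtain q where q: "q \<in> C" using ne by blast
        then have "u \<le> q" using le by (simp add: le_fun_def)
        also have "q \<le> p" using CA[OF q] by simp
        finally show ?thesis .
      qed
      ultimately show ?thesis using le by (auto simp: le_fun_def)
    qed
  qed
  then show thesis using that by (metis (mono_tags, lifting) mem_Collect_eq order_trans)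
qed

text \<open>A minimal sublinear functional is additive: tightening it along the ray through \<open>y\<close> cannot
  change it.\<close>

theorem real_hahn_banach:
  assumes p: "sublinear p" and C: "dominated_cone p C"
  obtains q where "\<And>x y. x \<in> V \<Longrightarrow> y \<in> V \<Longrightarrow> q (x \<oplus>\<^sub>v y) = q x + q y"
    "\<And>x r. x \<in> V \<Longrightarrow> q (of_real r \<cdot>\<^sub>v x) = r * q x" "\<And>x. q x \<le> p x"
    "\<And>e r. (e, r) \<in> C \<Longrightarrow> r \<le> q e"
proof -
  obtain q where q: "sublinear q" "q \<le> tighten p C" and min: "\<And>q'. sublinear q' \<Longrightarrow> q' \<le> q \<Longrightarrow> q' = q"
    using minimal_sublinear_exists[OF tighten(1)[OF p C]] by metis
  have add: "q (x \<oplus>\<^sub>v y) = q x + q y" if xy: "x \<in> V" "y \<in> V" for x y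
  proof -
    let ?D = "{(of_real t \<cdot>\<^sub>v y, t * q y) | t. t \<ge> 0}"
    have D: "dominated_cone q ?D"
      unfolding dominated_cone_def
    proof (intro conjI)
      show "(\<zero>\<^sub>v, 0) \<in> ?D" using smul_0[OF xy(2)] by force
      show "\<forall>(e, r)\<in>?D. e \<in> V \<and> r \<le> q e"
        using xy by (auto simp: smul_closed sublinear_scale[OF q(1)])
      show "\<forall>(e, r)\<in>?D. \<forall>(e', r')\<in>?D. (e \<oplus>\<^sub>v e', r + r') \<in> ?D"
      proof safe
        fix s t :: real assume "0 \<le> s" "0 \<le> t"
        then show "\<exists>u. (of_real s \<cdot>\<^sub>v y \<oplus>\<^sub>v of_real t \<cdot>\<^sub>v y, s * q y + t * q y) = (of_real u \<cdot>\<^sub>v y, u * q y) \<and> 0 \<le> u"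
          by (intro exI[of _ "s + t"]) (simp add: add_smul[OF xy(2)] distrib_right)
      qed
      show "\<forall>(e, r)\<in>?D. \<forall>t\<ge>0. (of_real t \<cdot>\<^sub>v e, t * r) \<in> ?D"
      proof safe
        fix s t :: real assume "0 \<le> s" "0 \<le> t"
        then show "\<exists>u. (of_real t \<cdot>\<^sub>v of_real s \<cdot>\<^sub>v y, t * (s * q y)) = (of_real u \<cdot>\<^sub>v y, u * q y) \<and> 0 \<le> u"
          by (intro exI[of _ "t * s"]) (simp add: smul_smul[OF xy(2)])
      qed
    qed
    have "tighten q ?D = q"
      using tighten(1,2)[OF q(1) D] by (intro min) (auto simp: le_fun_def)
    moreover have "(y, q y) \<in> ?D"
      using smul_one[OF xy(2)] by (intro CollectI exI[of _ 1]) auto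
    then have "tighten q ?D ((- 1) \<cdot>\<^sub>v y) \<le> - q y"
      by (rule tighten(3)[OF q(1) D])
    ultimately have neg: "q ((- 1) \<cdot>\<^sub>v y) \<le> - q y" by simp
    \<comment> \<open>With the bound on \<open>q (- y)\<close> this is superadditivity, the reverse
      of sublinearity.\<close>
    have "q x \<le> q (x \<oplus>\<^sub>v y) + q ((- 1) \<cdot>\<^sub>v y)"
    proof -
      have "(x \<oplus>\<^sub>v y) \<oplus>\<^sub>v (- 1) \<cdot>\<^sub>v y = x"
        using xy by (simp add: add_assoc smul_closed add_neg add_zero)
      then show ?thesis
        using sublinear_add[OF q(1), of "x \<oplus>\<^sub>v y" "(- 1) \<cdot>\<^sub>v y"] xy by (simp add: add_closed smul_closed)
    qed
    then show ?thesis using neg sublinear_add[OF q(1) xy] by simp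
  qed
  have neg: "q ((- 1) \<cdot>\<^sub>v x) = - q x" if "x \<in> V" for x
    using add[OF that smul_closed[OF that], of "- 1"] add_neg[OF that] sublinear_zero[OF q(1)] by simp
  show thesis
  proof (rule that[of q, OF add])
    show "q (of_real r \<cdot>\<^sub>v x) = r * q x" if x: "x \<in> V" for x r
    proof (cases "r \<ge> 0")
      case False
      then have "q (of_real (- r) \<cdot>\<^sub>v x) = - r * q x"
        using x by (intro sublinear_scale[OF q(1)]) auto
      moreover have "(- 1) \<cdot>\<^sub>v of_real (- r) \<cdot>\<^sub>v x = of_real r \<cdot>\<^sub>v x"
        using x by (simp add: smul_smul)
      ultimately show ?thesis using neg[OF smul_closed[OF x], of "of_real (- r)"] by simp
    qed (use x sublinear_scale[OF q(1)] in auto)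
    show "q x \<le> p x" for x
      using q(2) tighten(2)[OF p C, of x] by (meson le_funD order_trans)
    show "r \<le> q e" if "(e, r) \<in> C" for e r
    proof -
      have "e \<in> V" using C that unfolding dominated_cone_def by blast
      then show ?thesis
        using le_funD[OF q(2), of "(- 1) \<cdot>\<^sub>v e"] tighten(3)[OF p C that] neg by fastforce
    qed
  qed auto
qed

text \<open>A complex functional is recovered from its real part as
  \<open>q x - \<i> * q (\<i> x)\<close>. Rotating \<open>f x\<close> onto the positive axis turns
  the bound on the real part into a bound on the modulus; this uses that \<open>p\<close> is
  invariant under unimodular scalars.\<close>

theorem complex_hahn_banach:
  assumes p_add: "\<And>x y. x \<in> V \<Longrightarrow> y \<in> V \<Longrightarrow> p (x \<oplus>\<^sub>v y) \<le> p x + p y"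
    and p_scale: "\<And>c x. x \<in> V \<Longrightarrow> p (c \<cdot>\<^sub>v x) = cmod c * p x"
    and C: "dominated_cone p C"
  obtains f :: "'v \<Rightarrow> complex" where "\<And>x y. x \<in> V \<Longrightarrow> y \<in> V \<Longrightarrow> f (x \<oplus>\<^sub>v y) = f x + f y"
    "\<And>c x. x \<in> V \<Longrightarrow> f (c \<cdot>\<^sub>v x) = c * f x" "\<And>x. x \<in> V \<Longrightarrow> cmod (f x) \<le> p x"
    "\<And>e r. (e, r) \<in> C \<Longrightarrow> r \<le> Re (f e)"
proof -
  define p' where "p' x = (if x \<in> V then p x else 0)" for x
  have p': "sublinear p'"
    unfolding sublinear_def p'_def using p_add p_scale by (simp add: add_closed smul_closed)
  have C': "dominated_cone p' C"
    using C unfolding dominated_cone_def p'_def by auto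
  obtain q where add: "\<And>x y. x \<in> V \<Longrightarrow> y \<in> V \<Longrightarrow> q (x \<oplus>\<^sub>v y) = q x + q y"
    and scale: "\<And>x r. x \<in> V \<Longrightarrow> q (of_real r \<cdot>\<^sub>v x) = r * q x" and le: "\<And>x. q x \<le> p' x"
    and qC: "\<And>e r. (e, r) \<in> C \<Longrightarrow> r \<le> q e"
    using real_hahn_banach[OF p' C'] by metis
  define f where "f x = Complex (q x) (- q (\<i> \<cdot>\<^sub>v x))" for x
  have f_add: "f (x \<oplus>\<^sub>v y) = f x + f y" if "x \<in> V" "y \<in> V" for x y
    using that by (simp add: f_def complex_eq_iff add smul_add smul_closed)
  have f_scale: "f (c \<cdot>\<^sub>v x) = c * f x" if x: "x \<in> V" for c x
  proof -
    have *: "q (c \<cdot>\<^sub>v x) = Re c * q x + Im c * q (\<i> \<cdot>\<^sub>v x)" for c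
    proof -
      have "c \<cdot>\<^sub>v x = of_real (Re c) \<cdot>\<^sub>v x \<oplus>\<^sub>v of_real (Im c) \<cdot>\<^sub>v \<i> \<cdot>\<^sub>v x"
        using x complex_eq[of c] by (metis add_smul smul_smul mult.commute)
      then show ?thesis using x by (simp add: add scale smul_closed)
    qed
    show ?thesis
      using x *[of c] *[of "\<i> * c"] by (simp add: f_def complex_eq_iff smul_smul algebra_simps)
  qed
  show thesis
  proof (rule that[of f, OF f_add f_scale])
    show "cmod (f x) \<le> p x" if x: "x \<in> V" for x
    proof -
      define c where "c = (if f x = 0 then 1 else cnj (f x) / of_real (cmod (f x)))"
      have "cmod c = 1" by (simp add: c_def norm_divide)
      have "c * f x = of_real (cmod (f x))"
        by (simp add: c_def complex_norm_square[symmetric] power2_eq_square mult.commute[of "cnj _"])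
      then have "cmod (f x) = Re (f (c \<cdot>\<^sub>v x))" using f_scale[OF x] by simp
      also have "\<dots> = q (c \<cdot>\<^sub>v x)" by (simp add: f_def)
      also have "\<dots> \<le> p (c \<cdot>\<^sub>v x)" using le[of "c \<cdot>\<^sub>v x"] x by (simp add: p'_def smul_closed)
      also have "\<dots> = p x" using p_scale[OF x] \<open>cmod c = 1\<close> by simp
      finally show ?thesis .
    qed
  qed (use qC in \<open>auto simp: f_def\<close>)
qed

end


section \<open>Banach algebras and Hermitian elements\<close>

context complex_unital_banach_algebra
begin

lemma carrier_complex_ring [simp]: "carrier complex_ring = UNIV"
  by (simp add: complex_ring_def)

lemma smult_closed [simp, intro]: "x \<in> carrier A \<Longrightarrow> c \<odot> x \<in> carrier A"
  using Module.module.smult_closed[OF complex_module] by simp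

lemma smult_zero_left: "x \<in> carrier A \<Longrightarrow> 0 \<odot> x = \<zero>"
  using Module.module.smult_l_null[OF complex_module] by (simp add: complex_ring_def)

lemma smult_one: "x \<in> carrier A \<Longrightarrow> 1 \<odot> x = x"
  using Module.module.smult_one[OF complex_module] by (simp add: complex_ring_def)

lemma add_smult: "x \<in> carrier A \<Longrightarrow> (c + d) \<odot> x = c \<odot> x \<oplus> d \<odot> x"
  using Module.module.smult_l_distr[OF complex_module, of c d x] by (simp add: complex_ring_def)

lemma smult_add: "x \<in> carrier A \<Longrightarrow> y \<in> carrier A \<Longrightarrow> c \<odot> (x \<oplus> y) = c \<odot> x \<oplus> c \<odot> y"
  using Module.module.smult_r_distr[OF complex_module, of c x y] by simp

lemma smult_smult: "x \<in> carrier A \<Longrightarrow> c \<odot> (d \<odot> x) = (c * d) \<odot> x"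
  using Module.module.smult_assoc1[OF complex_module, of c d x] by (simp add: complex_ring_def)

sublocale vector: complex_vector_space "carrier A" "(\<oplus>)" "(\<odot>)" "\<zero>"
  by unfold_locales
    (auto simp: a_ac smult_add add_smult smult_smult smult_one smult_zero_left)

lemma neg_smult: "x \<in> carrier A \<Longrightarrow> (- 1) \<odot> x = \<ominus> x"
  using vector.add_neg[of x] by (metis add.inv_unique' minus_equality a_comm smult_closed)

lemma diff_eq_zero_iff: "x \<in> carrier A \<Longrightarrow> y \<in> carrier A \<Longrightarrow> x \<ominus> y = \<zero> \<longleftrightarrow> x = y"
  by (metis a_minus_def add.inv_closed minus_equality minus_minus r_neg)

lemma nrm_zero [simp]: "nrm A \<zero> = 0"
  by (simp add: nrm_eq_0_iff)

lemma nrm_neg: "x \<in> carrier A \<Longrightarrow> nrm A (\<ominus> x) = nrm A x"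
  using nrm_smult[of x "- 1"] by (simp add: neg_smult)

lemma nrm_diff_commute: "x \<in> carrier A \<Longrightarrow> y \<in> carrier A \<Longrightarrow> nrm A (x \<ominus> y) = nrm A (y \<ominus> x)"
  by (metis a_minus_def minus_add minus_minus nrm_neg a_comm a_inv_closed minus_closed)

lemma nrm_diff_triangle:
  assumes "x \<in> carrier A" "y \<in> carrier A" "z \<in> carrier A"
  shows "nrm A (x \<ominus> z) \<le> nrm A (x \<ominus> y) + nrm A (y \<ominus> z)"
proof -
  have "x \<ominus> z = (x \<ominus> y) \<oplus> (y \<ominus> z)"
    using assms by algebra
  then show ?thesis using nrm_triangle[of "x \<ominus> y" "y \<ominus> z"] assms by simp
qed

sublocale metric: Metric_space "carrier A" "nrm_dist A"
proof
  show "0 \<le> nrm_dist A x y" for x y by (simp add: nrm_dist_def nrm_nonneg)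
  show "nrm_dist A x y = nrm_dist A y x" for x y by (auto simp: nrm_dist_def nrm_diff_commute)
  show "nrm_dist A x y = 0 \<longleftrightarrow> x = y" if "x \<in> carrier A" "y \<in> carrier A" for x y
    using that by (auto simp: nrm_dist_def nrm_eq_0_iff diff_eq_zero_iff)
  show "nrm_dist A x z \<le> nrm_dist A x y + nrm_dist A y z"
    if "x \<in> carrier A" "y \<in> carrier A" "z \<in> carrier A" for x y z
    using that by (simp add: nrm_dist_def nrm_diff_triangle)
qed

text \<open>The Cauchy condition is stated with a separate error for each index, the form in which
  both series tails and Riemann sums deliver it.\<close>

lemma limit_exists:
  assumes s: "\<And>n. s n \<in> carrier A" and e: "e \<longlonglongrightarrow> (0::real)"
    and le: "\<And>m n. nrm A (s m \<ominus> s n) \<le> e m + e n"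
  obtains x where "x \<in> carrier A" "limitin (nrm_topology A) s x sequentially"
    "(\<lambda>n. nrm A (s n \<ominus> x)) \<longlonglongrightarrow> 0"
proof -
  have "metric.MCauchy s"
    unfolding metric.MCauchy_def
  proof (intro conjI allI impI)
    fix r :: real assume "r > 0"
    then obtain N where N: "\<And>n. n \<ge> N \<Longrightarrow> \<bar>e n\<bar> < r / 2"
      using LIMSEQ_D[OF e, of "r / 2"] by auto
    have "nrm_dist A (s m) (s n) < r" if "N \<le> m" "N \<le> n" for m n
      using N[OF that(1)] N[OF that(2)] le[of m n] s by (simp add: nrm_dist_def)
    then show "\<exists>N. \<forall>n n'. N \<le> n \<longrightarrow> N \<le> n' \<longrightarrow> nrm_dist A (s n) (s n') < r" by blast
  qed (use s in auto)
  then obtain x where x: "limitin metric.mtopology s x sequentially"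
    using complete unfolding metric.mcomplete_def by blast
  then have xc: "x \<in> carrier A" by (simp add: metric.limitin_metric)
  have "(\<lambda>n. nrm A (s n \<ominus> x)) \<longlonglongrightarrow> 0"
  proof (rule LIMSEQ_I)
    fix r :: real assume "r > 0"
    then obtain N where "\<And>n. n \<ge> N \<Longrightarrow> nrm_dist A (s n) x < r"
      using x unfolding metric.limit_metric_sequentially by metis
    then show "\<exists>N. \<forall>n\<ge>N. norm (nrm A (s n \<ominus> x) - 0) < r"
      using s xc by (auto simp: nrm_dist_def nrm_nonneg)
  qed
  with x xc that show thesis by blast
qed

section \<open>Duality and convergent series in the algebra\<close>

text \<open>The closed unit ball of the dual, described by a pointwise bound to avoid the supremum
  in \<open>dual_nrm\<close>.\<close>

definition contraction_functional :: "('a \<Rightarrow> complex) \<Rightarrow> bool" where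
  "contraction_functional f \<longleftrightarrow> f \<in> dual_space A \<and> (\<forall>x\<in>carrier A. cmod (f x) \<le> nrm A x)"

lemma contraction_functional_dual: "contraction_functional f \<Longrightarrow> f \<in> dual_space A"
  and contraction_functional_le: "contraction_functional f \<Longrightarrow> x \<in> carrier A \<Longrightarrow> cmod (f x) \<le> nrm A x"
  by (auto simp: contraction_functional_def)

lemma dual_add: "f \<in> dual_space A \<Longrightarrow> x \<in> carrier A \<Longrightarrow> y \<in> carrier A \<Longrightarrow> f (x \<oplus> y) = f x + f y"
  and dual_smult: "f \<in> dual_space A \<Longrightarrow> x \<in> carrier A \<Longrightarrow> f (c \<odot> x) = c * f x"
  by (auto simp: dual_space_def)

lemma dual_zero: "f \<in> dual_space A \<Longrightarrow> f \<zero> = 0"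
  using dual_smult[of f \<zero> 0] by (simp add: smult_zero_left)

lemma dual_diff:
  assumes "f \<in> dual_space A" "x \<in> carrier A" "y \<in> carrier A"
  shows "f (x \<ominus> y) = f x - f y"
  using assms dual_add[OF assms(1,2), of "\<ominus> y"] dual_smult[OF assms(1,3), of "- 1"]
  by (simp add: a_minus_def neg_smult)

lemma dual_bound:
  assumes "f \<in> dual_space A"
  obtains B where "B > 0" "\<And>x. x \<in> carrier A \<Longrightarrow> cmod (f x) \<le> B * nrm A x"
proof -
  obtain B where B: "\<And>x. x \<in> carrier A \<Longrightarrow> cmod (f x) \<le> B * nrm A x"
    using assms unfolding dual_space_def by blast
  show thesis
  proof (rule that[of "\<bar>B\<bar> + 1"])
    show "cmod (f x) \<le> (\<bar>B\<bar> + 1) * nrm A x" if "x \<in> carrier A" for x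
      by (rule order_trans[OF B[OF that]], rule mult_right_mono) (use nrm_nonneg[OF that] in auto)
  qed simp
qed

lemma dual_spaceI:
  assumes "\<And>x y. x \<in> carrier A \<Longrightarrow> y \<in> carrier A \<Longrightarrow> f (x \<oplus> y) = f x + f y"
    "\<And>c x. x \<in> carrier A \<Longrightarrow> f (c \<odot> x) = c * f x" "\<And>x. x \<in> carrier A \<Longrightarrow> cmod (f x) \<le> B * nrm A x"
  shows "f \<in> dual_space A"
  using assms unfolding dual_space_def by blast

lemma dual_mult_right:
  assumes f: "f \<in> dual_space A" and b: "b \<in> carrier A"
  shows "(\<lambda>x. f (x \<otimes> b)) \<in> dual_space A"
proof -
  obtain B where B: "B > 0" "\<And>x. x \<in> carrier A \<Longrightarrow> cmod (f x) \<le> B * nrm A x"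
    using dual_bound[OF f] by metis
  show ?thesis
  proof (rule dual_spaceI)
    fix x assume x: "x \<in> carrier A"
    have "cmod (f (x \<otimes> b)) \<le> B * nrm A (x \<otimes> b)" using B(2) x b by simp
    also have "\<dots> \<le> B * (nrm A x * nrm A b)"
      using B(1) nrm_mult[OF x b] by (intro mult_left_mono) auto
    finally show "cmod (f (x \<otimes> b)) \<le> B * nrm A b * nrm A x" by (simp add: mult_ac)
  qed (use f b in \<open>auto simp: l_distr smult_mult_left dual_add dual_smult\<close>)
qed

lemma dual_mult_left:
  assumes f: "f \<in> dual_space A" and b: "b \<in> carrier A"
  shows "(\<lambda>x. f (b \<otimes> x)) \<in> dual_space A"
proof -
  obtain B where B: "B > 0" "\<And>x. x \<in> carrier A \<Longrightarrow> cmod (f x) \<le> B * nrm A x"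
    using dual_bound[OF f] by metis
  show ?thesis
  proof (rule dual_spaceI)
    fix x assume x: "x \<in> carrier A"
    have "cmod (f (b \<otimes> x)) \<le> B * nrm A (b \<otimes> x)" using B(2) x b by simp
    also have "\<dots> \<le> B * (nrm A b * nrm A x)"
      using B(1) nrm_mult[OF b x] by (intro mult_left_mono) auto
    finally show "cmod (f (b \<otimes> x)) \<le> B * nrm A b * nrm A x" by (simp add: mult_ac)
  qed (use f b in \<open>auto simp: r_distr smult_mult_right dual_add dual_smult\<close>)
qed

lemma dual_limit:
  assumes f: "f \<in> dual_space A" and s: "\<And>n. s n \<in> carrier A" "x \<in> carrier A"
    and lim: "(\<lambda>n. nrm A (s n \<ominus> x)) \<longlonglongrightarrow> 0"
  shows "(\<lambda>n. f (s n)) \<longlonglongrightarrow> f x"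
proof -
  obtain B where B: "B > 0" "\<And>x. x \<in> carrier A \<Longrightarrow> cmod (f x) \<le> B * nrm A x"
    using dual_bound[OF f] by metis
  have "(\<lambda>n. B * nrm A (s n \<ominus> x)) \<longlonglongrightarrow> B * 0" by (intro tendsto_intros lim)
  then have "(\<lambda>n. B * nrm A (s n \<ominus> x)) \<longlonglongrightarrow> 0" by simp
  moreover have "norm (f (s n) - f x) \<le> B * nrm A (s n \<ominus> x)" for n
    using B(2)[of "s n \<ominus> x"] dual_diff[OF f s(1) s(2)] s by simp
  ultimately have "(\<lambda>n. f (s n) - f x) \<longlonglongrightarrow> 0"
    by (metis (mono_tags, lifting) Lim_null_comparison always_eventually)
  then show ?thesis by (simp add: LIM_zero_iff)
qed

text \<open>Hahn--Banach with the ray through \<open>(x, nrm A x)\<close> as cone. The constraint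
  gives real part at least \<open>nrm A x\<close>, the domination gives modulus at most that, so the
  value is exactly \<open>nrm A x\<close>.\<close>

lemma norming_functional:
  assumes x: "x \<in> carrier A"
  obtains f where "contraction_functional f" "f x = of_real (nrm A x)"
proof -
  let ?C = "{(of_real t \<odot> x, t * nrm A x) | t. t \<ge> 0}"
  have C: "vector.dominated_cone (nrm A) ?C"
    unfolding vector.dominated_cone_def
  proof (intro conjI)
    show "(\<zero>, 0) \<in> ?C" using smult_zero_left[OF x] by force
    show "\<forall>(e, r)\<in>?C. e \<in> carrier A \<and> r \<le> nrm A e"
      using x by (auto simp: nrm_smult)
    show "\<forall>(e, r)\<in>?C. \<forall>(e', r')\<in>?C. (e \<oplus> e', r + r') \<in> ?C"
    proof safe
      fix s t :: real assume "0 \<le> s" "0 \<le> t"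
      then show "\<exists>u. (of_real s \<odot> x \<oplus> of_real t \<odot> x, s * nrm A x + t * nrm A x) = (of_real u \<odot> x, u * nrm A x) \<and> 0 \<le> u"
        by (intro exI[of _ "s + t"]) (simp add: add_smult[OF x] distrib_right)
    qed
    show "\<forall>(e, r)\<in>?C. \<forall>t\<ge>0. (of_real t \<odot> e, t * r) \<in> ?C"
    proof safe
      fix s t :: real assume "0 \<le> s" "0 \<le> t"
      then show "\<exists>u. (of_real t \<odot> (of_real s \<odot> x), t * (s * nrm A x)) = (of_real u \<odot> x, u * nrm A x) \<and> 0 \<le> u"
        by (intro exI[of _ "t * s"]) (simp add: smult_smult[OF x])
    qed
  qed
  obtain f where f: "\<And>x y. x \<in> carrier A \<Longrightarrow> y \<in> carrier A \<Longrightarrow> f (x \<oplus> y) = f x + f y"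
    "\<And>c x. x \<in> carrier A \<Longrightarrow> f (c \<odot> x) = c * f x" "\<And>x. x \<in> carrier A \<Longrightarrow> cmod (f x) \<le> nrm A x"
    "\<And>e r. (e, r) \<in> ?C \<Longrightarrow> r \<le> Re (f e)"
    using vector.complex_hahn_banach[OF nrm_triangle nrm_smult C] by blast
  have "(x, nrm A x) \<in> ?C" using smult_one[OF x] by (intro CollectI exI[of _ 1]) auto
  from f(4)[OF this] have "nrm A x \<le> Re (f x)" .
  then have "Re (f x) = nrm A x" "cmod (f x) = Re (f x)"
    using f(3)[OF x] complex_Re_le_cmod[of "f x"] by linarith+
  then have "f x = of_real (nrm A x)"
    using cmod_power2[of "f x"] by (simp add: complex_eq_iff)
  moreover have "contraction_functional f"
    unfolding contraction_functional_def using f(1-3) by (auto intro!: dual_spaceI[where B = 1])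
  ultimately show thesis using that by blast
qed

lemma nrm_le_functional:
  assumes "x \<in> carrier A" "\<And>f. contraction_functional f \<Longrightarrow> cmod (f x) \<le> B"
  shows "nrm A x \<le> B"
proof -
  obtain f where f: "contraction_functional f" "f x = of_real (nrm A x)"
    using norming_functional[OF assms(1)] .
  then show ?thesis using assms(2)[OF f(1)] nrm_nonneg[OF assms(1)] by simp
qed

text \<open>Identities in the algebra become scalar identities. The lemma also gives the uniqueness
  behind the description operator in \<open>alg_integral\<close>.\<close>

lemma eq_functional:
  assumes "x \<in> carrier A" "y \<in> carrier A" "\<And>f. f \<in> dual_space A \<Longrightarrow> f x = f y"
  shows "x = y"
proof -
  have "nrm A (x \<ominus> y) \<le> 0"
  proof (rule nrm_le_functional)
    fix f assume "contraction_functional f"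
    then have f: "f \<in> dual_space A" by (rule contraction_functional_dual)
    show "cmod (f (x \<ominus> y)) \<le> 0"
      using dual_diff[OF f assms(1,2)] assms(3)[OF f] by simp
  qed (use assms in simp)
  then have "x \<ominus> y = \<zero>"
    using assms nrm_nonneg[of "x \<ominus> y"] nrm_eq_0_iff[of "x \<ominus> y"] by simp
  then show ?thesis using assms(1,2) by (simp add: diff_eq_zero_iff)
qed

lemma nrm_pow: "x \<in> carrier A \<Longrightarrow> nrm A (x [^] (k::nat)) \<le> nrm A x ^ k"
proof (induction k)
  case (Suc k)
  have "nrm A (x [^] k \<otimes> x) \<le> nrm A (x [^] k) * nrm A x"
    using Suc.prems by (intro nrm_mult) auto
  also have "\<dots> \<le> nrm A x ^ k * nrm A x"
    using Suc nrm_nonneg by (intro mult_right_mono) auto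
  finally show ?case by (simp add: mult.commute)
qed (simp add: nrm_one)

lemma smult_pow: "x \<in> carrier A \<Longrightarrow> (c \<odot> x) [^] (k::nat) = (c ^ k) \<odot> (x [^] k)"
proof (induction k)
  case (Suc k)
  then show ?case
    by (simp add: smult_mult_left smult_mult_right smult_smult mult.commute)
qed (simp add: smult_one)

lemma dual_finsum:
  assumes f: "f \<in> dual_space A" and "finite I" "\<And>i. i \<in> I \<Longrightarrow> g i \<in> carrier A"
  shows "f (\<Oplus>i\<in>I. g i) = (\<Sum>i\<in>I. f (g i))"
  using assms(2,3)
proof (induction I)
  case empty
  show ?case using dual_zero[OF f] by simp
next
  case (insert i I)
  then have "(\<Oplus>j\<in>insert i I. g j) = g i \<oplus> (\<Oplus>j\<in>I. g j)"
    by (intro finsum_insert) auto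
  then show ?case using insert dual_add[OF f, of "g i" "\<Oplus>j\<in>I. g j"] by (simp add: finsum_closed Pi_def)
qed

text \<open>Differences of partial sums are estimated through functionals by tails of
  \<open>b\<close>. The limit is delivered in two forms: in the topology, as \<open>alg_exp\<close>
  demands, and as scalar series, on which computations are based.\<close>

lemma series_converges:
  assumes g: "\<And>k::nat. g k \<in> carrier A" and b: "summable b" "\<And>k. nrm A (g k) \<le> b k"
  obtains x where "x \<in> carrier A" "limitin (nrm_topology A) (\<lambda>n. \<Oplus>k\<in>{..<n}. g k) x sequentially"
    "\<And>f. f \<in> dual_space A \<Longrightarrow> (\<lambda>k. f (g k)) sums f x"
proof -
  let ?s = "\<lambda>n. \<Oplus>k\<in>{..<n}. g k"
  have s: "?s n \<in> carrier A" for n using g by (intro finsum_closed) auto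
  have b0: "0 \<le> b k" for k using b(2)[of k] nrm_nonneg[OF g, of k] by simp
  let ?e = "\<lambda>n. (\<Sum>k. b (k + n))"
  have e: "?e \<longlonglongrightarrow> 0" by (rule suminf_exist_split2[OF b(1)])
  have e0: "0 \<le> ?e n" for n by (intro suminf_nonneg summable_ignore_initial_segment b b0)
  have half: "nrm A (?s n \<ominus> ?s m) \<le> ?e m" if "m \<le> n" for m n
  proof (rule nrm_le_functional)
    show "?s n \<ominus> ?s m \<in> carrier A" using s by simp
    fix f assume f: "contraction_functional f"
    have "f (?s n \<ominus> ?s m) = (\<Sum>k<n. f (g k)) - (\<Sum>k<m. f (g k))"
      using contraction_functional_dual[OF f] s g by (simp add: dual_diff dual_finsum)
    also have "\<dots> = (\<Sum>k\<in>{m..<n}. f (g k))"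
      using that sum_diff_nat_ivl[of 0 m n "\<lambda>k. f (g k)"] by (simp add: atLeast0LessThan)
    also have "cmod \<dots> \<le> (\<Sum>k\<in>{m..<n}. b k)"
      using contraction_functional_le[OF f g] b(2) by (intro sum_norm_le) (meson order_trans)
    also have "\<dots> = (\<Sum>k<n - m. b (k + m))"
      using that sum.shift_bounds_nat_ivl[of b 0 m "n - m"] by (simp add: atLeast0LessThan)
    also have "\<dots> \<le> ?e m"
      by (intro sum_le_suminf summable_ignore_initial_segment b b0) auto
    finally show "cmod (f (?s n \<ominus> ?s m)) \<le> ?e m" .
  qed
  have "nrm A (?s m \<ominus> ?s n) \<le> ?e m + ?e n" for m n
    using half[of m n] half[of n m] e0[of m] e0[of n] nrm_diff_commute[OF s s, of m n]
    by (cases "m \<le> n") auto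
  from limit_exists[OF s e this]
  obtain x where x: "x \<in> carrier A" "limitin (nrm_topology A) ?s x sequentially" "(\<lambda>n. nrm A (?s n \<ominus> x)) \<longlonglongrightarrow> 0" .
  have "(\<lambda>k. f (g k)) sums f x" if f: "f \<in> dual_space A" for f
    using dual_limit[OF f s x(1,3)] g by (simp add: sums_def dual_finsum[OF f])
  with x that show thesis by blast
qed

section \<open>Invertibility and the resolvent set\<close>

text \<open>The Neumann series. Under any functional, its product with
  \<open>\<one> \<ominus> x\<close> telescopes, from either side.\<close>

lemma Units_one_minus:
  assumes x: "x \<in> carrier A" and less: "nrm A x < 1"
  shows "\<one> \<ominus> x \<in> Units A"
proof -
  have "summable (\<lambda>k. nrm A x ^ k)"
    using less nrm_nonneg[OF x] by (intro summable_geometric) simp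
  then obtain y where y: "y \<in> carrier A" "\<And>f. f \<in> dual_space A \<Longrightarrow> (\<lambda>k. f (x [^] k)) sums f y"
    using series_converges[of "\<lambda>k. x [^] k"] x nrm_pow by (metis nat_pow_closed)
  have 0: "(\<lambda>k. f (x [^] k)) \<longlonglongrightarrow> 0" if "f \<in> dual_space A" for f
    using y(2)[OF that] sums_summable summable_LIMSEQ_zero by blast
  have tele: "(\<lambda>k. f (x [^] k) - f (x [^] Suc k)) sums f \<one>" if f: "f \<in> dual_space A" for f
    using telescope_sums'[OF 0[OF f]] by simp
  have "(\<one> \<ominus> x) \<otimes> y = \<one>"
  proof (rule eq_functional)
    fix f assume f: "f \<in> dual_space A"
    have "(\<lambda>k. f ((\<one> \<ominus> x) \<otimes> x [^] k)) sums f ((\<one> \<ominus> x) \<otimes> y)"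
      using y(2)[OF dual_mult_left[OF f, of "\<one> \<ominus> x"]] x by simp
    moreover have "(\<one> \<ominus> x) \<otimes> x [^] k = x [^] k \<ominus> x [^] Suc k" for k
      using x nat_pow_Suc2[OF x, of k] by (simp add: minus_eq l_distr l_minus)
    ultimately show "f ((\<one> \<ominus> x) \<otimes> y) = f \<one>"
      using tele[OF f] x dual_diff[OF f] by (simp add: sums_iff del: nat_pow_Suc)
  qed (use x y in auto)
  moreover have "y \<otimes> (\<one> \<ominus> x) = \<one>"
  proof (rule eq_functional)
    fix f assume f: "f \<in> dual_space A"
    have "(\<lambda>k. f (x [^] k \<otimes> (\<one> \<ominus> x))) sums f (y \<otimes> (\<one> \<ominus> x))"
      using y(2)[OF dual_mult_right[OF f, of "\<one> \<ominus> x"]] x by simp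
    moreover have "x [^] k \<otimes> (\<one> \<ominus> x) = x [^] k \<ominus> x [^] Suc k" for k
      using x by (simp add: minus_eq r_distr r_minus)
    ultimately show "f (y \<otimes> (\<one> \<ominus> x)) = f \<one>"
      using tele[OF f] x dual_diff[OF f] by (simp add: sums_iff del: nat_pow_Suc)
  qed (use x y in auto)
  ultimately show ?thesis unfolding Units_def using x y by auto
qed

lemma Units_perturb:
  assumes u: "u \<in> Units A" and w: "w \<in> carrier A" and less: "nrm A w * nrm A (inv u) < 1"
  shows "u \<ominus> w \<in> Units A"
proof -
  have uc: "u \<in> carrier A" "inv u \<in> carrier A" using u by auto
  have "nrm A (inv u \<otimes> w) < 1"
    using nrm_mult[OF uc(2) w] less by (simp add: mult.commute)
  then have "u \<otimes> (\<one> \<ominus> inv u \<otimes> w) \<in> Units A"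
    using u uc w Units_one_minus[of "inv u \<otimes> w"] by (intro Units_m_closed) auto
  moreover have "u \<otimes> (\<one> \<ominus> inv u \<otimes> w) = u \<ominus> w"
    using u uc w by (simp add: minus_eq r_distr r_minus m_assoc[symmetric])
  ultimately show ?thesis by simp
qed

lemma Units_smult:
  assumes u: "u \<in> Units A" and c: "c \<noteq> 0"
  shows "c \<odot> u \<in> Units A"
proof -
  have uc: "u \<in> carrier A" "inv u \<in> carrier A" using u by auto
  have "(c \<odot> u) \<otimes> ((1 / c) \<odot> inv u) = \<one>" "((1 / c) \<odot> inv u) \<otimes> (c \<odot> u) = \<one>"
    using u uc c by (simp_all add: smult_mult_left smult_mult_right smult_smult smult_one)
  then show ?thesis unfolding Units_def using uc by blast
qed

definition shift :: "'a \<Rightarrow> complex \<Rightarrow> 'a" where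
  "shift a z = z \<odot> \<one> \<ominus> a"

lemma spectrum_iff: "z \<in> spectrum A a \<longleftrightarrow> shift a z \<notin> Units A"
  by (simp add: spectrum_def shift_def)

lemma shift_closed [simp, intro]: "a \<in> carrier A \<Longrightarrow> shift a z \<in> carrier A"
  by (simp add: shift_def)

lemma Units_shift_large:
  assumes a: "a \<in> carrier A" and z: "nrm A a < cmod z"
  shows "shift a z \<in> Units A"
proof -
  have z0: "z \<noteq> 0" using z nrm_nonneg[OF a] by auto
  have "nrm A ((1 / z) \<odot> a) < 1"
    using a z z0 by (simp add: nrm_smult norm_divide)
  then have "z \<odot> (\<one> \<ominus> (1 / z) \<odot> a) \<in> Units A"
    using a z0 by (intro Units_smult Units_one_minus) auto
  moreover have "z \<odot> (\<one> \<ominus> (1 / z) \<odot> a) = shift a z"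
    using a z0 by (simp add: shift_def minus_eq smult_add smult_smult smult_one neg_smult[symmetric])
  ultimately show ?thesis by simp
qed

lemma shift_diff:
  assumes a: "a \<in> carrier A"
  shows "shift a w = shift a z \<ominus> (z - w) \<odot> \<one>"
proof -
  have "w \<odot> \<one> = z \<odot> \<one> \<oplus> (w - z) \<odot> \<one>"
    using add_smult[OF one_closed, of z "w - z"] by simp
  moreover have "(w - z) \<odot> \<one> = \<ominus> ((z - w) \<odot> \<one>)"
    using smult_smult[OF one_closed, of "- 1" "z - w"] neg_smult[of "(z - w) \<odot> \<one>"] by simp
  ultimately show ?thesis
    using a by (simp add: shift_def minus_eq a_ac)
qed

lemma shift_mult:
  assumes a: "a \<in> carrier A" and y: "y \<in> carrier A"
  shows "shift a z \<otimes> y = z \<odot> y \<ominus> a \<otimes> y" and "y \<otimes> shift a z = z \<odot> y \<ominus> y \<otimes> a"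
  using assms by (simp_all add: shift_def minus_eq l_distr r_distr l_minus r_minus smult_mult_left smult_mult_right)

text \<open>The lower bound of left multiplication by \<open>z - a\<close>. For Hermitian \<open>a\<close> it vanishes exactly on the
  spectrum (\<open>hermitian_spectrum_iff\<close>).\<close>

definition lower :: "'a \<Rightarrow> complex \<Rightarrow> real" where
  "lower a z = (INF y\<in>{y \<in> carrier A. nrm A y = 1}. nrm A (shift a z \<otimes> y))"

context
  fixes a
  assumes a: "a \<in> carrier A"
begin

lemma lower_le_unit: "y \<in> carrier A \<Longrightarrow> nrm A y = 1 \<Longrightarrow> lower a z \<le> nrm A (shift a z \<otimes> y)"
  unfolding lower_def using a nrm_nonneg by (intro cINF_lower bdd_belowI[of _ 0]) auto

lemma lower_greatest:
  assumes "\<And>y. y \<in> carrier A \<Longrightarrow> nrm A y = 1 \<Longrightarrow> c \<le> nrm A (shift a z \<otimes> y)"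
  shows "c \<le> lower a z"
  unfolding lower_def using nrm_one assms by (intro cINF_greatest) (auto intro: one_closed)

lemma lower_le:
  assumes y: "y \<in> carrier A"
  shows "lower a z * nrm A y \<le> nrm A (shift a z \<otimes> y)"
proof (cases "nrm A y = 0")
  case False
  then have ny: "nrm A y > 0" using nrm_nonneg[OF y] by simp
  let ?y = "of_real (1 / nrm A y) \<odot> y"
  have "nrm A ?y = 1" using ny y by (simp add: nrm_smult norm_divide)
  then have "lower a z \<le> nrm A (shift a z \<otimes> ?y)" using y by (intro lower_le_unit) auto
  also have "\<dots> = nrm A (shift a z \<otimes> y) / nrm A y"
    using y a ny by (simp add: smult_mult_right nrm_smult norm_divide)
  finally show ?thesis using ny by (simp add: field_simps)
qed (use a y nrm_nonneg in auto)

lemma lower_nonneg: "0 \<le> lower a z"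
  using a nrm_nonneg by (intro lower_greatest) auto

lemma lower_lipschitz: "lower a w \<le> lower a z + cmod (z - w)"
proof -
  have "lower a w - cmod (z - w) \<le> lower a z"
  proof (rule lower_greatest)
    fix y assume y: "y \<in> carrier A" "nrm A y = 1"
    have "shift a w \<otimes> y = shift a z \<otimes> y \<oplus> (w - z) \<odot> y"
      using y a shift_diff[OF a, of w z] smult_smult[of y "- 1" "z - w"]
      by (simp add: minus_eq l_distr l_minus smult_mult_left neg_smult[symmetric])
    then have "nrm A (shift a w \<otimes> y) \<le> nrm A (shift a z \<otimes> y) + nrm A ((w - z) \<odot> y)"
      using nrm_triangle[of "shift a z \<otimes> y" "(w - z) \<odot> y"] a y by simp
    then show "lower a w - cmod (z - w) \<le> nrm A (shift a z \<otimes> y)"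
      using lower_le_unit[OF y, of w] y by (simp add: nrm_smult norm_minus_commute)
  qed
  then show ?thesis by simp
qed

lemma lower_large: "cmod z - nrm A a \<le> lower a z"
proof (rule lower_greatest)
  fix y assume y: "y \<in> carrier A" "nrm A y = 1"
  have "z \<odot> y = shift a z \<otimes> y \<oplus> a \<otimes> y"
    using a y by (simp add: shift_mult minus_eq a_assoc l_neg)
  then have "nrm A (z \<odot> y) \<le> nrm A (shift a z \<otimes> y) + nrm A (a \<otimes> y)"
    using nrm_triangle[of "shift a z \<otimes> y" "a \<otimes> y"] a y by simp
  then show "cmod z - nrm A a \<le> nrm A (shift a z \<otimes> y)"
    using nrm_mult[OF a y(1)] y by (simp add: nrm_smult)
qed

text \<open>Testing \<open>lower\<close> on the inverse bounds it by the reciprocal of the norm of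
  the inverse. Writing \<open>y\<close> as the inverse times \<open>shift a z \<otimes> y\<close>
  gives the opposite estimate, hence positivity.\<close>

lemma lower_Units:
  assumes u: "shift a z \<in> Units A"
  shows "lower a z > 0" and "nrm A (inv (shift a z)) * lower a z \<le> 1"
proof -
  let ?r = "inv (shift a z)"
  have r: "?r \<in> carrier A" using u by simp
  have "lower a z * nrm A ?r \<le> nrm A (shift a z \<otimes> ?r)" by (rule lower_le[OF r])
  then show "nrm A ?r * lower a z \<le> 1" using u by (simp add: nrm_one mult.commute)
  have r0: "nrm A ?r > 0"
  proof (rule ccontr)
    assume "\<not> nrm A ?r > 0"
    then have "?r = \<zero>" using nrm_nonneg[OF r] nrm_eq_0_iff[OF r] by simp
    then have "\<one> = \<zero>" using Units_r_inv[OF u] a by simp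
    then show False using nrm_one by simp
  qed
  have "1 / nrm A ?r \<le> lower a z"
  proof (rule lower_greatest)
    fix y assume y: "y \<in> carrier A" "nrm A y = 1"
    have "y = ?r \<otimes> (shift a z \<otimes> y)"
      using u y a by (simp add: m_assoc[symmetric])
    then have "1 \<le> nrm A ?r * nrm A (shift a z \<otimes> y)"
      using nrm_mult[OF r, of "shift a z \<otimes> y"] y a by simp
    then show "1 / nrm A ?r \<le> nrm A (shift a z \<otimes> y)"
      using r0 by (simp add: field_simps)
  qed
  then show "lower a z > 0" using r0 by (meson less_le_trans zero_less_divide_1_iff)
qed

text \<open>The admissible perturbation is measured by \<open>lower\<close>, for which uniform
  bounds along a path are available, instead of by the norm of an inverse still to be found at the
  next point.\<close>

lemma Units_shift_near:
  assumes u: "shift a z \<in> Units A" and less: "cmod (z - w) < lower a z"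
  shows "shift a w \<in> Units A"
proof -
  have "cmod (z - w) * nrm A (inv (shift a z)) < 1"
  proof (cases "nrm A (inv (shift a z)) = 0")
    case False
    then have "nrm A (inv (shift a z)) > 0"
      using nrm_nonneg[of "inv (shift a z)"] u by simp
    then have "cmod (z - w) * nrm A (inv (shift a z)) < lower a z * nrm A (inv (shift a z))"
      using less by simp
    then show ?thesis using lower_Units(2)[OF u] by (simp add: mult.commute)
  qed simp
  then show ?thesis
    unfolding shift_diff[OF a, of w z] by (intro Units_perturb u) (auto simp: nrm_smult nrm_one)
qed

text \<open>Walk down a vertical ray, on which \<open>lower\<close> is bounded away from zero, from a point of
  large modulus.\<close>

lemma Units_shift_lower_pos:
  assumes herm: "\<And>z. \<bar>Im z\<bar> \<le> lower a z" and pos: "lower a z > 0"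
  shows "shift a z \<in> Units A"
proof -
  define s :: real where "s = (if Im z \<ge> 0 then 1 else - 1)"
  \<comment> \<open>Within distance \<open>2 * d\<close> of \<open>z\<close> the Lipschitz property
    keeps \<open>lower\<close> at least \<open>2 * d\<close>; farther out the imaginary part does.
    Steps of length \<open>d\<close> are therefore admissible everywhere on the ray.\<close>
  define d where "d = lower a z / 4"
  define w where "w n = z + \<i> * of_real (s * (real n * d))" for n
  have d: "d > 0" using pos by (simp add: d_def)
  have Im_w: "\<bar>Im (w n)\<bar> = \<bar>Im z\<bar> + real n * d" for n
  proof -
    have "0 \<le> real n * d" using d by simp
    then show ?thesis by (auto simp: w_def s_def abs_if)
  qed
  have low: "2 * d \<le> lower a (w n)" for n
  proof (cases "real n * d \<le> 2 * d")
    case True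
    have "cmod (z - w n) = real n * d" using d by (simp add: w_def norm_mult s_def)
    then have "cmod (w n - z) = real n * d" by (simp add: norm_minus_commute)
    then show ?thesis using lower_lipschitz[of z "w n"] True by (simp add: d_def)
  next
    case False
    then show ?thesis using herm[of "w n"] Im_w[of n] by simp
  qed
  have step: "shift a (w n) \<in> Units A" if "shift a (w (Suc n)) \<in> Units A" for n
  proof (rule Units_shift_near[OF that])
    have "w (Suc n) - w n = \<i> * of_real (s * d)" by (simp add: w_def algebra_simps)
    then have "cmod (w (Suc n) - w n) = d" using d by (simp add: norm_mult s_def)
    then show "cmod (w (Suc n) - w n) < lower a (w (Suc n))" using low[of "Suc n"] d by simp
  qed
  obtain N :: nat where N: "nrm A a < real N * d" using d reals_Archimedean3 by blast
  have "nrm A a < cmod (w N)" using N Im_w[of N] abs_Im_le_cmod[of "w N"] by simp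
  then have "shift a (w N) \<in> Units A" by (rule Units_shift_large[OF a])
  then have "shift a (w 0) \<in> Units A"
    by (induction N) (use step in auto)
  then show ?thesis by (simp add: w_def)
qed

end

text \<open>For a unit vector \<open>y\<close> with norming functional \<open>g\<close>, the
  functional sending \<open>x\<close> to \<open>g (x \<otimes> y)\<close> is 1 at the unit and has
  norm 1. Its value at \<open>a\<close> lies in the numerical range and is real, so its value at
  \<open>z - a\<close> has imaginary part \<open>Im z\<close>.\<close>

lemma hermitian_lower:
  assumes a: "a \<in> hermitian_elements A"
  shows "\<bar>Im z\<bar> \<le> lower a z"
proof (rule lower_greatest)
  show ac: "a \<in> carrier A" using a by (simp add: hermitian_elements_def)
  fix y assume y: "y \<in> carrier A" "nrm A y = 1"
  obtain g where g: "contraction_functional g" "g y = of_real (nrm A y)"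
    using norming_functional[OF y(1)] .
  define f where "f x = g (x \<otimes> y)" for x
  have f: "f \<in> dual_space A"
    unfolding f_def by (rule dual_mult_right[OF contraction_functional_dual[OF g(1)] y(1)])
  have le: "cmod (f x) \<le> nrm A x" if "x \<in> carrier A" for x
    using contraction_functional_le[OF g(1), of "x \<otimes> y"] nrm_mult[OF that y(1)] that y by (simp add: f_def)
  have f1: "f \<one> = 1" using g y by (simp add: f_def)
  have "dual_nrm A f = 1"
    unfolding dual_nrm_def
  proof (rule cSup_eq_maximum)
    show "1 \<in> (\<lambda>x. cmod (f x)) ` {x \<in> carrier A. nrm A x \<le> 1}"
      using f1 nrm_one by (intro image_eqI[of _ _ \<one>]) auto
  qed (use le order_trans in blast)
  then have "f a \<in> numerical_range A a" using f f1 unfolding numerical_range_def by blast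
  then have "Im (f a) = 0" using a complex_is_Real_iff by (auto simp: hermitian_elements_def)
  moreover have "f (shift a z) = z - f a"
    using f f1 ac by (simp add: shift_def dual_diff dual_smult)
  ultimately have "\<bar>Im z\<bar> \<le> cmod (f (shift a z))"
    using abs_Im_le_cmod[of "z - f a"] by simp
  also have "\<dots> \<le> nrm A (shift a z \<otimes> y)"
    using contraction_functional_le[OF g(1)] ac y by (simp add: f_def)
  finally show "\<bar>Im z\<bar> \<le> nrm A (shift a z \<otimes> y)" .
qed

text \<open>The spectrum of a Hermitian element consists of approximate eigenvalues: off the zeros
  of \<open>lower\<close> a vertical ray connects \<open>z\<close> with the resolvent set.\<close>

lemma hermitian_spectrum_iff:
  assumes a: "a \<in> hermitian_elements A"
  shows "z \<in> spectrum A a \<longleftrightarrow> lower a z = 0"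
proof -
  have ac: "a \<in> carrier A" using a by (simp add: hermitian_elements_def)
  show ?thesis
    using lower_Units(1)[OF ac, of z] Units_shift_lower_pos[OF ac hermitian_lower[OF a], of z]
      lower_nonneg[OF ac, of z] unfolding spectrum_iff by (metis less_irrefl order_less_le)
qed

end


section \<open>The one-parameter group of a Hermitian element\<close>

lemma vector_derivative_bound:
  fixes f :: "real \<Rightarrow> 'b::real_normed_vector"
  assumes "\<And>s. s \<in> closed_segment x y \<Longrightarrow> (f has_vector_derivative f' s) (at s)"
    and "\<And>s. s \<in> closed_segment x y \<Longrightarrow> norm (f' s) \<le> B"
  shows "norm (f y - f x) \<le> B * \<bar>y - x\<bar>"
proof -
  have "norm (f y - f x) \<le> B * norm (y - x)"
  proof (rule differentiable_bound[where S = "closed_segment x y" and f' = "\<lambda>s h. h *\<^sub>R f' s"])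
    show "(f has_derivative (\<lambda>h. h *\<^sub>R f' s)) (at s within closed_segment x y)"
      if "s \<in> closed_segment x y" for s
      using assms(1)[OF that] unfolding has_vector_derivative_def by (rule has_derivative_at_withinI)
    show "onorm (\<lambda>h. h *\<^sub>R f' s) \<le> B" if "s \<in> closed_segment x y" for s
      using assms(2)[OF that] by (intro onorm_le) (simp add: mult.commute[of B] mult_left_mono)
  qed auto
  then show ?thesis by simp
qed

context complex_unital_banach_algebra
begin

definition expi :: "'a \<Rightarrow> real \<Rightarrow> 'a" where
  "expi a t = alg_exp A ((\<i> * of_real t) \<odot> a)"

context
  fixes a
  assumes a: "a \<in> carrier A"
begin

text \<open>The description in \<open>alg_exp\<close> denotes the sum of the exponential series, as
  limits in the metric are unique. Later facts about the group rest on the scalar power series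
  obtained here.\<close>

lemma expi_closed [simp, intro]: "expi a t \<in> carrier A"
  and expi_sums: "f \<in> dual_space A \<Longrightarrow> (\<lambda>k. (\<i> * of_real t) ^ k / fact k * f (a [^] k)) sums f (expi a t)"
proof -
  let ?x = "(\<i> * of_real t) \<odot> a"
  let ?g = "\<lambda>k::nat. (1 / fact k) \<odot> (?x [^] k)"
  have x: "?x \<in> carrier A" using a by simp
  have g: "?g k \<in> carrier A" for k using x by simp
  have "nrm A (?g k) \<le> inverse (fact k) * nrm A ?x ^ k" for k
    using nrm_pow[OF x, of k] x by (simp add: nrm_smult norm_divide divide_simps)
  from series_converges[of ?g, OF g summable_exp this]
  obtain s where s: "s \<in> carrier A" "limitin (nrm_topology A) (\<lambda>n. \<Oplus>k\<in>{..<n}. ?g k) s sequentially"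
    "\<And>f. f \<in> dual_space A \<Longrightarrow> (\<lambda>k. f (?g k)) sums f s" by blast
  have "alg_exp A ?x = s"
    unfolding alg_exp_def
  proof (rule the_equality)
    show "limitin (nrm_topology A) (\<lambda>n. \<Oplus>k\<in>{..<n}. ?g k) s sequentially" by (rule s(2))
    show "s' = s" if "limitin (nrm_topology A) (\<lambda>n. \<Oplus>k\<in>{..<n}. ?g k) s' sequentially" for s'
      using metric.limitin_metric_unique[OF that s(2)] by simp
  qed
  then have E: "expi a t = s" by (simp add: expi_def)
  show "expi a t \<in> carrier A" using E s(1) by simp
  assume f: "f \<in> dual_space A"
  have "f (?g k) = (\<i> * of_real t) ^ k / fact k * f (a [^] k)" for k
    using f a by (simp add: smult_pow dual_smult)
  then show "(\<lambda>k. (\<i> * of_real t) ^ k / fact k * f (a [^] k)) sums f (expi a t)"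
    using s(3)[OF f] by (simp add: E)
qed

lemma expi_zero: "expi a 0 = \<one>"
proof (rule eq_functional)
  fix f assume f: "f \<in> dual_space A"
  have "(\<lambda>k. (\<i> * of_real 0) ^ k / fact k * f (a [^] k)) sums (\<Sum>k\<in>{0}. (\<i> * of_real 0) ^ k / fact k * f (a [^] k))"
    by (rule sums_finite) (auto simp: power_0_left)
  then show "f (expi a 0) = f \<one>"
    using expi_sums[OF f, of 0] sums_unique2 by fastforce
qed auto

lemma expi_commute: "a \<otimes> expi a t = expi a t \<otimes> a"
proof (rule eq_functional)
  fix f assume f: "f \<in> dual_space A"
  have "a \<otimes> a [^] k = a [^] k \<otimes> a" for k :: nat
    using nat_pow_Suc2[OF a, of k] by simp
  then show "f (a \<otimes> expi a t) = f (expi a t \<otimes> a)"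
    using expi_sums[OF dual_mult_left[OF f a], of t] expi_sums[OF dual_mult_right[OF f a], of t]
      sums_unique2 by fastforce
qed (use a in auto)

text \<open>Termwise differentiation of an entire scalar power series: its \<open>k\<close>-th
  coefficient \<open>f (a [^] k) / fact k\<close> is shifted to
  \<open>f (a \<otimes> a [^] k) / fact k\<close>.\<close>

lemma expi_has_derivative:
  assumes f: "f \<in> dual_space A"
  shows "((\<lambda>t. f (expi a t)) has_vector_derivative \<i> * f (a \<otimes> expi a t)) (at t)"
proof -
  define c where "c k = f (a [^] k) / fact k" for k :: nat
  have summand: "(\<i> * of_real t) ^ k / fact k * f (a [^] k) = c k * (\<i> * of_real t) ^ k" for k t
    by (simp add: c_def)
  obtain B where B: "B > 0" "\<And>x. x \<in> carrier A \<Longrightarrow> cmod (f x) \<le> B * nrm A x"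
    using dual_bound[OF f] by metis
  have "summable (\<lambda>k. c k * z ^ k)" for z
  proof (rule summable_comparison_test'[where N = 0])
    show "summable (\<lambda>k. B * (inverse (fact k) * (nrm A a * cmod z) ^ k))"
      by (intro summable_mult summable_exp)
    fix k
    have "cmod (f (a [^] k)) \<le> B * nrm A a ^ k"
      using B(2)[of "a [^] k"] nrm_pow[OF a, of k] B(1) a
      by (meson mult_left_mono less_imp_le nat_pow_closed order_trans)
    then have "cmod (f (a [^] k)) * cmod z ^ k / fact k \<le> B * nrm A a ^ k * cmod z ^ k / fact k"
      by (intro divide_right_mono mult_right_mono) auto
    moreover have "norm (c k * z ^ k) = cmod (f (a [^] k)) * cmod z ^ k / fact k"
      by (simp add: c_def norm_mult norm_divide norm_power)
    moreover have "B * (inverse (fact k) * (nrm A a * cmod z) ^ k) = B * nrm A a ^ k * cmod z ^ k / fact k"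
      by (simp add: power_mult_distrib divide_inverse mult_ac)
    ultimately show "norm (c k * z ^ k) \<le> B * (inverse (fact k) * (nrm A a * cmod z) ^ k)"
      by (simp only:)
  qed
  from termdiffs_strong_converges_everywhere[OF this]
  have D: "((\<lambda>z. \<Sum>k. c k * z ^ k) has_field_derivative (\<Sum>k. diffs c k * z ^ k)) (at z)" for z .
  have eq: "f (expi a t) = (\<Sum>k. c k * (\<i> * of_real t) ^ k)" for t
    using expi_sums[OF f, of t] unfolding summand by (simp add: sums_iff)
  have "diffs c k * (\<i> * of_real t) ^ k = (\<i> * of_real t) ^ k / fact k * f (a \<otimes> a [^] k)" for k
  proof -
    have "diffs c k = f (a [^] Suc k) / fact k"
      by (simp add: diffs_def c_def del: of_nat_Suc nat_pow_Suc)
    then show ?thesis using nat_pow_Suc2[OF a, of k] by (simp del: nat_pow_Suc)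
  qed
  then have deq: "(\<Sum>k. diffs c k * (\<i> * of_real t) ^ k) = f (a \<otimes> expi a t)"
    using expi_sums[OF dual_mult_left[OF f a], of t] by (simp add: sums_iff)
  have "((\<lambda>t. \<i> * of_real t) has_vector_derivative \<i>) (at t)"
    by (auto intro!: derivative_eq_intros)
  from field_vector_diff_chain_at[OF this D[of "\<i> * of_real t"]]
  show ?thesis by (simp add: o_def eq[abs_def] deq)
qed

text \<open>An a priori bound that makes the local error of the Euler scheme uniform on bounded time
  intervals.\<close>

lemma expi_norm_crude: "nrm A (expi a t) \<le> exp (\<bar>t\<bar> * nrm A a)"
proof (rule nrm_le_functional)
  fix f assume f: "contraction_functional f"
  have s: "(\<lambda>k. (\<i> * of_real t) ^ k / fact k * f (a [^] k)) sums f (expi a t)"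
    by (rule expi_sums[OF contraction_functional_dual[OF f]])
  have s': "(\<lambda>k. (\<bar>t\<bar> * nrm A a) ^ k /\<^sub>R fact k) sums exp (\<bar>t\<bar> * nrm A a)"
    by (rule exp_converges)
  have le: "norm ((\<i> * of_real t) ^ k / fact k * f (a [^] k)) \<le> (\<bar>t\<bar> * nrm A a) ^ k /\<^sub>R fact k" for k
  proof -
    have "cmod (f (a [^] k)) \<le> nrm A a ^ k"
      using contraction_functional_le[OF f] nrm_pow[OF a, of k] a order_trans by blast
    then have "\<bar>t\<bar> ^ k * cmod (f (a [^] k)) / fact k \<le> \<bar>t\<bar> ^ k * nrm A a ^ k / fact k"
      by (intro divide_right_mono mult_left_mono) auto
    then show ?thesis
      by (simp add: norm_mult norm_divide norm_inverse norm_power power_mult_distrib divide_inverse mult_ac)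
  qed
  show "cmod (f (expi a t)) \<le> exp (\<bar>t\<bar> * nrm A a)"
    using norm_suminf_le[OF le sums_summable[OF s']] s s' by (simp add: sums_iff)
qed auto

end

context
  fixes a
  assumes herm: "a \<in> hermitian_elements A"
begin

lemma hermitian_closed: "a \<in> carrier A"
  using herm by (simp add: hermitian_elements_def)

text \<open>Since \<open>\<parallel>x\<parallel> \<le> \<parallel>(1 - i h a) x\<parallel>\<close>, one step of the implicit Euler scheme does not increase the
  norm; its local error is quadratic in the step size.\<close>

lemma hermitian_expi_step:
  assumes "\<bar>t\<bar> \<le> T" "\<bar>t + h\<bar> \<le> T"
  shows "nrm A (expi a (t + h)) \<le> nrm A (expi a t) + (nrm A a)\<^sup>2 * exp (T * nrm A a) * h\<^sup>2"
proof (cases "h = 0")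
  case False
  note a = hermitian_closed
  let ?M = "(nrm A a)\<^sup>2 * exp (T * nrm A a)"
  \<comment> \<open>For this \<open>z\<close> one has
    \<open>\<i> * h * (z - a) = 1 - \<i> * h * a\<close>, and
    \<open>\<bar>Im z\<bar> = 1 / \<bar>h\<bar>\<close>; so \<open>hermitian_lower\<close> states
    that the implicit Euler factor does not shrink norms.\<close>
  define z where "z = - \<i> / of_real h"
  define v where "v = (\<i> * of_real h) \<odot> (shift a z \<otimes> expi a (t + h))"
  have vc: "v \<in> carrier A" using a by (simp add: v_def)
  have "nrm A (expi a (t + h)) \<le> nrm A v"
  proof -
    have "\<bar>Im z\<bar> = 1 / \<bar>h\<bar>" by (simp add: z_def Im_divide_of_real)
    then have "1 / \<bar>h\<bar> * nrm A (expi a (t + h)) \<le> lower a z * nrm A (expi a (t + h))"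
      using hermitian_lower[OF herm, of z] nrm_nonneg[OF expi_closed[OF a]] by (intro mult_right_mono) auto
    also have "\<dots> \<le> nrm A (shift a z \<otimes> expi a (t + h))"
      using lower_le[OF a] a by simp
    finally show ?thesis
      using a False by (simp add: v_def nrm_smult norm_mult field_simps)
  qed
  also have "nrm A v \<le> nrm A (expi a t) + ?M * h\<^sup>2"
  proof (rule nrm_le_functional[OF vc])
    fix f assume f: "contraction_functional f"
    note fd = contraction_functional_dual[OF f]
    let ?u' = "\<lambda>s. \<i> * f (a \<otimes> expi a s)"
    have z1: "\<i> * of_real h * z = 1" using False by (simp add: z_def)
    have "f v = (\<i> * of_real h * z) * f (expi a (t + h)) - \<i> * of_real h * f (a \<otimes> expi a (t + h))"
      using a fd by (simp add: v_def dual_smult shift_mult dual_diff right_diff_distrib)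
    then have fv: "f v = f (expi a (t + h)) - of_real h * ?u' (t + h)"
      by (simp add: z1)
    have seg: "\<bar>s\<bar> \<le> T" "\<bar>t + h - s\<bar> \<le> \<bar>h\<bar>" if "s \<in> closed_segment t (t + h)" for s
      using that assms by (auto simp: closed_segment_eq_real_ivl split: if_splits)
    have f2: "cmod (\<i> * f (a \<otimes> (a \<otimes> expi a s))) \<le> ?M" if "\<bar>s\<bar> \<le> T" for s
    proof -
      have "cmod (f (a \<otimes> (a \<otimes> expi a s))) \<le> nrm A (a \<otimes> (a \<otimes> expi a s))"
        using contraction_functional_le[OF f] a by simp
      also have "\<dots> \<le> nrm A a * nrm A (a \<otimes> expi a s)" using a by (intro nrm_mult) auto
      also have "\<dots> \<le> nrm A a * (nrm A a * nrm A (expi a s))"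
        using a nrm_nonneg[OF a] by (intro mult_left_mono nrm_mult) auto
      also have "nrm A (expi a s) \<le> exp (T * nrm A a)"
        by (rule order_trans[OF expi_norm_crude[OF a]])
          (use that nrm_nonneg[OF a] in \<open>simp add: mult_right_mono\<close>)
      finally show ?thesis
        using nrm_nonneg[OF a] by (simp add: norm_mult power2_eq_square mult_left_mono mult.assoc)
    qed
    have d1: "((\<lambda>s. f (a \<otimes> expi a s)) has_vector_derivative \<i> * f (a \<otimes> (a \<otimes> expi a s))) (at s)" for s
      using expi_has_derivative[OF a dual_mult_left[OF fd a]] .
    have bd: "cmod (?u' s - ?u' (t + h)) \<le> ?M * \<bar>h\<bar>" if s: "s \<in> closed_segment t (t + h)" for s
    proof -
      have "s' \<in> closed_segment s (t + h) \<Longrightarrow> \<bar>s'\<bar> \<le> T" for s'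
        using seg(1)[OF s] assms(2) by (auto simp: closed_segment_eq_real_ivl split: if_splits)
      then have "cmod (f (a \<otimes> expi a (t + h)) - f (a \<otimes> expi a s)) \<le> ?M * \<bar>t + h - s\<bar>"
        by (intro vector_derivative_bound[OF d1 f2]) auto
      also have "\<dots> \<le> ?M * \<bar>h\<bar>" using seg(2)[OF s] by (intro mult_left_mono) auto
      finally show ?thesis
        by (simp add: right_diff_distrib[symmetric] norm_mult norm_minus_commute)
    qed
    \<comment> \<open>Subtracting the linear part with the slope at \<open>t + h\<close> leaves a
      derivative of order \<open>h\<close>, hence an increment of order \<open>h\<close>
      squared.\<close>
    let ?k = "\<lambda>s. f (expi a s) - of_real s * ?u' (t + h)"
    have "(?k has_vector_derivative (?u' s - ?u' (t + h))) (at s)" for s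
      by (rule has_vector_derivative_diff[OF expi_has_derivative[OF a fd]])
        (auto intro!: derivative_eq_intros)
    from vector_derivative_bound[OF this bd]
    have "cmod (?k (t + h) - ?k t) \<le> ?M * \<bar>h\<bar> * \<bar>t + h - t\<bar>" .
    moreover have "?k (t + h) - ?k t = f v - f (expi a t)"
      by (simp add: fv algebra_simps)
    ultimately have "cmod (f v - f (expi a t)) \<le> ?M * \<bar>h\<bar> * \<bar>t + h - t\<bar>"
      by (simp only:)
    then have "cmod (f v - f (expi a t)) \<le> ?M * h\<^sup>2"
      by (simp add: power2_eq_square mult.assoc)
    moreover have "cmod (f (expi a t)) \<le> nrm A (expi a t)"
      using contraction_functional_le[OF f] a by simp
    ultimately show "cmod (f v) \<le> nrm A (expi a t) + ?M * h\<^sup>2"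
      using norm_triangle_ineq2[of "f v" "f (expi a t)"] by linarith
  qed
  finally show ?thesis .
qed simp

text \<open>Over \<open>n + 1\<close> Euler steps of size \<open>t / (n + 1)\<close> the quadratic
  local errors add up to \<open>?M * t\<^sup>2 / (n + 1)\<close>, which tends to 0.\<close>

lemma hermitian_expi_norm: "nrm A (expi a t) \<le> 1"
proof -
  note a = hermitian_closed
  let ?M = "(nrm A a)\<^sup>2 * exp (\<bar>t\<bar> * nrm A a)"
  have bound: "nrm A (expi a t) \<le> 1 + ?M * t\<^sup>2 / real (Suc n)" for n
  proof -
    define h where "h = t / real (Suc n)"
    have kh: "\<bar>real k * h\<bar> \<le> \<bar>t\<bar>" if "k \<le> Suc n" for k
    proof -
      have "\<bar>real k * h\<bar> = real k / real (Suc n) * \<bar>t\<bar>" by (simp add: h_def abs_mult)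
      also have "\<dots> \<le> 1 * \<bar>t\<bar>" using that by (intro mult_right_mono) auto
      finally show ?thesis by simp
    qed
    have "k \<le> Suc n \<Longrightarrow> nrm A (expi a (real k * h)) \<le> 1 + real k * (?M * h\<^sup>2)" for k
    proof (induction k)
      case 0
      then show ?case by (simp add: expi_zero[OF a] nrm_one)
    next
      case (Suc k)
      have "real k * h + h = real (Suc k) * h" by (simp add: algebra_simps)
      then have "nrm A (expi a (real (Suc k) * h)) \<le> nrm A (expi a (real k * h)) + ?M * h\<^sup>2"
        using hermitian_expi_step[of "real k * h" "\<bar>t\<bar>" h] kh[of k] kh[of "Suc k"] Suc.prems by simp
      then show ?case using Suc by (simp add: algebra_simps)
    qed
    from this[of "Suc n"] have "nrm A (expi a (real (Suc n) * h)) \<le> 1 + real (Suc n) * (?M * h\<^sup>2)" by simp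
    moreover have "real (Suc n) * h = t" by (simp add: h_def)
    moreover have "real (Suc n) * (?M * h\<^sup>2) = ?M * t\<^sup>2 / real (Suc n)"
      by (simp add: h_def power2_eq_square divide_simps del: of_nat_Suc)
    ultimately show ?thesis by simp
  qed
  have "(\<lambda>n. 1 + ?M * t\<^sup>2 / real (Suc n)) \<longlonglongrightarrow> 1"
    by real_asymp
  then show ?thesis by (rule Lim_bounded2) (use bound in auto)
qed

lemma hermitian_expi_functional:
  assumes "contraction_functional f"
  shows "cmod (f (expi a t)) \<le> 1"
  using contraction_functional_le[OF assms expi_closed[OF hermitian_closed]] hermitian_expi_norm order_trans by blast

lemma hermitian_expi_lipschitz:
  assumes f: "contraction_functional f"
  shows "cmod (f (expi a t) - f (expi a s)) \<le> nrm A a * \<bar>t - s\<bar>"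
proof (rule vector_derivative_bound)
  note a = hermitian_closed
  show "((\<lambda>t. f (expi a t)) has_vector_derivative \<i> * f (a \<otimes> expi a r)) (at r)" for r
    by (rule expi_has_derivative[OF a contraction_functional_dual[OF f]])
  show "cmod (\<i> * f (a \<otimes> expi a r)) \<le> nrm A a" for r
  proof -
    have "cmod (f (a \<otimes> expi a r)) \<le> nrm A a * nrm A (expi a r)"
      using contraction_functional_le[OF f, of "a \<otimes> expi a r"] nrm_mult[OF a expi_closed[OF a], of r] a by simp
    also have "\<dots> \<le> nrm A a * 1"
      using hermitian_expi_norm nrm_nonneg[OF a] by (intro mult_left_mono) auto
    finally show ?thesis by (simp add: norm_mult)
  qed
qed

lemma expi_functional_continuous:
  assumes "f \<in> dual_space A"
  shows "continuous_on S (\<lambda>t. f (expi a t))"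
  using expi_has_derivative[OF hermitian_closed assms]
  by (meson continuous_on_vector_derivative has_vector_derivative_at_within)

text \<open>Removing the factor \<open>iexp (t * l)\<close> leaves a function whose derivative
  contains \<open>(l - a) y\<close>, acted on by a contraction. Approximate eigenvectors of
  \<open>a\<close> are thus approximate eigenvectors of the group.\<close>

lemma expi_eigen_bound:
  assumes y: "y \<in> carrier A" and f: "contraction_functional f"
  shows "cmod (f (expi a t \<otimes> y) - iexp (t * l) * f y) \<le> \<bar>t\<bar> * nrm A (shift a (of_real l) \<otimes> y)"
proof -
  note a = hermitian_closed and fd = contraction_functional_dual[OF f]
  let ?y = "shift a (of_real l) \<otimes> y"
  let ?k = "\<lambda>t. exp (- \<i> * of_real (t * l)) * f (expi a t \<otimes> y)"
  have D: "(?k has_vector_derivative - \<i> * exp (- \<i> * of_real (r * l)) * f (expi a r \<otimes> ?y)) (at r)" for r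
  proof -
    have "((\<lambda>t. f (expi a t \<otimes> y)) has_vector_derivative \<i> * f ((a \<otimes> expi a r) \<otimes> y)) (at r)"
      using expi_has_derivative[OF a dual_mult_right[OF fd y]] .
    moreover have "((\<lambda>t. exp (- \<i> * of_real (t * l))) has_vector_derivative - \<i> * of_real l * exp (- \<i> * of_real (r * l))) (at r)"
    proof -
      have "((\<lambda>t. - \<i> * of_real (t * l)) has_vector_derivative - \<i> * of_real l) (at r)"
        by (auto intro!: derivative_eq_intros)
      from field_vector_diff_chain_at[OF this DERIV_exp] show ?thesis by (simp add: o_def)
    qed
    ultimately have "(?k has_vector_derivative exp (- \<i> * of_real (r * l)) * (\<i> * f ((a \<otimes> expi a r) \<otimes> y))
        + - \<i> * of_real l * exp (- \<i> * of_real (r * l)) * f (expi a r \<otimes> y)) (at r)"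
      by (intro has_vector_derivative_mult)
    moreover have eq: "f (expi a r \<otimes> ?y) = of_real l * f (expi a r \<otimes> y) - f ((a \<otimes> expi a r) \<otimes> y)"
      using a y fd
      by (simp add: shift_mult expi_commute m_assoc r_distr minus_eq r_minus smult_mult_right)
        (simp add: minus_eq[symmetric] dual_diff dual_smult)
    have "exp (- \<i> * of_real (r * l)) * (\<i> * f ((a \<otimes> expi a r) \<otimes> y))
        + - \<i> * of_real l * exp (- \<i> * of_real (r * l)) * f (expi a r \<otimes> y)
        = - \<i> * exp (- \<i> * of_real (r * l)) * f (expi a r \<otimes> ?y)"
      unfolding eq by (simp add: algebra_simps)
    ultimately show ?thesis by (simp only:)
  qed
  have "cmod (- \<i> * exp (- \<i> * of_real (r * l)) * f (expi a r \<otimes> ?y)) \<le> nrm A ?y" for r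
  proof -
    have "cmod (f (expi a r \<otimes> ?y)) \<le> nrm A (expi a r) * nrm A ?y"
      using contraction_functional_le[OF f, of "expi a r \<otimes> ?y"] nrm_mult[of "expi a r" ?y] a y by simp
    also have "\<dots> \<le> 1 * nrm A ?y"
      using hermitian_expi_norm nrm_nonneg[of ?y] a y by (intro mult_right_mono) auto
    finally show ?thesis by (simp add: norm_mult)
  qed
  from vector_derivative_bound[OF D this, of 0 t]
  have "cmod (?k t - f y) \<le> nrm A ?y * \<bar>t\<bar>"
    using a y by (simp add: expi_zero norm_minus_commute)
  moreover have "iexp (t * l) * ?k t = f (expi a t \<otimes> y)"
    by (simp add: mult.assoc[symmetric] exp_add[symmetric])
  then have "f (expi a t \<otimes> y) - iexp (t * l) * f y = iexp (t * l) * (?k t - f y)"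
    by (simp add: right_diff_distrib)
  then have "cmod (f (expi a t \<otimes> y) - iexp (t * l) * f y) = cmod (?k t - f y)"
    by (simp only: norm_mult) simp
  ultimately show ?thesis by (simp add: mult.commute)
qed

text \<open>The weak formula alone would only give an element of the bidual. Riemann sums with mesh
  \<open>1 / N n\<close> on a growing window are Cauchy in norm: the Lipschitz bound controls the
  mesh error and the integrability of \<open>h\<close> the tail.\<close>

lemma expi_integral_exists:
  assumes \<nu>: "finite_measure \<nu>" "sets \<nu> = sets borel" and h: "integrable \<nu> h"
  obtains b where "b \<in> carrier A" "\<And>f. f \<in> dual_space A \<Longrightarrow> f b = (LINT t|\<nu>. f (expi a t) * h t)"
proof -
  note a = hermitian_closed
  interpret \<nu>: finite_measure \<nu> by fact
  have [measurable_cong]: "sets \<nu> = sets borel" by fact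
  have hm [measurable]: "h \<in> borel_measurable borel" using h \<nu>(2) by (metis borel_measurable_integrable measurable_cong_sets)
  define N where "N n = real (Suc n)" for n
  have N: "N n > 0" "N n \<ge> 1" for n by (auto simp: N_def)
  \<comment> \<open>With mesh \<open>1 / N n\<close>, indices up to the square of
    \<open>Suc n\<close> cover all \<open>t\<close> with \<open>\<bar>t\<bar> < N n\<close>.\<close>
  define J where "J n = {- int (Suc n * Suc n)..int (Suc n * Suc n)}" for n
  define I where "I n k = {t. \<lfloor>N n * t\<rfloor> = k}" for n k
  define c where "c n k = (LINT t|\<nu>. indicator (I n k) t * h t)" for n k
  define s where "s n = (\<Oplus>k\<in>J n. c n k \<odot> expi a (of_int k / N n))" for n
  have sc: "s n \<in> carrier A" for n
    unfolding s_def using a by (intro finsum_closed) auto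
  define e where "e n = (LINT t|\<nu>. (nrm A a / N n + indicator {t. N n \<le> \<bar>t\<bar>} t) * cmod (h t))" for n
  have I_meas [measurable]: "I n k \<in> sets borel" for n k
    unfolding I_def by measurable
  have int_I: "integrable \<nu> (\<lambda>t. indicator (I n k) t * h t)" for n k
    by (rule Bochner_Integration.integrable_bound[OF h]) (auto simp: indicator_def)
  have int_f: "integrable \<nu> (\<lambda>t. f (expi a t) * h t)" if f: "contraction_functional f" for f
  proof (rule Bochner_Integration.integrable_bound[OF h])
    have "(\<lambda>t. f (expi a t)) \<in> borel_measurable borel"
      by (intro borel_measurable_continuous_onI expi_functional_continuous contraction_functional_dual f)
    then show "(\<lambda>t. f (expi a t) * h t) \<in> borel_measurable \<nu>" by measurable
    show "AE t in \<nu>. norm (f (expi a t) * h t) \<le> norm (h t)"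
      using hermitian_expi_functional[OF f] by (auto simp: norm_mult mult_left_le_one_le)
  qed
  have e_int: "integrable \<nu> (\<lambda>t. (nrm A a / N n + indicator {t. N n \<le> \<bar>t\<bar>} t) * cmod (h t))" for n
  proof (rule Bochner_Integration.integrable_bound[of _ "\<lambda>t. (nrm A a / N n + 1) * cmod (h t)"])
    have "\<bar>nrm A a / N n + indicator {t. N n \<le> \<bar>t\<bar>} t\<bar> \<le> \<bar>nrm A a / N n + 1\<bar>" for t
      using nrm_nonneg[OF a] N(1)[of n] by (auto simp: indicator_def)
    then show "AE t in \<nu>. norm ((nrm A a / N n + indicator {t. N n \<le> \<bar>t\<bar>} t) * cmod (h t)) \<le> norm ((nrm A a / N n + 1) * cmod (h t))"
      unfolding real_norm_def abs_mult abs_norm_cancel by (intro AE_I2 mult_right_mono) auto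
  qed (use h in auto)
  have approx: "cmod (f (s n) - (LINT t|\<nu>. f (expi a t) * h t)) \<le> e n" if f: "contraction_functional f" for f n
  proof -
    note fd = contraction_functional_dual[OF f]
    let ?g = "\<lambda>t. \<Sum>k\<in>J n. indicator (I n k) t * f (expi a (of_int k / N n))"
    have "f (s n) = (\<Sum>k\<in>J n. c n k * f (expi a (of_int k / N n)))"
      unfolding s_def using a by (subst dual_finsum[OF fd]) (auto simp: J_def dual_smult[OF fd])
    also have "\<dots> = (\<Sum>k\<in>J n. LINT t|\<nu>. f (expi a (of_int k / N n)) * (indicator (I n k) t * h t))"
      by (simp add: c_def mult.commute)
    also have "\<dots> = (LINT t|\<nu>. (\<Sum>k\<in>J n. f (expi a (of_int k / N n)) * (indicator (I n k) t * h t)))"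
      by (subst Bochner_Integration.integral_sum) (auto intro: int_I)
    also have "\<dots> = (LINT t|\<nu>. ?g t * h t)"
      by (simp add: sum_distrib_left mult_ac)
    finally have fs: "f (s n) = (LINT t|\<nu>. ?g t * h t)" .
    have int_g: "integrable \<nu> (\<lambda>t. ?g t * h t)"
    proof -
      have "integrable \<nu> (\<lambda>t. (\<Sum>k\<in>J n. f (expi a (of_int k / N n)) * (indicator (I n k) t * h t)))"
        by (intro Bochner_Integration.integrable_sum integrable_mult_right int_I)
      then show ?thesis by (simp add: sum_distrib_left mult_ac)
    qed
    have pt: "cmod (?g t - f (expi a t)) \<le> nrm A a / N n + indicator {t. N n \<le> \<bar>t\<bar>} t" for t
    proof -
      have g: "?g t = (if \<lfloor>N n * t\<rfloor> \<in> J n then f (expi a (of_int \<lfloor>N n * t\<rfloor> / N n)) else 0)"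
      proof -
        have "?g t = (\<Sum>k\<in>J n. if \<lfloor>N n * t\<rfloor> = k then f (expi a (of_int k / N n)) else 0)"
          by (intro sum.cong) (auto simp: I_def indicator_def)
        then show ?thesis by (simp add: J_def)
      qed
      show ?thesis
      proof (cases "\<lfloor>N n * t\<rfloor> \<in> J n")
        case True
        have "cmod (?g t - f (expi a t)) \<le> nrm A a * \<bar>of_int \<lfloor>N n * t\<rfloor> / N n - t\<bar>"
          unfolding g using True hermitian_expi_lipschitz[OF f] by simp
        also have "\<bar>of_int \<lfloor>N n * t\<rfloor> / N n - t\<bar> \<le> 1 / N n"
        proof -
          have "of_int \<lfloor>N n * t\<rfloor> / N n - t = (of_int \<lfloor>N n * t\<rfloor> - N n * t) / N n"
            using N(1)[of n] by (simp add: field_simps)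
          moreover have "\<bar>of_int \<lfloor>N n * t\<rfloor> - N n * t\<bar> \<le> 1" by linarith
          ultimately show ?thesis
            using N(1)[of n] by (simp only: abs_divide) (simp add: divide_right_mono)
        qed
        finally have "cmod (?g t - f (expi a t)) \<le> nrm A a / N n"
          using nrm_nonneg[OF a] by (simp add: mult_left_mono)
        then show ?thesis by (simp add: indicator_def)
      next
        case False
        have "N n \<le> \<bar>t\<bar>"
        proof (rule ccontr)
          assume "\<not> N n \<le> \<bar>t\<bar>"
          then have "- N n < t" "t < N n" by auto
          then have "- (N n * N n) < N n * t" "N n * t < N n * N n"
            using N(1)[of n] mult_strict_left_mono[of "- N n" t "N n"] mult_strict_left_mono[of t "N n" "N n"] by auto
          moreover have "N n * N n = of_int (int (Suc n * Suc n))" by (simp add: N_def algebra_simps)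
          ultimately have "- int (Suc n * Suc n) \<le> \<lfloor>N n * t\<rfloor>" "\<lfloor>N n * t\<rfloor> \<le> int (Suc n * Suc n)"
            by (simp_all only: le_floor_iff floor_le_iff of_int_minus)
          then show False using False by (simp add: J_def)
        qed
        then have "(1::real) = indicator {t. N n \<le> \<bar>t\<bar>} t" by (simp add: indicator_def)
        moreover have "cmod (?g t - f (expi a t)) = cmod (f (expi a t))"
          by (simp only: g False if_False) simp
        moreover have "0 \<le> nrm A a / N n"
          using N(1)[of n] nrm_nonneg[OF a] by simp
        ultimately show ?thesis
          using hermitian_expi_functional[OF f, of t] by linarith
      qed
    qed
    have "f (s n) - (LINT t|\<nu>. f (expi a t) * h t) = (LINT t|\<nu>. (?g t - f (expi a t)) * h t)"
      unfolding fs left_diff_distrib by (rule Bochner_Integration.integral_diff[OF int_g int_f[OF f], symmetric])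
    also have "cmod \<dots> \<le> e n"
      unfolding e_def
    proof (rule Bochner_Integration.integral_norm_bound_integral[OF _ e_int])
      show "integrable \<nu> (\<lambda>t. (?g t - f (expi a t)) * h t)"
        unfolding left_diff_distrib by (rule Bochner_Integration.integrable_diff[OF int_g int_f[OF f]])
      show "norm ((?g t - f (expi a t)) * h t) \<le> (nrm A a / N n + indicator {t. N n \<le> \<bar>t\<bar>} t) * cmod (h t)" for t
        unfolding norm_mult by (intro mult_right_mono pt) auto
    qed
    finally show ?thesis .
  qed
  have e0: "e \<longlonglongrightarrow> 0"
  proof -
    have "(\<lambda>n. LINT t|\<nu>. (nrm A a / N n + indicator {t. N n \<le> \<bar>t\<bar>} t) * cmod (h t)) \<longlonglongrightarrow> (LINT t|\<nu>. 0)"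
    proof (rule integral_dominated_convergence[of _ _ _ "\<lambda>t. (nrm A a + 1) * cmod (h t)"])
      show "AE t in \<nu>. (\<lambda>n. (nrm A a / N n + indicator {t. N n \<le> \<bar>t\<bar>} t) * cmod (h t)) \<longlonglongrightarrow> 0"
      proof (rule AE_I2)
        fix t
        have 1: "(\<lambda>n. nrm A a / N n) \<longlonglongrightarrow> 0" unfolding N_def by real_asymp
        obtain m :: nat where "\<bar>t\<bar> < real m" using reals_Archimedean2 by blast
        then have "indicator {t. N n \<le> \<bar>t\<bar>} t = (0::real)" if "n \<ge> m" for n
          using that by (auto simp: indicator_def N_def)
        then have "(\<lambda>n. indicator {t. N n \<le> \<bar>t\<bar>} t :: real) \<longlonglongrightarrow> 0"
          by (intro tendsto_eventually) (auto simp: eventually_sequentially)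
        from tendsto_mult[OF tendsto_add[OF 1 this] tendsto_const]
        show "(\<lambda>n. (nrm A a / N n + indicator {t. N n \<le> \<bar>t\<bar>} t) * cmod (h t)) \<longlonglongrightarrow> 0" by fastforce
      qed
      show "AE t in \<nu>. norm ((nrm A a / N n + indicator {t. N n \<le> \<bar>t\<bar>} t) * cmod (h t)) \<le> (nrm A a + 1) * cmod (h t)" for n
      proof (rule AE_I2)
        fix t
        have "nrm A a / N n \<le> nrm A a" "0 \<le> nrm A a / N n"
          using N[of n] nrm_nonneg[OF a] by (auto simp: divide_le_eq mult_le_cancel_left1)
        then have "\<bar>nrm A a / N n + indicator {t. N n \<le> \<bar>t\<bar>} t\<bar> \<le> nrm A a + 1"
          by (auto simp: indicator_def)
        then show "norm ((nrm A a / N n + indicator {t. N n \<le> \<bar>t\<bar>} t) * cmod (h t)) \<le> (nrm A a + 1) * cmod (h t)"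
          by (simp add: abs_mult mult_right_mono)
      qed
    qed (use h in auto)
    then show ?thesis by (simp add: e_def[abs_def])
  qed
  have "nrm A (s m \<ominus> s n) \<le> e m + e n" for m n
  proof (rule nrm_le_functional)
    fix f assume f: "contraction_functional f"
    have "f (s m \<ominus> s n) = (f (s m) - (LINT t|\<nu>. f (expi a t) * h t)) - (f (s n) - (LINT t|\<nu>. f (expi a t) * h t))"
      using dual_diff[OF contraction_functional_dual[OF f] sc sc] by simp
    then show "cmod (f (s m \<ominus> s n)) \<le> e m + e n"
      using norm_triangle_le_diff[OF add_mono[OF approx[OF f, of m] approx[OF f, of n]]] by simp
  qed (use sc in simp)
  from limit_exists[OF sc e0 this]
  obtain b where b: "b \<in> carrier A" "(\<lambda>n. nrm A (s n \<ominus> b)) \<longlonglongrightarrow> 0" .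
  have fb: "f b = (LINT t|\<nu>. f (expi a t) * h t)" if f: "contraction_functional f" for f
  proof (rule LIMSEQ_unique[OF dual_limit[OF contraction_functional_dual[OF f] sc b]])
    have "(\<lambda>n. f (s n) - (LINT t|\<nu>. f (expi a t) * h t)) \<longlonglongrightarrow> 0"
      by (rule Lim_null_comparison[OF always_eventually e0]) (use approx[OF f] in blast)
    then show "(\<lambda>n. f (s n)) \<longlonglongrightarrow> (LINT t|\<nu>. f (expi a t) * h t)"
      by (simp add: LIM_zero_iff)
  qed
  show thesis
  proof (rule that[OF b(1)])
    fix f assume f: "f \<in> dual_space A"
    obtain B where B: "B > 0" "\<And>x. x \<in> carrier A \<Longrightarrow> cmod (f x) \<le> B * nrm A x"
      using dual_bound[OF f] by metis
    define g where "g x = of_real (1 / B) * f x" for x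
    have "contraction_functional g"
      unfolding contraction_functional_def g_def
    proof (intro conjI ballI)
      show le: "cmod (of_real (1 / B) * f x) \<le> nrm A x" if "x \<in> carrier A" for x
        using B(1) B(2)[OF that] by (simp add: norm_mult norm_divide divide_le_eq mult.commute)
      show "(\<lambda>x. of_real (1 / B) * f x) \<in> dual_space A"
        using le by (intro dual_spaceI[where B = 1]) (auto simp: dual_add[OF f] dual_smult[OF f] distrib_left)
    qed
    then have "g b = (LINT t|\<nu>. g (expi a t) * h t)" by (rule fb)
    also have "\<dots> = of_real (1 / B) * (LINT t|\<nu>. f (expi a t) * h t)"
      by (simp only: g_def mult.assoc integral_mult_right_zero)
    finally show "f b = (LINT t|\<nu>. f (expi a t) * h t)"
      using B(1) by (simp add: g_def)
  qed
qed

end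

end


section \<open>Resolvents and the damped group\<close>

lemma integrable_inverse_square: "integrable lborel (\<lambda>x::real. C / (1 + x\<^sup>2))"
proof -
  have "integrable lborel (\<lambda>x::real. inverse (1 + x\<^sup>2))"
    using integrable_inverse_1_plus_square by (simp add: set_integrable_def)
  then have "integrable lborel (\<lambda>x::real. C * inverse (1 + x\<^sup>2))" by simp
  then show ?thesis by (simp add: divide_inverse)
qed

lemma exp_minus_abs_integrable:
  assumes "\<epsilon> > 0"
  shows "integrable lborel (\<lambda>t::real. exp (- \<epsilon> * \<bar>t\<bar>))"
proof (rule Bochner_Integration.integrable_bound)
  \<comment> \<open>Chosen so that \<open>\<kappa> * (1 + t\<^sup>2)\<close> lies below the
    quadratic Taylor polynomial of \<open>exp (\<epsilon> * \<bar>t\<bar>)\<close>.\<close>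
  define \<kappa> where "\<kappa> = min 1 (\<epsilon>\<^sup>2 / 2)"
  have \<kappa>: "\<kappa> > 0" using assms by (simp add: \<kappa>_def)
  show "integrable lborel (\<lambda>t::real. (1 / \<kappa>) / (1 + t\<^sup>2))" by (rule integrable_inverse_square)
  show "AE t in lborel. norm (exp (- \<epsilon> * \<bar>t\<bar>)) \<le> norm (1 / \<kappa> / (1 + t\<^sup>2))"
  proof (rule AE_I2)
    fix t :: real
    have "\<kappa> * (1 + t\<^sup>2) \<le> 1 + \<epsilon>\<^sup>2 / 2 * t\<^sup>2"
      unfolding distrib_left by (intro add_mono mult_right_mono) (auto simp: \<kappa>_def)
    also have "\<dots> \<le> 1 + \<epsilon> * \<bar>t\<bar> + (\<epsilon> * \<bar>t\<bar>)\<^sup>2 / 2"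
      using assms by (simp add: power_mult_distrib)
    also have "\<dots> \<le> exp (\<epsilon> * \<bar>t\<bar>)"
      using assms by (intro exp_lower_Taylor_quadratic) simp
    finally have "\<kappa> * (1 + t\<^sup>2) \<le> exp (\<epsilon> * \<bar>t\<bar>)" .
    moreover have "0 < \<kappa> * (1 + t\<^sup>2)"
      using \<kappa> by (intro mult_pos_pos add_pos_nonneg) auto
    ultimately have "1 / exp (\<epsilon> * \<bar>t\<bar>) \<le> 1 / (\<kappa> * (1 + t\<^sup>2))"
      by (intro divide_left_mono) auto
    then show "norm (exp (- \<epsilon> * \<bar>t\<bar>)) \<le> norm (1 / \<kappa> / (1 + t\<^sup>2))"
      using \<kappa> by (simp add: exp_minus divide_inverse)
  qed
qed simp

text \<open>Exhausts \<open>S\<close> by compact intervals; the hypotheses on eventual membership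
  let one proof serve both half-lines.\<close>

lemma integral_FTC_limit:
  fixes F g :: "real \<Rightarrow> complex"
  assumes F: "\<And>x. (F has_vector_derivative g x) (at x)" and cont: "continuous_on UNIV g"
    and lim: "(\<lambda>n. F (b n) - F (a n)) \<longlonglongrightarrow> l" and ab: "\<And>n::nat. a n \<le> b n"
    and mono: "\<And>x. x \<in> S \<longleftrightarrow> (\<forall>\<^sub>F n in sequentially. x \<in> {a n..b n})"
      "\<And>x. x \<notin> S \<longleftrightarrow> (\<forall>\<^sub>F n in sequentially. x \<notin> {a n..b n})"
    and sub: "\<And>n. {a n..b n} \<subseteq> S" and S: "S \<in> sets borel"
    and int: "integrable lborel (\<lambda>x. indicator S x *\<^sub>R g x)"
  shows "(LINT x|lborel. indicator S x *\<^sub>R g x) = l"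
proof (rule LIMSEQ_unique[OF _ lim])
  have gm [measurable]: "g \<in> borel_measurable borel" by (intro borel_measurable_continuous_onI cont)
  have eq: "F (b n) - F (a n) = (LINT x|lborel. indicator {a n..b n} x *\<^sub>R g x)" for n
    using F cont by (intro integral_FTC_atLeastAtMost[symmetric] ab)
      (auto intro: has_vector_derivative_at_within continuous_on_subset)
  show "(\<lambda>n. F (b n) - F (a n)) \<longlonglongrightarrow> (LINT x|lborel. indicator S x *\<^sub>R g x)"
    unfolding eq
  proof (rule integral_dominated_convergence[of _ _ _ "\<lambda>x. cmod (indicator S x *\<^sub>R g x)"])
    show "AE x in lborel. (\<lambda>n. indicator {a n..b n} x *\<^sub>R g x) \<longlonglongrightarrow> indicator S x *\<^sub>R g x"
    proof (rule AE_I2)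
      fix x
      have "\<forall>\<^sub>F n in sequentially. indicator {a n..b n} x *\<^sub>R g x = indicator S x *\<^sub>R g x"
      proof (cases "x \<in> S")
        case True
        then show ?thesis using mono(1)[of x] by (auto elim!: eventually_mono)
      next
        case False
        then show ?thesis using mono(2)[of x] by (auto elim!: eventually_mono)
      qed
      then show "(\<lambda>n. indicator {a n..b n} x *\<^sub>R g x) \<longlonglongrightarrow> indicator S x *\<^sub>R g x"
        by (rule tendsto_eventually)
    qed
    show "AE x in lborel. norm (indicator {a n..b n} x *\<^sub>R g x) \<le> cmod (indicator S x *\<^sub>R g x)" for n
      using sub[of n] by (intro AE_I2) (auto simp: indicator_def)
    show "integrable lborel (\<lambda>x. cmod (indicator S x *\<^sub>R g x))" by (rule integrable_norm[OF int])
  qed (use S in auto)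
qed

context complex_unital_banach_algebra
begin

context
  fixes a f and \<epsilon> :: real
  assumes herm: "a \<in> hermitian_elements A" and f: "contraction_functional f" and \<epsilon>: "\<epsilon> > 0"
begin

text \<open>The argument \<open>- t\<close> matches the sign in \<open>fourier_inversion\<close>, so
  that inverting at \<open>- s\<close> returns \<open>f (expi a s)\<close>.\<close>

definition damped :: "real \<Rightarrow> complex" where
  "damped t = exp (- \<epsilon> * \<bar>t\<bar>) * f (expi a (- t))"

private lemma ac: "a \<in> carrier A"
  by (rule hermitian_closed[OF herm])

private lemma fd: "f \<in> dual_space A"
  by (rule contraction_functional_dual[OF f])

lemma damped_continuous: "continuous_on UNIV damped"
proof -
  have "continuous_on UNIV (\<lambda>t. f (expi a (- t)))"
    by (rule continuous_on_compose2[OF expi_functional_continuous[OF herm fd, of UNIV]]) (auto intro!: continuous_intros)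
  then show ?thesis
    unfolding damped_def by (intro continuous_intros continuous_on_of_real)
qed

lemma damped_le: "cmod (damped t) \<le> exp (- \<epsilon> * \<bar>t\<bar>)"
proof -
  have "exp (- \<epsilon> * \<bar>t\<bar>) * cmod (f (expi a (- t))) \<le> exp (- \<epsilon> * \<bar>t\<bar>) * 1"
    by (intro mult_left_mono hermitian_expi_functional[OF herm f]) auto
  then show ?thesis by (simp add: damped_def norm_mult)
qed

lemma damped_bound: "cmod (damped t) \<le> 1"
proof -
  have "exp (- \<epsilon> * \<bar>t\<bar>) \<le> 1" using \<epsilon> by simp
  then show ?thesis using damped_le[of t] by linarith
qed

lemma damped_integrable: "integrable lborel damped"
proof (rule Bochner_Integration.integrable_bound[OF exp_minus_abs_integrable[OF \<epsilon>]])
  show "damped \<in> borel_measurable lborel"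
    using borel_measurable_continuous_onI[OF damped_continuous] by simp
  show "AE t in lborel. norm (damped t) \<le> norm (exp (- \<epsilon> * \<bar>t\<bar>))"
    using damped_le by simp
qed

lemma resolvent_Units: "Im z \<noteq> 0 \<Longrightarrow> shift a z \<in> Units A"
  using Units_shift_lower_pos[OF ac hermitian_lower[OF herm], of z] hermitian_lower[OF herm, of z] by simp

text \<open>Formally the integrand is \<open>f (exp (it(z - a)))\<close>, whose exponential is
  integrated by dividing by \<open>\<i> * (z - a)\<close>.\<close>

lemma resolvent_derivative:
  assumes z: "Im z \<noteq> 0"
  shows "((\<lambda>t. - \<i> * exp (\<i> * z * of_real t) * f (expi a (- t) \<otimes> inv (shift a z))) has_vector_derivative
     exp (\<i> * z * of_real t) * f (expi a (- t))) (at t)"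
proof -
  let ?R = "inv (shift a z)"
  have R: "?R \<in> carrier A" using resolvent_Units[OF z] by simp
  have neg: "((\<lambda>t::real. - t) has_vector_derivative - 1) (at t)"
    by (auto intro!: derivative_eq_intros)
  have D: "((\<lambda>t. f (expi a (- t) \<otimes> ?R)) has_vector_derivative - (\<i> * f ((a \<otimes> expi a (- t)) \<otimes> ?R))) (at t)"
    using vector_diff_chain_at[OF neg expi_has_derivative[OF ac dual_mult_right[OF fd R]]]
    by (simp add: o_def)
  have "((\<lambda>t. \<i> * z * of_real t) has_vector_derivative \<i> * z) (at t)"
    by (auto intro!: derivative_eq_intros)
  from field_vector_diff_chain_at[OF this DERIV_exp]
  have E: "((\<lambda>t. exp (\<i> * z * of_real t)) has_vector_derivative \<i> * z * exp (\<i> * z * of_real t)) (at t)"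
    by (simp add: o_def)
  have "f (expi a (- t)) = f (expi a (- t) \<otimes> (shift a z \<otimes> ?R))"
    using resolvent_Units[OF z] ac by simp
  also have "\<dots> = z * f (expi a (- t) \<otimes> ?R) - f ((a \<otimes> expi a (- t)) \<otimes> ?R)"
    using ac R fd
    by (simp add: shift_mult expi_commute m_assoc r_distr minus_eq r_minus smult_mult_right)
      (simp add: minus_eq[symmetric] dual_diff dual_smult)
  finally have eq: "f (expi a (- t)) = z * f (expi a (- t) \<otimes> ?R) - f ((a \<otimes> expi a (- t)) \<otimes> ?R)" .
  have "((\<lambda>t. - \<i> * (exp (\<i> * z * of_real t) * f (expi a (- t) \<otimes> ?R))) has_vector_derivative
     - \<i> * (exp (\<i> * z * of_real t) * - (\<i> * f ((a \<otimes> expi a (- t)) \<otimes> ?R)) + \<i> * z * exp (\<i> * z * of_real t) * f (expi a (- t) \<otimes> ?R))) (at t)"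
    by (rule has_vector_derivative_mult_right[OF has_vector_derivative_mult[OF E D]])
  moreover have "- \<i> * (exp (\<i> * z * of_real t) * - (\<i> * f ((a \<otimes> expi a (- t)) \<otimes> ?R)) + \<i> * z * exp (\<i> * z * of_real t) * f (expi a (- t) \<otimes> ?R))
     = exp (\<i> * z * of_real t) * f (expi a (- t))"
    unfolding eq by (simp add: algebra_simps)
  ultimately show ?thesis by (simp only: mult.assoc)
qed

text \<open>The group is bounded by 1, while the scalar exponential has modulus
  \<open>exp (- (Im z * b n))\<close>. The formulation covers the upper half-plane at plus infinity
  and the lower one at minus infinity.\<close>

lemma resolvent_primitive_tendsto:
  assumes z: "Im z \<noteq> 0" and lim: "filterlim (\<lambda>n. Im z * b n) at_top sequentially"
  shows "(\<lambda>n. - \<i> * exp (\<i> * z * of_real (b n)) * f (expi a (- b n) \<otimes> inv (shift a z))) \<longlonglongrightarrow> 0"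
proof (rule Lim_null_comparison)
  let ?R = "inv (shift a z)"
  have R: "?R \<in> carrier A" using resolvent_Units[OF z] by simp
  have "cmod (f (expi a t \<otimes> ?R)) \<le> nrm A ?R" for t
  proof -
    have "cmod (f (expi a t \<otimes> ?R)) \<le> nrm A (expi a t) * nrm A ?R"
      using contraction_functional_le[OF f, of "expi a t \<otimes> ?R"] nrm_mult[of "expi a t" ?R] ac R by simp
    also have "\<dots> \<le> 1 * nrm A ?R"
      using hermitian_expi_norm[OF herm] nrm_nonneg[OF R] by (intro mult_right_mono) auto
    finally show ?thesis by simp
  qed
  then show "\<forall>\<^sub>F n in sequentially. norm (- \<i> * exp (\<i> * z * of_real (b n)) * f (expi a (- b n) \<otimes> ?R)) \<le> exp (- (Im z * b n)) * nrm A ?R"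
    by (intro always_eventually allI) (simp add: norm_mult mult_left_mono)
  have "(\<lambda>n. exp (- (Im z * b n))) \<longlonglongrightarrow> 0"
    using lim by (intro filterlim_compose[OF exp_at_bot]) (simp add: filterlim_uminus_at_top)
  from tendsto_mult_left_zero[OF this]
  show "(\<lambda>n. exp (- (Im z * b n)) * nrm A ?R) \<longlonglongrightarrow> 0" .
qed

text \<open>On each half-line \<open>iexp (x * t)\<close> and the damping merge into
  \<open>exp (\<i> * z * t)\<close> with \<open>z = x + \<i> * \<epsilon>\<close> for positive
  \<open>t\<close> and \<open>z = x - \<i> * \<epsilon>\<close> for negative \<open>t\<close>. The
  primitive vanishes at infinity and contributes a resolvent at 0.\<close>

lemma fourier_damped:
  defines "R z \<equiv> f (inv (shift a z))"
  shows "fourier damped x = \<i> * R (Complex x \<epsilon>) - \<i> * R (Complex x (- \<epsilon>))"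
proof -
  let ?z = "Complex x \<epsilon>" and ?z' = "Complex x (- \<epsilon>)"
  let ?g = "\<lambda>z t. exp (\<i> * z * of_real t) * f (expi a (- t))"
  let ?F = "\<lambda>z t. - \<i> * exp (\<i> * z * of_real t) * f (expi a (- t) \<otimes> inv (shift a z))"
  let ?d = "\<lambda>t. iexp (x * t) * damped t"
  have int: "integrable lborel ?d"
    by (rule Bochner_Integration.integrable_bound[OF damped_integrable])
      (use borel_measurable_integrable[OF damped_integrable] in \<open>auto simp: norm_mult\<close>)
  have contg: "continuous_on UNIV (?g z)" for z
  proof -
    have "continuous_on UNIV (\<lambda>t. f (expi a (- t)))"
      by (rule continuous_on_compose2[OF expi_functional_continuous[OF herm fd, of UNIV]]) (auto intro!: continuous_intros)
    then show ?thesis by (intro continuous_intros continuous_on_of_real)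
  qed
  have e1: "exp (\<i> * ?z * of_real t) = iexp (x * t) * exp (- \<epsilon> * \<bar>t\<bar>)" if "t \<ge> 0" for t
  proof -
    have "\<i> * ?z * of_real t = \<i> * of_real (x * t) + of_real (- \<epsilon> * \<bar>t\<bar>)"
      using that by (simp add: complex_eq_iff)
    then show ?thesis by (simp only: exp_add exp_of_real)
  qed
  have e2: "exp (\<i> * ?z' * of_real t) = iexp (x * t) * exp (- \<epsilon> * \<bar>t\<bar>)" if "t \<le> 0" for t
  proof -
    have "\<i> * ?z' * of_real t = \<i> * of_real (x * t) + of_real (- \<epsilon> * \<bar>t\<bar>)"
      using that by (simp add: complex_eq_iff)
    then show ?thesis by (simp only: exp_add exp_of_real)
  qed
  have g1: "indicator {0..} t *\<^sub>R ?d t = indicator {0..} t *\<^sub>R ?g ?z t" for t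
  proof (cases "0 \<le> t")
    case True
    show ?thesis unfolding e1[OF True] damped_def by (simp only: mult.assoc)
  qed simp
  have g2: "indicator {..0} t *\<^sub>R ?d t = indicator {..0} t *\<^sub>R ?g ?z' t" for t
  proof (cases "t \<le> 0")
    case True
    show ?thesis unfolding e2[OF True] damped_def by (simp only: mult.assoc)
  qed simp
  have int1: "integrable lborel (\<lambda>t. indicator {0..} t *\<^sub>R ?d t)"
    and int2: "integrable lborel (\<lambda>t. indicator {..0} t *\<^sub>R ?d t)"
    by (intro integrable_mult_indicator int; simp)+
  have nz: "Im ?z \<noteq> 0" "Im ?z' \<noteq> 0" using \<epsilon> by auto
  have R1: "?F z 0 = - \<i> * R z" if "Im z \<noteq> 0" for z
    using resolvent_Units[OF that] ac by (simp add: R_def expi_zero)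
  have I1: "(LINT t|lborel. indicator {0..} t *\<^sub>R ?d t) = \<i> * R ?z"
    unfolding g1
  proof (rule integral_FTC_limit[where F = "?F ?z" and a = "\<lambda>n. 0" and b = "\<lambda>n. real n"])
    show "(?F ?z has_vector_derivative ?g ?z t) (at t)" for t by (rule resolvent_derivative[OF nz(1)])
    have "filterlim (\<lambda>n. Im ?z * real n) at_top sequentially"
      using \<epsilon> by (simp add: filterlim_tendsto_pos_mult_at_top[OF tendsto_const] filterlim_real_sequentially)
    from tendsto_diff[OF resolvent_primitive_tendsto[OF nz(1) this] tendsto_const[of "?F ?z 0"]]
    show "(\<lambda>n. ?F ?z (real n) - ?F ?z 0) \<longlonglongrightarrow> \<i> * R ?z"
      unfolding R1[OF nz(1)] by simp
    have ev: "\<forall>\<^sub>F n in sequentially. x \<le> real n" for x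
      using filterlim_real_sequentially by (simp add: filterlim_at_top)
    show "(x \<in> {0..}) = (\<forall>\<^sub>F n in sequentially. x \<in> {0..real n})" for x
    proof
      assume "x \<in> {0..}"
      with ev[of x] show "\<forall>\<^sub>F n in sequentially. x \<in> {0..real n}" by (auto elim!: eventually_mono)
    next
      assume "\<forall>\<^sub>F n in sequentially. x \<in> {0..real n}"
      then have "\<forall>\<^sub>F n::nat in sequentially. x \<in> {0..}" by eventually_elim auto
      then show "x \<in> {0..}" by (simp add: eventually_const_iff)
    qed
    show "(x \<notin> {0..}) = (\<forall>\<^sub>F n in sequentially. x \<notin> {0..real n})" for x
    proof
      assume "\<forall>\<^sub>F n in sequentially. x \<notin> {0..real n}"
      with ev[of x] have "\<forall>\<^sub>F n::nat in sequentially. x \<notin> {0..}" by eventually_elim auto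
      then show "x \<notin> {0..}" by (simp add: eventually_const_iff)
    qed auto
    show "integrable lborel (\<lambda>t. indicator {0..} t *\<^sub>R ?g ?z t)" using int1 by (simp only: g1)
  qed (use contg in auto)
  have I2: "(LINT t|lborel. indicator {..0} t *\<^sub>R ?d t) = - \<i> * R ?z'"
    unfolding g2
  proof (rule integral_FTC_limit[where F = "?F ?z'" and a = "\<lambda>n. - real n" and b = "\<lambda>n. 0"])
    show "(?F ?z' has_vector_derivative ?g ?z' t) (at t)" for t by (rule resolvent_derivative[OF nz(2)])
    have "filterlim (\<lambda>n. Im ?z' * - real n) at_top sequentially"
      using \<epsilon> by (simp add: filterlim_tendsto_pos_mult_at_top[OF tendsto_const] filterlim_real_sequentially)
    from tendsto_diff[OF tendsto_const[of "?F ?z' 0"] resolvent_primitive_tendsto[OF nz(2) this]]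
    show "(\<lambda>n. ?F ?z' 0 - ?F ?z' (- real n)) \<longlonglongrightarrow> - \<i> * R ?z'"
      unfolding R1[OF nz(2)] by simp
    have ev: "\<forall>\<^sub>F n in sequentially. - x \<le> real n" for x
      using filterlim_real_sequentially by (simp add: filterlim_at_top)
    show "(x \<in> {..0}) = (\<forall>\<^sub>F n in sequentially. x \<in> {- real n..0})" for x
    proof
      assume "x \<in> {..0}"
      with ev[of x] show "\<forall>\<^sub>F n in sequentially. x \<in> {- real n..0}" by (auto elim!: eventually_mono)
    next
      assume "\<forall>\<^sub>F n in sequentially. x \<in> {- real n..0}"
      then have "\<forall>\<^sub>F n::nat in sequentially. x \<in> {..0}" by eventually_elim auto
      then show "x \<in> {..0}" by (simp add: eventually_const_iff)
    qed
    show "(x \<notin> {..0}) = (\<forall>\<^sub>F n in sequentially. x \<notin> {- real n..0})" for x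
    proof
      assume "\<forall>\<^sub>F n in sequentially. x \<notin> {- real n..0}"
      with ev[of x] have "\<forall>\<^sub>F n::nat in sequentially. x \<notin> {..0}" by eventually_elim auto
      then show "x \<notin> {..0}" by (simp add: eventually_const_iff)
    qed auto
    show "integrable lborel (\<lambda>t. indicator {..0} t *\<^sub>R ?g ?z' t)" using int2 by (simp only: g2)
  qed (use contg in auto)
  have "fourier damped x = (LINT t|lborel. indicator {0..} t *\<^sub>R ?d t + indicator {..0} t *\<^sub>R ?d t)"
    unfolding fourier_def
  proof (rule integral_cong_AE)
    \<comment> \<open>Both half-lines contain 0, a null set.\<close>
    show "AE t in lborel. ?d t = indicator {0..} t *\<^sub>R ?d t + indicator {..0} t *\<^sub>R ?d t"
      using AE_lborel_singleton[of 0] by eventually_elim (auto simp: indicator_def)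
  qed (use int int1 int2 in auto)
  also have "\<dots> = \<i> * R ?z - \<i> * R ?z'"
    unfolding Bochner_Integration.integral_add[OF int1 int2] I1 I2 by simp
  finally show ?thesis .
qed

text \<open>By the resolvent identity the difference of the two resolvents is their product times
  the distance \<open>2 * \<epsilon>\<close> of the two points, and each norm is at most the
  reciprocal of \<open>lower\<close>.\<close>

lemma fourier_damped_lower:
  "cmod (fourier damped x) * (lower a (Complex x \<epsilon>) * lower a (Complex x (- \<epsilon>))) \<le> 2 * \<epsilon>"
proof -
  let ?z = "Complex x \<epsilon>" and ?z' = "Complex x (- \<epsilon>)"
  have u: "shift a ?z \<in> Units A" "shift a ?z' \<in> Units A" using \<epsilon> by (auto intro!: resolvent_Units)
  let ?R = "inv (shift a ?z)" and ?R' = "inv (shift a ?z')"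
  have R: "?R \<in> carrier A" "?R' \<in> carrier A" using u by auto
  have "?R \<ominus> ?R' = (?z' - ?z) \<odot> (?R \<otimes> ?R')"
  proof -
    have "shift a ?z = shift a ?z' \<ominus> (?z' - ?z) \<odot> \<one>" by (rule shift_diff[OF ac])
    then have "\<one> = ?R \<otimes> (shift a ?z' \<ominus> (?z' - ?z) \<odot> \<one>)" using Units_l_inv[OF u(1)] by simp
    then have "?R' = ?R \<otimes> (shift a ?z' \<ominus> (?z' - ?z) \<odot> \<one>) \<otimes> ?R'" using R by simp
    also have "\<dots> = ?R \<otimes> shift a ?z' \<otimes> ?R' \<ominus> (?z' - ?z) \<odot> (?R \<otimes> ?R')"
      using R ac by (simp add: minus_eq r_distr l_distr r_minus l_minus smult_mult_right smult_mult_left)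
    also have "?R \<otimes> shift a ?z' \<otimes> ?R' = ?R"
      using R ac u(2) by (simp add: m_assoc)
    finally have eq: "?R' = ?R \<ominus> (?z' - ?z) \<odot> (?R \<otimes> ?R')" .
    have "?R \<ominus> (?R \<ominus> y) = y" if "y \<in> carrier A" for y
      using R that by algebra
    from this[of "(?z' - ?z) \<odot> (?R \<otimes> ?R')"] show ?thesis using R eq[symmetric] by simp
  qed
  then have eq: "f ?R - f ?R' = (?z' - ?z) * f (?R \<otimes> ?R')"
    using dual_diff[OF fd R] dual_smult[OF fd] R by simp
  have "cmod (?z' - ?z) = 2 * \<epsilon>"
  proof -
    have "?z' - ?z = - 2 * \<i> * of_real \<epsilon>" by (simp add: complex_eq_iff)
    then show ?thesis using \<epsilon> by (simp add: norm_mult)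
  qed
  then have "cmod (fourier damped x) = 2 * \<epsilon> * cmod (f (?R \<otimes> ?R'))"
    using eq by (simp add: fourier_damped right_diff_distrib[symmetric] norm_mult)
  also have "\<dots> \<le> 2 * \<epsilon> * (nrm A ?R * nrm A ?R')"
    using contraction_functional_le[OF f, of "?R \<otimes> ?R'"] nrm_mult[OF R] R \<epsilon> by (intro mult_left_mono) auto
  finally have "cmod (fourier damped x) * (lower a ?z * lower a ?z') \<le>
      2 * \<epsilon> * (nrm A ?R * nrm A ?R') * (lower a ?z * lower a ?z')"
    by (intro mult_right_mono mult_nonneg_nonneg lower_nonneg ac)
  also have "\<dots> = 2 * \<epsilon> * ((nrm A ?R * lower a ?z) * (nrm A ?R' * lower a ?z'))" by (simp add: mult_ac)
  also have "\<dots> \<le> 2 * \<epsilon> * (1 * 1)"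
    using \<epsilon> R by (intro mult_left_mono mult_mono lower_Units(2) ac u mult_nonneg_nonneg nrm_nonneg lower_nonneg) auto
  finally show ?thesis by simp
qed

text \<open>Linear growth of \<open>lower\<close> on both lines gives an integrable majorant. Its
  factor \<epsilon> is what makes the kernel vanish in the limit wherever \<kappa> can be kept
  fixed.\<close>

lemma fourier_damped_decay:
  assumes \<kappa>: "\<kappa> > 0" and low: "\<kappa> * (1 + \<bar>x\<bar>) \<le> lower a (Complex x \<epsilon>)" "\<kappa> * (1 + \<bar>x\<bar>) \<le> lower a (Complex x (- \<epsilon>))"
  shows "cmod (fourier damped x) \<le> (2 * \<epsilon> / \<kappa>\<^sup>2) / (1 + x\<^sup>2)"
proof -
  have "\<kappa>\<^sup>2 * (1 + x\<^sup>2) \<le> (\<kappa> * (1 + \<bar>x\<bar>)) * (\<kappa> * (1 + \<bar>x\<bar>))"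
  proof -
    have "1 + x\<^sup>2 \<le> (1 + \<bar>x\<bar>)\<^sup>2" by (simp add: power2_sum)
    then have "\<kappa>\<^sup>2 * (1 + x\<^sup>2) \<le> \<kappa>\<^sup>2 * (1 + \<bar>x\<bar>)\<^sup>2" by (intro mult_left_mono) auto
    then show ?thesis by (simp add: power2_eq_square mult_ac)
  qed
  also have "\<dots> \<le> lower a (Complex x \<epsilon>) * lower a (Complex x (- \<epsilon>))"
    using \<kappa> low by (intro mult_mono lower_nonneg ac) auto
  finally have "cmod (fourier damped x) * (\<kappa>\<^sup>2 * (1 + x\<^sup>2)) \<le> cmod (fourier damped x) * (lower a (Complex x \<epsilon>) * lower a (Complex x (- \<epsilon>)))"
    by (intro mult_left_mono) auto
  also have "\<dots> \<le> 2 * \<epsilon>" by (rule fourier_damped_lower)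
  finally show ?thesis
    using \<kappa> by (simp add: divide_simps add_pos_nonneg mult_ac)
qed

lemma fourier_damped_integrable: "integrable lborel (fourier damped)"
proof -
  define Q where "Q = nrm A a"
  have Q: "Q \<ge> 0" using nrm_nonneg[OF ac] by (simp add: Q_def)
  \<comment> \<open>The slope for which \<open>\<kappa> * (1 + \<bar>x\<bar>)\<close> reaches
    \<epsilon> at \<open>\<bar>x\<bar> = Q + \<epsilon>\<close>: up to there the imaginary part
    bounds \<open>lower\<close>, beyond it the growth \<open>\<bar>x\<bar> - Q\<close> does.\<close>
  define \<kappa> where "\<kappa> = \<epsilon> / (1 + Q + \<epsilon>)"
  have \<kappa>: "\<kappa> > 0" "\<kappa> \<le> 1" "\<kappa> * (1 + Q + \<epsilon>) = \<epsilon>" using \<epsilon> Q by (auto simp: \<kappa>_def divide_simps)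
  have low: "\<kappa> * (1 + \<bar>x\<bar>) \<le> lower a z" if z: "\<bar>Im z\<bar> = \<epsilon>" "Re z = x" for x z
  proof (cases "\<bar>x\<bar> \<le> Q + \<epsilon>")
    case True
    then have "\<kappa> * (1 + \<bar>x\<bar>) \<le> \<kappa> * (1 + Q + \<epsilon>)" using \<kappa> by (intro mult_left_mono) auto
    then show ?thesis using hermitian_lower[OF herm, of z] z \<kappa>(3) by simp
  next
    case False
    have "\<kappa> * (1 + \<bar>x\<bar>) = \<epsilon> + \<kappa> * (\<bar>x\<bar> - Q - \<epsilon>)" using \<kappa>(3) by (simp add: algebra_simps)
    also have "\<dots> \<le> \<epsilon> + 1 * (\<bar>x\<bar> - Q - \<epsilon>)" using False \<kappa> by (intro add_left_mono mult_right_mono) auto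
    also have "\<dots> \<le> cmod z - Q" using abs_Re_le_cmod[of z] z by simp
    also have "\<dots> \<le> lower a z" unfolding Q_def by (rule lower_large[OF ac])
    finally show ?thesis .
  qed
  show ?thesis
  proof (rule Bochner_Integration.integrable_bound[OF integrable_inverse_square[of "2 * \<epsilon> / \<kappa>\<^sup>2"]])
    show "fourier damped \<in> borel_measurable lborel" using fourier_measurable[OF damped_integrable] by simp
    have "cmod (fourier damped x) \<le> 2 * \<epsilon> / \<kappa>\<^sup>2 / (1 + x\<^sup>2)" for x
      using \<epsilon> by (intro fourier_damped_decay \<kappa> low) auto
    then show "AE x in lborel. norm (fourier damped x) \<le> norm (2 * \<epsilon> / \<kappa>\<^sup>2 / (1 + x\<^sup>2))"
      unfolding real_norm_def by (intro AE_I2 order_trans[OF _ abs_ge_self])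
  qed
qed

lemma fourier_damped_inversion:
  "(LINT x|lborel. fourier damped x * iexp (x * s)) = 2 * pi * (exp (- \<epsilon> * \<bar>s\<bar>) * f (expi a s))"
  using fourier_inversion[OF damped_integrable damped_continuous damped_bound fourier_damped_integrable, of "- s"]
  by (simp add: damped_def)

end

end


section \<open>Localization at the spectrum and the norm of F(a)\<close>

context complex_unital_banach_algebra
begin

context
  fixes a
  assumes herm: "a \<in> hermitian_elements A"
begin

private lemma herm_carrier: "a \<in> carrier A"
  by (rule hermitian_closed[OF herm])

lemma lower_continuous: "continuous_on S (\<lambda>x::real. lower a (of_real x))"
proof (rule continuous_on_subset[OF lipschitz_on_continuous_on[of 1]])
  show "1-lipschitz_on UNIV (\<lambda>x::real. lower a (of_real x))"
  proof (rule lipschitz_onI)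
    fix x y :: real
    have "cmod (of_real y - of_real x) = \<bar>y - x\<bar>" by (metis norm_of_real of_real_diff)
    then show "dist (lower a (of_real x)) (lower a (of_real y)) \<le> 1 * dist x y"
      using lower_lipschitz[OF herm_carrier, of "of_real x" "of_real y"] lower_lipschitz[OF herm_carrier, of "of_real y" "of_real x"]
      by (simp add: dist_real_def norm_minus_commute abs_minus_commute abs_le_iff)
  qed simp
qed simp

text \<open>For \<open>\<bar>x\<bar>\<close> up to \<open>Q + 1\<close> the continuous function
  \<open>lower\<close> has a positive minimum on the compact complement of \<open>U\<close>; beyond,
  \<open>lower_large\<close> gives linear growth. Dividing by \<open>2 + Q\<close> fits both into
  one linear bound.\<close>

lemma lower_away_from_spectrum:
  assumes U: "open U" "spectrum A a \<subseteq> of_real ` U"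
  obtains \<kappa> where "\<kappa> > 0" "\<And>x. x \<notin> U \<Longrightarrow> \<kappa> * (1 + \<bar>x\<bar>) \<le> lower a (of_real x)"
proof -
  define Q where "Q = nrm A a"
  have Q: "Q \<ge> 0" using nrm_nonneg[OF herm_carrier] by (simp add: Q_def)
  define K where "K = {- (Q + 1)..Q + 1} - U"
  have K: "compact K" unfolding K_def using U(1) by (intro compact_diff) auto
  have pos: "0 < lower a (of_real x)" if "x \<notin> U" for x
  proof -
    have "complex_of_real x \<notin> spectrum A a" using that U(2) by auto
    then show ?thesis
      using hermitian_spectrum_iff[OF herm] lower_nonneg[OF herm_carrier, of "of_real x"] by force
  qed
  obtain \<delta> where \<delta>: "0 < \<delta>" "\<delta> \<le> 1" "\<And>x. x \<in> K \<Longrightarrow> \<delta> \<le> lower a (of_real x)"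
  proof (cases "K = {}")
    case True
    then show ?thesis using that[of 1] by auto
  next
    case False
    obtain x0 where "x0 \<in> K" "\<forall>y\<in>K. lower a (of_real x0) \<le> lower a (of_real y)"
      using continuous_attains_inf[OF K False lower_continuous] by blast
    then show ?thesis using that[of "min 1 (lower a (of_real x0))"] pos by (fastforce simp: K_def)
  qed
  define \<kappa> where "\<kappa> = \<delta> / (2 + Q)"
  have \<kappa>: "\<kappa> > 0" "\<kappa> \<le> 1" "\<kappa> * (2 + Q) = \<delta>" using \<delta> Q by (auto simp: \<kappa>_def divide_simps)
  show thesis
  proof (rule that[OF \<kappa>(1)])
    fix x assume x: "x \<notin> U"
    show "\<kappa> * (1 + \<bar>x\<bar>) \<le> lower a (of_real x)"
    proof (cases "\<bar>x\<bar> \<le> Q + 1")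
      case True
      then have "\<kappa> * (1 + \<bar>x\<bar>) \<le> \<kappa> * (2 + Q)" using \<kappa> by (intro mult_left_mono) auto
      moreover have "x \<in> K" using True x by (auto simp: K_def)
      ultimately show ?thesis using \<delta>(3) \<kappa>(3) by fastforce
    next
      case False
      have "\<kappa> * (1 + \<bar>x\<bar>) = \<delta> + \<kappa> * (\<bar>x\<bar> - Q - 1)" using \<kappa>(3) by (simp add: algebra_simps)
      also have "\<dots> \<le> 1 + 1 * (\<bar>x\<bar> - Q - 1)" using False \<kappa> \<delta> by (intro add_mono mult_right_mono) auto
      also have "\<dots> \<le> lower a (of_real x)" using lower_large[OF herm_carrier, of "of_real x"] by (simp add: Q_def)
      finally show ?thesis .
    qed
  qed
qed

text \<open>The Poisson kernels \<open>fourier (damped a f \<epsilon>)\<close> reproduce \<open>f (exp (i t a))\<close> and converge to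
  zero in \<open>L\<^sup>1\<close> off every neighbourhood of the spectrum as \<open>\<epsilon> \<rightarrow> 0\<close>. Hence the integral only depends on the
  values of the transform near the spectrum.\<close>

theorem expi_integral_localization:
  fixes h :: "real \<Rightarrow> complex" and f :: "'a \<Rightarrow> complex"
  assumes \<nu>: "finite_measure \<nu>" "sets \<nu> = sets borel" and h: "integrable \<nu> h"
    and f: "contraction_functional f"
    and U: "open U" "spectrum A a \<subseteq> of_real ` U"
    and \<Phi>: "\<Phi> \<in> borel_measurable borel" "\<And>x. cmod (\<Phi> x) \<le> M"
    and eq: "\<And>x. x \<in> U \<Longrightarrow> \<Phi> x = (LINT s|\<nu>. iexp (x * s) * h s)"
  defines "d \<equiv> \<lambda>n. 1 / real (Suc n)"
  shows "(\<lambda>n. LINT x|lborel. fourier (damped a f (d n)) x * \<Phi> x) \<longlonglongrightarrow> 2 * pi * (LINT s|\<nu>. f (expi a s) * h s)"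
proof -
  interpret \<nu>: finite_measure \<nu> by fact
  have [measurable_cong]: "sets \<nu> = sets borel" by fact
  have hm [measurable]: "h \<in> borel_measurable borel" using h \<nu>(2) by (metis borel_measurable_integrable measurable_cong_sets)
  have fm [measurable]: "(\<lambda>s. f (expi a s)) \<in> borel_measurable borel"
    by (intro borel_measurable_continuous_onI expi_functional_continuous[OF herm] contraction_functional_dual f)
  note \<Phi>(1)[measurable]
  have d: "d n > 0" for n by (simp add: d_def)
  have d0: "d \<longlonglongrightarrow> 0" unfolding d_def by real_asymp
  note fint = fourier_damped_integrable[OF herm f d]
  have [measurable]: "fourier (damped a f (d n)) \<in> borel_measurable borel" for n using fint[of n] by auto
  define G where "G x = (LINT s|\<nu>. iexp (x * s) * h s)" for x
  define H where "H = (LINT s|\<nu>. cmod (h s))"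
  have Gm [measurable]: "G \<in> borel_measurable borel" unfolding G_def by measurable
  have GH: "cmod (G x) \<le> H" for x
    unfolding G_def H_def
  proof (rule Bochner_Integration.integral_norm_bound_integral)
    show "integrable \<nu> (\<lambda>s. iexp (x * s) * h s)"
      by (rule Bochner_Integration.integrable_bound[OF h]) (auto simp: norm_mult)
  qed (use h in \<open>auto simp: norm_mult\<close>)
  have int_bd: "integrable lborel (\<lambda>x. fourier (damped a f (d n)) x * g x)"
    if [measurable]: "g \<in> borel_measurable borel" and "\<And>x. cmod (g x) \<le> C" for g C n
  proof (rule Bochner_Integration.integrable_bound)
    show "integrable lborel (\<lambda>x. C * cmod (fourier (damped a f (d n)) x))" using fint[of n] by auto
    have "norm (fourier (damped a f (d n)) x * g x) \<le> C * cmod (fourier (damped a f (d n)) x)" for x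
      using that(2)[of x] by (simp add: norm_mult mult.commute mult_right_mono)
    then show "AE x in lborel. norm (fourier (damped a f (d n)) x * g x) \<le> norm (C * cmod (fourier (damped a f (d n)) x))"
      unfolding real_norm_def by (intro AE_I2 order_trans[OF _ abs_ge_self])
  qed measurable
  have rep: "(LINT x|lborel. fourier (damped a f (d n)) x * G x) = 2 * pi * (LINT s|\<nu>. exp (- d n * \<bar>s\<bar>) * (f (expi a s) * h s))" for n
  proof -
    interpret P: pair_sigma_finite lborel \<nu> by unfold_locales
    have "(LINT x|lborel. fourier (damped a f (d n)) x * G x) =
       (LINT s|\<nu>. (LINT x|lborel. fourier (damped a f (d n)) x * iexp (x * s)) * h s)"
      unfolding G_def by (rule P.Fubini_bounded_kernel[OF fint h]) auto
    also have "\<dots> = (LINT s|\<nu>. complex_of_real (2 * pi) * (exp (- d n * \<bar>s\<bar>) * (f (expi a s) * h s)))"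
      by (simp only: fourier_damped_inversion[OF herm f d] mult.assoc)
    finally show ?thesis by simp
  qed
  \<comment> \<open>For the true transform \<open>G\<close> in place of \<Phi>, Fubini and inversion
    turn the integral into the damped version of the target, and the damping tends to 1.\<close>
  have lim1: "(\<lambda>n. LINT x|lborel. fourier (damped a f (d n)) x * G x) \<longlonglongrightarrow> 2 * pi * (LINT s|\<nu>. f (expi a s) * h s)"
    unfolding rep
  proof (intro tendsto_intros integral_dominated_convergence[of _ _ _ "\<lambda>s. cmod (h s)"])
    show "AE s in \<nu>. (\<lambda>n. complex_of_real (exp (- d n * \<bar>s\<bar>)) * (f (expi a s) * h s)) \<longlonglongrightarrow> f (expi a s) * h s"
    proof (rule AE_I2)
      fix s
      have "(\<lambda>n. complex_of_real (exp (- d n * \<bar>s\<bar>)) * (f (expi a s) * h s)) \<longlonglongrightarrow> complex_of_real (exp (- 0 * \<bar>s\<bar>)) * (f (expi a s) * h s)"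
        by (intro tendsto_intros d0)
      then show "(\<lambda>n. complex_of_real (exp (- d n * \<bar>s\<bar>)) * (f (expi a s) * h s)) \<longlonglongrightarrow> f (expi a s) * h s" by simp
    qed
    have "exp (- d n * \<bar>s\<bar>) * (cmod (f (expi a s)) * cmod (h s)) \<le> 1 * (1 * cmod (h s))" for n s
      using d[of n] hermitian_expi_functional[OF herm f, of s] by (intro mult_mono mult_right_mono) auto
    then show "AE s in \<nu>. norm (complex_of_real (exp (- d n * \<bar>s\<bar>)) * (f (expi a s) * h s)) \<le> cmod (h s)" for n
      by (auto simp: norm_mult)
  qed (use h in auto)
  obtain \<kappa> where \<kappa>: "\<kappa> > 0" "\<And>x. x \<notin> U \<Longrightarrow> \<kappa> * (1 + \<bar>x\<bar>) \<le> lower a (of_real x)"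
    using lower_away_from_spectrum[OF U] by metis
  define C where "C = (LINT x|lborel. (8 * (M + H) / \<kappa>\<^sup>2) / (1 + x\<^sup>2))"
  have MH: "0 \<le> M + H"
    using \<Phi>(2)[of 0] GH[of 0] norm_ge_zero[of "\<Phi> 0"] norm_ge_zero[of "G 0"] by linarith
  have lim2: "(\<lambda>n. LINT x|lborel. fourier (damped a f (d n)) x * (\<Phi> x - G x)) \<longlonglongrightarrow> 0"
  proof (rule Lim_null_comparison)
    \<comment> \<open>Leaving the real axis by \<open>d n\<close> then costs at most half of the
      lower bound. The remaining constant \<open>\<kappa> / 2\<close> turns the factor 2 of the
      decay estimate into the 8 in \<open>C\<close>.\<close>
    have "\<forall>\<^sub>F n in sequentially. d n < \<kappa> / 2"
      using order_tendstoD(2)[OF d0, of "\<kappa> / 2"] \<kappa> by simp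
    then show "\<forall>\<^sub>F n in sequentially. norm (LINT x|lborel. fourier (damped a f (d n)) x * (\<Phi> x - G x)) \<le> d n * C"
    proof eventually_elim
      case (elim n)
      have bound: "norm (fourier (damped a f (d n)) x * (\<Phi> x - G x)) \<le> d n * ((8 * (M + H) / \<kappa>\<^sup>2) / (1 + x\<^sup>2))" for x
      proof (cases "x \<in> U")
        case True
        then have "\<Phi> x - G x = 0" using eq by (simp add: G_def)
        then show ?thesis using d[of n] MH by simp
      next
        case False
        have low: "\<kappa> / 2 * (1 + \<bar>x\<bar>) \<le> lower a z" if z: "\<bar>Im z\<bar> = d n" "Re z = x" for z
        proof -
          have "z - of_real x = \<i> * of_real (Im z)" using z by (simp add: complex_eq_iff)
          then have "cmod (z - of_real x) = d n" using z(1) by (simp add: norm_mult)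
          then have "lower a (of_real x) - d n \<le> lower a z"
            using lower_lipschitz[OF herm_carrier, of "of_real x" z] by simp
          moreover have "d n \<le> \<kappa> / 2 * (1 + \<bar>x\<bar>)"
          proof -
            have "\<kappa> / 2 * 1 \<le> \<kappa> / 2 * (1 + \<bar>x\<bar>)" using \<kappa>(1) by (intro mult_left_mono) auto
            then show ?thesis using elim by simp
          qed
          ultimately show ?thesis using \<kappa>(2)[OF False] by simp
        qed
        have "cmod (fourier (damped a f (d n)) x) \<le> (2 * d n / (\<kappa> / 2)\<^sup>2) / (1 + x\<^sup>2)"
          using \<kappa>(1) d[of n] by (intro fourier_damped_decay[OF herm f d] low) auto
        moreover have "cmod (\<Phi> x - G x) \<le> M + H"
          using norm_triangle_ineq4[of "\<Phi> x" "G x"] \<Phi>(2)[of x] GH[of x] by linarith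
        ultimately have "norm (fourier (damped a f (d n)) x * (\<Phi> x - G x)) \<le> (2 * d n / (\<kappa> / 2)\<^sup>2) / (1 + x\<^sup>2) * (M + H)"
          unfolding norm_mult using d[of n]
          by (intro mult_mono divide_nonneg_nonneg mult_nonneg_nonneg add_nonneg_nonneg) (auto intro: less_imp_le)
        also have "\<dots> = d n * ((8 * (M + H) / \<kappa>\<^sup>2) / (1 + x\<^sup>2))"
          by (simp add: power_divide)
        finally show ?thesis .
      qed
      have "norm (LINT x|lborel. fourier (damped a f (d n)) x * (\<Phi> x - G x)) \<le> (LINT x|lborel. d n * ((8 * (M + H) / \<kappa>\<^sup>2) / (1 + x\<^sup>2)))"
      proof (rule Bochner_Integration.integral_norm_bound_integral[OF _ _ bound])
        show "integrable lborel (\<lambda>x. fourier (damped a f (d n)) x * (\<Phi> x - G x))"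
        proof (rule int_bd)
          show "cmod (\<Phi> x - G x) \<le> M + H" for x
            using norm_triangle_ineq4[of "\<Phi> x" "G x"] \<Phi>(2)[of x] GH[of x] by linarith
        qed measurable
        show "integrable lborel (\<lambda>x. d n * ((8 * (M + H) / \<kappa>\<^sup>2) / (1 + x\<^sup>2)))"
          by (intro integrable_mult_right integrable_inverse_square)
      qed
      then show ?case by (simp only: C_def integral_mult_right_zero)
    qed
    show "(\<lambda>n. d n * C) \<longlonglongrightarrow> 0" using tendsto_mult_left_zero[OF d0] .
  qed
  have "(LINT x|lborel. fourier (damped a f (d n)) x * (\<Phi> x - G x)) + (LINT x|lborel. fourier (damped a f (d n)) x * G x)
     = (LINT x|lborel. fourier (damped a f (d n)) x * \<Phi> x)" for n
    using int_bd[OF \<Phi>] int_bd[OF Gm GH] by (simp add: right_diff_distrib)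
  with tendsto_add[OF lim2 lim1] show ?thesis by simp
qed

text \<open>If the spectrum were empty, localization would hold with \<open>U = {}\<close> and
  \<open>\<Phi> = 0\<close>. For the point mass at 0 it would give \<open>f \<one> = 0\<close>,
  although \<open>f\<close> was chosen with value 1 there.\<close>

lemma hermitian_spectrum_nonempty: "spectrum A a \<noteq> {}"
proof
  assume empty: "spectrum A a = {}"
  obtain f where f: "contraction_functional f" "f \<one> = of_real (nrm A \<one>)"
    using norming_functional[OF one_closed] .
  let ?\<nu> = "return borel (0::real)"
  have fm: "(\<lambda>s. f (expi a s)) \<in> borel_measurable borel"
    by (intro borel_measurable_continuous_onI expi_functional_continuous[OF herm] contraction_functional_dual f)
  have fin: "finite_measure ?\<nu>" by (intro prob_space.finite_measure prob_space_return) simp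
  then have "integrable ?\<nu> (\<lambda>_. 1::complex)" by (rule finite_measure.integrable_const)
  from expi_integral_localization[OF fin sets_return this f(1) open_empty, of "\<lambda>_. 0" 0]
  have "(\<lambda>n. LINT x|lborel. fourier (damped a f (1 / real (Suc n))) x * 0) \<longlonglongrightarrow> 2 * pi * (LINT s|?\<nu>. f (expi a s) * 1)"
    by (simp add: empty)
  then have "(LINT s|?\<nu>. f (expi a s)) = 0"
    by (simp add: LIMSEQ_const_iff)
  moreover have "(LINT s|?\<nu>. f (expi a s)) = f (expi a 0)"
    by (rule integral_return) (use fm in auto)
  ultimately show False using f(2) by (simp add: expi_zero[OF herm_carrier] nrm_one)
qed

lemma hermitian_spectrum_compact:
  obtains S where "compact S" "S \<noteq> {}" "spectrum A a = of_real ` S"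
    "\<And>x. x \<in> S \<longleftrightarrow> lower a (of_real x) = 0"
proof -
  define S where "S = {x::real. lower a (of_real x) = 0}"
  have spec: "spectrum A a = of_real ` S"
  proof
    show "spectrum A a \<subseteq> of_real ` S"
    proof
      fix z assume "z \<in> spectrum A a"
      then have z: "lower a z = 0" using hermitian_spectrum_iff[OF herm] by simp
      then have "Im z = 0" using hermitian_lower[OF herm, of z] by simp
      then have "z = of_real (Re z)" by (simp add: complex_eq_iff)
      with z show "z \<in> of_real ` S" unfolding S_def by (metis (mono_tags, lifting) imageI mem_Collect_eq)
    qed
  qed (auto simp: S_def hermitian_spectrum_iff[OF herm])
  have "closed S"
    using lower_continuous[of UNIV] continuous_closed_vimage[of "{0}" "\<lambda>x::real. lower a (of_real x)"]
    by (simp add: S_def vimage_def continuous_on_eq_continuous_at)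
  moreover have "bounded S"
  proof (rule boundedI)
    fix x assume "x \<in> S"
    then show "norm x \<le> nrm A a" using lower_large[OF herm_carrier, of "of_real x"] by (simp add: S_def)
  qed
  ultimately have "compact S" by (simp add: compact_eq_bounded_closed)
  moreover have "S \<noteq> {}" using hermitian_spectrum_nonempty spec by auto
  ultimately show thesis using that spec by (simp add: S_def)
qed

lemma hermitian_approximate_eigenvector:
  assumes "lower a z = 0" "\<delta> > 0"
  obtains y where "y \<in> carrier A" "nrm A y = 1" "nrm A (shift a z \<otimes> y) < \<delta>"
proof (rule ccontr)
  assume "\<not> thesis"
  then have "\<delta> \<le> lower a z"
    using that by (intro lower_greatest[OF herm_carrier]) (meson not_less)
  with assms show False by simp
qed

text \<open>Approximate eigenvectors \<open>y\<close> of \<open>a\<close> at \<open>x\<close> make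
  \<open>shift b l \<otimes> y\<close> small, because the group acts on them almost as the character
  does. This contradicts \<open>lower b l > 0\<close>, which invertibility would imply.\<close>

lemma symbol_value_in_spectrum:
  fixes h :: "real \<Rightarrow> complex"
  assumes \<nu>: "finite_measure \<nu>" "sets \<nu> = sets borel" and h: "integrable \<nu> h"
    and b: "b \<in> carrier A" "\<And>f. f \<in> dual_space A \<Longrightarrow> f b = (LINT t|\<nu>. f (expi a t) * h t)"
    and x: "lower a (of_real x) = 0"
  shows "(LINT t|\<nu>. iexp (x * t) * h t) \<in> spectrum A b"
proof (rule ccontr)
  interpret \<nu>: finite_measure \<nu> by fact
  have [measurable_cong]: "sets \<nu> = sets borel" by fact
  have hm [measurable]: "h \<in> borel_measurable borel" using h \<nu>(2) by (metis borel_measurable_integrable measurable_cong_sets)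
  define l where "l = (LINT t|\<nu>. iexp (x * t) * h t)"
  assume "l \<notin> spectrum A b"
  then have pos: "lower b l > 0" using lower_Units(1)[OF b(1)] by (simp add: spectrum_iff)
  \<comment> \<open>The bound by \<open>\<bar>t\<bar>\<close> times the eigenvector error tends to 0
    pointwise; capping it at the trivial bound 2 makes it dominated even if \<open>t * h t\<close>
    is not integrable.\<close>
  define e where "e n = (LINT t|\<nu>. min 2 (\<bar>t\<bar> * (1 / real (Suc n))) * cmod (h t))" for n
  have min_bd: "\<bar>min 2 (\<bar>t\<bar> * (1 / real (Suc n)))\<bar> \<le> 2" for t n by auto
  have e_int: "integrable \<nu> (\<lambda>t. min 2 (\<bar>t\<bar> * (1 / real (Suc n))) * cmod (h t))" for n
  proof (rule Bochner_Integration.integrable_bound[of _ "\<lambda>t. 2 * cmod (h t)"])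
    show "AE t in \<nu>. norm (min 2 (\<bar>t\<bar> * (1 / real (Suc n))) * cmod (h t)) \<le> norm (2 * cmod (h t))"
      unfolding real_norm_def abs_mult abs_norm_cancel using min_bd[of _ n] by (intro AE_I2 mult_right_mono) auto
  qed (use h in auto)
  have "e \<longlonglongrightarrow> (LINT t|\<nu>. 0)"
    unfolding e_def
  proof (rule integral_dominated_convergence[of _ _ _ "\<lambda>t. 2 * cmod (h t)"])
    show "AE t in \<nu>. (\<lambda>n. min 2 (\<bar>t\<bar> * (1 / real (Suc n))) * cmod (h t)) \<longlonglongrightarrow> 0"
    proof (rule AE_I2)
      fix t
      have "(\<lambda>n. 1 / real (Suc n)) \<longlonglongrightarrow> 0" by real_asymp
      then have "(\<lambda>n. min 2 (\<bar>t\<bar> * (1 / real (Suc n))) * cmod (h t)) \<longlonglongrightarrow> min 2 (\<bar>t\<bar> * 0) * cmod (h t)"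
        by (intro tendsto_intros)
      then show "(\<lambda>n. min 2 (\<bar>t\<bar> * (1 / real (Suc n))) * cmod (h t)) \<longlonglongrightarrow> 0" by simp
    qed
    show "AE t in \<nu>. norm (min 2 (\<bar>t\<bar> * (1 / real (Suc n))) * cmod (h t)) \<le> 2 * cmod (h t)" for n
      unfolding real_norm_def abs_mult abs_norm_cancel by (intro AE_I2 mult_right_mono min_bd) auto
  qed (use h in auto)
  then have e0: "e \<longlonglongrightarrow> 0" by simp
  have "lower b l \<le> e n" for n
  proof -
    obtain y where y: "y \<in> carrier A" "nrm A y = 1" "nrm A (shift a (of_real x) \<otimes> y) < 1 / real (Suc n)"
      using hermitian_approximate_eigenvector[OF x, of "1 / real (Suc n)"] by auto
    have "lower b l \<le> nrm A (shift b l \<otimes> y)" by (rule lower_le_unit[OF b(1) y(1,2)])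
    also have "\<dots> \<le> e n"
    proof (rule nrm_le_functional)
      fix f assume f: "contraction_functional f"
      note fd = contraction_functional_dual[OF f]
      have fm [measurable]: "(\<lambda>t. f (expi a t \<otimes> y)) \<in> borel_measurable borel"
        by (intro borel_measurable_continuous_onI expi_functional_continuous[OF herm] dual_mult_right fd y)
      have fy: "cmod (f y) \<le> 1" using contraction_functional_le[OF f y(1)] y by simp
      have fE: "cmod (f (expi a t \<otimes> y)) \<le> 1" for t
        using contraction_functional_le[OF f, of "expi a t \<otimes> y"] nrm_mult[of "expi a t" y] hermitian_expi_norm[OF herm, of t] y herm_carrier
        by simp
      have i1: "integrable \<nu> (\<lambda>t. f (expi a t \<otimes> y) * h t)"
        by (rule Bochner_Integration.integrable_bound[OF h]) (use fE in \<open>auto simp: norm_mult mult_left_le_one_le\<close>)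
      have i2: "integrable \<nu> (\<lambda>t. iexp (x * t) * f y * h t)"
        by (rule Bochner_Integration.integrable_bound[OF h]) (use fy in \<open>auto simp: norm_mult mult_left_le_one_le\<close>)
      have "f (shift b l \<otimes> y) = l * f y - f (b \<otimes> y)"
        using b(1) y(1) fd by (simp add: shift_mult dual_diff dual_smult)
      also have "f (b \<otimes> y) = (LINT t|\<nu>. f (expi a t \<otimes> y) * h t)"
        by (rule b(2)[OF dual_mult_right[OF fd y(1)]])
      also have "l * f y = (LINT t|\<nu>. iexp (x * t) * h t * f y)"
        unfolding l_def by simp
      also have "\<dots> = (LINT t|\<nu>. iexp (x * t) * f y * h t)"
        by (simp add: mult_ac)
      finally have eq: "f (shift b l \<otimes> y) = (LINT t|\<nu>. (iexp (x * t) * f y - f (expi a t \<otimes> y)) * h t)"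
        using Bochner_Integration.integral_diff[OF i2 i1] by (simp add: left_diff_distrib)
      show "cmod (f (shift b l \<otimes> y)) \<le> e n"
        unfolding eq e_def
      proof (rule Bochner_Integration.integral_norm_bound_integral[OF _ e_int])
        show "integrable \<nu> (\<lambda>t. (iexp (x * t) * f y - f (expi a t \<otimes> y)) * h t)"
          unfolding left_diff_distrib by (rule Bochner_Integration.integrable_diff[OF i2 i1])
        fix t
        have "cmod (iexp (x * t) * f y - f (expi a t \<otimes> y)) \<le> \<bar>t\<bar> * nrm A (shift a (of_real x) \<otimes> y)"
          using expi_eigen_bound[OF herm y(1) f, of t x] by (simp add: norm_minus_commute mult.commute)
        also have "\<dots> \<le> \<bar>t\<bar> * (1 / real (Suc n))" using y(3) by (intro mult_left_mono) auto
        finally have 1: "cmod (iexp (x * t) * f y - f (expi a t \<otimes> y)) \<le> \<bar>t\<bar> * (1 / real (Suc n))" .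
        have "cmod (iexp (x * t) * f y - f (expi a t \<otimes> y)) \<le> cmod (iexp (x * t) * f y) + cmod (f (expi a t \<otimes> y))"
          by (rule norm_triangle_ineq4)
        also have "\<dots> \<le> 1 + 1" using fy fE by (intro add_mono) (auto simp: norm_mult)
        finally have "cmod (iexp (x * t) * f y - f (expi a t \<otimes> y)) \<le> 2" by simp
        with 1 show "norm ((iexp (x * t) * f y - f (expi a t \<otimes> y)) * h t) \<le> min 2 (\<bar>t\<bar> * (1 / real (Suc n))) * cmod (h t)"
          unfolding norm_mult by (intro mult_right_mono) auto
      qed
    qed (use b y in auto)
    finally show ?thesis .
  qed
  then have "lower b l \<le> 0" by (intro LIMSEQ_le_const[OF e0]) auto
  with pos show False by simp
qed

lemma spectral_radius_bounds:
  assumes b: "b \<in> carrier A" and z: "z \<in> spectrum A b"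
  shows "cmod z \<le> spectral_radius A b" and "spectral_radius A b \<le> nrm A b"
proof -
  have le: "cmod w \<le> nrm A b" if "w \<in> spectrum A b" for w
    using that Units_shift_large[OF b, of w] unfolding spectrum_iff by fastforce
  show "cmod z \<le> spectral_radius A b"
    unfolding spectral_radius_def using le z by (intro cSUP_upper bdd_aboveI2[of _ _ "nrm A b"])
  show "spectral_radius A b \<le> nrm A b"
    unfolding spectral_radius_def using le z by (intro cSUP_least) auto
qed

text \<open>Localization replaces the transform by \<open>c * \<phi> (x - x0)\<close> on the whole
  line. Every approximating integral is then bounded by
  \<open>positive_definite_fourier_bound\<close> with \<open>W = 1\<close>, uniformly in the
  damping, and the factor \<open>2 * pi\<close> cancels.\<close>

lemma CH_symbol_bound:
  fixes h F \<phi> :: "real \<Rightarrow> complex" and f :: "'a \<Rightarrow> complex"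
  assumes \<nu>: "finite_measure \<nu>" "sets \<nu> = sets borel" and h: "integrable \<nu> h"
    and f: "contraction_functional f"
    and U: "open U" "spectrum A a \<subseteq> of_real ` U"
    and F: "\<And>x. x \<in> U \<Longrightarrow> F x = (LINT s|\<nu>. iexp (x * s) * h s)"
    and V: "open V" "spectrum A a \<subseteq> of_real ` V"
    and \<phi>: "positive_definite \<phi>" "continuous_on UNIV \<phi>" "\<And>x. x \<in> V \<Longrightarrow> F x = c * \<phi> (x - x0)"
  shows "cmod (LINT s|\<nu>. f (expi a s) * h s) \<le> cmod c * cmod (\<phi> 0)"
proof -
  define \<Phi> where "\<Phi> x = c * \<phi> (x - x0)" for x
  define d where "d n = 1 / real (Suc n)" for n
  have d: "d n > 0" for n by (simp add: d_def)
  have [measurable]: "\<phi> \<in> borel_measurable borel" by (intro borel_measurable_continuous_onI \<phi>)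
  have \<Phi>m: "\<Phi> \<in> borel_measurable borel" unfolding \<Phi>_def by measurable
  have \<Phi>b: "cmod (\<Phi> x) \<le> cmod c * cmod (\<phi> 0)" for x
    unfolding \<Phi>_def norm_mult by (intro mult_left_mono positive_definite_bound[OF \<phi>(1)]) auto
  have UV: "open (U \<inter> V)" "spectrum A a \<subseteq> of_real ` (U \<inter> V)"
  proof -
    show "open (U \<inter> V)" using U(1) V(1) by (rule open_Int)
    have "complex_of_real ` U \<inter> complex_of_real ` V = complex_of_real ` (U \<inter> V)"
      by (rule image_Int[symmetric]) (simp add: inj_on_def)
    then show "spectrum A a \<subseteq> of_real ` (U \<inter> V)" using U(2) V(2) by auto
  qed
  have "(\<lambda>n. LINT x|lborel. fourier (damped a f (d n)) x * \<Phi> x) \<longlonglongrightarrow> 2 * pi * (LINT s|\<nu>. f (expi a s) * h s)"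
    unfolding d_def
  proof (rule expi_integral_localization[OF \<nu> h f UV \<Phi>m \<Phi>b])
    fix x assume x: "x \<in> U \<inter> V"
    then have "\<Phi> x = F x" using \<phi>(3)[of x] by (simp add: \<Phi>_def)
    also have "\<dots> = (LINT s|\<nu>. iexp (x * s) * h s)" using x by (intro F) simp
    finally show "\<Phi> x = (LINT s|\<nu>. iexp (x * s) * h s)" .
  qed
  then have lim: "(\<lambda>n. cmod (LINT x|lborel. fourier (damped a f (d n)) x * \<Phi> x)) \<longlonglongrightarrow> cmod (2 * pi * (LINT s|\<nu>. f (expi a s) * h s))"
    by (rule tendsto_norm)
  have "cmod (LINT x|lborel. fourier (damped a f (d n)) x * \<Phi> x) \<le> 2 * pi * (cmod c * cmod (\<phi> 0))" for n
  proof -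
    let ?w = "damped a f (d n)"
    \<comment> \<open>Modulating by \<open>iexp (x0 * t)\<close> translates the transform by
      \<open>x0\<close>, which moves the base point to the origin.\<close>
    define w where "w t = iexp (x0 * t) * ?w t" for t
    have int: "integrable lborel ?w" "integrable lborel (fourier ?w)"
      using damped_integrable[OF herm f d] fourier_damped_integrable[OF herm f d] by auto
    have [measurable]: "?w \<in> borel_measurable borel" "fourier ?w \<in> borel_measurable borel" using int by auto
    have [measurable]: "w \<in> borel_measurable borel" unfolding w_def[abs_def] by measurable
    have w: "integrable lborel w"
      by (rule Bochner_Integration.integrable_bound[OF int(1)]) (auto simp: w_def norm_mult)
    have wb: "cmod (w t) \<le> 1" for t
      using damped_bound[OF herm f d] by (simp add: w_def norm_mult)
    have fw: "fourier w x = fourier ?w (x0 + 1 * x)" for x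
    proof -
      have "iexp (x * t) * w t = iexp ((x0 + 1 * x) * t) * ?w t" for t
      proof -
        have "\<i> * of_real (x * t) + \<i> * of_real (x0 * t) = \<i> * of_real ((x0 + 1 * x) * t)"
          by (simp add: algebra_simps)
        then show ?thesis by (simp only: w_def mult.assoc[symmetric] exp_add[symmetric])
      qed
      then show ?thesis unfolding fourier_def by (simp only:)
    qed
    have fwi: "integrable lborel (fourier w)"
      unfolding fw by (rule lborel_integrable_real_affine[OF int(2)]) simp
    have "(LINT x|lborel. fourier ?w x * \<Phi> x) = \<bar>1\<bar> *\<^sub>R (LINT x|lborel. fourier ?w (x0 + 1 * x) * \<Phi> (x0 + 1 * x))"
      by (rule lborel_integral_real_affine) simp
    also have "\<dots> = (LINT x|lborel. c * (fourier w x * \<phi> x))"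
      by (simp add: fw \<Phi>_def mult_ac)
    also have "\<dots> = c * (LINT x|lborel. fourier w x * \<phi> x)"
      by (rule integral_mult_right_zero)
    finally have "cmod (LINT x|lborel. fourier ?w x * \<Phi> x) = cmod c * cmod (LINT x|lborel. fourier w x * \<phi> x)"
      by (simp add: norm_mult)
    also have "\<dots> \<le> cmod c * (2 * pi * (cmod (\<phi> 0) * 1))"
      by (intro mult_left_mono positive_definite_fourier_bound[OF \<phi>(1,2) w wb fwi]) auto
    finally show ?thesis by (simp add: mult_ac)
  qed
  then have "cmod (2 * pi * (LINT s|\<nu>. f (expi a s) * h s)) \<le> 2 * pi * (cmod c * cmod (\<phi> 0))"
    by (intro LIMSEQ_le_const2[OF lim]) auto
  then show ?thesis by (simp add: norm_mult)
qed

lemma CH_norm_eq_spectral_radius: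
  assumes F: "F \<in> CH" and FPD: "F \<in> PD"
  shows "nrm A (symbol_apply A F a) = spectral_radius A (symbol_apply A F a)"
proof -
  have FB: "F \<in> B_loc" using F by (simp add: CH_def)
  have cont: "continuous_on S F" for S using B_loc_continuous[OF FB] continuous_on_subset by blast
  obtain S where S: "compact S" "S \<noteq> {}" "spectrum A a = of_real ` S" "\<And>x. x \<in> S \<longleftrightarrow> lower a (of_real x) = 0"
    using hermitian_spectrum_compact by metis
  obtain lo hi where lh: "lo \<in> S" "hi \<in> S" "\<And>x. x \<in> S \<Longrightarrow> lo \<le> x" "\<And>x. x \<in> S \<Longrightarrow> x \<le> hi"
    using compact_attains_inf[OF S(1,2)] compact_attains_sup[OF S(1,2)] by metis
  have lohi: "lo \<le> hi" using lh by blast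
  obtain G e where G: "G \<in> B_R" "e > 0" "\<And>y. y \<in> {lo - e..hi + e} \<Longrightarrow> F y = G y"
    using B_loc_on_interval[OF FB lohi] by metis
  obtain \<mu>' where \<mu>': "complex_borel_measure \<mu>'" "G = fourier_stieltjes \<mu>'"
    using G(1) by (auto simp: B_R_def)
  have Sopen: "spectrum A a \<subseteq> of_real ` {lo - r<..<hi + r}" if "r > 0" for r
    unfolding S(3) using lh that by (intro image_mono) force
  have "represents_near_spectrum A F a \<mu>'"
    unfolding represents_near_spectrum_def
    using \<mu>' G Sopen[OF G(2)] by (intro conjI exI[of _ "{lo - e<..<hi + e}"]) auto
  \<comment> \<open>The measure found above only witnesses that the choice in
    \<open>symbol_apply\<close> succeeds; the chosen measure matches \<open>F\<close> merely on some
    neighbourhood \<open>U\<close> of its own.\<close>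
  then have rep: "represents_near_spectrum A F a (SOME \<mu>. represents_near_spectrum A F a \<mu>)" (is "represents_near_spectrum A F a ?\<mu>")
    by (rule someI[of "represents_near_spectrum A F a"])
  then have \<mu>: "complex_borel_measure ?\<mu>" by (simp add: represents_near_spectrum_def)
  obtain U where U: "open U" "spectrum A a \<subseteq> of_real ` U" "\<And>x. x \<in> U \<Longrightarrow> F x = fourier_stieltjes ?\<mu> x"
    using rep unfolding represents_near_spectrum_def by blast
  obtain \<nu> h where \<nu>: "finite_measure \<nu>" "sets \<nu> = sets borel" and h: "integrable \<nu> h"
    and cm: "\<And>g. cm_integral ?\<mu> g = (LINT x|\<nu>. g x * h x)"
    using complex_borel_measure_integral[OF \<mu>] by metis
  have FU: "F x = (LINT s|\<nu>. iexp (x * s) * h s)" if "x \<in> U" for x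
    using U(3)[OF that] by (simp add: fourier_stieltjes_def cm)
  obtain b where b: "b \<in> carrier A" "\<And>f. f \<in> dual_space A \<Longrightarrow> f b = (LINT t|\<nu>. f (expi a t) * h t)"
    using expi_integral_exists[OF herm \<nu> h] by metis
  have sb: "symbol_apply A F a = b"
    unfolding symbol_apply_def alg_integral_def
  proof (rule the_equality)
    show "b \<in> carrier A \<and> (\<forall>f\<in>dual_space A. f b = cm_integral ?\<mu> (\<lambda>t. f (alg_exp A ((\<i> * of_real t) \<odot> a))))"
      using b by (simp add: cm expi_def)
    fix b' assume b': "b' \<in> carrier A \<and> (\<forall>f\<in>dual_space A. f b' = cm_integral ?\<mu> (\<lambda>t. f (alg_exp A ((\<i> * of_real t) \<odot> a))))"
    show "b' = b"
    proof (rule eq_functional)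
      fix f assume f: "f \<in> dual_space A"
      then have "f b' = (LINT t|\<nu>. f (expi a t) * h t)" using b' by (simp add: cm expi_def)
      also have "\<dots> = f b" by (rule b(2)[OF f, symmetric])
      finally show "f b' = f b" .
    qed (use b b' in auto)
  qed
  \<comment> \<open>The hull of the spectrum is enlarged by \<open>r\<close> so that the
    positive-definite representation holds on an open neighbourhood; continuity of \<open>F\<close>
    later lets \<open>r\<close> tend to 0.\<close>
  have nb: "nrm A b \<le> max (cmod (F (lo - r))) (cmod (F (hi + r)))" if r: "r > 0" for r
  proof (rule nrm_le_functional[OF b(1)])
    fix f assume f: "contraction_functional f"
    let ?K = "{lo - r..hi + r}"
    have "?K \<noteq> {}" using lohi r by simp
    then obtain c x0 \<phi> where \<phi>: "x0 \<in> ?K" "positive_definite \<phi>" "continuous_on UNIV \<phi>" "\<forall>x\<in>?K. F x = c * \<phi> (x - x0)"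
      using F compact_Icc[of "lo - r" "hi + r"] unfolding CH_def by blast
    have "cmod (f b) = cmod (LINT s|\<nu>. f (expi a s) * h s)" using b(2)[OF contraction_functional_dual[OF f]] by simp
    also have "\<dots> \<le> cmod c * cmod (\<phi> 0)"
      by (rule CH_symbol_bound[OF \<nu> h f U(1,2) FU _ Sopen[OF r] \<phi>(2,3)]) (use \<phi>(4) in auto)
    also have "\<dots> = cmod (F x0)" using \<phi>(1,4) by (simp add: norm_mult)
    also have "\<dots> \<le> max (cmod (F (lo - r))) (cmod (F (hi + r)))"
      using PD_max_at_endpoint[OF FPD _ cont, of "lo - r" "hi + r"] lohi r \<phi>(1) by simp
    finally show "cmod (f b) \<le> max (cmod (F (lo - r))) (cmod (F (hi + r)))" .
  qed
  have isc: "isCont F x" for x using cont[of UNIV] by (simp add: continuous_on_eq_continuous_at)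
  have "nrm A b \<le> max (cmod (F lo)) (cmod (F hi))"
  proof (rule LIMSEQ_le_const)
    have "(\<lambda>n. lo - 1 / real (Suc n)) \<longlonglongrightarrow> lo" "(\<lambda>n. hi + 1 / real (Suc n)) \<longlonglongrightarrow> hi" by real_asymp+
    then show "(\<lambda>n. max (cmod (F (lo - 1 / real (Suc n)))) (cmod (F (hi + 1 / real (Suc n))))) \<longlonglongrightarrow> max (cmod (F lo)) (cmod (F hi))"
      by (intro tendsto_max tendsto_norm isCont_tendsto_compose[OF isc])
  qed (use nb in auto)
  moreover have spec: "F x \<in> spectrum A b" if "x \<in> S" for x
  proof -
    have "x \<in> U" using that U(2) S(3) by (auto simp: image_iff subset_eq)
    then show ?thesis
      using symbol_value_in_spectrum[OF \<nu> h b, of x] S(4) that FU by simp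
  qed
  ultimately have "nrm A b \<le> spectral_radius A b"
    using spectral_radius_bounds(1)[OF b(1) spec[OF lh(1)]] spectral_radius_bounds(1)[OF b(1) spec[OF lh(2)]]
    by linarith
  then show ?thesis
    unfolding sb using spectral_radius_bounds(2)[OF b(1) spec[OF lh(1)]] by simp
qed

end

end

lemma PD_subset_US: "PD \<subseteq> US TYPE('a)"
proof
  fix F assume F: "F \<in> PD"
  then have "F \<in> CH" using PD_subset_CH[OF B_loc_continuous] by blast
  with F show "F \<in> US TYPE('a)"
    unfolding US_def PD_def[symmetric]
    by (intro CollectI conjI allI impI ballI complex_unital_banach_algebra.CH_norm_eq_spectral_radius)
      (auto simp: PD_def)
qed


section \<open>Multipliers of trigonometric polynomials\<close>

definition trig :: "real set \<Rightarrow> (real \<Rightarrow> complex) \<Rightarrow> real \<Rightarrow> complex" where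
  "trig K l x = (\<Sum>k\<in>K. l k * iexp (x * k))"

lemma geometric_average_tendsto_0:
  fixes q :: complex
  assumes q: "q \<noteq> 1" "cmod q = 1"
  shows "(\<lambda>n. (\<Sum>m<n. q ^ m) / of_nat n) \<longlonglongrightarrow> 0"
proof (rule Lim_null_comparison[OF always_eventually])
  show "\<forall>n. norm ((\<Sum>m<n. q ^ m) / of_nat n) \<le> (2 / cmod (q - 1)) / real n"
  proof
    fix n
    have "cmod (q ^ n - 1) \<le> 2"
      using norm_triangle_ineq4[of "q ^ n" 1] q by (simp add: norm_power)
    then have "cmod (\<Sum>m<n. q ^ m) \<le> 2 / cmod (q - 1)"
      using q by (simp add: geometric_sum norm_divide divide_right_mono)
    from divide_right_mono[OF this, of "real n"]
    show "norm ((\<Sum>m<n. q ^ m) / of_nat n) \<le> (2 / cmod (q - 1)) / real n"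
      by (simp only: norm_divide norm_of_nat of_nat_0_le_iff)
  qed
  show "(\<lambda>n. (2 / cmod (q - 1)) / real n) \<longlonglongrightarrow> 0" by (rule lim_const_over_n)
qed

text \<open>A coefficient is the mean of the polynomial against the conjugate character; the mean is taken over an
  arithmetic progression so fine that it separates the frequencies.\<close>

lemma trig_coefficient_bound:
  assumes K: "finite K" and bound: "\<And>x. cmod (trig K l x) \<le> S" and k: "k \<in> K"
  shows "cmod (l k) \<le> S"
proof (rule tendsto_upperbound)
  define D where "D = (\<Sum>j\<in>K. \<bar>j - k\<bar>)"
  have D: "\<bar>j - k\<bar> \<le> D" if "j \<in> K" for j
    unfolding D_def using K that by (intro member_le_sum) auto
  \<comment> \<open>With this step all products \<open>\<tau> * (j - k)\<close> are smaller than 1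
    in modulus, hence below the period of the exponential, so \<open>q j = 1\<close> only for
    \<open>j = k\<close>.\<close>
  define \<tau> where "\<tau> = 1 / (1 + D)"
  have D0: "D \<ge> 0" using D[OF k] by simp
  define q where "q j = iexp (\<tau> * (j - k))" for j
  have q1: "q j \<noteq> 1" if "j \<in> K" "j \<noteq> k" for j
  proof
    assume "q j = 1"
    then obtain n :: int where n: "\<tau> * (j - k) = of_int (2 * n) * pi"
      unfolding q_def exp_eq_1 by auto
    have "\<bar>\<tau> * (j - k)\<bar> < 1"
      using D[OF that(1)] D0 by (simp add: \<tau>_def abs_mult)
    moreover have "\<bar>\<tau> * (j - k)\<bar> > 0" using that D0 by (simp add: \<tau>_def)
    ultimately have "\<bar>of_int (2 * n) * pi\<bar> < 1" "n \<noteq> 0" using n by auto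
    moreover have "1 \<le> \<bar>real_of_int (2 * n)\<bar> * pi"
    proof -
      have "1 * 1 \<le> \<bar>real_of_int (2 * n)\<bar> * pi"
        using \<open>n \<noteq> 0\<close> pi_ge_two by (intro mult_mono) auto
      then show ?thesis by simp
    qed
    ultimately show False by (simp add: abs_mult)
  qed
  define avg where "avg n = (\<Sum>m<n. trig K l (real m * \<tau>) * exp (- \<i> * of_real (real m * \<tau> * k))) / of_nat n" for n
  have avg: "avg n = (\<Sum>j\<in>K. l j * ((\<Sum>m<n. q j ^ m) / of_nat n))" for n
  proof -
    have "iexp (real m * \<tau> * j) * exp (- \<i> * of_real (real m * \<tau> * k)) = q j ^ m" for j m
      by (simp add: q_def exp_of_nat_mult[symmetric] exp_add[symmetric] algebra_simps)
    then have "trig K l (real m * \<tau>) * exp (- \<i> * of_real (real m * \<tau> * k)) = (\<Sum>j\<in>K. l j * q j ^ m)" for m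
      by (simp only: trig_def sum_distrib_right mult.assoc)
    then have "avg n = (\<Sum>m<n. \<Sum>j\<in>K. l j * q j ^ m) / of_nat n" by (simp only: avg_def)
    also have "\<dots> = (\<Sum>j\<in>K. l j * (\<Sum>m<n. q j ^ m)) / of_nat n"
      by (subst sum.swap) (simp only: sum_distrib_left)
    finally show ?thesis
      unfolding times_divide_eq_right sum_divide_distrib[symmetric] .
  qed
  have "avg \<longlonglongrightarrow> (\<Sum>j\<in>K. l j * (if j = k then 1 else 0))"
    unfolding avg
  proof (intro tendsto_sum tendsto_mult tendsto_const)
    fix j assume j: "j \<in> K"
    show "(\<lambda>n. (\<Sum>m<n. q j ^ m) / of_nat n) \<longlonglongrightarrow> (if j = k then 1 else 0)"
    proof (cases "j = k")
      case True
      have "\<forall>\<^sub>F n in sequentially. (\<Sum>m<n. q j ^ m) / of_nat n = 1"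
        using eventually_gt_at_top[of 0] by eventually_elim (simp add: q_def True)
      then show ?thesis using True by (simp add: tendsto_eventually)
    next
      case False
      have "cmod (q j) = 1" by (simp add: q_def)
      then show ?thesis using geometric_average_tendsto_0[OF q1[OF j False]] False by simp
    qed
  qed
  moreover have "(\<Sum>j\<in>K. l j * (if j = k then 1 else 0)) = (\<Sum>j\<in>K. if j = k then l j else 0)"
    by (intro sum.cong) auto
  ultimately have "avg \<longlonglongrightarrow> l k" using K k by (simp add: sum.delta)
  then show "(\<lambda>n. cmod (avg n)) \<longlonglongrightarrow> cmod (l k)" by (rule tendsto_norm)
  show "\<forall>\<^sub>F n in sequentially. cmod (avg n) \<le> S"
    using eventually_gt_at_top[of 0]
  proof eventually_elim
    case (elim n)
    have "cmod (\<Sum>m<n. trig K l (real m * \<tau>) * exp (- \<i> * of_real (real m * \<tau> * k))) \<le> (\<Sum>m<n. S)"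
      using bound by (intro sum_norm_le) (simp add: norm_mult)
    then show ?case using elim by (simp add: avg_def norm_divide divide_le_eq mult.commute)
  qed
qed simp

text \<open>The norm of multiplication of coefficients by \<open>f\<close>, as an operator on the trigonometric polynomials with
  frequencies in \<open>K\<close> under the sup norm. By translation invariance it suffices to evaluate at \<open>0\<close>.\<close>

definition mult_norm :: "real set \<Rightarrow> (real \<Rightarrow> complex) \<Rightarrow> real" where
  "mult_norm K f = (SUP l\<in>{l. \<forall>x. cmod (trig K l x) \<le> 1}. cmod (\<Sum>k\<in>K. l k * f k))"

context
  fixes K :: "real set"
  assumes K: "finite K" "K \<noteq> {}"
begin

lemma mult_norm_le_unit:
  assumes l: "\<And>x. cmod (trig K l x) \<le> 1"
  shows "cmod (\<Sum>k\<in>K. l k * f k) \<le> mult_norm K f"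
  unfolding mult_norm_def
proof (rule cSUP_upper)
  show "bdd_above ((\<lambda>l. cmod (\<Sum>k\<in>K. l k * f k)) ` {l. \<forall>x. cmod (trig K l x) \<le> 1})"
  proof (rule bdd_aboveI2)
    fix l assume "l \<in> {l. \<forall>x. cmod (trig K l x) \<le> 1}"
    then have "cmod (l k) \<le> 1" if "k \<in> K" for k
      using trig_coefficient_bound[OF K(1) _ that] by simp
    then show "cmod (\<Sum>k\<in>K. l k * f k) \<le> (\<Sum>k\<in>K. cmod (f k))"
      by (intro sum_norm_le) (simp add: norm_mult mult_left_le_one_le)
  qed
qed (use l in simp)

lemma mult_norm_le:
  assumes "\<And>l. (\<And>x. cmod (trig K l x) \<le> 1) \<Longrightarrow> cmod (\<Sum>k\<in>K. l k * f k) \<le> C"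
  shows "mult_norm K f \<le> C"
  unfolding mult_norm_def
proof (rule cSUP_least)
  have "(\<lambda>_. 0) \<in> {l. \<forall>x. cmod (trig K l x) \<le> 1}" by (simp add: trig_def)
  then show "{l. \<forall>x. cmod (trig K l x) \<le> 1} \<noteq> {}" by blast
qed (use assms in auto)

lemma mult_norm_bound:
  assumes l: "\<And>x. cmod (trig K l x) \<le> S"
  shows "cmod (\<Sum>k\<in>K. l k * f k) \<le> mult_norm K f * S"
proof (cases "S = 0")
  case True
  then have "l k = 0" if "k \<in> K" for k
    using trig_coefficient_bound[OF K(1) l that] by simp
  then show ?thesis using True by simp
next
  case False
  then have S: "S > 0" using l[of 0] norm_ge_zero[of "trig K l 0"] by linarith
  have "trig K (\<lambda>k. l k / of_real S) x = trig K l x / of_real S" for x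
    by (simp add: trig_def sum_divide_distrib)
  then have "cmod (\<Sum>k\<in>K. l k / of_real S * f k) \<le> mult_norm K f"
    using l S by (intro mult_norm_le_unit) (simp add: norm_divide)
  moreover have "(\<Sum>k\<in>K. l k / of_real S * f k) = (\<Sum>k\<in>K. l k * f k) / of_real S"
    by (simp add: sum_divide_distrib)
  ultimately show ?thesis using S by (simp add: norm_divide divide_le_eq)
qed

lemma mult_norm_ge:
  assumes k: "k \<in> K"
  shows "cmod (f k) \<le> mult_norm K f"
proof -
  have "cmod (trig K (\<lambda>j. if j = k then 1 else 0) x) \<le> 1" for x
    using K k by (simp add: trig_def if_distrib[of "\<lambda>y. y * _"] cong: if_cong)
  from mult_norm_le_unit[OF this, of f] show ?thesis
    using K k by (simp add: if_distrib[of "\<lambda>y. y * _"] cong: if_cong)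
qed

lemma mult_norm_nonneg: "0 \<le> mult_norm K f"
  using K(2) mult_norm_ge norm_ge_zero order_trans by blast

lemma mult_norm_sum: "mult_norm K f \<le> (\<Sum>k\<in>K. cmod (f k))"
proof (rule mult_norm_le)
  fix l assume "\<And>x. cmod (trig K l x) \<le> 1"
  then have "cmod (l k) \<le> 1" if "k \<in> K" for k
    using trig_coefficient_bound[OF K(1) _ that] by simp
  then show "cmod (\<Sum>k\<in>K. l k * f k) \<le> (\<Sum>k\<in>K. cmod (f k))"
    by (intro sum_norm_le) (simp add: norm_mult mult_left_le_one_le)
qed

lemma mult_norm_cong: "(\<And>k. k \<in> K \<Longrightarrow> f k = g k) \<Longrightarrow> mult_norm K f = mult_norm K g"
  by (simp add: mult_norm_def)

lemma mult_norm_triangle: "mult_norm K (\<lambda>k. f k + g k) \<le> mult_norm K f + mult_norm K g"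
proof (rule mult_norm_le)
  fix l assume l: "\<And>x. cmod (trig K l x) \<le> 1"
  have eq: "(\<Sum>k\<in>K. l k * (f k + g k)) = (\<Sum>k\<in>K. l k * f k) + (\<Sum>k\<in>K. l k * g k)"
    by (simp add: distrib_left sum.distrib)
  show "cmod (\<Sum>k\<in>K. l k * (f k + g k)) \<le> mult_norm K f + mult_norm K g"
    unfolding eq using mult_norm_le_unit[OF l, of f] mult_norm_le_unit[OF l, of g]
      norm_triangle_ineq[of "\<Sum>k\<in>K. l k * f k" "\<Sum>k\<in>K. l k * g k"] by linarith
qed

lemma mult_norm_scale_le: "mult_norm K (\<lambda>k. c * f k) \<le> cmod c * mult_norm K f"
proof (rule mult_norm_le)
  fix l assume l: "\<And>x. cmod (trig K l x) \<le> 1"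
  have "(\<Sum>k\<in>K. l k * (c * f k)) = c * (\<Sum>k\<in>K. l k * f k)"
    by (simp add: sum_distrib_left mult_ac)
  then show "cmod (\<Sum>k\<in>K. l k * (c * f k)) \<le> cmod c * mult_norm K f"
    using mult_norm_le_unit[OF l, of f] by (simp add: norm_mult mult_left_mono)
qed

lemma mult_norm_scale: "mult_norm K (\<lambda>k. c * f k) = cmod c * mult_norm K f"
proof (cases "c = 0")
  case True
  have "mult_norm K (\<lambda>k. c * f k) \<le> 0" using mult_norm_scale_le[of c f] True by simp
  then show ?thesis using mult_norm_nonneg[of "\<lambda>k. c * f k"] True by simp
next
  case False
  have "mult_norm K (\<lambda>k. (1 / c) * (c * f k)) \<le> cmod (1 / c) * mult_norm K (\<lambda>k. c * f k)"
    by (rule mult_norm_scale_le)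
  then have "cmod c * mult_norm K f \<le> mult_norm K (\<lambda>k. c * f k)"
    using False by (simp add: norm_divide field_simps)
  then show ?thesis using mult_norm_scale_le[of c f] by simp
qed

text \<open>The value at \<open>x\<close> of the polynomial with coefficients
  \<open>l k * g k\<close> is the \<open>g\<close>-sum of the translate of \<open>trig K l\<close>
  by \<open>x\<close>, again in the unit ball. So multiplication by \<open>g\<close> has operator
  norm at most \<open>mult_norm K g\<close>.\<close>

lemma mult_norm_mult: "mult_norm K (\<lambda>k. f k * g k) \<le> mult_norm K f * mult_norm K g"
proof (rule mult_norm_le)
  fix l assume l: "\<And>x. cmod (trig K l x) \<le> 1"
  have "cmod (trig K (\<lambda>k. l k * g k) x) \<le> mult_norm K g" for x
  proof -
    have "trig K (\<lambda>k. l k * iexp (x * k)) y = trig K l (x + y)" for y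
      by (simp add: trig_def mult.assoc exp_add[symmetric] algebra_simps)
    then have "cmod (\<Sum>k\<in>K. (l k * iexp (x * k)) * g k) \<le> mult_norm K g"
      using l by (intro mult_norm_le_unit) simp
    then show ?thesis by (simp add: trig_def mult_ac)
  qed
  from mult_norm_bound[OF this, of f]
  show "cmod (\<Sum>k\<in>K. l k * (f k * g k)) \<le> mult_norm K f * mult_norm K g"
    by (simp add: mult_ac)
qed

lemma mult_norm_one: "mult_norm K (\<lambda>_. 1) = 1"
proof (rule order_antisym)
  show "mult_norm K (\<lambda>_. 1) \<le> 1"
  proof (rule mult_norm_le)
    fix l assume "\<And>x. cmod (trig K l x) \<le> 1"
    from this[of 0] show "cmod (\<Sum>k\<in>K. l k * 1) \<le> 1" by (simp add: trig_def)
  qed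
  show "1 \<le> mult_norm K (\<lambda>_. 1)"
    using K(2) mult_norm_ge[of _ "\<lambda>_. 1"] by auto
qed

text \<open>Multiplying coefficients by \<open>iexp (t * k)\<close> translates the polynomial by
  \<open>t\<close>; this makes the coordinate function Hermitian.\<close>

lemma mult_norm_exp: "mult_norm K (\<lambda>k. iexp (t * k)) \<le> 1"
proof (rule mult_norm_le)
  fix l assume "\<And>x. cmod (trig K l x) \<le> 1"
  from this[of t] show "cmod (\<Sum>k\<in>K. l k * iexp (t * k)) \<le> 1" by (simp add: trig_def)
qed

end


section \<open>The multiplier algebra realised inside a given type\<close>

text \<open>Reals correspond to sets of naturals, so a function on a finite set is coded by one such
  set: the members coding its real and imaginary parts, tagged by the number of the point and by 0
  or 1. The code is read as a real and sent into \<open>'a\<close>.\<close>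

lemma finite_support_functions_embed:
  assumes "\<exists>f :: real \<Rightarrow> 'a. inj f" and K: "finite K"
  obtains \<iota> :: "(real \<Rightarrow> complex) \<Rightarrow> 'a" where "inj_on \<iota> {g. \<forall>x. x \<notin> K \<longrightarrow> g x = 0}"
proof -
  obtain s2r :: "nat set \<Rightarrow> real" where bij: "bij s2r"
    using nat_sets_eqpoll_reals unfolding eqpoll_def by blast
  then have s2r: "inj s2r" by (rule bij_is_inj)
  define r2s where "r2s = inv_into UNIV s2r"
  have r2s: "inj r2s" unfolding r2s_def using bij by (intro bij_is_inj bij_imp_bij_inv)
  obtain j :: "real \<Rightarrow> 'a" where j: "inj j" using assms(1) by blast
  obtain e :: "real \<Rightarrow> nat" where e: "inj_on e K"
    using finite_imp_inj_to_nat_seg[OF K] by metis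
  define code where "code g = {prod_encode (prod_encode (e x, 0), m) | x m. x \<in> K \<and> m \<in> r2s (Re (g x))} \<union>
    {prod_encode (prod_encode (e x, 1), m) | x m. x \<in> K \<and> m \<in> r2s (Im (g x))}" for g :: "real \<Rightarrow> complex"
  have dec: "m \<in> r2s (Re (g x)) \<longleftrightarrow> prod_encode (prod_encode (e x, 0), m) \<in> code g"
    "m \<in> r2s (Im (g x)) \<longleftrightarrow> prod_encode (prod_encode (e x, 1), m) \<in> code g" if "x \<in> K" for g x m
    using that inj_onD[OF e] by (auto simp: code_def prod_encode_eq)
  have "inj_on (\<lambda>g. j (s2r (code g))) {g. \<forall>x. x \<notin> K \<longrightarrow> g x = 0}"
  proof (rule inj_onI)
    fix g g' assume g: "g \<in> {g. \<forall>x. x \<notin> K \<longrightarrow> g x = 0}" "g' \<in> {g. \<forall>x. x \<notin> K \<longrightarrow> g x = 0}"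
      and "j (s2r (code g)) = j (s2r (code g'))"
    then have eq: "code g = code g'" using j s2r by (simp add: inj_eq)
    show "g = g'"
    proof
      fix x
      show "g x = g' x"
      proof (cases "x \<in> K")
        case True
        then have "r2s (Re (g x)) = r2s (Re (g' x))" "r2s (Im (g x)) = r2s (Im (g' x))"
          using dec[OF True, of _ g] dec[OF True, of _ g'] eq by auto
        then show ?thesis using r2s by (simp add: inj_eq complex_eq_iff)
      qed (use g in auto)
    qed
  qed
  then show thesis by (rule that)
qed

locale multiplier_algebra =
  fixes K :: "real set" and \<iota> :: "(real \<Rightarrow> complex) \<Rightarrow> 'a"
  assumes K: "finite K" "K \<noteq> {}" and inj: "inj_on \<iota> {g. \<forall>x. x \<notin> K \<longrightarrow> g x = 0}"
begin

text \<open>Values off \<open>K\<close> are erased before encoding, since \<iota> is injective only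
  on functions supported in \<open>K\<close>; equality of codes then means equality on
  \<open>K\<close>.\<close>

definition cut :: "(real \<Rightarrow> complex) \<Rightarrow> real \<Rightarrow> complex" where
  "cut g x = (if x \<in> K then g x else 0)"

definition enc :: "(real \<Rightarrow> complex) \<Rightarrow> 'a" where
  "enc g = \<iota> (cut g)"

definition dec :: "'a \<Rightarrow> real \<Rightarrow> complex" where
  "dec x = inv_into {g. \<forall>x. x \<notin> K \<longrightarrow> g x = 0} \<iota> x"

definition alg :: "'a normed_alg" where
  "alg = \<lparr>carrier = range enc, mult = (\<lambda>x y. enc (\<lambda>k. dec x k * dec y k)), one = enc (\<lambda>_. 1),
     zero = enc (\<lambda>_. 0), add = (\<lambda>x y. enc (\<lambda>k. dec x k + dec y k)),
     smult = (\<lambda>c x. enc (\<lambda>k. c * dec x k)), nrm = (\<lambda>x. mult_norm K (dec x))\<rparr>"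

lemma dec_enc: "dec (enc g) = cut g"
  unfolding dec_def enc_def by (rule inv_into_f_f[OF inj]) (simp add: cut_def)

lemma dec_enc_K [simp]: "k \<in> K \<Longrightarrow> dec (enc g) k = g k"
  by (simp add: dec_enc cut_def)

lemma enc_eq_iff: "enc g = enc h \<longleftrightarrow> (\<forall>k\<in>K. g k = h k)"
proof
  assume "enc g = enc h"
  then have "dec (enc g) = dec (enc h)" by simp
  then show "\<forall>k\<in>K. g k = h k" by (metis dec_enc_K)
next
  assume "\<forall>k\<in>K. g k = h k"
  then have "cut g = cut h" by (simp add: cut_def fun_eq_iff)
  then show "enc g = enc h" by (simp add: enc_def)
qed

lemma carrier_iff: "x \<in> carrier alg \<longleftrightarrow> (\<exists>g. x = enc g)"
  by (auto simp: alg_def)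

lemma enc_closed [simp, intro]: "enc g \<in> carrier alg"
  by (auto simp: carrier_iff)

lemma alg_simps [simp]:
  "enc g \<otimes>\<^bsub>alg\<^esub> enc h = enc (\<lambda>k. g k * h k)" "\<one>\<^bsub>alg\<^esub> = enc (\<lambda>_. 1)" "\<zero>\<^bsub>alg\<^esub> = enc (\<lambda>_. 0)"
  "enc g \<oplus>\<^bsub>alg\<^esub> enc h = enc (\<lambda>k. g k + h k)" "c \<odot>\<^bsub>alg\<^esub> enc g = enc (\<lambda>k. c * g k)"
  "nrm alg (enc g) = mult_norm K g"
  by (auto simp: alg_def enc_eq_iff intro: mult_norm_cong[OF K])

lemma abelian: "abelian_group alg"
proof (rule abelian_groupI)
  fix x assume "x \<in> carrier alg"
  then obtain g where "x = enc g" by (auto simp: carrier_iff)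
  then show "\<exists>y\<in>carrier alg. y \<oplus>\<^bsub>alg\<^esub> x = \<zero>\<^bsub>alg\<^esub>"
    by (intro bexI[of _ "enc (\<lambda>k. - g k)"]) (auto simp: enc_eq_iff)
qed (auto simp: carrier_iff enc_eq_iff algebra_simps)

lemma ring: "Ring.ring alg"
proof (rule ringI[OF abelian])
  show "Group.monoid alg"
    by (rule Group.monoidI) (auto simp: carrier_iff enc_eq_iff algebra_simps)
qed (auto simp: carrier_iff enc_eq_iff algebra_simps)

lemma cring_complex: "cring complex_ring"
proof (rule cringI)
  show "abelian_group complex_ring"
  proof (rule abelian_groupI)
    fix x assume "x \<in> carrier complex_ring"
    show "\<exists>y\<in>carrier complex_ring. y \<oplus>\<^bsub>complex_ring\<^esub> x = \<zero>\<^bsub>complex_ring\<^esub>"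
      by (intro bexI[of _ "- x"]) (auto simp: complex_ring_def)
  qed (auto simp: complex_ring_def)
  show "Group.comm_monoid complex_ring"
    by (rule Group.comm_monoidI) (auto simp: complex_ring_def)
qed (auto simp: complex_ring_def distrib_right)

lemma minus_enc [simp]: "enc g \<ominus>\<^bsub>alg\<^esub> enc h = enc (\<lambda>k. g k - h k)"
proof -
  interpret Ring.ring alg by (rule ring)
  have "\<ominus>\<^bsub>alg\<^esub> enc h = enc (\<lambda>k. - h k)"
    by (rule minus_equality) (auto simp: enc_eq_iff)
  then show ?thesis by (simp add: a_minus_def)
qed

lemma nrm_dist_enc: "nrm_dist alg (enc g) (enc h) = mult_norm K (\<lambda>k. g k - h k)"
  by (simp add: nrm_dist_def)

lemma metric: "Metric_space (carrier alg) (nrm_dist alg)"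
proof
  show "0 \<le> nrm_dist alg x y" for x y
    by (auto simp: nrm_dist_def carrier_iff mult_norm_nonneg[OF K])
  show "nrm_dist alg x y = nrm_dist alg y x" for x y
  proof -
    have "mult_norm K (\<lambda>k. g k - h k) = mult_norm K (\<lambda>k. h k - g k)" for g h
      using mult_norm_scale[OF K, of "- 1" "\<lambda>k. h k - g k"] by simp
    then show ?thesis by (auto simp: nrm_dist_def carrier_iff)
  qed
  show "nrm_dist alg x y = 0 \<longleftrightarrow> x = y" if xy: "x \<in> carrier alg" "y \<in> carrier alg" for x y
  proof -
    obtain g h where gh: "x = enc g" "y = enc h" using xy by (auto simp: carrier_iff)
    show ?thesis
    proof
      assume "nrm_dist alg x y = 0"
      then have "cmod (g k - h k) \<le> 0" if "k \<in> K" for k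
        using mult_norm_ge[OF K that, of "\<lambda>k. g k - h k"] by (simp add: gh nrm_dist_enc)
      then show "x = y" by (simp add: gh enc_eq_iff)
    next
      assume "x = y"
      then have "(\<Sum>k\<in>K. cmod (g k - h k)) = 0" by (simp add: gh enc_eq_iff)
      then show "nrm_dist alg x y = 0"
        using mult_norm_sum[OF K, of "\<lambda>k. g k - h k"] mult_norm_nonneg[OF K, of "\<lambda>k. g k - h k"]
        by (simp add: gh nrm_dist_enc)
    qed
  qed
  show "nrm_dist alg x z \<le> nrm_dist alg x y + nrm_dist alg y z"
    if xyz: "x \<in> carrier alg" "y \<in> carrier alg" "z \<in> carrier alg" for x y z
  proof -
    obtain f g h where "x = enc f" "y = enc g" "z = enc h" using xyz by (auto simp: carrier_iff)
    then show ?thesis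
      using mult_norm_triangle[OF K, of "\<lambda>k. f k - g k" "\<lambda>k. g k - h k"] by (simp add: nrm_dist_enc)
  qed
qed

text \<open>The norm lies between each coordinate modulus and the sum of all of them, so on finite
  \<open>K\<close> convergence in norm is coordinatewise convergence.\<close>

lemma complete: "Metric_space.mcomplete (carrier alg) (nrm_dist alg)"
proof -
  interpret M: Metric_space "carrier alg" "nrm_dist alg" by (rule metric)
  show ?thesis
    unfolding M.mcomplete_def
  proof (intro allI impI)
    fix s assume s: "M.MCauchy s"
    then have "\<forall>n. \<exists>g. s n = enc g" by (auto simp: M.MCauchy_def carrier_iff image_subset_iff)
    then obtain g where g: "\<And>n. s n = enc (g n)" by metis
    have lim: "convergent (\<lambda>n. g n k)" if k: "k \<in> K" for k
    proof (rule Cauchy_convergent, rule metric_CauchyI)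
      fix r :: real assume "r > 0"
      then obtain N where N: "\<And>m n. m \<ge> N \<Longrightarrow> n \<ge> N \<Longrightarrow> nrm_dist alg (s m) (s n) < r"
        using s unfolding M.MCauchy_def by blast
      have "dist (g m k) (g n k) < r" if "m \<ge> N" "n \<ge> N" for m n
        using N[OF that] mult_norm_ge[OF K k, of "\<lambda>k. g m k - g n k"]
        by (simp add: g nrm_dist_enc dist_norm)
      then show "\<exists>N. \<forall>m\<ge>N. \<forall>n\<ge>N. dist (g m k) (g n k) < r" by blast
    qed
    define l where "l k = lim (\<lambda>n. g n k)" for k
    have l: "(\<lambda>n. g n k) \<longlonglongrightarrow> l k" if "k \<in> K" for k
      using lim[OF that] by (simp add: l_def convergent_LIMSEQ_iff)
    have "(\<lambda>n. \<Sum>k\<in>K. cmod (g n k - l k)) \<longlonglongrightarrow> (\<Sum>k\<in>K. cmod (l k - l k))"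
      by (intro tendsto_intros l)
    then have sum0: "(\<lambda>n. \<Sum>k\<in>K. cmod (g n k - l k)) \<longlonglongrightarrow> 0" by simp
    have "limitin M.mtopology s (enc l) sequentially"
      unfolding M.limit_metric_sequentially
    proof (intro conjI allI impI)
      fix r :: real assume "r > 0"
      then obtain N where N: "\<And>n. n \<ge> N \<Longrightarrow> (\<Sum>k\<in>K. cmod (g n k - l k)) < r"
        using LIMSEQ_D[OF sum0, of r] by fastforce
      have "s n \<in> carrier alg \<and> nrm_dist alg (s n) (enc l) < r" if "n \<ge> N" for n
        using N[OF that] mult_norm_sum[OF K, of "\<lambda>k. g n k - l k"] by (simp add: g nrm_dist_enc)
      then show "\<exists>N. \<forall>n\<ge>N. s n \<in> carrier alg \<and> nrm_dist alg (s n) (enc l) < r" by blast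
    qed simp
    then show "\<exists>x. limitin M.mtopology s x sequentially" by blast
  qed
qed

sublocale A: complex_unital_banach_algebra alg
proof (intro complex_unital_banach_algebra.intro complex_unital_banach_algebra_axioms.intro ring)
  show "Module.module complex_ring alg"
    by (rule Module.moduleI[OF cring_complex abelian])
      (auto simp: carrier_iff enc_eq_iff complex_ring_def algebra_simps)
  show "Metric_space.mcomplete (carrier alg) (nrm_dist alg)" by (rule complete)
  fix x assume "x \<in> carrier alg"
  then obtain g where g: "x = enc g" by (auto simp: carrier_iff)
  show "0 \<le> nrm alg x" by (simp add: g mult_norm_nonneg[OF K])
  show "nrm alg (c \<odot>\<^bsub>alg\<^esub> x) = cmod c * nrm alg x" for c
    by (simp add: g mult_norm_scale[OF K])
  show "nrm alg x = 0 \<longleftrightarrow> x = \<zero>\<^bsub>alg\<^esub>"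
    using Metric_space.zero[OF metric, of x "\<zero>\<^bsub>alg\<^esub>"] by (simp add: g nrm_dist_enc)
  fix y assume "y \<in> carrier alg"
  then obtain h where h: "y = enc h" by (auto simp: carrier_iff)
  show "(c \<odot>\<^bsub>alg\<^esub> x) \<otimes>\<^bsub>alg\<^esub> y = c \<odot>\<^bsub>alg\<^esub> (x \<otimes>\<^bsub>alg\<^esub> y)" "x \<otimes>\<^bsub>alg\<^esub> (c \<odot>\<^bsub>alg\<^esub> y) = c \<odot>\<^bsub>alg\<^esub> (x \<otimes>\<^bsub>alg\<^esub> y)" for c
    by (simp_all add: g h enc_eq_iff)
  show "nrm alg (x \<oplus>\<^bsub>alg\<^esub> y) \<le> nrm alg x + nrm alg y"
    by (simp add: g h mult_norm_triangle[OF K])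
  show "nrm alg (x \<otimes>\<^bsub>alg\<^esub> y) \<le> nrm alg x * nrm alg y"
    by (simp add: g h mult_norm_mult[OF K])
qed (simp add: mult_norm_one[OF K])

lemma Units_iff: "enc g \<in> Units alg \<longleftrightarrow> (\<forall>k\<in>K. g k \<noteq> 0)"
proof
  assume "enc g \<in> Units alg"
  then obtain y where "y \<in> carrier alg" "enc g \<otimes>\<^bsub>alg\<^esub> y = \<one>\<^bsub>alg\<^esub>" unfolding Units_def by blast
  then obtain h where "\<forall>k\<in>K. g k * h k = 1" by (auto simp: carrier_iff enc_eq_iff)
  then show "\<forall>k\<in>K. g k \<noteq> 0" by force
next
  assume "\<forall>k\<in>K. g k \<noteq> 0"
  then show "enc g \<in> Units alg"
    unfolding Units_def by (auto simp: enc_eq_iff intro!: bexI[of _ "enc (\<lambda>k. 1 / g k)"])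
qed

lemma spectrum_enc: "spectrum alg (enc g) = g ` K"
  by (auto simp: spectrum_def Units_iff)

lemma spectral_radius_enc:
  assumes "k \<in> K" "\<And>j. j \<in> K \<Longrightarrow> cmod (g j) \<le> cmod (g k)"
  shows "spectral_radius alg (enc g) = cmod (g k)"
  unfolding spectral_radius_def spectrum_enc image_image
  by (rule cSup_eq_maximum) (use assms in auto)

definition coord :: "'a" where
  "coord = enc of_real"

lemma coord_closed: "coord \<in> carrier alg"
  by (simp add: coord_def)

lemma eval_dual: "k \<in> K \<Longrightarrow> (\<lambda>x. dec x k) \<in> dual_space alg"
  by (rule A.dual_spaceI[where B = 1]) (auto simp: carrier_iff mult_norm_ge[OF K])

lemma pow_enc: "enc g [^]\<^bsub>alg\<^esub> (n::nat) = enc (\<lambda>k. g k ^ n)"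
  by (induction n) (simp_all add: mult.commute)

lemma expi_coord: "A.expi coord t = enc (\<lambda>k. iexp (t * k))"
proof -
  obtain g where g: "A.expi coord t = enc g"
    using A.expi_closed[OF coord_closed] by (auto simp: carrier_iff)
  have "g k = iexp (t * k)" if k: "k \<in> K" for k
  proof -
    have "(\<lambda>n. (\<i> * of_real t) ^ n / fact n * dec (coord [^]\<^bsub>alg\<^esub> n) k) sums dec (A.expi coord t) k"
      by (rule A.expi_sums[OF coord_closed eval_dual[OF k]])
    moreover have "(\<i> * of_real t) ^ n / fact n * dec (coord [^]\<^bsub>alg\<^esub> n) k = (\<i> * of_real (t * k)) ^ n /\<^sub>R fact n" for n
      using k by (simp add: coord_def pow_enc power_mult_distrib scaleR_conv_of_real divide_inverse mult_ac)
    ultimately have "(\<lambda>n. (\<i> * of_real (t * k)) ^ n /\<^sub>R fact n) sums g k"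
      using k by (simp add: g)
    then show ?thesis using exp_converges sums_unique2 by blast
  qed
  then show ?thesis by (simp add: g enc_eq_iff)
qed

text \<open>For a normalised functional \<open>f\<close> the real part of
  \<open>f (exp (ita))\<close> is at most 1 and equals 1 at \<open>t = 0\<close>. Its derivative
  there, the real part of \<open>\<i> * f a\<close>, must vanish.\<close>

lemma coord_hermitian: "coord \<in> hermitian_elements alg"
proof -
  have "f coord \<in> \<real>" if f: "f \<in> dual_space alg" "f \<one>\<^bsub>alg\<^esub> = 1" "dual_nrm alg f = 1" for f
  proof -
    obtain B where B: "B > 0" "\<And>x. x \<in> carrier alg \<Longrightarrow> cmod (f x) \<le> B * nrm alg x"
      using A.dual_bound[OF f(1)] by metis
    have bdd: "bdd_above ((\<lambda>x. cmod (f x)) ` {x \<in> carrier alg. nrm alg x \<le> 1})"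
    proof (rule bdd_aboveI2)
      fix x assume "x \<in> {x \<in> carrier alg. nrm alg x \<le> 1}"
      then have x: "x \<in> carrier alg" "nrm alg x \<le> 1" by auto
      have "B * nrm alg x \<le> B * 1" using x(2) B(1) by (intro mult_left_mono) auto
      then show "cmod (f x) \<le> B" using B(2)[OF x(1)] by simp
    qed
    have le: "cmod (f (A.expi coord t)) \<le> 1" for t
    proof -
      have "cmod (f (A.expi coord t)) \<le> dual_nrm alg f"
        unfolding dual_nrm_def
        by (rule cSUP_upper[OF _ bdd]) (use mult_norm_exp[OF K, of t] in \<open>simp add: expi_coord\<close>)
      then show ?thesis using f(3) by simp
    qed
    have D: "((\<lambda>t. f (A.expi coord t)) has_vector_derivative \<i> * f (coord \<otimes>\<^bsub>alg\<^esub> A.expi coord 0)) (at 0)"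
      by (rule A.expi_has_derivative[OF coord_closed f(1)])
    then have "((\<lambda>t. Re (f (A.expi coord t))) has_vector_derivative Re (\<i> * f (coord \<otimes>\<^bsub>alg\<^esub> A.expi coord 0))) (at 0)"
      by (rule bounded_linear.has_vector_derivative[OF bounded_linear_Re])
    then have "DERIV (\<lambda>t. Re (f (A.expi coord t))) 0 :> Re (\<i> * f (coord \<otimes>\<^bsub>alg\<^esub> A.expi coord 0))"
      by (simp add: has_real_derivative_iff_has_vector_derivative)
    moreover have "Re (f (A.expi coord t)) \<le> Re (f (A.expi coord 0))" for t
      using le[of t] complex_Re_le_cmod[of "f (A.expi coord t)"] f(2)
      by (simp add: A.expi_zero[OF coord_closed] del: alg_simps)
    ultimately have "Re (\<i> * f (coord \<otimes>\<^bsub>alg\<^esub> A.expi coord 0)) = 0"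
      by (intro DERIV_local_max[of _ _ 0 1]) auto
    then have "Im (f coord) = 0"
      using coord_closed by (simp add: A.expi_zero[OF coord_closed] del: alg_simps)
    then show ?thesis by (simp add: complex_is_Real_iff)
  qed
  then show ?thesis
    unfolding hermitian_elements_def numerical_range_def using coord_closed by blast
qed

definition unit_fun :: "real \<Rightarrow> 'a" where
  "unit_fun k = enc (\<lambda>j. if j = k then 1 else 0)"

lemma dual_expand:
  assumes f: "f \<in> dual_space alg"
  shows "f (enc g) = (\<Sum>k\<in>K. g k * f (unit_fun k))"
proof -
  have "f (enc (\<lambda>j. if j \<in> S then g j else 0)) = (\<Sum>k\<in>S. g k * f (unit_fun k))" if "finite S" "S \<subseteq> K" for S
    using that
  proof (induction S)
    case empty
    then show ?case using A.dual_zero[OF f] by simp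
  next
    case (insert s S)
    have "enc (\<lambda>j. if j \<in> insert s S then g j else 0) = (g s \<odot>\<^bsub>alg\<^esub> unit_fun s) \<oplus>\<^bsub>alg\<^esub> enc (\<lambda>j. if j \<in> S then g j else 0)"
      using insert by (auto simp: unit_fun_def enc_eq_iff)
    also have "f \<dots> = g s * f (unit_fun s) + f (enc (\<lambda>j. if j \<in> S then g j else 0))"
      by (subst A.dual_add[OF f]) (auto simp: unit_fun_def A.dual_smult[OF f] simp del: alg_simps)
    finally show ?case using insert by simp
  qed
  moreover have "enc (\<lambda>j. if j \<in> K then g j else 0) = enc g" by (simp add: enc_eq_iff)
  ultimately show ?thesis using K(1) by fastforce
qed

text \<open>Every functional is a finite combination of evaluations at points of \<open>K\<close>.
  Evaluation at \<open>k\<close> turns the group into \<open>iexp (t * k)\<close>, whose integral is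
  \<open>F k\<close> by the choice of the measure.\<close>

lemma symbol_apply_coord:
  assumes F: "F \<in> B_loc"
  shows "symbol_apply alg F coord = enc F"
proof -
  let ?\<mu> = "SOME \<mu>. represents_near_spectrum alg F coord \<mu>"
  have "Min K \<le> Max K" using K by simp
  then obtain G e where G: "G \<in> B_R" "e > 0" "\<And>y. y \<in> {Min K - e..Max K + e} \<Longrightarrow> F y = G y"
    using B_loc_on_interval[OF F] by metis
  obtain \<mu>' where \<mu>': "complex_borel_measure \<mu>'" "G = fourier_stieltjes \<mu>'"
    using G(1) by (auto simp: B_R_def)
  have "represents_near_spectrum alg F coord \<mu>'"
    unfolding represents_near_spectrum_def
  proof (intro conjI exI[of _ "{Min K - e<..<Max K + e}"])
    show "spectrum alg coord \<subseteq> of_real ` {Min K - e<..<Max K + e}"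
      unfolding coord_def spectrum_enc
    proof (rule image_mono, rule subsetI)
      fix k assume "k \<in> K"
      then have "Min K \<le> k" "k \<le> Max K" using K by auto
      then show "k \<in> {Min K - e<..<Max K + e}" using G(2) by auto
    qed
  qed (use \<mu>' G in auto)
  then have rep: "represents_near_spectrum alg F coord ?\<mu>"
    by (rule someI[of "represents_near_spectrum alg F coord"])
  then have \<mu>: "complex_borel_measure ?\<mu>" by (simp add: represents_near_spectrum_def)
  have Fk: "F k = cm_integral ?\<mu> (\<lambda>x. iexp (k * x))" if "k \<in> K" for k
  proof -
    obtain U where U: "complex_of_real ` K \<subseteq> of_real ` U" "\<forall>x\<in>U. F x = fourier_stieltjes ?\<mu> x"
      using rep unfolding represents_near_spectrum_def coord_def spectrum_enc by blast
    then have "k \<in> U" using that by auto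
    then show ?thesis using U(2) by (simp add: fourier_stieltjes_def)
  qed
  have eq: "f (enc F) = cm_integral ?\<mu> (\<lambda>t. f (A.expi coord t))" if f: "f \<in> dual_space alg" for f
  proof -
    note L = sigma_functional_cm_integral(1)[OF \<mu>]
    let ?g = "\<lambda>k x. f (unit_fun k) * iexp (k * x)"
    have bb: "bounded_borel (?g k)" for k
      unfolding bounded_borel_def by (auto simp: norm_mult intro!: exI[of _ "cmod (f (unit_fun k))"])
    have "cm_integral ?\<mu> (\<lambda>t. f (A.expi coord t)) = cm_integral ?\<mu> (\<lambda>x. \<Sum>k\<in>K. ?g k x)"
      by (simp only: expi_coord dual_expand[OF f] mult.commute[of "f _"] mult.commute[of _ "_::real"])
    also have "\<dots> = (\<Sum>k\<in>K. cm_integral ?\<mu> (?g k))"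
      using sigma_functional_sum[OF L K(1), of ?g] bb by blast
    also have "\<dots> = (\<Sum>k\<in>K. f (unit_fun k) * F k)"
      by (intro sum.cong refl) (simp add: sigma_functionalD(2)[OF L bounded_borel_exp] Fk del: of_real_mult)
    also have "\<dots> = f (enc F)"
      by (simp only: dual_expand[OF f] mult.commute)
    finally show ?thesis ..
  qed
  show ?thesis
    unfolding symbol_apply_def alg_integral_def A.expi_def[symmetric]
  proof (rule the_equality)
    show "enc F \<in> carrier alg \<and> (\<forall>f\<in>dual_space alg. f (enc F) = cm_integral ?\<mu> (\<lambda>t. f (A.expi coord t)))"
      using eq by simp
    fix b assume b: "b \<in> carrier alg \<and> (\<forall>f\<in>dual_space alg. f b = cm_integral ?\<mu> (\<lambda>t. f (A.expi coord t)))"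
    show "b = enc F"
      by (rule A.eq_functional) (use b eq in auto)
  qed
qed

end

lemma US_trig_bound:
  assumes "\<exists>f :: real \<Rightarrow> 'a. inj f" and F: "F \<in> US TYPE('a)" and K: "finite K" "K \<noteq> {}"
    and M: "\<And>k. k \<in> K \<Longrightarrow> cmod (F k) \<le> M" and l: "\<And>x. cmod (trig K l x) \<le> S"
  shows "cmod (\<Sum>k\<in>K. l k * F k) \<le> M * S"
proof -
  obtain \<iota> :: "(real \<Rightarrow> complex) \<Rightarrow> 'a" where "inj_on \<iota> {g. \<forall>x. x \<notin> K \<longrightarrow> g x = 0}"
    using finite_support_functions_embed[OF assms(1) K(1)] .
  then interpret multiplier_algebra K \<iota> using K by unfold_locales
  have "Max ((\<lambda>k. cmod (F k)) ` K) \<in> (\<lambda>k. cmod (F k)) ` K"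
    using K by (intro Max_in) auto
  then obtain k where k: "k \<in> K" "cmod (F k) = Max ((\<lambda>k. cmod (F k)) ` K)" by auto
  then have kmax: "cmod (F j) \<le> cmod (F k)" if "j \<in> K" for j using that K by simp
  have "nrm alg (symbol_apply alg F coord) = spectral_radius alg (symbol_apply alg F coord)"
    using F A.complex_unital_banach_algebra_axioms coord_hermitian unfolding US_def by blast
  then have "mult_norm K F = cmod (F k)"
    using F by (simp add: symbol_apply_coord US_def spectral_radius_enc[where g = F, OF k(1) kmax])
  then have "cmod (\<Sum>k\<in>K. l k * F k) \<le> cmod (F k) * S"
    using mult_norm_bound[OF K l, of F] by simp
  also have "\<dots> \<le> M * S"
    using M[OF k(1)] l[of 0] norm_ge_zero order_trans by (intro mult_right_mono) blast+
  finally show ?thesis .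
qed


section \<open>Universal symbols\<close>

definition bounded_funs :: "(real \<Rightarrow> complex) set" where
  "bounded_funs = {g. bounded (range g)}"

definition sup_norm :: "(real \<Rightarrow> complex) \<Rightarrow> real" where
  "sup_norm g = (SUP x. cmod (g x))"

lemma bounded_funsI: "(\<And>x. cmod (g x) \<le> B) \<Longrightarrow> g \<in> bounded_funs"
  unfolding bounded_funs_def by (auto intro!: boundedI)

lemma sup_norm_upper:
  assumes "g \<in> bounded_funs"
  shows "cmod (g x) \<le> sup_norm g"
proof -
  obtain B where "\<And>x. cmod (g x) \<le> B"
    using assms unfolding bounded_funs_def bounded_iff by auto
  then show ?thesis
    unfolding sup_norm_def by (intro cSUP_upper bdd_aboveI2[of _ _ B]) auto
qed

lemma sup_norm_least: "(\<And>x. cmod (g x) \<le> B) \<Longrightarrow> sup_norm g \<le> B"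
  unfolding sup_norm_def by (intro cSUP_least) auto

lemma bounded_funs_add: "f \<in> bounded_funs \<Longrightarrow> g \<in> bounded_funs \<Longrightarrow> (\<lambda>x. f x + g x) \<in> bounded_funs"
  by (rule bounded_funsI[of _ "sup_norm f + sup_norm g"])
    (meson add_mono norm_triangle_le sup_norm_upper)

lemma bounded_funs_scale: "g \<in> bounded_funs \<Longrightarrow> (\<lambda>x. c * g x) \<in> bounded_funs"
  by (rule bounded_funsI[of _ "cmod c * sup_norm g"]) (simp add: norm_mult mult_left_mono sup_norm_upper)

lemma sup_norm_add:
  assumes "f \<in> bounded_funs" "g \<in> bounded_funs"
  shows "sup_norm (\<lambda>x. f x + g x) \<le> sup_norm f + sup_norm g"
  by (rule sup_norm_least) (meson add_mono assms norm_triangle_le sup_norm_upper)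

lemma sup_norm_scale:
  assumes g: "g \<in> bounded_funs"
  shows "sup_norm (\<lambda>x. c * g x) = cmod c * sup_norm g"
proof -
  have le: "sup_norm (\<lambda>x. c * g x) \<le> cmod c * sup_norm g" if "g \<in> bounded_funs" for c g
    by (rule sup_norm_least) (simp add: norm_mult mult_left_mono sup_norm_upper[OF that])
  show ?thesis
  proof (cases "c = 0")
    case True
    then show ?thesis by (simp add: sup_norm_def)
  next
    case False
    have "sup_norm (\<lambda>x. (1 / c) * (c * g x)) \<le> cmod (1 / c) * sup_norm (\<lambda>x. c * g x)"
      by (rule le[OF bounded_funs_scale[OF g]])
    then have "cmod c * sup_norm g \<le> sup_norm (\<lambda>x. c * g x)"
      using False by (simp add: norm_divide field_simps)
    then show ?thesis using le[OF g, of c] by simp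
  qed
qed

interpretation bounded_funs: complex_vector_space bounded_funs
  "\<lambda>f g x. f x + g x" "\<lambda>c g x. c * g x" "\<lambda>_. 0"
  by unfold_locales (auto simp: bounded_funs_add bounded_funs_scale algebra_simps intro: bounded_funsI[of _ 0])

text \<open>A functional of norm one with \<open>L 1 = 1\<close> is positive: compare \<open>L (g - M/2 + i s)\<close> with the sup
  norm of \<open>g - M/2 + i s\<close> for all real \<open>s\<close>.\<close>

lemma unital_contraction_positive:
  assumes add: "\<And>f g. f \<in> bounded_funs \<Longrightarrow> g \<in> bounded_funs \<Longrightarrow> L (\<lambda>x. f x + g x) = L f + L g"
    and scale: "\<And>c g. g \<in> bounded_funs \<Longrightarrow> L (\<lambda>x. c * g x) = c * L g"
    and le: "\<And>g. g \<in> bounded_funs \<Longrightarrow> cmod (L g) \<le> sup_norm g"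
    and one: "L (\<lambda>_. 1) = 1"
    and g: "\<And>x. 0 \<le> g x" "\<And>x. g x \<le> M"
  shows "L (\<lambda>x. complex_of_real (g x)) \<in> \<real>\<^sub>\<ge>\<^sub>0"
proof -
  let ?g = "\<lambda>x. complex_of_real (g x)"
  have M: "0 \<le> M" using g[of 0] by linarith
  have gb: "?g \<in> bounded_funs" by (rule bounded_funsI[of _ M]) (use g in auto)
  have ob: "(\<lambda>_. 1) \<in> bounded_funs" by (rule bounded_funsI[of _ 1]) auto
  have key: "(Re (L ?g) - M / 2)\<^sup>2 + (Im (L ?g) + s)\<^sup>2 \<le> (M / 2)\<^sup>2 + s\<^sup>2" for s :: real
  proof -
    \<comment> \<open>The resulting inequality puts \<open>L ?g\<close> into every disc whose
      boundary passes through 0 and \<open>M\<close>; the intersection of these discs is the segment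
      from 0 to \<open>M\<close>.\<close>
    define c where "c = Complex (- M / 2) s"
    have cb: "(\<lambda>x. c * 1) \<in> bounded_funs" by (rule bounded_funs_scale[OF ob])
    have "L (\<lambda>x. ?g x + c * 1) = L ?g + c"
    proof -
      have "L (\<lambda>x. c * 1) = c * L (\<lambda>_. 1)" by (rule scale[OF ob])
      then show ?thesis unfolding add[OF gb cb] one by simp
    qed
    then have "cmod (L ?g + c) \<le> sup_norm (\<lambda>x. ?g x + c * 1)"
      using le[OF bounded_funs_add[OF gb cb]] by simp
    also have "\<dots> \<le> sqrt ((M / 2)\<^sup>2 + s\<^sup>2)"
    proof (rule sup_norm_least)
      fix x
      have "\<bar>g x - M / 2\<bar> \<le> M / 2" using g(1)[of x] g(2)[of x] by linarith
      then have "(g x - M / 2)\<^sup>2 \<le> (M / 2)\<^sup>2" by (metis abs_le_square_iff M abs_of_nonneg divide_nonneg_pos zero_less_numeral)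
      then show "cmod (?g x + c * 1) \<le> sqrt ((M / 2)\<^sup>2 + s\<^sup>2)"
        by (simp add: cmod_def c_def)
    qed
    finally have "(cmod (L ?g + c))\<^sup>2 \<le> (sqrt ((M / 2)\<^sup>2 + s\<^sup>2))\<^sup>2"
      by (intro power_mono) auto
    then show ?thesis by (simp add: cmod_power2 c_def)
  qed
  have Im0: "Im (L ?g) = 0"
  proof (rule ccontr)
    assume nz: "Im (L ?g) \<noteq> 0"
    define b where "b = Im (L ?g)"
    \<comment> \<open>Makes the term \<open>2 * b * s\<close>, linear in \<open>s\<close>, exceed
      the constant bound by 1; the squares of \<open>s\<close> cancel in \<open>key\<close>.\<close>
    define s where "s = ((M / 2)\<^sup>2 + 1) / (2 * b)"
    have "2 * b * s = (M / 2)\<^sup>2 + 1" using nz by (simp add: s_def b_def)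
    moreover have "(Re (L ?g) - M / 2)\<^sup>2 + b\<^sup>2 + 2 * b * s \<le> (M / 2)\<^sup>2"
      using key[of s] by (simp add: b_def[symmetric] power2_sum algebra_simps)
    moreover have "0 \<le> (Re (L ?g) - M / 2)\<^sup>2" "0 \<le> b\<^sup>2" by auto
    ultimately show False by linarith
  qed
  have "(Re (L ?g) - M / 2)\<^sup>2 \<le> (M / 2)\<^sup>2" using key[of 0] Im0 by simp
  then have "\<bar>Re (L ?g) - M / 2\<bar> \<le> \<bar>M / 2\<bar>" by (simp only: abs_le_square_iff)
  then have "0 \<le> Re (L ?g)" using M by linarith
  with Im0 show ?thesis by (simp add: complex_nonneg_Reals_iff)
qed

lemma exp_bounded_fun: "(\<lambda>x. iexp (x * t)) \<in> bounded_funs"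
  by (rule bounded_funsI[of _ 1]) simp

text \<open>The quadratic form at the points \<open>y j\<close> is the value of \<open>L\<close> at
  the squared modulus of the polynomial \<open>P\<close>, which is a nonnegative bounded
  function.\<close>

lemma unital_contraction_positive_definite:
  assumes add: "\<And>f g. f \<in> bounded_funs \<Longrightarrow> g \<in> bounded_funs \<Longrightarrow> L (\<lambda>x. f x + g x) = L f + L g"
    and scale: "\<And>c g. g \<in> bounded_funs \<Longrightarrow> L (\<lambda>x. c * g x) = c * L g"
    and le: "\<And>g. g \<in> bounded_funs \<Longrightarrow> cmod (L g) \<le> sup_norm g"
    and one: "L (\<lambda>_. 1) = 1"
  shows "positive_definite (\<lambda>t. L (\<lambda>x. iexp (x * t)))"
  unfolding positive_definite_def
proof (intro allI)
  fix n :: nat and y :: "nat \<Rightarrow> real" and c :: "nat \<Rightarrow> complex"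
  let ?e = "\<lambda>t x. iexp (x * t)"
  have sum: "(\<lambda>x. \<Sum>i\<in>I. f i x) \<in> bounded_funs \<and> L (\<lambda>x. \<Sum>i\<in>I. f i x) = (\<Sum>i\<in>I. L (f i))"
    if "finite I" "\<And>i. i \<in> I \<Longrightarrow> f i \<in> bounded_funs" for I and f :: "nat \<Rightarrow> real \<Rightarrow> complex"
    using that
  proof (induction I)
    case empty
    have "(\<lambda>_. 0) \<in> bounded_funs" by (rule bounded_funs.zero_closed)
    with scale[OF this, of 0] show ?case by simp
  next
    case (insert i I)
    then have *: "(\<lambda>x. \<Sum>i\<in>I. f i x) \<in> bounded_funs" "L (\<lambda>x. \<Sum>i\<in>I. f i x) = (\<Sum>i\<in>I. L (f i))" "f i \<in> bounded_funs"
      by auto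
    show ?case
      using bounded_funs_add[OF *(3,1)] add[OF *(3,1)] insert(1,2) *(2) by simp
  qed
  define P where "P x = (\<Sum>j<n. c j * ?e (y j) x)" for x
  have b1: "(\<lambda>x. (c j * cnj (c k)) * ?e (y j - y k) x) \<in> bounded_funs" for j k
    by (rule bounded_funs_scale[OF exp_bounded_fun])
  have b2: "(\<lambda>x. \<Sum>k<n. (c j * cnj (c k)) * ?e (y j - y k) x) \<in> bounded_funs"
    and L2: "L (\<lambda>x. \<Sum>k<n. (c j * cnj (c k)) * ?e (y j - y k) x) = (\<Sum>k<n. L (\<lambda>x. (c j * cnj (c k)) * ?e (y j - y k) x))" for j
    using sum[of "{..<n}" "\<lambda>k x. (c j * cnj (c k)) * ?e (y j - y k) x"] b1 by blast+
  have "L (\<lambda>x. \<Sum>j<n. \<Sum>k<n. (c j * cnj (c k)) * ?e (y j - y k) x) = (\<Sum>j<n. L (\<lambda>x. \<Sum>k<n. (c j * cnj (c k)) * ?e (y j - y k) x))"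
    using sum[of "{..<n}" "\<lambda>j x. \<Sum>k<n. (c j * cnj (c k)) * ?e (y j - y k) x"] b2 by blast
  also have "\<dots> = (\<Sum>j<n. \<Sum>k<n. L (?e (y j - y k)) * c j * cnj (c k))"
    unfolding L2 by (intro sum.cong refl) (subst scale[OF exp_bounded_fun], simp only: mult_ac)
  finally have eq: "(\<Sum>j<n. \<Sum>k<n. L (?e (y j - y k)) * c j * cnj (c k)) = L (\<lambda>x. \<Sum>j<n. \<Sum>k<n. (c j * cnj (c k)) * ?e (y j - y k) x)" ..
  have "(\<Sum>j<n. \<Sum>k<n. (c j * cnj (c k)) * ?e (y j - y k) x) = complex_of_real ((cmod (P x))\<^sup>2)" for x
  proof -
    have "(c j * cnj (c k)) * ?e (y j - y k) x = (c j * ?e (y j) x) * cnj (c k * ?e (y k) x)" for j k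
    proof -
      have "?e (y j - y k) x = ?e (y j) x * cnj (?e (y k) x)"
        by (simp add: exp_cnj exp_add[symmetric] right_diff_distrib)
      then show ?thesis by simp
    qed
    then have "(\<Sum>j<n. \<Sum>k<n. (c j * cnj (c k)) * ?e (y j - y k) x) = P x * cnj (P x)"
      by (simp only: P_def sum_product cnj_sum)
    then show ?thesis by (simp only: complex_norm_square)
  qed
  then have eq': "(\<lambda>x. \<Sum>j<n. \<Sum>k<n. (c j * cnj (c k)) * ?e (y j - y k) x) = (\<lambda>x. complex_of_real ((cmod (P x))\<^sup>2))"
    by (simp only: fun_eq_iff) simp
  have "cmod (P x) \<le> (\<Sum>j<n. cmod (c j))" for x
    unfolding P_def by (intro sum_norm_le) (simp add: norm_mult)
  then have "(cmod (P x))\<^sup>2 \<le> (\<Sum>j<n. cmod (c j))\<^sup>2" for x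
    by (intro power_mono) auto
  then show "(\<Sum>j<n. \<Sum>k<n. L (?e (y j - y k)) * c j * cnj (c k)) \<in> \<real>\<^sub>\<ge>\<^sub>0"
    unfolding eq eq'
    by (intro unital_contraction_positive[where L = L and M = "(\<Sum>j<n. cmod (c j))\<^sup>2"] add scale le one) auto
qed

text \<open>Extend the functional \<open>e\<^sub>k \<mapsto> G k\<close> on trigonometric polynomials with frequencies in \<open>K\<close> by
  Hahn--Banach.\<close>

lemma positive_definite_extension:
  assumes bound: "\<And>T l. finite T \<Longrightarrow> T \<subseteq> K \<Longrightarrow> cmod (\<Sum>k\<in>T. l k * G k) \<le> sup_norm (trig T l)"
    and 0: "0 \<in> K" "G 0 = 1"
  obtains \<phi> where "positive_definite \<phi>" "\<And>k. k \<in> K \<Longrightarrow> \<phi> k = G k"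
proof -
  let ?e = "\<lambda>t x. iexp (x * t)"
  \<comment> \<open>The graph of the real part of the prescribed functional, a real subspace. Two
    coefficient families of the same polynomial simply yield two pairs; domination by the sup norm
    is the hypothesis \<open>bound\<close>.\<close>
  let ?C = "{(trig T l, Re (\<Sum>k\<in>T. l k * G k)) | T l. finite T \<and> T \<subseteq> K}"
  have tb: "trig T l \<in> bounded_funs" for T l
  proof (rule bounded_funsI)
    show "cmod (trig T l x) \<le> (\<Sum>k\<in>T. cmod (l k))" for x
      unfolding trig_def by (intro sum_norm_le) (simp add: norm_mult)
  qed
  have C: "bounded_funs.dominated_cone sup_norm ?C"
    unfolding bounded_funs.dominated_cone_def
  proof (intro conjI)
    show "((\<lambda>_. 0), 0) \<in> ?C"
      by (intro CollectI exI[of _ "{}"] exI[of _ "\<lambda>_. 0"]) (simp add: trig_def fun_eq_iff)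
    show "\<forall>(e, r)\<in>?C. e \<in> bounded_funs \<and> r \<le> sup_norm e"
      using tb bound complex_Re_le_cmod order_trans by blast
    show "\<forall>(e, r)\<in>?C. \<forall>(e', r')\<in>?C. ((\<lambda>x. e x + e' x), r + r') \<in> ?C"
    proof safe
      fix T T' :: "real set" and l l' :: "real \<Rightarrow> complex" assume T: "finite T" "T \<subseteq> K" "finite T'" "T' \<subseteq> K"
      define m where "m k = (if k \<in> T then l k else 0) + (if k \<in> T' then l' k else 0)" for k
      have m: "(\<Sum>k\<in>T \<union> T'. m k * g k) = (\<Sum>k\<in>T. l k * g k) + (\<Sum>k\<in>T'. l' k * g k)" for g :: "real \<Rightarrow> complex"
      proof -
        have "(\<Sum>k\<in>T. l k * g k) = (\<Sum>k\<in>T \<union> T'. (if k \<in> T then l k else 0) * g k)"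
          using T by (intro sum.mono_neutral_cong_left) auto
        moreover have "(\<Sum>k\<in>T'. l' k * g k) = (\<Sum>k\<in>T \<union> T'. (if k \<in> T' then l' k else 0) * g k)"
          using T by (intro sum.mono_neutral_cong_left) auto
        ultimately show ?thesis by (simp only: m_def distrib_right sum.distrib)
      qed
      have "(\<lambda>x. trig T l x + trig T' l' x) = trig (T \<union> T') m"
        unfolding trig_def m ..
      moreover have "Re (\<Sum>k\<in>T. l k * G k) + Re (\<Sum>k\<in>T'. l' k * G k) = Re (\<Sum>k\<in>T \<union> T'. m k * G k)"
        unfolding m by simp
      ultimately show "\<exists>S q. ((\<lambda>x. trig T l x + trig T' l' x), Re (\<Sum>k\<in>T. l k * G k) + Re (\<Sum>k\<in>T'. l' k * G k)) = (trig S q, Re (\<Sum>k\<in>S. q k * G k)) \<and> finite S \<and> S \<subseteq> K"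
        using T by (intro exI[of _ "T \<union> T'"] exI[of _ m]) simp
    qed
    show "\<forall>(e, r)\<in>?C. \<forall>t\<ge>0. ((\<lambda>x. complex_of_real t * e x), t * r) \<in> ?C"
    proof safe
      fix T :: "real set" and l :: "real \<Rightarrow> complex" and t :: real assume T: "finite T" "T \<subseteq> K"
      have "(\<lambda>x. complex_of_real t * trig T l x) = trig T (\<lambda>k. of_real t * l k)"
        by (simp add: trig_def sum_distrib_left mult.assoc fun_eq_iff)
      moreover have "t * Re (\<Sum>k\<in>T. l k * G k) = Re (\<Sum>k\<in>T. of_real t * l k * G k)"
      proof -
        have "(\<Sum>k\<in>T. of_real t * l k * G k) = of_real t * (\<Sum>k\<in>T. l k * G k)"
          by (simp add: sum_distrib_left mult.assoc)
        then show ?thesis by simp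
      qed
      ultimately show "\<exists>S q. ((\<lambda>x. complex_of_real t * trig T l x), t * Re (\<Sum>k\<in>T. l k * G k)) = (trig S q, Re (\<Sum>k\<in>S. q k * G k)) \<and> finite S \<and> S \<subseteq> K"
        using T by (intro exI[of _ T] exI[of _ "\<lambda>k. of_real t * l k"]) simp
    qed
  qed
  obtain L :: "(real \<Rightarrow> complex) \<Rightarrow> complex" where L: "\<And>f g. f \<in> bounded_funs \<Longrightarrow> g \<in> bounded_funs \<Longrightarrow> L (\<lambda>x. f x + g x) = L f + L g"
    "\<And>c g. g \<in> bounded_funs \<Longrightarrow> L (\<lambda>x. c * g x) = c * L g" "\<And>g. g \<in> bounded_funs \<Longrightarrow> cmod (L g) \<le> sup_norm g"
    "\<And>e r. (e, r) \<in> ?C \<Longrightarrow> r \<le> Re (L e)"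
    by (rule bounded_funs.complex_hahn_banach[OF sup_norm_add sup_norm_scale C]) blast+
  have LG: "L (?e k) = G k" if k: "k \<in> K" for k
  proof -
    \<comment> \<open>The cone only gives lower bounds on real parts; the factors 1, -1,
      \<open>\<i>\<close> and \<open>-\<i>\<close> turn them into equality of both parts.\<close>
    have *: "Re (c * G k) \<le> Re (c * L (?e k))" for c
    proof -
      have "trig {k} (\<lambda>_. c) = (\<lambda>x. c * ?e k x)" by (simp add: trig_def fun_eq_iff)
      moreover have "(trig {k} (\<lambda>_. c), Re (\<Sum>k\<in>{k}. c * G k)) \<in> ?C" using k by blast
      ultimately have "Re (c * G k) \<le> Re (L (\<lambda>x. c * ?e k x))" using L(4) by simp
      then show ?thesis by (simp only: L(2)[OF exp_bounded_fun])
    qed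
    show ?thesis
      using *[of 1] *[of "- 1"] *[of \<i>] *[of "- \<i>"] by (simp add: complex_eq_iff)
  qed
  have "L (\<lambda>_. 1) = 1" using LG[OF 0(1)] 0(2) by simp
  from unital_contraction_positive_definite[where L = L, OF L(1-3) this]
  have "positive_definite (\<lambda>t. L (?e t))" .
  then show thesis using LG by (rule that)
qed

lemma US_subset_PD:
  assumes inj: "\<exists>f :: real \<Rightarrow> 'a. inj f"
  shows "US TYPE('a) \<subseteq> PD"
proof
  fix F assume F: "F \<in> US TYPE('a)"
  then have B: "F \<in> B_loc" by (simp add: US_def)
  have "\<exists>c. \<exists>x0\<in>K. \<exists>\<phi>. positive_definite \<phi> \<and> (\<forall>x\<in>K. F x = c * \<phi> (x - x0))"
    if K: "compact K" "K \<noteq> {}" for K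
  proof -
    have "continuous_on K (\<lambda>x. cmod (F x))"
      using B_loc_continuous[OF B] by (intro continuous_on_norm) (rule continuous_on_subset, auto)
    then obtain x0 where x0: "x0 \<in> K" "\<And>x. x \<in> K \<Longrightarrow> cmod (F x) \<le> cmod (F x0)"
      using continuous_attains_sup[OF K] by blast
    show ?thesis
    proof (cases "F x0 = 0")
      case True
      then have "\<forall>x\<in>K. F x = 0 * (\<lambda>_. 1) (x - x0)" using x0 by simp
      with positive_definite_one x0(1) show ?thesis by blast
    next
      case False
      \<comment> \<open>Normalised so that the maximum point becomes frequency 0 with value 1, which
        gives the extended functional the value 1 at the constant 1.\<close>
      define G where "G k = F (k + x0) / F x0" for k
      have bound: "cmod (\<Sum>k\<in>T. l k * G k) \<le> sup_norm (trig T l)"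
        if T: "finite T" "T \<subseteq> (\<lambda>x. x - x0) ` K" for T l
      proof (cases "T = {}")
        case True
        then show ?thesis by (simp add: sup_norm_def trig_def)
      next
        case ne: False
        define T' where "T' = (\<lambda>k. k + x0) ` T"
        define l' where "l' j = l (j - x0)" for j
        have T': "finite T'" "T' \<noteq> {}" "T' \<subseteq> K" using T ne by (auto simp: T'_def)
        have reindex: "(\<Sum>j\<in>T'. l' j * g j) = (\<Sum>k\<in>T. l k * g (k + x0))" for g :: "real \<Rightarrow> complex"
          unfolding T'_def l'_def by (subst sum.reindex) (auto simp: inj_on_def)
        have tb: "trig T l \<in> bounded_funs"
        proof (rule bounded_funsI)
          show "cmod (trig T l x) \<le> (\<Sum>k\<in>T. cmod (l k))" for x
            unfolding trig_def by (intro sum_norm_le) (simp add: norm_mult)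
        qed
        \<comment> \<open>Shifting all frequencies by \<open>x0\<close> multiplies the polynomial by
          a unimodular character, which preserves the sup norm.\<close>
        have "trig T' l' x = iexp (x * x0) * trig T l x" for x
          unfolding trig_def reindex
          by (simp add: sum_distrib_left distrib_left exp_add mult_ac)
        then have "cmod (trig T' l' x) \<le> sup_norm (trig T l)" for x
          using sup_norm_upper[OF tb, of x] by (simp add: norm_mult)
        from US_trig_bound[OF inj F T'(1,2) _ this, of "cmod (F x0)"]
        have "cmod (\<Sum>j\<in>T'. l' j * F j) \<le> cmod (F x0) * sup_norm (trig T l)"
          using x0(2) T'(3) by blast
        moreover have "(\<Sum>j\<in>T'. l' j * F j) = F x0 * (\<Sum>k\<in>T. l k * G k)"
          unfolding reindex using False by (simp add: G_def sum_distrib_left)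
        ultimately show ?thesis using False by (simp add: norm_mult)
      qed
      obtain \<phi> where \<phi>: "positive_definite \<phi>" "\<And>k. k \<in> (\<lambda>x. x - x0) ` K \<Longrightarrow> \<phi> k = G k"
        by (rule positive_definite_extension[OF bound, of "(\<lambda>x. x - x0) ` K"])
          (use x0(1) False in \<open>auto simp: G_def\<close>)
      have "\<forall>x\<in>K. F x = F x0 * \<phi> (x - x0)"
        using \<phi>(2) False by (auto simp: G_def)
      with \<phi>(1) x0(1) show ?thesis by blast
    qed
  qed
  with B show "F \<in> PD" unfolding PD_def by blast
qed

theorem theorem2p1:
  assumes "\<exists>f :: real \<Rightarrow> 'a. inj f"
  shows "US TYPE('a) = CH \<and> CH = PD"
proof -
  have "CH = PD"
    using CH_subset_PD PD_subset_CH[OF B_loc_continuous] by blast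
  moreover have "US TYPE('a) = PD"
    using US_subset_PD[OF assms] PD_subset_US by (rule equalityI)
  ultimately show ?thesis by simp
qed

end
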